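(* Let $k$ be a field, $S=k[x_1,\dots,x_n]$, and let $h_{n,c}(z)$ denote the $h$-polynomial of the Veronese subring $S^{(c)}$. One has $h_{n,c}(-1)>0$ for the following values of $(n,c)$: $(7,2)$, $(5,4)$, $(5,3)$, and $(4,c)$ with $c>4$. In particular, $S^{(c)}$ does not have the Backelin-Roos property for those values of $(n,c)$.
   Context: The Veronese subring is $S^{(c)}=\bigoplus_{i\ge0}S_{ic}$, where $S$ has the standard grading, graded by $(S^{(c)})_i=S_{ic}$; it is a standard graded $k$-algebra. A standard graded $k$-algebra is a commutative graded ring $R=\bigoplus_{i\ge 0}R_i$ with $R_0=k$, generated as a $k$-algebra by $R_1$, with $\dim_k R_1<\infty$; morphisms are homomorphisms of graded $k$-algebras. The $h$-polynomial $h_R(z)\in\mathbb Z[z]$ is defined by $\sum_{i\ge0}(\dim_kR_i)z^i=h_R(z)/(1-z)^{\dim R}$. For a finitely generated graded $R$-module $M$ let $\beta^R_{i,j}(M)=\dim_k \operatorname{Tor}^R_i(k,M)_j$ and $P^R_M(s,z)=\sum_{i,j}\beta^R_{i,j}(M)s^jz^i$. Golod morphisms: let $\varphi\colon Q\to R$ be a surjective morphism of standard graded $k$-algebras with $\operatorname{Ker}\varphi\subseteq (Q_{\ge 1})^2$. There is always a coefficientwise inequality $P^R_k(s,z)\preccurlyeq \frac{P^Q_k(s,z)}{1-z(P^Q_R(s,z)-1)}$; $\varphi$ is Golod if equality holds. $R$ has the Backelin-Roos property if there is a surjective Golod morphism $Q\to R$ with $Q$ a standard graded complete intersection ring (a quotient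 of a standard graded polynomial ring by an ideal generated by a homogeneous regular sequence). *)

theory Defs
  imports
    "HOL-Library.Poly_Mapping"
    "HOL-Library.Extended_Nat"
    "HOL-Computational_Algebra.Polynomial_FPS"
    "HOL-Algebra.Subrings"
    "HOL-Algebra.QuotRing"
    "HOL-Algebra.Ideal_Product"
    "Jordan_Normal_Form.VS_Connect"
begin

section \<open>Graded modules and standard graded algebras\<close>

text \<open>
  As in \<^locale>\<open>algebra\<close>, one record type serves for modules and for algebras; for modules the
  fields \<^const>\<open>monoid.mult\<close> and \<^const>\<open>one\<close> carry no information.  Gradings are by the natural
  numbers, which suffices for the modules considered here.
\<close>

record ('k, 'a) graded = "('k, 'a) module" +
  grade :: "nat \<Rightarrow> 'a set"

definition is_decomposition ::
  "('k, 'a, 'm) graded_scheme \<Rightarrow> 'a \<Rightarrow> (nat \<Rightarrow> 'a) \<Rightarrow> bool" where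
  "is_decomposition M x f \<longleftrightarrow>
     (\<forall>i. f i \<in> grade M i) \<and> finite {i. f i \<noteq> \<zero>\<^bsub>M\<^esub>} \<and>
     x = (\<Oplus>\<^bsub>M\<^esub>i\<in>{i. f i \<noteq> \<zero>\<^bsub>M\<^esub>}. f i)"

definition component :: "('k, 'a, 'm) graded_scheme \<Rightarrow> 'a \<Rightarrow> nat \<Rightarrow> 'a" where
  "component M x = (THE f. is_decomposition M x f)"

text \<open>\<open>grade_zero\<close> says that the structure map of the \<open>K\<close>-algebra \<open>A\<close> identifies \<open>K\<close> with \<open>A\<^sub>0\<close>.\<close>

locale standard_graded_algebra = algebra K A + field K
  for K :: "('k, 'n) ring_scheme" and A :: "('k, 'a, 'm) graded_scheme" +
  assumes grade_subgroup: "subgroup (grade A i) (add_monoid A)"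
    and grade_smult: "\<lbrakk>c \<in> carrier K; x \<in> grade A i\<rbrakk> \<Longrightarrow> c \<odot>\<^bsub>A\<^esub> x \<in> grade A i"
    and grade_mult: "\<lbrakk>x \<in> grade A i; y \<in> grade A j\<rbrakk> \<Longrightarrow> x \<otimes>\<^bsub>A\<^esub> y \<in> grade A (i + j)"
    and decomposition: "x \<in> carrier A \<Longrightarrow> \<exists>!f. is_decomposition A x f"
    and grade_zero: "bij_betw (\<lambda>c. c \<odot>\<^bsub>A\<^esub> \<one>\<^bsub>A\<^esub>) (carrier K) (grade A 0)"
    and generated:
      "\<lbrakk>subcring B A; \<And>c x. \<lbrakk>c \<in> carrier K; x \<in> B\<rbrakk> \<Longrightarrow> c \<odot>\<^bsub>A\<^esub> x \<in> B; grade A 1 \<subseteq> B\<rbrakk>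
        \<Longrightarrow> B = carrier A"
    and finite_dim: "vectorspace.fin_dim K (A\<lparr>carrier := grade A 1\<rparr>)"

definition graded_algebra_hom ::
  "('k, 'n) ring_scheme \<Rightarrow> ('k, 'a, 'm) graded_scheme \<Rightarrow> ('k, 'b, 'l) graded_scheme \<Rightarrow> ('a \<Rightarrow> 'b) set" where
  "graded_algebra_hom K A B =
     {f \<in> Ring.ring_hom A B.
       (\<forall>c\<in>carrier K. \<forall>x\<in>carrier A. f (c \<odot>\<^bsub>A\<^esub> x) = c \<odot>\<^bsub>B\<^esub> f x) \<and>
       (\<forall>i. f ` grade A i \<subseteq> grade B i)}"

definition graded_module_hom ::
  "('a, 'n) ring_scheme \<Rightarrow> ('a, 'b, 'm) graded_scheme \<Rightarrow> ('a, 'c, 'l) graded_scheme \<Rightarrow> ('b \<Rightarrow> 'c) set" where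
  "graded_module_hom A M N = {f \<in> module_hom A M N. \<forall>i. f ` grade M i \<subseteq> grade N i}"

definition graded_sub ::
  "('k, 'a) graded \<Rightarrow> 'a set \<Rightarrow> ('k, 'a) graded" where
  "graded_sub M N = M\<lparr>carrier := N, grade := (\<lambda>i. grade M i \<inter> N)\<rparr>"

text \<open>Quotient by a graded submodule, and quotient algebra by a homogeneous ideal.\<close>

definition graded_quot ::
  "('k, 'a) graded \<Rightarrow> 'a set \<Rightarrow> ('k, 'a set) graded" where
  "graded_quot M N =
     \<lparr>carrier = a_rcosets\<^bsub>M\<^esub> N,
      mult = rcoset_mult M N,
      one = N +>\<^bsub>M\<^esub> \<one>\<^bsub>M\<^esub>,
      zero = N,
      add = set_add M,
      smult = (\<lambda>c X. \<Union>x\<in>X. N +>\<^bsub>M\<^esub> (c \<odot>\<^bsub>M\<^esub> x)),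
      grade = (\<lambda>i. (\<lambda>x. N +>\<^bsub>M\<^esub> x) ` grade M i)\<rparr>"

section \<open>Hilbert series and the h-polynomial\<close>

definition hilbert_function ::
  "('k, 'n) ring_scheme \<Rightarrow> ('k, 'a, 'm) graded_scheme \<Rightarrow> nat \<Rightarrow> nat" where
  "hilbert_function K M i = vectorspace.dim K (M\<lparr>carrier := grade M i\<rparr>)"

definition hilbert_series ::
  "('k, 'n) ring_scheme \<Rightarrow> ('k, 'a, 'm) graded_scheme \<Rightarrow> int fps" where
  "hilbert_series K M = Abs_fps (\<lambda>i. int (hilbert_function K M i))"

definition krull_dim :: "('a, 'm) ring_scheme \<Rightarrow> enat" where
  "krull_dim R =
     (SUP n\<in>{n. \<exists>P. (\<forall>i\<le>n. primeideal (P i) R) \<and> (\<forall>i<n. P i \<subset> P (Suc i))}. enat n)"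

definition h_polynomial ::
  "('k, 'n) ring_scheme \<Rightarrow> ('k, 'a, 'm) graded_scheme \<Rightarrow> int poly" where
  "h_polynomial K A =
     (THE h. hilbert_series K A * (1 - fps_X) ^ the_enat (krull_dim A) = fps_of_poly h)"

section \<open>Tor and graded Betti numbers\<close>

definition irrelevant_ideal :: "('k, 'a, 'm) graded_scheme \<Rightarrow> 'a set" where
  "irrelevant_ideal A = {x \<in> carrier A. component A x 0 = \<zero>\<^bsub>A\<^esub>}"

text \<open>The projection \<open>A \<rightarrow> A\<^sub>0 = K\<close> with kernel the irrelevant ideal.\<close>

definition augmentation ::
  "('k, 'n) ring_scheme \<Rightarrow> ('k, 'a, 'm) graded_scheme \<Rightarrow> 'a \<Rightarrow> 'k" where
  "augmentation K A x = (THE c. c \<in> carrier K \<and> c \<odot>\<^bsub>A\<^esub> \<one>\<^bsub>A\<^esub> = component A x 0)"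

text \<open>\<open>K\<close> as a graded \<open>A\<close>-module concentrated in degree 0.\<close>

definition residue_module ::
  "('k, 'n) ring_scheme \<Rightarrow> ('k, 'a, 'm) graded_scheme \<Rightarrow> ('a, 'k) graded" where
  "residue_module K A =
     \<lparr>carrier = carrier K, mult = monoid.mult K, one = one K, zero = zero K, add = add K,
      smult = (\<lambda>a c. augmentation K A a \<otimes>\<^bsub>K\<^esub> c),
      grade = (\<lambda>i. if i = 0 then carrier K else {\<zero>\<^bsub>K\<^esub>})\<rparr>"

definition restrict_scalars ::
  "('q \<Rightarrow> 'r) \<Rightarrow> ('k, 'r, 'm) graded_scheme \<Rightarrow> ('q, 'r) graded" where
  "restrict_scalars \<phi> R =
     \<lparr>carrier = carrier R, mult = monoid.mult R, one = one R, zero = zero R, add = add R,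
      smult = (\<lambda>q r. \<phi> q \<otimes>\<^bsub>R\<^esub> r), grade = grade R\<rparr>"

text \<open>\<open>A(-d\<^sub>0) \<oplus> \<dots> \<oplus> A(-d\<^sub>r)\<close> for a list \<open>ds\<close> of degrees of the basis elements.\<close>

definition graded_free ::
  "('k, 'a, 'm) graded_scheme \<Rightarrow> nat list \<Rightarrow> ('a, nat \<Rightarrow> 'a) graded" where
  "graded_free A ds =
     \<lparr>carrier = {..<length ds} \<rightarrow>\<^sub>E carrier A,
      mult = (\<lambda>v w. \<lambda>t\<in>{..<length ds}. v t \<otimes>\<^bsub>A\<^esub> w t),
      one = (\<lambda>t\<in>{..<length ds}. \<one>\<^bsub>A\<^esub>),
      zero = (\<lambda>t\<in>{..<length ds}. \<zero>\<^bsub>A\<^esub>),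
      add = (\<lambda>v w. \<lambda>t\<in>{..<length ds}. v t \<oplus>\<^bsub>A\<^esub> w t),
      smult = (\<lambda>a v. \<lambda>t\<in>{..<length ds}. a \<otimes>\<^bsub>A\<^esub> v t),
      grade = (\<lambda>j. {v \<in> {..<length ds} \<rightarrow>\<^sub>E carrier A. \<forall>t<length ds.
                      if ds ! t \<le> j then v t \<in> grade A (j - ds ! t) else v t = \<zero>\<^bsub>A\<^esub>})\<rparr>"

definition free_basis :: "('k, 'a, 'm) graded_scheme \<Rightarrow> nat list \<Rightarrow> nat \<Rightarrow> nat \<Rightarrow> 'a" where
  "free_basis A ds t = (\<lambda>s\<in>{..<length ds}. if s = t then \<one>\<^bsub>A\<^esub> else \<zero>\<^bsub>A\<^esub>)"

text \<open>
  \<open>\<dots> \<rightarrow> F\<^sub>2 \<rightarrow> F\<^sub>1 \<rightarrow> F\<^sub>0 \<rightarrow> M \<rightarrow> 0\<close> is exact, where \<open>F\<^sub>i = graded_free A (F i)\<close> has finite rank,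
  \<open>d i : F\<^bsub>i+1\<^esub> \<rightarrow> F\<^sub>i\<close> and \<open>\<epsilon> : F\<^sub>0 \<rightarrow> M\<close>; the resolution need not be minimal.
\<close>

definition graded_free_resolution ::
  "('k, 'a, 'm) graded_scheme \<Rightarrow> ('a, 'b, 'l) graded_scheme \<Rightarrow>
   (nat \<Rightarrow> nat list) \<times> (nat \<Rightarrow> (nat \<Rightarrow> 'a) \<Rightarrow> (nat \<Rightarrow> 'a)) \<times> ((nat \<Rightarrow> 'a) \<Rightarrow> 'b) \<Rightarrow> bool" where
  "graded_free_resolution A M = (\<lambda>(F, d, \<epsilon>).
     (\<forall>i. d i \<in> graded_module_hom A (graded_free A (F (Suc i))) (graded_free A (F i))) \<and>
     \<epsilon> \<in> graded_module_hom A (graded_free A (F 0)) M \<and>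
     \<epsilon> ` carrier (graded_free A (F 0)) = carrier M \<and>
     {v \<in> carrier (graded_free A (F 0)). \<epsilon> v = \<zero>\<^bsub>M\<^esub>} = d 0 ` carrier (graded_free A (F 1)) \<and>
     (\<forall>i. {v \<in> carrier (graded_free A (F (Suc i))). d i v = \<zero>\<^bsub>graded_free A (F i)\<^esub>} =
          d (Suc i) ` carrier (graded_free A (F (Suc (Suc i))))))"

definition base_algebra :: "('k, 'n) ring_scheme \<Rightarrow> ('k, 'k) graded" where
  "base_algebra K =
     \<lparr>carrier = carrier K, mult = monoid.mult K, one = one K, zero = zero K, add = add K,
      smult = monoid.mult K, grade = (\<lambda>i. if i = 0 then carrier K else {\<zero>\<^bsub>K\<^esub>})\<rparr>"

text \<open>
  Base change along \<open>A \<rightarrow> K\<close>: \<open>K \<otimes>\<^sub>A A(-d)\<close> is \<open>K(-d)\<close>, and \<open>1 \<otimes> f\<close> is given by the matrix of \<open>f\<close>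
  with its entries reduced modulo the irrelevant ideal.
\<close>

definition tensor_map ::
  "('k, 'n) ring_scheme \<Rightarrow> ('k, 'a, 'm) graded_scheme \<Rightarrow> nat list \<Rightarrow> nat list \<Rightarrow>
   ((nat \<Rightarrow> 'a) \<Rightarrow> (nat \<Rightarrow> 'a)) \<Rightarrow> (nat \<Rightarrow> 'k) \<Rightarrow> (nat \<Rightarrow> 'k)" where
  "tensor_map K A ds es f v =
     (\<lambda>u\<in>{..<length es}. \<Oplus>\<^bsub>K\<^esub>t\<in>{..<length ds}. augmentation K A (f (free_basis A ds t) u) \<otimes>\<^bsub>K\<^esub> v t)"

definition tor_cycles where
  "tor_cycles K A F d i =
     (case i of
        0 \<Rightarrow> carrier (graded_free (base_algebra K) (F 0))
      | Suc m \<Rightarrow> {v \<in> carrier (graded_free (base_algebra K) (F (Suc m))).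
                   tensor_map K A (F (Suc m)) (F m) (d m) v = \<zero>\<^bsub>graded_free (base_algebra K) (F m)\<^esub>})"

definition tor_boundaries where
  "tor_boundaries K A F d i =
     tensor_map K A (F (Suc i)) (F i) (d i) ` carrier (graded_free (base_algebra K) (F (Suc i)))"

text \<open>
  \<open>Tor\<^sub>i\<close> of \<open>K\<close> and \<open>M\<close> over \<open>A\<close>, for \<open>M\<close> finitely generated over a standard graded algebra \<open>A\<close>
  (so that a resolution by free modules of finite rank exists, \<open>A\<close> being Noetherian); up to
  isomorphism of graded vector spaces it does not depend on the resolution that is chosen.
\<close>

definition Tor ::
  "('k, 'n) ring_scheme \<Rightarrow> ('k, 'a, 'm) graded_scheme \<Rightarrow> ('a, 'b, 'l) graded_scheme \<Rightarrow>
   nat \<Rightarrow> ('k, (nat \<Rightarrow> 'k) set) graded" where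
  "Tor K A M i =
     (case (SOME r. graded_free_resolution A M r) of (F, d, \<epsilon>) \<Rightarrow>
        graded_quot
          (graded_sub (graded_free (base_algebra K) (F i)) (tor_cycles K A F d i))
          (tor_boundaries K A F d i))"

definition betti ::
  "('k, 'n) ring_scheme \<Rightarrow> ('k, 'a, 'm) graded_scheme \<Rightarrow> ('a, 'b, 'l) graded_scheme \<Rightarrow>
   nat \<Rightarrow> nat \<Rightarrow> nat" where
  "betti K A M i j = hilbert_function K (Tor K A M i) j"

text \<open>
  Elements of \<^typ>\<open>int fps fps\<close> are power series in \<open>z\<close> (outer variable, homological degree) whose
  coefficients are power series in \<open>s\<close> (inner variable, internal degree).
\<close>

definition poincare_series ::
  "('k, 'n) ring_scheme \<Rightarrow> ('k, 'a, 'm) graded_scheme \<Rightarrow> ('a, 'b, 'l) graded_scheme \<Rightarrow> int fps fps" where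
  "poincare_series K A M = Abs_fps (\<lambda>i. Abs_fps (\<lambda>j. int (betti K A M i j)))"

section \<open>Golod morphisms\<close>

text \<open>
  The last condition is \<open>P\<^sup>R\<^sub>k = P\<^sup>Q\<^sub>k / (1 - z (P\<^sup>Q\<^sub>R - 1))\<close>; the denominator has constant coefficient 1
  as a power series in \<open>z\<close>, hence is invertible.
\<close>

definition golod ::
  "('k, 'n) ring_scheme \<Rightarrow> ('k, 'q, 'm) graded_scheme \<Rightarrow> ('k, 'r, 'l) graded_scheme \<Rightarrow> ('q \<Rightarrow> 'r) \<Rightarrow> bool" where
  "golod K Q R \<phi> \<longleftrightarrow>
     standard_graded_algebra K Q \<and> standard_graded_algebra K R \<and>
     \<phi> \<in> graded_algebra_hom K Q R \<and> \<phi> ` carrier Q = carrier R \<and>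
     a_kernel Q R \<phi> \<subseteq> ideal_prod Q (irrelevant_ideal Q) (irrelevant_ideal Q) \<and>
     poincare_series K R (residue_module K R) *
       (1 - fps_X * (poincare_series K Q (restrict_scalars \<phi> R) - 1)) =
     poincare_series K Q (residue_module K Q)"

section \<open>Polynomial rings, complete intersections and Veronese subrings\<close>

text \<open>Polynomials in the variables \<open>x\<^sub>0, \<dots>, x\<^bsub>n-1\<^esub>\<close>, with the standard grading.\<close>

definition poly_ring :: "nat \<Rightarrow> ('k::field, (nat \<Rightarrow>\<^sub>0 nat) \<Rightarrow>\<^sub>0 'k) graded" where
  "poly_ring n =
     \<lparr>carrier = {p. \<forall>m\<in>Poly_Mapping.keys p. Poly_Mapping.keys m \<subseteq> {..<n}},
      mult = (*), one = 1, zero = 0, add = (+),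
      smult = (\<lambda>c p. Poly_Mapping.single 0 c * p),
      grade = (\<lambda>i. {p. \<forall>m\<in>Poly_Mapping.keys p. Poly_Mapping.keys m \<subseteq> {..<n} \<and> (\<Sum>t\<in>Poly_Mapping.keys m. Poly_Mapping.lookup m t) = i})\<rparr>"

definition homogeneous_regular_sequence :: "('k, 'a, 'm) graded_scheme \<Rightarrow> 'a list \<Rightarrow> bool" where
  "homogeneous_regular_sequence A fs \<longleftrightarrow>
     (\<forall>f\<in>set fs. \<exists>j. f \<in> grade A j) \<and>
     (\<forall>i<length fs. \<forall>g\<in>carrier A.
        fs ! i \<otimes>\<^bsub>A\<^esub> g \<in> Idl\<^bsub>A\<^esub> (set (take i fs)) \<longrightarrow> g \<in> Idl\<^bsub>A\<^esub> (set (take i fs))) \<and>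
     Idl\<^bsub>A\<^esub> (set fs) \<noteq> carrier A"

text \<open>
  Complete intersections are taken in the presented form (polynomial ring modulo a regular sequence)
  rather than up to isomorphism; \<open>backelin_roos\<close> is insensitive to this, since a Golod morphism may
  be composed with a graded isomorphism \<open>Q' \<cong> Q\<close>.
\<close>

definition standard_graded_ci ::
  "('k::field, ((nat \<Rightarrow>\<^sub>0 nat) \<Rightarrow>\<^sub>0 'k) set) graded \<Rightarrow> bool" where
  "standard_graded_ci Q \<longleftrightarrow>
     (\<exists>m fs. homogeneous_regular_sequence (poly_ring m) fs \<and>
        Q = graded_quot (poly_ring m) (Idl\<^bsub>poly_ring m\<^esub> (set fs)))"

definition backelin_roos :: "('k::field, 'r, 'm) graded_scheme \<Rightarrow> bool" where
  "backelin_roos R \<longleftrightarrow> (\<exists>Q \<phi>. standard_graded_ci Q \<and> golod class_ring Q R \<phi>)"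

definition veronese :: "('k, 'a) graded \<Rightarrow> nat \<Rightarrow> ('k, 'a) graded" where
  "veronese A c =
     A\<lparr>carrier := {x \<in> carrier A. \<forall>i. \<not> c dvd i \<longrightarrow> component A x i = \<zero>\<^bsub>A\<^esub>},
       grade := (\<lambda>i. grade A (i * c))\<rparr>"

end

theory Submission
  imports Defs "HOL-Analysis.FPS_Convergence"
begin

text \<open>
  Let \<open>R = S^(c)\<close> with Hilbert series \<open>H(z) = h(z) / (1 - z)^n\<close>.  The degree \<open>i\<close> part of \<open>R\<close> has the
  monomials of degree \<open>i c\<close> as a basis (\<open>hilbert_function_veronese\<close>) and \<open>R\<close> has Krull dimension \<open>n\<close>
  (\<open>krull_dim_veronese\<close>), so that \<open>h\<close> can be computed: in all cases considered it is a cubic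
  polynomial, and its value at \<open>-1\<close> is read off.

  That \<open>R\<close> has no surjective Golod morphism from a complete intersection \<open>Q\<close> is a consequence of
  \<open>h(-1) > 0\<close>.  The ring \<open>R\<close> is Koszul: by \<open>linear_resolution\<close> the residue field \<open>k\<close> has a linear
  resolution over \<open>R\<close>, so \<open>P^R_k(s,z) H(-sz) = 1\<close>, and for a Golod morphism \<open>Q \<rightarrow> R\<close> the defining equality
  turns into
  \<open>P^Q_k(s,z) H(-sz) = 1 - z (P^Q_R(s,z) - 1)\<close>.
  The Betti numbers in \<open>P^Q_R\<close> are nonnegative, so on the right every coefficient of a power of \<open>z\<close>
  from \<open>z^2\<close> on is at most \<open>0\<close>.  Each power of \<open>z\<close> occurs on the left with finitely many powers of \<open>s\<close>,
  and one may put \<open>s = 1\<close> (\<open>golod_coefficients\<close>).  With \<open>P(z) = P^Q_k(1,z)\<close> the series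
  \<open>P(z) H(-z) = 1 + a z + ...\<close> then has no positive coefficient after the linear term.

  Adjoining one element of a regular sequence multiplies the ranks of a resolution of \<open>k\<close> at most by
  the series \<open>1 / (1 - z^2)\<close> (\<open>shamash\<close>), so over the complete intersection \<open>Q\<close> the Betti numbers of \<open>k\<close>
  grow polynomially and \<open>P\<close> converges, with positive values, on \<open>(0,1)\<close>.  On this interval
  \<open>(P(z) H(-z) - 1) / z\<close> is decreasing.  If \<open>h(-w) \<le> 0\<close> for one \<open>w\<close> in \<open>(0,1)\<close>, then
  \<open>P(w) H(-w) \<le> 0\<close>, hence \<open>P(z) H(-z) < 0\<close> for all \<open>z\<close> in \<open>(w,1)\<close>, and \<open>h(-z) < 0\<close> there, which
  contradicts \<open>h(-1) > 0\<close> (\<open>no_sign_return\<close>).  Such a \<open>w\<close> exists in all cases: \<open>w = 1/4\<close> or \<open>w = 1/8\<close>.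

  Tor is defined by the choice of some graded free resolution.  It is computed with matrices of
  homogeneous polynomials modulo an ideal: \<open>R\<close> and \<open>Q\<close> are both quotients of a Veronese subring of a
  polynomial ring (\<open>presented_algebra\<close>), resolutions of \<open>k\<close> correspond to systems of such matrices, and
  \<open>betti_residue_eq\<close> says that any of them gives the Betti numbers.
\<close>

section \<open>A sign argument for power series\<close>

lemma summable_poly_growth:
  fixes a :: "nat \<Rightarrow> real" and x :: real
  assumes a: "\<And>i. \<bar>a i\<bar> \<le> C * real (i + 1) ^ r" and x: "\<bar>x\<bar> < 1"
  shows "summable (\<lambda>i. norm (a i * x ^ i))"
proof -
  have "summable (\<lambda>i. real (i + 1) ^ r * \<bar>x\<bar> ^ i)"
  proof -
    have "(\<lambda>n. real (Suc n + 1) ^ r / real (n + 1) ^ r) \<longlonglongrightarrow> 1"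
    proof -
      have "(\<lambda>n. (1 + 1 / real (n + 1)) ^ r) \<longlonglongrightarrow> (1 + 0) ^ r"
        by (intro tendsto_power tendsto_add tendsto_const)
           (use LIMSEQ_inverse_real_of_nat in \<open>simp add: inverse_eq_divide add.commute\<close>)
      moreover have "(1 + 1 / real (n + 1)) ^ r = real (Suc n + 1) ^ r / real (n + 1) ^ r" for n
      proof -
        have "1 + 1 / real (n + 1) = real (Suc n + 1) / real (n + 1)" by (simp add: field_simps)
        then show ?thesis by (simp only: power_divide)
      qed
      ultimately show ?thesis by simp
    qed
    then have lim: "(\<lambda>n. \<bar>x\<bar> * (real (Suc n + 1) ^ r / real (n + 1) ^ r)) \<longlonglongrightarrow> \<bar>x\<bar> * 1"
      by (intro tendsto_intros)
    obtain c where c: "\<bar>x\<bar> < c" "c < 1" using x dense by blast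
    from order_tendstoD(2)[OF lim, of c] c have
      "eventually (\<lambda>n. \<bar>x\<bar> * (real (Suc n + 1) ^ r / real (n + 1) ^ r) < c) sequentially" by simp
    then obtain N where N: "\<And>n. n \<ge> N \<Longrightarrow> \<bar>x\<bar> * (real (Suc n + 1) ^ r / real (n + 1) ^ r) < c"
      by (auto simp: eventually_sequentially)
    show ?thesis
    proof (rule summable_ratio_test[OF c(2), of N])
      fix n assume "N \<le> n"
      from N[OF this] have "\<bar>x\<bar> * real (Suc n + 1) ^ r \<le> c * real (n + 1) ^ r"
        by (simp add: field_simps del: of_nat_Suc)
      then have "\<bar>x\<bar> ^ n * (\<bar>x\<bar> * real (Suc n + 1) ^ r) \<le> \<bar>x\<bar> ^ n * (c * real (n + 1) ^ r)"
        by (intro mult_left_mono) auto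
      then show "norm (real (Suc n + 1) ^ r * \<bar>x\<bar> ^ Suc n) \<le> c * norm (real (n + 1) ^ r * \<bar>x\<bar> ^ n)"
        by (simp add: abs_mult algebra_simps)
    qed
  qed
  then have "summable (\<lambda>i. C * (real (i + 1) ^ r * \<bar>x\<bar> ^ i))" by (rule summable_mult)
  then show ?thesis
  proof (rule summable_comparison_test'[of _ 0])
    fix i :: nat
    have "\<bar>a i\<bar> * \<bar>x\<bar> ^ i \<le> (C * real (i + 1) ^ r) * \<bar>x\<bar> ^ i"
      by (intro mult_right_mono a) auto
    then show "norm (norm (a i * x ^ i)) \<le> C * (real (i + 1) ^ r * \<bar>x\<bar> ^ i)"
      by (simp add: abs_mult power_abs mult.assoc)
  qed
qed

lemma hilbert_series_value:
  fixes H :: "nat \<Rightarrow> real" and h :: "real poly"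
  assumes H: "\<And>i. \<bar>H i\<bar> \<le> C * real (i + 1) ^ r" and x: "\<bar>x\<bar> < 1"
    and eq: "Abs_fps H * (1 - fps_X) ^ n = fps_of_poly h"
  shows "suminf (\<lambda>i. H i * x ^ i) * (1 - x) ^ n = poly h x"
proof -
  have "fps_conv_radius (Abs_fps H) \<ge> 1"
  proof -
    have "conv_radius H \<ge> 1"
    proof (rule conv_radius_geI_ex)
      fix s :: real assume "0 < s" "ereal s < 1"
      then have "\<bar>s\<bar> < 1" by auto
      from summable_norm_cancel[OF summable_poly_growth[OF H this]] \<open>0 < s\<close>
      show "\<exists>z. norm z = s \<and> summable (\<lambda>n. H n * z ^ n)" by (intro exI[of _ s]) auto
    qed
    then show ?thesis by (simp add: fps_conv_radius_def)
  qed
  then have r: "ereal (norm x) < fps_conv_radius (Abs_fps H)"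
    by (rule order.strict_trans2[rotated]) (use x in \<open>simp add: one_ereal_def\<close>)
  have r1: "fps_conv_radius (1 - fps_X :: real fps) = \<infinity>"
    using fps_conv_radius_diff[of "1 :: real fps" fps_X] by simp
  have "eval_fps (Abs_fps H * (1 - fps_X) ^ n) x = eval_fps (Abs_fps H) x * eval_fps ((1 - fps_X) ^ n) x"
    by (rule eval_fps_mult[OF r])
       (use fps_conv_radius_power[of "1 - fps_X :: real fps" n] r1 in auto)
  also have "eval_fps ((1 - fps_X) ^ n) x = (1 - x) ^ n"
    using r1 by (subst eval_fps_power) (auto simp: eval_fps_diff)
  finally show ?thesis unfolding eq eval_fps_of_poly by (simp add: eval_fps_def)
qed

text \<open>
  Write \<open>P (z)\<close> and \<open>H (z)\<close> for the series with coefficients \<open>p\<close> and \<open>H\<close>.  By \<open>coeff\<close>,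
  \<open>P (z) H (-z) = 1 + a z - N (z)\<close> with \<open>N\<close> having nonnegative coefficients and order at least 2, so
  that \<open>(P (z) H (-z) - 1) / z\<close> decreases on \<open>(0, 1)\<close>.  Hence once \<open>P (z) H (-z)\<close> has become
  nonpositive, it stays negative, against the sign of \<open>H (-z) = h (-z) / (1 + z)\<^sup>n\<close> near \<open>1\<close>.
\<close>

lemma no_sign_return:
  fixes p H :: "nat \<Rightarrow> real" and h :: "real poly"
  assumes p: "\<And>i. 0 \<le> p i" "\<And>i. p i \<le> C * real (i + 1) ^ r" "p 0 = 1"
    and H: "\<And>i. \<bar>H i\<bar> \<le> C' * real (i + 1) ^ s" "H 0 = 1"
    and eq: "Abs_fps H * (1 - fps_X) ^ n = fps_of_poly h"
    and coeff: "\<And>i. 2 \<le> i \<Longrightarrow> (\<Sum>l\<le>i. p l * ((-1) ^ (i - l) * H (i - l))) \<le> 0"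
    and w0: "0 < w0" "w0 < 1" "poly h (- w0) \<le> 0"
    and pos: "poly h (-1) > 0"
  shows False
proof -
  define f where "f i = (\<Sum>l\<le>i. p l * ((-1) ^ (i - l) * H (i - l)))" for i
  define P where "P w = suminf (\<lambda>i. p i * w ^ i)" for w
  define Q where "Q w = suminf (\<lambda>i. H i * (- w) ^ i)" for w :: real
  have f0: "f 0 = 1" by (simp add: f_def p(3) H(2))
  have sumP: "summable (\<lambda>i. norm (p i * w ^ i))" if "\<bar>w\<bar> < 1" for w
    using p that by (intro summable_poly_growth[of p C r]) auto
  have sumH: "summable (\<lambda>i. norm (H i * (- w) ^ i))" if "\<bar>w\<bar> < 1" for w
    using H that by (intro summable_poly_growth[of H C' s]) auto
  have sums: "(\<lambda>i. f i * w ^ i) sums (P w * Q w)" if w: "\<bar>w\<bar> < 1" for w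
  proof -
    have "(\<lambda>k. \<Sum>i\<le>k. (p i * w ^ i) * (H (k - i) * (- w) ^ (k - i))) sums (P w * Q w)"
      unfolding P_def Q_def by (rule Cauchy_product_sums[OF sumP[OF w] sumH[OF w]])
    moreover have "(\<Sum>i\<le>k. (p i * w ^ i) * (H (k - i) * (- w) ^ (k - i))) = f k * w ^ k" for k
      unfolding f_def sum_distrib_right
    proof (rule sum.cong[OF refl])
      fix i assume "i \<in> {..k}"
      then have "w ^ k = w ^ i * w ^ (k - i)" by (simp flip: power_add)
      then show "p i * w ^ i * (H (k - i) * (- w) ^ (k - i)) = p i * ((- 1) ^ (k - i) * H (k - i)) * w ^ k"
        by (simp add: power_minus[of w])
    qed
    ultimately show ?thesis by simp
  qed
  have tail: "(\<lambda>i. f (Suc i) * w ^ i) sums ((P w * Q w - 1) / w)" if w: "0 < w" "w < 1" for w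
  proof -
    have "(\<lambda>i. f (Suc i) * w ^ Suc i) sums (P w * Q w - f 0 * w ^ 0)"
      by (subst sums_Suc_iff[of "\<lambda>i. f i * w ^ i"]) (use sums[of w] w in simp)
    then have "(\<lambda>i. f (Suc i) * w ^ Suc i / w) sums ((P w * Q w - 1) / w)"
      by (intro sums_divide) (simp add: f0)
    then show ?thesis using w by simp
  qed
  have Ppos: "P w > 0" if w: "0 < w" "w < 1" for w
  proof -
    have "(\<Sum>i<1. p i * w ^ i) \<le> P w" unfolding P_def
      using w p by (intro sum_le_suminf summable_norm_cancel[OF sumP]) auto
    then show ?thesis by (simp add: p(3))
  qed
  have Q: "Q w * (1 + w) ^ n = poly h (- w)" if "0 < w" "w < 1" for w
    unfolding Q_def using hilbert_series_value[OF H(1), of "- w" n h] eq that by simp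
  \<comment> \<open>The constant term of the series in \<open>tail\<close> does not depend on \<open>w\<close>, and all others have coefficient at most \<open>0\<close>.\<close>
  have mono: "(P w * Q w - 1) / w \<le> (P w0 * Q w0 - 1) / w0" if w: "w0 < w" "w < 1" for w
  proof (rule sums_le[OF _ tail tail])
    show "f (Suc i) * w ^ i \<le> f (Suc i) * w0 ^ i" for i
    proof (cases i)
      case (Suc j)
      have "f (Suc i) \<le> 0" unfolding f_def by (rule coeff) (simp add: Suc)
      then show ?thesis using w w0 by (intro mult_left_mono_neg power_mono) auto
    qed simp
  qed (use w w0 in auto)
  have Q0: "Q w0 \<le> 0"
  proof -
    have "(1 + w0) ^ n > 0" using w0 by simp
    with Q[OF w0(1,2)] w0(3) show ?thesis by (metis linorder_not_less mult_pos_pos)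
  qed
  have neg: "P w * Q w < 0" if w: "w0 < w" "w < 1" for w
  proof -
    have "P w0 * Q w0 \<le> 0" using Ppos[OF w0(1,2)] Q0 by (simp add: mult_nonneg_nonpos)
    then have "(P w0 * Q w0 - 1) / w0 \<le> - 1 / w0" using w0 by (intro divide_right_mono) auto
    with mono[OF w] have "(P w * Q w - 1) / w \<le> - 1 / w0" by linarith
    then have "P w * Q w - 1 \<le> - 1 / w0 * w" using w w0 by (simp add: pos_divide_le_eq)
    moreover have "w / w0 > 1" using w w0 by simp
    ultimately show ?thesis by simp
  qed
  have "((\<lambda>w. poly h (- w)) \<longlongrightarrow> poly h (- 1)) (at_left 1)"
    by (intro tendsto_intros tendsto_ident_at)
  from order_tendstoD(1)[OF this pos] obtain b where b: "b < 1" "\<And>w. b < w \<Longrightarrow> w < 1 \<Longrightarrow> poly h (- w) > 0"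
    unfolding eventually_at_left_field by auto
  define w where "w = (max b w0 + 1) / 2"
  have w: "b < w" "w0 < w" "w < 1" using b w0 by (auto simp: w_def field_simps max_def)
  have "(1 + w) ^ n > 0" using w w0 by simp
  moreover have "Q w * (1 + w) ^ n > 0" using Q[of w] b(2)[OF w(1,3)] w w0 by simp
  ultimately have "Q w > 0" using zero_less_mult_pos2 by blast
  with Ppos[of w] w w0 have "P w * Q w > 0" by (intro mult_pos_pos) auto
  with neg[OF w(2,3)] show False by simp
qed

section \<open>Monomials\<close>

type_synonym mon = "nat \<Rightarrow>\<^sub>0 nat"

definition mdeg :: "mon \<Rightarrow> nat" where
  "mdeg m = (\<Sum>t\<in>Poly_Mapping.keys m. Poly_Mapping.lookup m t)"

lemma mdeg_superset:
  assumes "finite A" "Poly_Mapping.keys m \<subseteq> A"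
  shows "mdeg m = (\<Sum>t\<in>A. Poly_Mapping.lookup m t)"
  unfolding mdeg_def using assms by (intro sum.mono_neutral_left) (auto simp: in_keys_iff)

lemma mon_keys_add: "Poly_Mapping.keys (a + b :: mon) = Poly_Mapping.keys a \<union> Poly_Mapping.keys b"
  by (auto simp: in_keys_iff lookup_add)

lemma mdeg_add: "mdeg (a + b) = mdeg a + mdeg b"
proof -
  let ?A = "Poly_Mapping.keys a \<union> Poly_Mapping.keys b"
  have "mdeg (a + b) = (\<Sum>t\<in>?A. Poly_Mapping.lookup (a + b) t)"
    by (rule mdeg_superset) (auto simp: mon_keys_add)
  also have "\<dots> = (\<Sum>t\<in>?A. Poly_Mapping.lookup a t) + (\<Sum>t\<in>?A. Poly_Mapping.lookup b t)"
    by (simp add: lookup_add sum.distrib)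
  also have "\<dots> = mdeg a + mdeg b"
    by (metis finite_UnI finite_keys mdeg_superset sup_ge1 sup_ge2)
  finally show ?thesis .
qed

lemma mdeg_0 [simp]: "mdeg 0 = 0" by (simp add: mdeg_def)

lemma mdeg_eq_0_iff: "mdeg m = 0 \<longleftrightarrow> m = 0"
  by (auto simp: mdeg_def in_keys_iff poly_mapping_eq_iff fun_eq_iff)

lemma mdeg_single [simp]: "mdeg (Poly_Mapping.single t k) = k"
  by (cases "k = 0") (auto simp: mdeg_def)

definition mdvd :: "mon \<Rightarrow> mon \<Rightarrow> bool" where
  "mdvd a b \<longleftrightarrow> (\<exists>d. b = a + d)"

lemma mdvd_iff: "mdvd a b \<longleftrightarrow> (\<forall>t. Poly_Mapping.lookup a t \<le> Poly_Mapping.lookup b t)"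
proof
  assume "\<forall>t. Poly_Mapping.lookup a t \<le> Poly_Mapping.lookup b t"
  then have "b = a + (b - a)"
    by (intro poly_mapping_eqI) (simp add: lookup_add lookup_minus)
  then show "mdvd a b" by (auto simp: mdvd_def)
qed (auto simp: mdvd_def lookup_add)

lemma mdvd_add_diff: "mdvd a b \<Longrightarrow> a + (b - a) = b"
  by (intro poly_mapping_eqI) (simp add: mdvd_iff lookup_add lookup_minus)

lemma mdvd_refl [simp]: "mdvd a a" by (simp add: mdvd_iff)
lemma mdvd_trans: "mdvd a b \<Longrightarrow> mdvd b d \<Longrightarrow> mdvd a d"
  by (meson mdvd_iff order_trans)
lemma mdvd_add [simp]: "mdvd a (a + b)" "mdvd a (b + a)"
  by (auto simp: mdvd_iff lookup_add)

lemma mdvd_deg: "mdvd a b \<Longrightarrow> mdeg a \<le> mdeg b"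
  by (auto simp: mdvd_def mdeg_add)

lemma mdvd_deg_eq: "mdvd a b \<Longrightarrow> mdeg a = mdeg b \<Longrightarrow> a = b"
  by (auto simp: mdvd_def mdeg_add mdeg_eq_0_iff)

lemma mdvd_keys: "mdvd a b \<Longrightarrow> Poly_Mapping.keys a \<subseteq> Poly_Mapping.keys b"
  by (auto simp: mdvd_def mon_keys_add)

text \<open>
  Exponents can be raised one at a time, so every degree in between is attained.
\<close>

lemma mdvd_interpolate:
  assumes "mdvd a m" "mdeg a \<le> d" "d \<le> mdeg m"
  shows "\<exists>w. mdvd a w \<and> mdvd w m \<and> mdeg w = d"
  using assms(2)
proof (induction d rule: dec_induct)
  case base
  then show ?case using assms by (intro exI[of _ a]) auto
next
  case (step k)
  then obtain w where w: "mdvd a w" "mdvd w m" "mdeg w = k" using assms(3) by auto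
  then have "w \<noteq> m" using step assms(3) by auto
  obtain e where e: "m = w + e" using w by (auto simp: mdvd_def)
  with \<open>w \<noteq> m\<close> obtain t where t: "t \<in> Poly_Mapping.keys e"
    by (metis add.right_neutral ex_in_conv keys_eq_empty)
  show ?case
  proof (intro exI conjI)
    have "Poly_Mapping.lookup e t \<ge> 1" using t by (simp add: in_keys_iff)
    then show "mdvd (w + Poly_Mapping.single t 1) m"
      unfolding e by (auto simp: mdvd_iff lookup_add lookup_single when_def)
  qed (use w in \<open>auto simp: mdeg_add intro: mdvd_trans[OF _ mdvd_add(1)]\<close>)
qed

definition Mon :: "nat \<Rightarrow> nat \<Rightarrow> mon set" where
  "Mon n d = {m. Poly_Mapping.keys m \<subseteq> {..<n} \<and> mdeg m = d}"

lemma Mon_0: "Mon n 0 = {0}"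
  by (auto simp: Mon_def mdeg_eq_0_iff)

lemma Mon_add: "a \<in> Mon n d \<Longrightarrow> b \<in> Mon n e \<Longrightarrow> a + b \<in> Mon n (d + e)"
  by (auto simp: Mon_def mdeg_add mon_keys_add)

text \<open>Splitting off the last variable: a Pascal-type recursion for the number of monomials.\<close>

lemma Mon_Suc_Suc:
  "Mon (Suc n) (Suc d) = Mon n (Suc d) \<union> (\<lambda>m. m + Poly_Mapping.single n 1) ` Mon (Suc n) d"
  (is "?L = ?A \<union> ?B")
proof (intro equalityI subsetI)
  fix m assume m: "m \<in> ?L"
  show "m \<in> ?A \<union> ?B"
  proof (cases "n \<in> Poly_Mapping.keys m")
    case True
    then have dv: "mdvd (Poly_Mapping.single n 1) m"
      by (auto simp: mdvd_iff lookup_single when_def in_keys_iff)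
    from mdvd_add_diff[OF this] have *: "m = (m - Poly_Mapping.single n 1) + Poly_Mapping.single n 1"
      by (simp add: add.commute)
    have "mdeg m = mdeg (m - Poly_Mapping.single n 1) + 1"
      by (subst *) (simp only: mdeg_add mdeg_single)
    moreover have "Poly_Mapping.keys (m - Poly_Mapping.single n 1) \<subseteq> Poly_Mapping.keys m"
      by (subst (2) *) (simp only: mon_keys_add Un_upper1)
    ultimately have "m - Poly_Mapping.single n 1 \<in> Mon (Suc n) d"
      using m by (auto simp: Mon_def)
    with * show ?thesis by blast
  next
    case False
    then show ?thesis using m by (auto simp: Mon_def lessThan_Suc)
  qed
next
  fix m assume "m \<in> ?A \<union> ?B"
  then show "m \<in> ?L"
    by (auto simp: Mon_def mdeg_add mon_keys_add less_Suc_eq)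
qed

lemma finite_Mon [simp]: "finite (Mon n d)"
  and card_Mon: "card (Mon (Suc n) d) = (n + d) choose n"
proof -
  have "finite (Mon n d) \<and> (n > 0 \<longrightarrow> card (Mon n d) = (n - 1 + d) choose (n - 1))" for n
  proof (induction n arbitrary: d)
    case 0
    have "Mon 0 d \<subseteq> {0}" by (auto simp: Mon_def)
    then show ?case by (auto intro: finite_subset)
  next
    case (Suc n)
    show ?case
    proof (induction d)
      case 0
      then show ?case by (simp add: Mon_0)
    next
      case (Suc d)
      have disj: "Mon n (Suc d) \<inter> (\<lambda>m. m + Poly_Mapping.single n 1) ` Mon (Suc n) d = {}"
        by (auto simp: Mon_def mon_keys_add)
      have inj: "inj_on (\<lambda>m. m + Poly_Mapping.single n 1) (Mon (Suc n) d)"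
        by (auto simp: inj_on_def)
      have f: "finite (Mon n (Suc d))" and f': "finite (Mon (Suc n) d)"
        using \<open>\<And>d. finite (Mon n d) \<and> _ d\<close> Suc by auto
      have c: "card (Mon (Suc n) (Suc d)) = card (Mon n (Suc d)) + card (Mon (Suc n) d)"
        unfolding Mon_Suc_Suc using card_Un_disjoint[OF f finite_imageI[OF f'] disj]
        by (simp only: card_image[OF inj])
      have "card (Mon (Suc n) (Suc d)) = (n + Suc d) choose n"
      proof (cases n)
        case 0
        have "Mon 0 (Suc d) = {}" by (auto simp: Mon_def)
        with 0 c Suc show ?thesis by simp
      next
        case (Suc k)
        with c \<open>\<And>d. finite (Mon n d) \<and> _ d\<close>[of "Suc d"] Suc.IH show ?thesis
          by (simp add: \<open>finite (Mon (Suc n) d) \<and> _\<close>)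
      qed
      then show ?case using f f' by (simp add: Mon_Suc_Suc)
    qed
  qed
  from this[of n] this[of "Suc n"] show "finite (Mon n d)" "card (Mon (Suc n) d) = (n + d) choose n"
    by auto
qed

section \<open>Homogeneous matrices modulo an ideal\<close>

text \<open>
  A graded ring is given by its homogeneous pieces \<open>H d\<close>, with \<open>d\<close> an integer so that shifted degrees need
  no case distinction.  A vector of degree \<open>j\<close> in the graded free module with basis degrees \<open>ds\<close> is a
  function whose values beyond the length of \<open>ds\<close> are arbitrary.
\<close>

definition hvec :: "(int \<Rightarrow> 'p::comm_ring_1 set) \<Rightarrow> nat list \<Rightarrow> int \<Rightarrow> (nat \<Rightarrow> 'p) set" where
  "hvec H ds j = {v. \<forall>t<length ds. v t \<in> H (j - int (ds ! t))}"

definition hmat :: "(int \<Rightarrow> 'p::comm_ring_1 set) \<Rightarrow> nat list \<Rightarrow> nat list \<Rightarrow> (nat \<Rightarrow> nat \<Rightarrow> 'p) \<Rightarrow> bool" where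
  "hmat H ds es M \<longleftrightarrow> (\<forall>t<length ds. M t \<in> hvec H es (int (ds ! t)))"

text \<open>
  The vector \<open>M t\<close>, the \<open>t\<close>-th column in the usual convention, is the image of the \<open>t\<close>-th basis vector.
\<close>

definition appm :: "nat list \<Rightarrow> (nat \<Rightarrow> nat \<Rightarrow> 'p::comm_ring_1) \<Rightarrow> (nat \<Rightarrow> 'p) \<Rightarrow> nat \<Rightarrow> 'p" where
  "appm ds M v u = (\<Sum>t<length ds. v t * M t u)"

text \<open>
  Congruence modulo \<open>I\<close> of vectors of degree \<open>j\<close>.
\<close>

definition cvec :: "(int \<Rightarrow> 'p::comm_ring_1 set) \<Rightarrow> nat list \<Rightarrow> int \<Rightarrow> (nat \<Rightarrow> 'p) \<Rightarrow> (nat \<Rightarrow> 'p) \<Rightarrow> bool" where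
  "cvec I es j v w \<longleftrightarrow> (\<lambda>u. v u - w u) \<in> hvec I es j"

lemma appm_diff_any: "appm ds M (\<lambda>t. v t - w t) u = appm ds M v u - appm ds M w u"
  by (simp add: appm_def left_diff_distrib sum_subtractf)

locale graded_pieces =
  fixes H :: "int \<Rightarrow> 'p::comm_ring_1 set"
  assumes H0: "0 \<in> H d"
    and Hadd: "x \<in> H d \<Longrightarrow> y \<in> H d \<Longrightarrow> x + y \<in> H d"
    and Huminus: "x \<in> H d \<Longrightarrow> - x \<in> H d"
    and Hmult: "x \<in> H d \<Longrightarrow> y \<in> H e \<Longrightarrow> x * y \<in> H (d + e)"
    and Hone: "1 \<in> H 0"
    and Hneg: "d < 0 \<Longrightarrow> x \<in> H d \<Longrightarrow> x = 0"
begin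

definition hideal :: "(int \<Rightarrow> 'p set) \<Rightarrow> bool" where
  "hideal I \<longleftrightarrow> (\<forall>d. I d \<subseteq> H d \<and> 0 \<in> I d \<and> (\<forall>x\<in>I d. \<forall>y\<in>I d. x + y \<in> I d) \<and> (\<forall>x\<in>I d. - x \<in> I d)) \<and>
     (\<forall>d e. \<forall>x\<in>H d. \<forall>y\<in>I e. x * y \<in> I (d + e))"

lemma hideal_sub: "hideal I \<Longrightarrow> x \<in> I d \<Longrightarrow> x \<in> H d"
  and hideal_0: "hideal I \<Longrightarrow> 0 \<in> I d"
  and hideal_add: "hideal I \<Longrightarrow> x \<in> I d \<Longrightarrow> y \<in> I d \<Longrightarrow> x + y \<in> I d"
  and hideal_uminus: "hideal I \<Longrightarrow> x \<in> I d \<Longrightarrow> - x \<in> I d"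
  and hideal_mult: "hideal I \<Longrightarrow> x \<in> H d \<Longrightarrow> y \<in> I e \<Longrightarrow> x * y \<in> I (d + e)"
  unfolding hideal_def by blast+

lemma hideal_diff: "hideal I \<Longrightarrow> x \<in> I d \<Longrightarrow> y \<in> I d \<Longrightarrow> x - y \<in> I d"
  using hideal_add[of I x d "- y"] hideal_uminus[of I y d] by simp

lemma hideal_sum: "hideal I \<Longrightarrow> (\<And>a. a \<in> A \<Longrightarrow> f a \<in> I d) \<Longrightarrow> sum f A \<in> I d"
  by (induction A rule: infinite_finite_induct) (auto intro: hideal_add hideal_0)

lemma hideal_H: "hideal H"
  unfolding hideal_def using H0 Hadd Huminus Hmult by blast

lemmas Hdiff = hideal_diff[OF hideal_H] and Hsum = hideal_sum[OF hideal_H]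

lemma hvec_0: "hideal I \<Longrightarrow> (\<lambda>u. 0) \<in> hvec I es j"
  by (simp add: hvec_def hideal_0)

lemma hvec_add: "hideal I \<Longrightarrow> v \<in> hvec I es j \<Longrightarrow> w \<in> hvec I es j \<Longrightarrow> (\<lambda>u. v u + w u) \<in> hvec I es j"
  by (simp add: hvec_def hideal_add)

lemma hvec_uminus: "hideal I \<Longrightarrow> v \<in> hvec I es j \<Longrightarrow> (\<lambda>u. - v u) \<in> hvec I es j"
  by (simp add: hvec_def hideal_uminus)

lemma hvec_diff: "hideal I \<Longrightarrow> v \<in> hvec I es j \<Longrightarrow> w \<in> hvec I es j \<Longrightarrow> (\<lambda>u. v u - w u) \<in> hvec I es j"
  by (simp add: hvec_def hideal_diff)

lemma hvec_mult:
  assumes "hideal I" "x \<in> H a" "v \<in> hvec I es j"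
  shows "(\<lambda>u. x * v u) \<in> hvec I es (a + j)"
  unfolding hvec_def
proof (intro CollectI allI impI)
  fix t assume "t < length es"
  then have "v t \<in> I (j - int (es ! t))" using assms(3) by (simp add: hvec_def)
  from hideal_mult[OF assms(1,2) this] show "x * v t \<in> I (a + j - int (es ! t))"
    by (simp add: algebra_simps)
qed

lemma appm_hvec_ideal:
  assumes "hideal I" "hmat H ds es M" "v \<in> hvec I ds j"
  shows "appm ds M v \<in> hvec I es j"
  unfolding hvec_def appm_def
proof (intro CollectI allI impI hideal_sum[OF assms(1)])
  fix u t assume u: "u < length es" and t: "t \<in> {..<length ds}"
  then have "v t \<in> I (j - int (ds ! t))" "M t u \<in> H (int (ds ! t) - int (es ! u))"
    using assms by (auto simp: hvec_def hmat_def)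
  from hideal_mult[OF assms(1) this(2,1)] show "v t * M t u \<in> I (j - int (es ! u))"
    by (simp add: mult.commute)
qed

lemmas appm_hvec = appm_hvec_ideal[OF hideal_H]

lemma appm_diff: "appm ds M (\<lambda>t. v t - w t) u = appm ds M v u - appm ds M w u"
  by (simp add: appm_def left_diff_distrib sum_subtractf)

lemma appm_add: "appm ds M (\<lambda>t. v t + w t) u = appm ds M v u + appm ds M w u"
  by (simp add: appm_def distrib_right sum.distrib)

lemma appm_mult: "appm ds M (\<lambda>t. x * v t) u = x * appm ds M v u"
  by (simp add: appm_def sum_distrib_left mult.assoc)

lemma appm_mat_diff: "appm ds (\<lambda>t u. M t u - N t u) v u = appm ds M v u - appm ds N v u"
  by (simp add: appm_def right_diff_distrib sum_subtractf)

lemma appm_unit: "t < length ds \<Longrightarrow> appm ds M (\<lambda>s. if s = t then 1 else 0) u = M t u"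
  by (simp add: appm_def if_distrib[of "\<lambda>x. x * _"] cong: if_cong)

lemma appm_id: "u < length ds \<Longrightarrow> appm ds (\<lambda>t u. if u = t then 1 else 0) v u = v u"
  by (simp add: appm_def if_distrib[of "\<lambda>x. _ * x"] cong: if_cong)

lemma appm_comp: "appm es N (appm ds M v) u = appm ds (\<lambda>t. appm es N (M t)) v u"
proof -
  have "appm es N (appm ds M v) u = (\<Sum>s<length es. \<Sum>t<length ds. v t * M t s * N s u)"
    by (simp add: appm_def sum_distrib_right)
  also have "\<dots> = (\<Sum>t<length ds. \<Sum>s<length es. v t * M t s * N s u)" by (rule sum.swap)
  finally show ?thesis by (simp add: appm_def sum_distrib_left mult.assoc)
qed

lemma appm_comp_fun: "appm es N (appm ds M v) = appm ds (\<lambda>t. appm es N (M t)) v"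
  by (rule ext) (rule appm_comp)

lemma appm_zero_mat [simp]: "appm ds (\<lambda>_ _. 0) v = (\<lambda>_. 0)"
  and appm_zero_vec [simp]: "appm ds M (\<lambda>_. 0) = (\<lambda>_. 0)"
  by (simp_all add: appm_def[abs_def])

lemma hmat_comp: "hmat H ds es M \<Longrightarrow> hmat H es fs N \<Longrightarrow> hmat H ds fs (\<lambda>t. appm es N (M t))"
  unfolding hmat_def[of H ds] by (auto intro: appm_hvec)

lemma hmat_diff: "hmat H ds es M \<Longrightarrow> hmat H ds es N \<Longrightarrow> hmat H ds es (\<lambda>t u. M t u - N t u)"
  unfolding hmat_def[of H ds] by (auto intro: hvec_diff[OF hideal_H])

lemma hmat_id: "hmat H ds ds (\<lambda>t u. if u = t then 1 else 0)"
  unfolding hmat_def hvec_def by (auto simp: H0 Hone)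

lemma hmat_0: "hmat H ds es (\<lambda>t u. 0)"
  unfolding hmat_def hvec_def by (auto simp: H0)

lemma cvec_refl: "hideal I \<Longrightarrow> cvec I es j v v"
  by (simp add: cvec_def hvec_0)

lemma cvec_sym: "hideal I \<Longrightarrow> cvec I es j v w \<Longrightarrow> cvec I es j w v"
  unfolding cvec_def using hvec_uminus[of I "\<lambda>u. v u - w u"] by simp

lemma cvec_trans: "hideal I \<Longrightarrow> cvec I es j v w \<Longrightarrow> cvec I es j w x \<Longrightarrow> cvec I es j v x"
  unfolding cvec_def using hvec_add[of I "\<lambda>u. v u - w u" es j "\<lambda>u. w u - x u"] by simp

lemma cvec_add: "hideal I \<Longrightarrow> cvec I es j v w \<Longrightarrow> cvec I es j v' w' \<Longrightarrow>
    cvec I es j (\<lambda>u. v u + v' u) (\<lambda>u. w u + w' u)"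
  unfolding cvec_def using hvec_add[of I "\<lambda>u. v u - w u" es j "\<lambda>u. v' u - w' u"]
  by (simp add: algebra_simps)

lemma cvec_diff: "hideal I \<Longrightarrow> cvec I es j v w \<Longrightarrow> cvec I es j v' w' \<Longrightarrow>
    cvec I es j (\<lambda>u. v u - v' u) (\<lambda>u. w u - w' u)"
  unfolding cvec_def using hvec_diff[of I "\<lambda>u. v u - w u" es j "\<lambda>u. v' u - w' u"]
  by (simp add: algebra_simps)

lemma cvec_appm: "hideal I \<Longrightarrow> hmat H ds es M \<Longrightarrow> cvec I ds j v w \<Longrightarrow> cvec I es j (appm ds M v) (appm ds M w)"
  unfolding cvec_def using appm_hvec_ideal[of I ds es M "\<lambda>u. v u - w u" j] by (simp flip: appm_diff)

lemma cvec_mono: "(\<And>d. I d \<subseteq> J d) \<Longrightarrow> cvec I es j v w \<Longrightarrow> cvec J es j v w"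
  unfolding cvec_def hvec_def by blast

lemma cvec_cong_right: "(\<And>u. u < length es \<Longrightarrow> w u = w' u) \<Longrightarrow> cvec I es j v w \<longleftrightarrow> cvec I es j v w'"
  by (auto simp: cvec_def hvec_def)

text \<open>
  Coordinates of vectors are homogeneous and \<open>I\<close> is an ideal, so the images of the basis vectors decide.
\<close>

lemma cvec_columns:
  assumes "hideal I" "v \<in> hvec H ds j"
    and "\<And>t. t < length ds \<Longrightarrow> cvec I es (int (ds ! t)) (M t) (N t)"
  shows "cvec I es j (appm ds M v) (appm ds N v)"
  unfolding cvec_def hvec_def appm_def
proof (intro CollectI allI impI)
  fix u assume u: "u < length es"
  have "(\<Sum>t<length ds. v t * (M t u - N t u)) \<in> I (j - int (es ! u))"
  proof (rule hideal_sum[OF assms(1)])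
    fix t assume t: "t \<in> {..<length ds}"
    then have "v t \<in> H (j - int (ds ! t))" "M t u - N t u \<in> I (int (ds ! t) - int (es ! u))"
      using assms(2,3) u by (auto simp: hvec_def cvec_def)
    from hideal_mult[OF assms(1) this] show "v t * (M t u - N t u) \<in> I (j - int (es ! u))" by simp
  qed
  then show "(\<Sum>t<length ds. v t * M t u) - (\<Sum>t<length ds. v t * N t u) \<in> I (j - int (es ! u))"
    by (simp add: right_diff_distrib sum_subtractf)
qed

end

section \<open>Resolutions of the residue field by matrices\<close>

context graded_pieces begin

text \<open>
  The ideal generated by \<open>I\<close> and the elements of positive degree; the quotient by it is \<open>k\<close>.
\<close>

definition aug :: "(int \<Rightarrow> 'p set) \<Rightarrow> int \<Rightarrow> 'p set" where
  "aug I d = (if d > 0 then H d else I d)"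

lemma aug_ideal: assumes "hideal I" shows "hideal (aug I)"
  unfolding hideal_def
proof (intro conjI allI ballI)
  fix d e x y assume x: "x \<in> H d" and y: "y \<in> aug I e"
  show "x * y \<in> aug I (d + e)"
  proof (cases "d < 0")
    case True
    then show ?thesis using Hneg[OF True x] assms by (auto simp: aug_def H0 hideal_0)
  next
    case False
    then show ?thesis
      using x y hideal_mult[OF assms x, of y e] Hmult[OF x, of y e] hideal_sub[OF assms]
      by (auto simp: aug_def split: if_splits)
  qed
qed (use assms in \<open>auto simp: aug_def hideal_sub hideal_0 hideal_add hideal_uminus H0 Hadd Huminus\<close>)

text \<open>
  A graded free resolution of \<open>k\<close> over \<open>A / I\<close>, moved up by one degree: position \<open>0\<close> is the
  module \<open>k = A / A\<^sub>+\<close>, presented as a module of rank one in which vectors are compared modulo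
  \<open>A\<^sub>+\<close>, so that the augmentation is one more matrix.
\<close>

definition rel :: "(int \<Rightarrow> 'p set) \<Rightarrow> nat \<Rightarrow> int \<Rightarrow> 'p set" where
  "rel I i = (if i = 0 then aug I else I)"

definition hres :: "(int \<Rightarrow> 'p set) \<Rightarrow> (nat \<Rightarrow> nat list) \<Rightarrow> (nat \<Rightarrow> nat \<Rightarrow> nat \<Rightarrow> 'p) \<Rightarrow> bool" where
  "hres I F D \<longleftrightarrow> F 0 = [0] \<and> (\<forall>i. hmat H (F (Suc i)) (F i) (D i)) \<and>
     (\<forall>j. \<forall>v\<in>hvec H (F 0) j. \<exists>w\<in>hvec H (F 1) j. cvec (rel I 0) (F 0) j (appm (F 1) (D 0) w) v) \<and>
     (\<forall>i j. \<forall>v\<in>hvec H (F (Suc (Suc i))) j.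
        cvec (rel I i) (F i) j (appm (F (Suc i)) (D i) (appm (F (Suc (Suc i))) (D (Suc i)) v)) (\<lambda>_. 0)) \<and>
     (\<forall>i j. \<forall>v\<in>hvec H (F (Suc i)) j. cvec (rel I i) (F i) j (appm (F (Suc i)) (D i) v) (\<lambda>_. 0) \<longrightarrow>
        (\<exists>w\<in>hvec H (F (Suc (Suc i))) j. cvec I (F (Suc i)) j (appm (F (Suc (Suc i))) (D (Suc i)) w) v))"

lemma rel_ideal: "hideal I \<Longrightarrow> hideal (rel I i)"
  by (simp add: rel_def aug_ideal)

context
  fixes I F D
  assumes I: "hideal I" and F: "hres I F D"
begin

lemma hres_mat: "hmat H (F (Suc i)) (F i) (D i)"
  and hres_surj: "v \<in> hvec H (F 0) j \<Longrightarrow> \<exists>w\<in>hvec H (F 1) j. cvec (rel I 0) (F 0) j (appm (F 1) (D 0) w) v"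
  and hres_comp: "v \<in> hvec H (F (Suc (Suc i))) j \<Longrightarrow>
        cvec (rel I i) (F i) j (appm (F (Suc i)) (D i) (appm (F (Suc (Suc i))) (D (Suc i)) v)) (\<lambda>_. 0)"
  and hres_exact: "v \<in> hvec H (F (Suc i)) j \<Longrightarrow> cvec (rel I i) (F i) j (appm (F (Suc i)) (D i) v) (\<lambda>_. 0) \<Longrightarrow>
        \<exists>w\<in>hvec H (F (Suc (Suc i))) j. cvec I (F (Suc i)) j (appm (F (Suc (Suc i))) (D (Suc i)) w) v"
  and hres_0: "F 0 = [0]"
  using F unfolding hres_def by blast+

text \<open>
  The step that builds chain maps and homotopies: columns that are cycles lift through the differential,
  by surjectivity at position \<open>0\<close> and by exactness at the later positions.
\<close>

lemma lift_matrix: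
  assumes a: "hmat H ds (F i) \<alpha>"
    and c: "\<And>k t. i = Suc k \<Longrightarrow> t < length ds \<Longrightarrow>
              cvec (rel I k) (F k) (int (ds ! t)) (appm (F i) (D k) (\<alpha> t)) (\<lambda>_. 0)"
  shows "\<exists>\<gamma>. hmat H ds (F (Suc i)) \<gamma> \<and>
           (\<forall>t<length ds. cvec (rel I i) (F i) (int (ds ! t)) (appm (F (Suc i)) (D i) (\<gamma> t)) (\<alpha> t))"
proof -
  have "\<exists>w\<in>hvec H (F (Suc i)) (int (ds ! t)).
          cvec (rel I i) (F i) (int (ds ! t)) (appm (F (Suc i)) (D i) w) (\<alpha> t)" if t: "t < length ds" for t
  proof (cases i)
    case 0
    then show ?thesis using hres_surj[of "\<alpha> t" "int (ds ! t)"] a t by (simp add: hmat_def)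
  next
    case (Suc k)
    then show ?thesis using hres_exact[of "\<alpha> t" k "int (ds ! t)"] a c[OF Suc t] t
      by (simp add: hmat_def rel_def)
  qed
  then obtain \<gamma> where "\<And>t. t < length ds \<Longrightarrow> \<gamma> t \<in> hvec H (F (Suc i)) (int (ds ! t)) \<and>
      cvec (rel I i) (F i) (int (ds ! t)) (appm (F (Suc i)) (D i) (\<gamma> t)) (\<alpha> t)" by metis
  then show ?thesis by (intro exI[of _ \<gamma>]) (auto simp: hmat_def)
qed

text \<open>A chain map is unique up to homotopy; here for one that vanishes at position \<open>0\<close>.\<close>

lemma null_homotopy:
  assumes th: "\<And>i. hmat H (F i) (F i) (\<theta> i)"
    and sq: "\<And>i j v. v \<in> hvec H (F (Suc i)) j \<Longrightarrow>
      cvec (rel I i) (F i) j (appm (F (Suc i)) (D i) (appm (F (Suc i)) (\<theta> (Suc i)) v))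
        (appm (F i) (\<theta> i) (appm (F (Suc i)) (D i) v))"
    and th0: "\<And>v u. appm (F 0) (\<theta> 0) v u = 0 \<or> u \<ge> length (F 0)"
  shows "\<exists>h. h 0 = (\<lambda>_ _. 0) \<and> (\<forall>i. hmat H (F i) (F (Suc i)) (h i) \<and>
     (\<forall>j. \<forall>v\<in>hvec H (F (Suc i)) j. cvec I (F (Suc i)) j
       (appm (F (Suc (Suc i))) (D (Suc i)) (appm (F (Suc i)) (h (Suc i)) v))
       (\<lambda>u. appm (F (Suc i)) (\<theta> (Suc i)) v u - appm (F i) (h i) (appm (F (Suc i)) (D i) v) u)))"
proof -
  define P where "P i h \<longleftrightarrow> hmat H (F i) (F (Suc i)) h \<and> (i = 0 \<longrightarrow> h = (\<lambda>_ _. 0)) \<and>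
     (\<forall>j. \<forall>v\<in>hvec H (F (Suc i)) j. cvec (rel I i) (F i) j (appm (F (Suc i)) (D i)
        (\<lambda>u. appm (F (Suc i)) (\<theta> (Suc i)) v u - appm (F i) h (appm (F (Suc i)) (D i) v) u)) (\<lambda>_. 0))"
    for i h
  define Q where "Q i h h' \<longleftrightarrow> (\<forall>j. \<forall>v\<in>hvec H (F (Suc i)) j. cvec I (F (Suc i)) j
       (appm (F (Suc (Suc i))) (D (Suc i)) (appm (F (Suc i)) h' v))
       (\<lambda>u. appm (F (Suc i)) (\<theta> (Suc i)) v u - appm (F i) h (appm (F (Suc i)) (D i) v) u))"
    for i h h'
  have "\<exists>f. \<forall>i. P i (f i) \<and> Q i (f i) (f (Suc i))"
  proof (rule dependent_nat_choice)
    have "cvec (rel I 0) (F 0) j (appm (F (Suc 0)) (D 0) (appm (F (Suc 0)) (\<theta> (Suc 0)) v)) (\<lambda>_. 0)"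
      if "v \<in> hvec H (F (Suc 0)) j" for v j
    proof -
      have "appm (F 0) (\<theta> 0) (appm (F (Suc 0)) (D 0) v) u = 0" if "u < length (F 0)" for u
        using th0 that by (meson not_less)
      then show ?thesis using sq[OF that] by (simp cong: cvec_cong_right)
    qed
    then show "\<exists>h. P 0 h"
      by (intro exI[of _ "\<lambda>_ _. 0"]) (simp add: P_def hmat_0)
  next
    fix h i assume h: "P i h"
    let ?\<alpha> = "\<lambda>t u. \<theta> (Suc i) t u - appm (F i) h (D i t) u"
    have hm: "hmat H (F i) (F (Suc i)) h" using h by (simp add: P_def)
    have am: "hmat H (F (Suc i)) (F (Suc i)) ?\<alpha>"
      by (rule hmat_diff[OF th hmat_comp[OF hres_mat hm]])
    have app_a: "appm (F (Suc i)) ?\<alpha> v = (\<lambda>u. appm (F (Suc i)) (\<theta> (Suc i)) v u - appm (F i) h (appm (F (Suc i)) (D i) v) u)" for v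
      by (rule ext) (simp add: appm_mat_diff appm_comp)
    have col: "cvec (rel I k) (F k) (int (F (Suc i) ! t)) (appm (F (Suc i)) (D k) (?\<alpha> t)) (\<lambda>_. 0)"
      if "Suc i = Suc k" "t < length (F (Suc i))" for k t
    proof -
      let ?e = "\<lambda>s. if s = t then 1 else 0 :: 'p"
      have "?e \<in> hvec H (F (Suc i)) (int (F (Suc i) ! t))" by (auto simp: hvec_def Hone H0)
      with h have "cvec (rel I i) (F i) (int (F (Suc i) ! t)) (appm (F (Suc i)) (D i) (appm (F (Suc i)) ?\<alpha> ?e)) (\<lambda>_. 0)"
        unfolding P_def app_a by blast
      moreover have "appm (F (Suc i)) ?\<alpha> ?e = ?\<alpha> t" by (rule ext) (rule appm_unit[OF that(2)])
      ultimately show ?thesis using that(1) by simp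
    qed
    obtain g where g: "hmat H (F (Suc i)) (F (Suc (Suc i))) g"
      "\<And>t. t < length (F (Suc i)) \<Longrightarrow> cvec I (F (Suc i)) (int (F (Suc i) ! t)) (appm (F (Suc (Suc i))) (D (Suc i)) (g t)) (?\<alpha> t)"
      using lift_matrix[OF am col] by (auto simp: rel_def)
    have Q: "Q i h g" unfolding Q_def
    proof (intro allI ballI)
      fix j v assume v: "v \<in> hvec H (F (Suc i)) j"
      from cvec_columns[OF I v g(2)]
      show "cvec I (F (Suc i)) j (appm (F (Suc (Suc i))) (D (Suc i)) (appm (F (Suc i)) g v))
        (\<lambda>u. appm (F (Suc i)) (\<theta> (Suc i)) v u - appm (F i) h (appm (F (Suc i)) (D i) v) u)"
        unfolding app_a by (simp add: appm_comp_fun)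
    qed
    have "P (Suc i) g" unfolding P_def
    proof (intro conjI allI ballI g)
      fix j v assume v: "v \<in> hvec H (F (Suc (Suc i))) j"
      let ?Dv = "appm (F (Suc (Suc i))) (D (Suc i)) v"
      have Dv: "?Dv \<in> hvec H (F (Suc i)) j" by (rule appm_hvec[OF hres_mat v])
      have 1: "cvec I (F (Suc i)) j (appm (F (Suc (Suc i))) (D (Suc i)) (appm (F (Suc (Suc i))) (\<theta> (Suc (Suc i))) v))
         (appm (F (Suc i)) (\<theta> (Suc i)) ?Dv)" using sq[OF v] by (simp add: rel_def)
      have 2: "cvec I (F (Suc i)) j (appm (F (Suc (Suc i))) (D (Suc i)) (appm (F (Suc i)) g ?Dv))
         (\<lambda>u. appm (F (Suc i)) (\<theta> (Suc i)) ?Dv u - appm (F i) h (appm (F (Suc i)) (D i) ?Dv) u)"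
        using Q Dv unfolding Q_def by blast
      have 3: "cvec I (F (Suc i)) j (appm (F i) h (appm (F (Suc i)) (D i) ?Dv)) (\<lambda>_. 0)"
      proof (cases "i = 0")
        case True
        then show ?thesis using h cvec_refl[OF I] by (simp add: P_def)
      next
        case False
        then have "cvec I (F i) j (appm (F (Suc i)) (D i) ?Dv) (\<lambda>_. 0)"
          using hres_comp[OF v] by (simp add: rel_def)
        from cvec_appm[OF I hm this] show ?thesis by simp
      qed
      from cvec_diff[OF I 1 2] have "cvec I (F (Suc i)) j (appm (F (Suc (Suc i))) (D (Suc i))
          (\<lambda>u. appm (F (Suc (Suc i))) (\<theta> (Suc (Suc i))) v u - appm (F (Suc i)) g ?Dv u))
          (appm (F i) h (appm (F (Suc i)) (D i) ?Dv))"
        by (simp flip: appm_diff)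
      from cvec_trans[OF I this 3]
      show "cvec (rel I (Suc i)) (F (Suc i)) j (appm (F (Suc (Suc i))) (D (Suc i))
          (\<lambda>u. appm (F (Suc (Suc i))) (\<theta> (Suc (Suc i))) v u - appm (F (Suc i)) g ?Dv u)) (\<lambda>_. 0)"
        by (simp add: rel_def)
    qed auto
    with Q show "\<exists>g. P (Suc i) g \<and> Q i h g" by blast
  qed
  then obtain f where f: "\<And>i. P i (f i)" "\<And>i. Q i (f i) (f (Suc i))" by blast
  then show ?thesis unfolding P_def Q_def by (intro exI[of _ f]) blast
qed

end

text \<open>
  Lifting position by position with \<open>lift_matrix\<close> extends the identity of \<open>k\<close> at position \<open>0\<close>.
\<close>

lemma chain_map_exists:
  assumes I: "hideal I" and F: "hres I F D" and G: "hres I G E"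
  shows "\<exists>\<phi>. \<phi> 0 = (\<lambda>t u. if u = t then 1 else 0) \<and> (\<forall>i. hmat H (F i) (G i) (\<phi> i) \<and>
     (\<forall>j. \<forall>v\<in>hvec H (F (Suc i)) j. cvec (rel I i) (G i) j
        (appm (G (Suc i)) (E i) (appm (F (Suc i)) (\<phi> (Suc i)) v))
        (appm (F i) (\<phi> i) (appm (F (Suc i)) (D i) v))))"
proof -
  note F_mat = hres_mat[OF I F] and F_comp = hres_comp[OF I F] and F_0 = hres_0[OF I F]
  note G_0 = hres_0[OF I G]
  define P where "P i h \<longleftrightarrow> hmat H (F i) (G i) h \<and> (i = 0 \<longrightarrow> h = (\<lambda>t u. if u = t then 1 else 0)) \<and>
     (\<forall>k. i = Suc k \<longrightarrow> (\<forall>j. \<forall>v\<in>hvec H (F i) j. cvec (rel I k) (F k) j (appm (F i) (D k) v) (\<lambda>_. 0) \<longrightarrow>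
        cvec (rel I k) (G k) j (appm (G i) (E k) (appm (F i) h v)) (\<lambda>_. 0)))" for i h
  define Q where "Q i h h' \<longleftrightarrow> (\<forall>j. \<forall>v\<in>hvec H (F (Suc i)) j. cvec (rel I i) (G i) j
        (appm (G (Suc i)) (E i) (appm (F (Suc i)) h' v))
        (appm (F i) h (appm (F (Suc i)) (D i) v)))" for i h h'
  have "\<exists>f. \<forall>i. P i (f i) \<and> Q i (f i) (f (Suc i))"
  proof (rule dependent_nat_choice)
    show "\<exists>h. P 0 h" using hmat_id[of "[0]"] by (auto simp: P_def F_0 G_0)
  next
    fix h i assume h: "P i h"
    let ?\<alpha> = "\<lambda>t. appm (F i) h (D i t)"
    have hm: "hmat H (F i) (G i) h" using h by (simp add: P_def)
    have am: "hmat H (F (Suc i)) (G i) ?\<alpha>" by (rule hmat_comp[OF F_mat hm])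
    have col: "cvec (rel I k) (G k) (int (F (Suc i) ! t)) (appm (G i) (E k) (?\<alpha> t)) (\<lambda>_. 0)"
      if k: "i = Suc k" and t: "t < length (F (Suc i))" for k t
    proof -
      let ?e = "\<lambda>s. if s = t then 1 else 0 :: 'p"
      have e: "?e \<in> hvec H (F (Suc i)) (int (F (Suc i) ! t))" by (auto simp: hvec_def Hone H0)
      have eq: "appm (F (Suc i)) (D i) ?e = D i t" by (rule ext) (rule appm_unit[OF t])
      have "cvec (rel I k) (F k) (int (F (Suc i) ! t)) (appm (F i) (D k) (D i t)) (\<lambda>_. 0)"
        using F_comp[of ?e k] e eq unfolding k by simp
      moreover have "D i t \<in> hvec H (F i) (int (F (Suc i) ! t))"
        using F_mat t by (simp add: hmat_def)
      ultimately show ?thesis using h k unfolding P_def by blast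
    qed
    obtain g where g: "hmat H (F (Suc i)) (G (Suc i)) g"
      "\<And>t. t < length (F (Suc i)) \<Longrightarrow> cvec (rel I i) (G i) (int (F (Suc i) ! t)) (appm (G (Suc i)) (E i) (g t)) (?\<alpha> t)"
      using lift_matrix[OF I G am col] by auto
    have Q: "Q i h g" unfolding Q_def
    proof (intro allI ballI)
      fix j v assume v: "v \<in> hvec H (F (Suc i)) j"
      from cvec_columns[OF rel_ideal[OF I] v g(2)]
      show "cvec (rel I i) (G i) j (appm (G (Suc i)) (E i) (appm (F (Suc i)) g v))
          (appm (F i) h (appm (F (Suc i)) (D i) v))"
        by (simp add: appm_comp_fun)
    qed
    have "P (Suc i) g" unfolding P_def
    proof (intro conjI allI ballI impI g)
      fix k j v assume k: "Suc i = Suc k" and v: "v \<in> hvec H (F (Suc i)) j"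
        and z: "cvec (rel I k) (F k) j (appm (F (Suc i)) (D k) v) (\<lambda>_. 0)"
      have "cvec (rel I i) (G i) j (appm (F i) h (appm (F (Suc i)) (D i) v)) (appm (F i) h (\<lambda>_. 0))"
        using z k by (intro cvec_appm[OF rel_ideal[OF I] hm]) simp
      then have "cvec (rel I i) (G i) j (appm (F i) h (appm (F (Suc i)) (D i) v)) (\<lambda>_. 0)"
        by simp
      moreover have "cvec (rel I i) (G i) j (appm (G (Suc i)) (E i) (appm (F (Suc i)) g v))
          (appm (F i) h (appm (F (Suc i)) (D i) v))" using Q v unfolding Q_def by blast
      ultimately show "cvec (rel I k) (G k) j (appm (G (Suc i)) (E k) (appm (F (Suc i)) g v)) (\<lambda>_. 0)"
        using cvec_trans[OF rel_ideal[OF I]] k by blast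
    qed auto
    with Q show "\<exists>g. P (Suc i) g \<and> Q i h g" by blast
  qed
  then obtain f where f: "\<And>i. P i (f i)" "\<And>i. Q i (f i) (f (Suc i))" by blast
  then show ?thesis unfolding P_def Q_def by (intro exI[of _ f]) blast
qed


text \<open>
  Tensoring with \<open>k\<close> amounts to applying the ring homomorphism \<open>\<kappa>\<close> (for polynomials: the constant
  coefficient) to all matrix entries.  A chain map between two resolutions is then injective on
  homology, since a chain map in the other direction composes with it to a map homotopic to the
  identity.
\<close>

definition kmat :: "('p \<Rightarrow> 'k::field) \<Rightarrow> (nat \<Rightarrow> nat \<Rightarrow> 'p) \<Rightarrow> nat \<Rightarrow> nat \<Rightarrow> 'k" where
  "kmat \<kappa> M t u = \<kappa> (M t u)"

end

locale augmented_pieces = graded_pieces H for H :: "int \<Rightarrow> 'p::comm_ring_1 set" +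
  fixes \<kappa> :: "'p \<Rightarrow> 'k::field" and I :: "int \<Rightarrow> 'p set"
  assumes k_add: "\<kappa> (x + y) = \<kappa> x + \<kappa> y"
    and k_mult: "\<kappa> (x * y) = \<kappa> x * \<kappa> y"
    and k_one: "\<kappa> 1 = 1"
    and k_deg: "x \<in> H d \<Longrightarrow> d \<noteq> 0 \<Longrightarrow> \<kappa> x = 0"
    and ideal: "hideal I"
    and k_ideal: "x \<in> I d \<Longrightarrow> \<kappa> x = 0"
begin

lemma k_zero: "\<kappa> 0 = 0" using k_add[of 0 0] by (metis add.right_neutral add_left_cancel)
lemma k_diff: "\<kappa> (x - y) = \<kappa> x - \<kappa> y" using k_add[of "x - y" y] by (simp add: algebra_simps)
lemma k_sum: "\<kappa> (sum f A) = (\<Sum>a\<in>A. \<kappa> (f a))"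
  by (induction A rule: infinite_finite_induct) (auto simp: k_zero k_add)

lemma k_appm: "\<kappa> (appm ds M v u) = appm ds (kmat \<kappa> M) (\<lambda>t. \<kappa> (v t)) u"
  by (simp add: appm_def k_sum k_mult kmat_def)

lemma k_cvec: "cvec I es j v w \<Longrightarrow> u < length es \<Longrightarrow> \<kappa> (v u) = \<kappa> (w u)"
  using k_ideal[of "v u - w u" "j - int (es ! u)"] by (simp add: cvec_def hvec_def k_diff)

text \<open>
  Transfers a congruence modulo \<open>I\<close> between two linear maps to their reduced matrices, by comparing
  the images of the basis vectors.
\<close>

lemma k_columns:
  assumes eq: "\<And>j v. v \<in> hvec H ds j \<Longrightarrow> cvec I es j (L v) (R v)"
    and L: "\<And>v u. u < length es \<Longrightarrow> L v u = appm ds M v u"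
    and R: "\<And>v u. u < length es \<Longrightarrow> R v u = appm ds N v u"
    and u: "u < length es"
  shows "appm ds (kmat \<kappa> M) z u = appm ds (kmat \<kappa> N) z u"
  unfolding appm_def
proof (rule sum.cong[OF refl])
  fix t assume "t \<in> {..<length ds}"
  then have t: "t < length ds" by simp
  let ?e = "\<lambda>s. if s = t then 1 else 0 :: 'p"
  have "?e \<in> hvec H ds (int (ds ! t))" by (auto simp: hvec_def Hone H0)
  from k_cvec[OF eq[OF this] u] show "z t * kmat \<kappa> M t u = z t * kmat \<kappa> N t u"
    by (simp add: L[OF u] R[OF u] appm_unit[OF t] kmat_def)
qed

lemma kmat_comp: "kmat \<kappa> (\<lambda>t. appm es N (M t)) = (\<lambda>t. appm es (kmat \<kappa> N) (kmat \<kappa> M t))"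
  by (intro ext) (simp add: kmat_def k_appm[unfolded kmat_def[abs_def]] kmat_def[abs_def])

lemma appm_cong: "(\<And>t. t < length ds \<Longrightarrow> v t = w t) \<Longrightarrow> appm ds M v u = appm ds M w u"
  by (simp add: appm_def)

lemma appm_eq_0: "(\<And>t. t < length ds \<Longrightarrow> v t = 0) \<Longrightarrow> appm ds M v u = 0"
  by (simp add: appm_def)

text \<open>
  Because resolutions are moved up by one position, the homology at \<open>i\<close> is formed at position \<open>Suc i\<close>.
  Position \<open>0\<close> is the resolved module itself, so for \<open>i = 0\<close> every vector is a cycle.
\<close>

definition kcyc :: "(nat \<Rightarrow> nat list) \<Rightarrow> (nat \<Rightarrow> nat \<Rightarrow> nat \<Rightarrow> 'p) \<Rightarrow> nat \<Rightarrow> (nat \<Rightarrow> 'k) \<Rightarrow> bool" where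
  "kcyc F D i z \<longleftrightarrow> (\<forall>k. i = Suc k \<longrightarrow> (\<forall>u<length (F i). appm (F (Suc i)) (kmat \<kappa> (D i)) z u = 0))"

definition kbnd :: "(nat \<Rightarrow> nat list) \<Rightarrow> (nat \<Rightarrow> nat \<Rightarrow> nat \<Rightarrow> 'p) \<Rightarrow> nat \<Rightarrow> (nat \<Rightarrow> 'k) \<Rightarrow> bool" where
  "kbnd F D i z \<longleftrightarrow> (\<exists>y. \<forall>u<length (F (Suc i)). z u = appm (F (Suc (Suc i))) (kmat \<kappa> (D (Suc i))) y u)"

text \<open>
  The matrix \<open>\<Phi>\<close> is a comparison map reduced by \<open>\<kappa>\<close>; reduction kills the entries of nonzero degree, so
  \<open>\<Phi>\<close> preserves degrees.  The equivalence for boundaries is the injectivity on homology.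
\<close>

lemma homology_injection:
  assumes F: "hres I F D" and G: "hres I G E"
  shows "\<exists>\<Phi>. (\<forall>t<length (F (Suc i)). \<forall>u<length (G (Suc i)). \<Phi> t u \<noteq> 0 \<longrightarrow> F (Suc i) ! t = G (Suc i) ! u) \<and>
     (\<forall>z. kcyc F D i z \<longrightarrow> kcyc G E i (appm (F (Suc i)) \<Phi> z)) \<and>
     (\<forall>z. kcyc F D i z \<longrightarrow> (kbnd F D i z \<longleftrightarrow> kbnd G E i (appm (F (Suc i)) \<Phi> z)))"
proof -
  obtain \<phi> where p0: "\<phi> 0 = (\<lambda>t u. if u = t then 1 else 0)"
    and pm: "\<And>i. hmat H (F i) (G i) (\<phi> i)"
    and ps: "\<And>i j v. v \<in> hvec H (F (Suc i)) j \<Longrightarrow> cvec (rel I i) (G i) j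
        (appm (G (Suc i)) (E i) (appm (F (Suc i)) (\<phi> (Suc i)) v))
        (appm (F i) (\<phi> i) (appm (F (Suc i)) (D i) v))"
    using chain_map_exists[OF ideal F G] by blast
  obtain \<psi> where q0: "\<psi> 0 = (\<lambda>t u. if u = t then 1 else 0)"
    and qm: "\<And>i. hmat H (G i) (F i) (\<psi> i)"
    and qs: "\<And>i j v. v \<in> hvec H (G (Suc i)) j \<Longrightarrow> cvec (rel I i) (F i) j
        (appm (F (Suc i)) (D i) (appm (G (Suc i)) (\<psi> (Suc i)) v))
        (appm (G i) (\<psi> i) (appm (G (Suc i)) (E i) v))"
    using chain_map_exists[OF ideal G F] by blast
  have Dm: "hmat H (F (Suc i)) (F i) (D i)" for i by (rule hres_mat[OF ideal F])
  define \<theta> where "\<theta> i = (\<lambda>t u. appm (G i) (\<psi> i) (\<phi> i t) u - (if u = t then 1 else 0))" for i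
  have tm: "hmat H (F i) (F i) (\<theta> i)" for i
    unfolding \<theta>_def by (rule hmat_diff[OF hmat_comp[OF pm qm] hmat_id])
  have app_t: "appm (F i) (\<theta> i) v u = appm (G i) (\<psi> i) (appm (F i) (\<phi> i) v) u - v u"
    if "u < length (F i)" for i v u
    using that by (simp add: \<theta>_def appm_mat_diff appm_comp appm_id)
  have "\<exists>h. h 0 = (\<lambda>_ _. 0) \<and> (\<forall>i. hmat H (F i) (F (Suc i)) (h i) \<and>
     (\<forall>j. \<forall>v\<in>hvec H (F (Suc i)) j. cvec I (F (Suc i)) j
       (appm (F (Suc (Suc i))) (D (Suc i)) (appm (F (Suc i)) (h (Suc i)) v))
       (\<lambda>u. appm (F (Suc i)) (\<theta> (Suc i)) v u - appm (F i) (h i) (appm (F (Suc i)) (D i) v) u)))"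
  proof (rule null_homotopy[OF ideal F tm])
    fix v u show "appm (F 0) (\<theta> 0) v u = 0 \<or> u \<ge> length (F 0)"
      using app_t[of u 0 v] hres_0[OF ideal F] hres_0[OF ideal G]
      by (cases "u = 0") (auto simp: q0 p0 appm_id)
  next
    fix i j v assume v: "v \<in> hvec H (F (Suc i)) j"
    have "cvec (rel I i) (F i) j (\<lambda>u. appm (F (Suc i)) (D i) (appm (G (Suc i)) (\<psi> (Suc i)) (appm (F (Suc i)) (\<phi> (Suc i)) v)) u
           - appm (F (Suc i)) (D i) v u)
        (\<lambda>u. appm (G i) (\<psi> i) (appm (F i) (\<phi> i) (appm (F (Suc i)) (D i) v)) u - appm (F (Suc i)) (D i) v u)"
      by (intro cvec_diff[OF rel_ideal[OF ideal]] cvec_refl[OF rel_ideal[OF ideal]]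
          cvec_trans[OF rel_ideal[OF ideal] qs[OF appm_hvec[OF pm v]]]
          cvec_appm[OF rel_ideal[OF ideal] qm ps[OF v]])
    moreover have "appm (F (Suc i)) (D i) (appm (F (Suc i)) (\<theta> (Suc i)) v) =
        (\<lambda>u. appm (F (Suc i)) (D i) (appm (G (Suc i)) (\<psi> (Suc i)) (appm (F (Suc i)) (\<phi> (Suc i)) v)) u
           - appm (F (Suc i)) (D i) v u)"
      unfolding appm_diff[symmetric] by (rule ext, rule appm_cong) (rule app_t)
    ultimately have "cvec (rel I i) (F i) j (appm (F (Suc i)) (D i) (appm (F (Suc i)) (\<theta> (Suc i)) v))
        (\<lambda>u. appm (G i) (\<psi> i) (appm (F i) (\<phi> i) (appm (F (Suc i)) (D i) v)) u - appm (F (Suc i)) (D i) v u)"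
      by simp
    then show "cvec (rel I i) (F i) j (appm (F (Suc i)) (D i) (appm (F (Suc i)) (\<theta> (Suc i)) v))
        (appm (F i) (\<theta> i) (appm (F (Suc i)) (D i) v))"
      by (simp add: app_t cong: cvec_cong_right)
  qed
  then obtain h where h0: "h 0 = (\<lambda>_ _. 0)" and
    h: "\<And>i j v. v \<in> hvec H (F (Suc i)) j \<Longrightarrow> cvec I (F (Suc i)) j
       (appm (F (Suc (Suc i))) (D (Suc i)) (appm (F (Suc i)) (h (Suc i)) v))
       (\<lambda>u. appm (F (Suc i)) (\<theta> (Suc i)) v u - appm (F i) (h i) (appm (F (Suc i)) (D i) v) u)"
    by blast
  let ?k = "kmat \<kappa>"
  have comm: "appm (G (Suc (Suc i))) (?k (E (Suc i))) (appm (F (Suc (Suc i))) (?k (\<phi> (Suc (Suc i)))) z) u =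
      appm (F (Suc i)) (?k (\<phi> (Suc i))) (appm (F (Suc (Suc i))) (?k (D (Suc i))) z) u"
    if "u < length (G (Suc i))" for i z u
  proof -
    have "appm (F (Suc (Suc i))) (?k (\<lambda>t. appm (G (Suc (Suc i))) (E (Suc i)) (\<phi> (Suc (Suc i)) t))) z u =
      appm (F (Suc (Suc i))) (?k (\<lambda>t. appm (F (Suc i)) (\<phi> (Suc i)) (D (Suc i) t))) z u"
      by (rule k_columns[OF ps[of _ "Suc i", unfolded rel_def, simplified] _ _ that]) (simp_all add: appm_comp)
    then show ?thesis by (simp add: appm_comp kmat_comp)
  qed
  have comm': "appm (F (Suc (Suc i))) (?k (D (Suc i))) (appm (G (Suc (Suc i))) (?k (\<psi> (Suc (Suc i)))) z) u =
      appm (G (Suc i)) (?k (\<psi> (Suc i))) (appm (G (Suc (Suc i))) (?k (E (Suc i))) z) u"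
    if "u < length (F (Suc i))" for i z u
  proof -
    have "appm (G (Suc (Suc i))) (?k (\<lambda>t. appm (F (Suc (Suc i))) (D (Suc i)) (\<psi> (Suc (Suc i)) t))) z u =
      appm (G (Suc (Suc i))) (?k (\<lambda>t. appm (G (Suc i)) (\<psi> (Suc i)) (E (Suc i) t))) z u"
      by (rule k_columns[OF qs[of _ "Suc i", unfolded rel_def, simplified] _ _ that]) (simp_all add: appm_comp)
    then show ?thesis by (simp add: appm_comp kmat_comp)
  qed
  have htpy: "appm (F (Suc (Suc i))) (?k (D (Suc i))) (appm (F (Suc i)) (?k (h (Suc i))) z) u =
      appm (G (Suc i)) (?k (\<psi> (Suc i))) (appm (F (Suc i)) (?k (\<phi> (Suc i))) z) u - z u -
      appm (F i) (?k (h i)) (appm (F (Suc i)) (?k (D i)) z) u"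
    if u: "u < length (F (Suc i))" for z u
  proof -
    have "appm (F (Suc i)) (?k (\<lambda>t. appm (F (Suc (Suc i))) (D (Suc i)) (h (Suc i) t))) z u =
      appm (F (Suc i)) (?k (\<lambda>t u. \<theta> (Suc i) t u - appm (F i) (h i) (D i t) u)) z u"
      by (rule k_columns[OF h _ _ u]) (simp_all add: appm_comp appm_mat_diff)
    also have "?k (\<lambda>t u. \<theta> (Suc i) t u - appm (F i) (h i) (D i t) u) =
      (\<lambda>t u. appm (G (Suc i)) (?k (\<psi> (Suc i))) (?k (\<phi> (Suc i)) t) u - (if u = t then 1 else 0)
         - appm (F i) (?k (h i)) (?k (D i) t) u)"
      by (intro ext) (simp add: kmat_def k_diff \<theta>_def k_appm k_one k_zero, simp add: kmat_def[abs_def])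
    finally show ?thesis using u
      by (simp add: kmat_comp appm_comp appm_mat_diff appm_id)
  qed
  let ?P = "?k (\<phi> (Suc i))"
  show ?thesis
  proof (intro exI[of _ ?P] conjI allI impI)
    fix t u assume t: "t < length (F (Suc i))" and u: "u < length (G (Suc i))" and n: "?P t u \<noteq> 0"
    have "\<phi> (Suc i) t u \<in> H (int (F (Suc i) ! t) - int (G (Suc i) ! u))"
      using pm t u by (auto simp: hmat_def hvec_def)
    from k_deg[OF this] n show "F (Suc i) ! t = G (Suc i) ! u" by (auto simp: kmat_def)
  next
    fix z assume "kcyc F D i z"
    then show "kcyc G E i (appm (F (Suc i)) ?P z)"
      unfolding kcyc_def by (simp add: comm appm_eq_0)
  next
    fix z assume z: "kcyc F D i z"
    show "kbnd F D i z \<longleftrightarrow> kbnd G E i (appm (F (Suc i)) ?P z)"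
    proof
      assume "kbnd F D i z"
      then obtain y where y: "\<And>u. u < length (F (Suc i)) \<Longrightarrow> z u = appm (F (Suc (Suc i))) (?k (D (Suc i))) y u"
        by (auto simp: kbnd_def)
      have "appm (F (Suc i)) ?P z u = appm (F (Suc i)) ?P (appm (F (Suc (Suc i))) (?k (D (Suc i))) y) u" for u
        by (rule appm_cong) (rule y)
      then show "kbnd G E i (appm (F (Suc i)) ?P z)"
        unfolding kbnd_def by (intro exI[of _ "appm (F (Suc (Suc i))) (?k (\<phi> (Suc (Suc i)))) y"]) (simp add: comm)
    next
      assume "kbnd G E i (appm (F (Suc i)) ?P z)"
      then obtain y where y: "\<And>u. u < length (G (Suc i)) \<Longrightarrow> appm (F (Suc i)) ?P z u = appm (G (Suc (Suc i))) (?k (E (Suc i))) y u"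
        by (auto simp: kbnd_def)
      let ?y' = "\<lambda>t. appm (G (Suc (Suc i))) (?k (\<psi> (Suc (Suc i)))) y t - appm (F (Suc i)) (?k (h (Suc i))) z t"
      have "z u = appm (F (Suc (Suc i))) (?k (D (Suc i))) ?y' u" if u: "u < length (F (Suc i))" for u
      proof -
        have "appm (F i) (?k (h i)) (appm (F (Suc i)) (?k (D i)) z) u = 0"
        proof (cases i)
          case 0
          then show ?thesis by (simp add: h0 kmat_def k_zero appm_def)
        next
          case (Suc k)
          then show ?thesis using z unfolding kcyc_def by (simp add: appm_eq_0)
        qed
        moreover have "appm (G (Suc i)) (?k (\<psi> (Suc i))) (appm (F (Suc i)) ?P z) u =
            appm (G (Suc i)) (?k (\<psi> (Suc i))) (appm (G (Suc (Suc i))) (?k (E (Suc i))) y) u"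
          by (rule appm_cong) (rule y)
        ultimately show ?thesis using htpy[OF u, of z] comm'[OF u, of y]
          by (simp add: appm_diff_any)
      qed
      then show "kbnd F D i z" unfolding kbnd_def by blast
    qed
  qed
qed

end

section \<open>Adjoining a regular element\<close>

context graded_pieces begin

text \<open>
  Exactness only at the positions from \<open>1\<close> on: \<open>F\<close> is a presentation of the cokernel of its first matrix,
  continued to a resolution.
\<close>

definition exact_mod :: "(int \<Rightarrow> 'p set) \<Rightarrow> (nat \<Rightarrow> nat list) \<Rightarrow> (nat \<Rightarrow> nat \<Rightarrow> nat \<Rightarrow> 'p) \<Rightarrow> bool" where
  "exact_mod I F D \<longleftrightarrow> (\<forall>i. hmat H (F (Suc i)) (F i) (D i)) \<and>
     (\<forall>i j. \<forall>v\<in>hvec H (F (Suc (Suc i))) j.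
        cvec I (F i) j (appm (F (Suc i)) (D i) (appm (F (Suc (Suc i))) (D (Suc i)) v)) (\<lambda>_. 0)) \<and>
     (\<forall>i j. \<forall>v\<in>hvec H (F (Suc i)) j. cvec I (F i) j (appm (F (Suc i)) (D i) v) (\<lambda>_. 0) \<longrightarrow>
        (\<exists>w\<in>hvec H (F (Suc (Suc i))) j. cvec I (F (Suc i)) j (appm (F (Suc (Suc i))) (D (Suc i)) w) v))"

text \<open>
  Multiplication by \<open>f\<close> maps the cokernel of the first matrix to zero.
\<close>

definition kills :: "(int \<Rightarrow> 'p set) \<Rightarrow> nat \<Rightarrow> 'p \<Rightarrow> (nat \<Rightarrow> nat list) \<Rightarrow> (nat \<Rightarrow> nat \<Rightarrow> nat \<Rightarrow> 'p) \<Rightarrow> bool" where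
  "kills I a f F D \<longleftrightarrow> (\<forall>j. \<forall>v\<in>hvec H (F 0) j.
     \<exists>w\<in>hvec H (F 1) (int a + j). cvec I (F 0) (int a + j) (appm (F 1) (D 0) w) (\<lambda>u. f * v u))"

definition adjoin :: "(int \<Rightarrow> 'p set) \<Rightarrow> nat \<Rightarrow> 'p \<Rightarrow> int \<Rightarrow> 'p set" where
  "adjoin I a f d = {p + f * q | p q. p \<in> I d \<and> q \<in> H (d - int a)}"

lemma adjoin_ideal:
  assumes I: "hideal I" and f: "f \<in> H (int a)"
  shows "hideal (adjoin I a f)"
  unfolding hideal_def
proof (intro conjI allI ballI subsetI)
  fix d x assume "x \<in> adjoin I a f d"
  then obtain p q where x: "x = p + f * q" "p \<in> I d" "q \<in> H (d - int a)" by (auto simp: adjoin_def)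
  with Hmult[OF f x(3)] show "x \<in> H d" by (auto intro: Hadd hideal_sub[OF I x(2)])
next
  fix d show "0 \<in> adjoin I a f d"
    unfolding adjoin_def using hideal_0[OF I] H0 by (intro CollectI exI[of _ 0]) auto
next
  fix d x y assume "x \<in> adjoin I a f d" "y \<in> adjoin I a f d"
  then obtain p q p' q' where "x = p + f * q" "y = p' + f * q'" "p \<in> I d" "p' \<in> I d"
    "q \<in> H (d - int a)" "q' \<in> H (d - int a)" by (auto simp: adjoin_def)
  then show "x + y \<in> adjoin I a f d" unfolding adjoin_def
    by (intro CollectI exI[of _ "p + p'"] exI[of _ "q + q'"])
       (auto simp: algebra_simps intro: Hadd hideal_add[OF I])
next
  fix d x assume "x \<in> adjoin I a f d"
  then obtain p q where "x = p + f * q" "p \<in> I d" "q \<in> H (d - int a)" by (auto simp: adjoin_def)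
  then show "- x \<in> adjoin I a f d" unfolding adjoin_def
    by (intro CollectI exI[of _ "- p"] exI[of _ "- q"])
       (auto simp: algebra_simps intro: Huminus hideal_uminus[OF I])
next
  fix d e x y assume x: "x \<in> H d" and "y \<in> adjoin I a f e"
  then obtain p q where y: "y = p + f * q" "p \<in> I e" "q \<in> H (e - int a)" by (auto simp: adjoin_def)
  have "x * q \<in> H (d + e - int a)" using Hmult[OF x y(3)] by (simp add: add_diff_eq)
  moreover have "x * y = x * p + f * (x * q)" by (simp add: y algebra_simps)
  ultimately show "x * y \<in> adjoin I a f (d + e)"
    unfolding adjoin_def using hideal_mult[OF I x y(2)] by blast
qed

lemma sub_adjoin: "I d \<subseteq> adjoin I a f d"
  using H0 by (force simp: adjoin_def)

lemma appm_mult_fun: "appm ds M (\<lambda>t. x * v t) = (\<lambda>u. x * appm ds M v u)"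
  by (rule ext) (rule appm_mult)

lemma cvec_adjoin: "cvec I es j v w \<Longrightarrow> cvec (adjoin I a f) es j v w"
  by (rule cvec_mono[of I]) (rule sub_adjoin)

lemma sum_lessThan_add: "(\<Sum>t<m + n. g t) = (\<Sum>t<m. g t) + (\<Sum>t<n. g (m + t))"
  for g :: "nat \<Rightarrow> 'b::comm_monoid_add"
  by (induction n) (simp_all add: add.assoc)

lemma appm_append:
  "appm (ds @ es) M v u = appm ds M v u + appm es (\<lambda>t. M (length ds + t)) (\<lambda>t. v (length ds + t)) u"
  by (simp add: appm_def sum_lessThan_add)

lemma hvec_append:
  "v \<in> hvec I (ds @ es) j \<longleftrightarrow> v \<in> hvec I ds j \<and> (\<lambda>t. v (length ds + t)) \<in> hvec I es j"
  unfolding hvec_def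
proof (intro iffI conjI; (intro CollectI allI impI)?)
  fix t assume *: "v \<in> {v. \<forall>t<length (ds @ es). v t \<in> I (j - int ((ds @ es) ! t))}"
  { assume "t < length ds" then show "v t \<in> I (j - int (ds ! t))"
      using * by (auto simp: nth_append dest: spec[of _ t]) }
  { assume "t < length es" then show "v (length ds + t) \<in> I (j - int (es ! t))"
      using * by (auto simp: nth_append dest: spec[of _ "length ds + t"]) }
next
  fix t assume *: "v \<in> {v. \<forall>t<length ds. v t \<in> I (j - int (ds ! t))} \<and>
      (\<lambda>t. v (length ds + t)) \<in> {v. \<forall>t<length es. v t \<in> I (j - int (es ! t))}"
    and "t < length (ds @ es)"
  then show "v t \<in> I (j - int ((ds @ es) ! t))"
    by (cases "t < length ds") (auto simp: nth_append dest: spec[of _ "t - length ds"])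
qed

lemma hvec_shift: "v \<in> hvec I (map (\<lambda>d. d + a) ds) j \<longleftrightarrow> v \<in> hvec I ds (j - int a)"
  by (simp add: hvec_def algebra_simps)

text \<open>
  One step of the resolution over \<open>A / (I, f)\<close> of a module \<open>N\<close> killed by \<open>f\<close>, presented over
  \<open>A / I\<close> by an exact complex \<open>F\<close>.  Its first syzygy over \<open>A / (I, f)\<close> is \<open>Z / f F\<^sub>0\<close>, where \<open>Z\<close> is the
  first syzygy over \<open>A / I\<close>.  A lift \<open>h\<close> of the multiplication by \<open>f\<close> through \<open>F\<^sub>1 \<rightarrow> F\<^sub>0\<close> gives the
  complex \<open>\<dots> \<rightarrow> F\<^sub>3 \<rightarrow> F\<^sub>2 \<oplus> F\<^sub>0 \<rightarrow> F\<^sub>1\<close> presenting that syzygy over \<open>A / I\<close>, and the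
  syzygy is again killed by \<open>f\<close>.  Iterating this gives the whole resolution.
\<close>

lemma shamash_step:
  assumes I: "hideal I" and f: "f \<in> H (int a)"
    and reg: "\<And>d g. g \<in> H d \<Longrightarrow> f * g \<in> I (int a + d) \<Longrightarrow> g \<in> I d"
    and ex: "exact_mod I F D" and kf: "kills I a f F D"
  shows "\<exists>F' D'. exact_mod I F' D' \<and> kills I a f F' D' \<and> F' 0 = F 1 \<and>
     length (F' 1) = length (F 2) + length (F 0) \<and> (\<forall>k. F' (Suc (Suc k)) = F (Suc (Suc (Suc k)))) \<and>
     (\<forall>j. \<forall>w\<in>hvec H (F' 1) j. cvec (adjoin I a f) (F 0) j (appm (F 1) (D 0) (appm (F' 1) (D' 0) w)) (\<lambda>_. 0)) \<and>
     (\<forall>j. \<forall>v\<in>hvec H (F 1) j. cvec (adjoin I a f) (F 0) j (appm (F 1) (D 0) v) (\<lambda>_. 0) \<longrightarrow>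
        (\<exists>w\<in>hvec H (F' 1) j. cvec I (F 1) j (appm (F' 1) (D' 0) w) v))"
proof -
  have Dm: "hmat H (F (Suc i)) (F i) (D i)" for i using ex by (simp add: exact_mod_def)
  have comp: "cvec I (F i) j (appm (F (Suc i)) (D i) (appm (F (Suc (Suc i))) (D (Suc i)) v)) (\<lambda>_. 0)"
    if "v \<in> hvec H (F (Suc (Suc i))) j" for i j v using ex that by (simp add: exact_mod_def)
  have exact: "\<exists>w\<in>hvec H (F (Suc (Suc i))) j. cvec I (F (Suc i)) j (appm (F (Suc (Suc i))) (D (Suc i)) w) v"
    if "v \<in> hvec H (F (Suc i)) j" "cvec I (F i) j (appm (F (Suc i)) (D i) v) (\<lambda>_. 0)" for i j v
    using ex that unfolding exact_mod_def by blast
  let ?F0 = "map (\<lambda>d. d + a) (F 0)"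
  have "\<exists>w\<in>hvec H (F 1) (int a + int (F 0 ! t)). cvec I (F 0) (int a + int (F 0 ! t)) (appm (F 1) (D 0) w)
      (\<lambda>u. f * (if u = t then 1 else 0))" if "t < length (F 0)" for t
  proof -
    have "(\<lambda>u. if u = t then 1 else 0) \<in> hvec H (F 0) (int (F 0 ! t))" by (auto simp: hvec_def Hone H0)
    from kf[unfolded kills_def, rule_format, OF this] show ?thesis .
  qed
  then obtain h where h: "\<And>t. t < length (F 0) \<Longrightarrow> h t \<in> hvec H (F 1) (int a + int (F 0 ! t))"
    "\<And>t. t < length (F 0) \<Longrightarrow> cvec I (F 0) (int a + int (F 0 ! t)) (appm (F 1) (D 0) (h t)) (\<lambda>u. f * (if u = t then 1 else 0))"
    by metis
  have hm: "hmat H ?F0 (F 1) h" using h(1) by (simp add: hmat_def add.commute)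
  have Dh: "cvec I (F 0) j (appm (F 1) (D 0) (appm ?F0 h w)) (\<lambda>u. f * w u)" if "w \<in> hvec H ?F0 j" for j w
  proof -
    have "cvec I (F 0) j (appm ?F0 (\<lambda>t. appm (F 1) (D 0) (h t)) w) (appm ?F0 (\<lambda>t u. f * (if u = t then 1 else 0)) w)"
      using h(2) by (intro cvec_columns[OF I that]) (simp add: add.commute)
    moreover have "appm ?F0 (\<lambda>t u. f * (if u = t then 1 else 0)) w u = f * w u" if "u < length (F 0)" for u
      using that by (simp add: appm_def if_distrib[of "\<lambda>x. _ * x"] mult.commute cong: if_cong)
    ultimately have "cvec I (F 0) j (appm ?F0 (\<lambda>t. appm (F 1) (D 0) (h t)) w) (\<lambda>u. f * w u)"
      by (simp cong: cvec_cong_right)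
    then show ?thesis by (simp add: appm_comp_fun)
  qed
  define F' where "F' i = (case i of 0 \<Rightarrow> F 1 | Suc 0 \<Rightarrow> F 2 @ ?F0 | Suc (Suc k) \<Rightarrow> F (Suc (Suc (Suc k))))" for i
  define D' where "D' i = (case i of 0 \<Rightarrow> (\<lambda>t. if t < length (F 2) then D 1 t else h (t - length (F 2)))
     | Suc 0 \<Rightarrow> (\<lambda>t u. if u < length (F 2) then D 2 t u else 0) | Suc (Suc k) \<Rightarrow> D (Suc (Suc (Suc k))))" for i
  have F': "F' 0 = F 1" "F' 1 = F 2 @ ?F0" "F' (Suc 0) = F 2 @ ?F0" "F' (Suc (Suc k)) = F (Suc (Suc (Suc k)))"
    "F' 2 = F 3" for k
    by (simp_all add: F'_def numeral_2_eq_2 numeral_3_eq_3)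
  have D': "D' (Suc (Suc k)) = D (Suc (Suc (Suc k)))" for k by (simp add: D'_def)
  have D'0: "appm (F 2 @ ?F0) (D' 0) v = (\<lambda>u. appm (F 2) (D 1) v u + appm ?F0 h (\<lambda>t. v (length (F 2) + t)) u)" for v
    unfolding appm_append fun_eq_iff by (simp add: D'_def appm_def)
  have D'1: "appm (F 3) (D' 1) v u = (if u < length (F 2) then appm (F 3) (D 2) v u else 0)" for v u
    by (simp add: D'_def appm_def)
  note D'1' = D'1[unfolded One_nat_def]
  have two: "Suc (Suc 0) = 2" "Suc (Suc (Suc 0)) = 3" by simp_all
  note Dm' = Dm[of 0, simplified] Dm[of "Suc 0", unfolded two, simplified] Dm[of 2, simplified]
  have D10: "hmat H (F 1) (F 0) (D 0)" using Dm'(1) by simp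
  have m0: "hmat H (F 2 @ ?F0) (F 1) (D' 0)"
    using Dm'(2) hm by (auto simp: hmat_def D'_def nth_append)
  have m1: "hmat H (F 3) (F 2 @ ?F0) (D' 1)"
    unfolding hmat_def hvec_append
  proof (intro allI impI conjI)
    fix t assume "t < length (F 3)"
    then show "D' 1 t \<in> hvec H (F 2) (int (F 3 ! t))" using Dm'(3) by (simp add: hmat_def D'_def hvec_def)
    show "(\<lambda>u. D' 1 t (length (F 2) + u)) \<in> hvec H ?F0 (int (F 3 ! t))" by (simp add: D'_def hvec_def H0)
  qed
  have c0: "cvec I (F 0) j (appm (F 1) (D 0) (appm (F 2 @ ?F0) (D' 0) w)) (\<lambda>u. f * w (length (F 2) + u))"
    if w: "w \<in> hvec H (F 2 @ ?F0) j" for w j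
  proof -
    have "cvec I (F 0) j (\<lambda>u. appm (F 1) (D 0) (appm (F 2) (D 1) w) u + appm (F 1) (D 0) (appm ?F0 h (\<lambda>t. w (length (F 2) + t))) u)
        (\<lambda>u. 0 + f * w (length (F 2) + u))"
      using w comp[of w 0 j] Dh[of "\<lambda>t. w (length (F 2) + t)" j]
      by (intro cvec_add[OF I]) (simp_all add: hvec_append two)
    then show ?thesis by (simp add: D'0 flip: appm_add)
  qed
  have e0: "\<exists>w\<in>hvec H (F 2 @ ?F0) j. cvec I (F 1) j (appm (F 2 @ ?F0) (D' 0) w) v"
    if v: "v \<in> hvec H (F 1) j" and q: "q \<in> hvec H ?F0 j" and eq: "cvec I (F 0) j (appm (F 1) (D 0) v) (\<lambda>u. f * q u)"
    for v j q
  proof -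
    let ?x = "\<lambda>u. v u - appm ?F0 h q u"
    have x: "?x \<in> hvec H (F 1) j" by (rule hvec_diff[OF hideal_H v appm_hvec[OF hm q]])
    have "cvec I (F 0) j (\<lambda>u. appm (F 1) (D 0) v u - appm (F 1) (D 0) (appm ?F0 h q) u) (\<lambda>u. f * q u - f * q u)"
      by (rule cvec_diff[OF I eq Dh[OF q]])
    then have "cvec I (F 0) j (appm (F 1) (D 0) ?x) (\<lambda>_. 0)" by (simp flip: appm_diff)
    with exact[of ?x 0 j] x obtain w where w: "w \<in> hvec H (F 2) j" "cvec I (F 1) j (appm (F 2) (D 1) w) ?x"
      by (auto simp: two)
    let ?w = "\<lambda>t. if t < length (F 2) then w t else q (t - length (F 2))"
    have "?w \<in> hvec H (F 2 @ ?F0) j" using w(1) q unfolding hvec_append by (simp add: hvec_def)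
    moreover have "cvec I (F 1) j (\<lambda>u. appm (F 2) (D 1) w u + appm ?F0 h q u) (\<lambda>u. ?x u + appm ?F0 h q u)"
      by (rule cvec_add[OF I w(2) cvec_refl[OF I]])
    moreover have "appm (F 2) (D 1) ?w = appm (F 2) (D 1) w" by (simp add: appm_def fun_eq_iff)
    ultimately show ?thesis by (intro bexI[of _ ?w]) (simp_all add: D'0)
  qed
  show ?thesis
  proof (intro exI[of _ F'] exI[of _ D'] conjI allI ballI impI F')
    show "exact_mod I F' D'"
      unfolding exact_mod_def
    proof (intro conjI allI ballI impI)
      fix i show "hmat H (F' (Suc i)) (F' i) (D' i)"
      proof (cases i)
        case 0 then show ?thesis using m0 by (simp add: F')
      next
        case (Suc k)
        then show ?thesis using m1 Dm by (cases k) (auto simp: F' D' two)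
      qed
    next
      fix i j v assume v: "v \<in> hvec H (F' (Suc (Suc i))) j"
      show "cvec I (F' i) j (appm (F' (Suc i)) (D' i) (appm (F' (Suc (Suc i))) (D' (Suc i)) v)) (\<lambda>_. 0)"
      proof (cases i)
        case 0
        have "appm (F 2 @ ?F0) (D' 0) (appm (F 3) (D' 1) v) = appm (F 2) (D 1) (appm (F 3) (D 2) v)"
          unfolding D'0 by (simp add: fun_eq_iff D'1' appm_def[of "F 2"] appm_def[of ?F0])
        then show ?thesis using comp[of v 1 j] v 0 by (simp add: F' two)
      next
        case (Suc k)
        show ?thesis
        proof (cases k)
          case 0
          have v3: "v \<in> hvec H (F 4) j" using v Suc 0 by (simp add: F' eval_nat_numeral)
          have "cvec I (F 2) j (appm (F 3) (D 2) (appm (F 4) (D 3) v)) (\<lambda>_. 0)"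
            using comp[of v 2 j] v3 by (simp add: eval_nat_numeral)
          then have "cvec I (F 2 @ ?F0) j (appm (F 3) (D' 1) (appm (F 4) (D 3) v)) (\<lambda>_. 0)"
            unfolding cvec_def hvec_append using hideal_0[OF I] by (simp add: D'1' hvec_def)
          then show ?thesis using Suc 0 by (simp add: F' D' eval_nat_numeral)
        next
          case (Suc l)
          then show ?thesis using \<open>i = Suc k\<close> v comp[of v "Suc (Suc (Suc l))" j] by (simp add: F' D')
        qed
      qed
    next
      fix i j v assume v: "v \<in> hvec H (F' (Suc i)) j" and z: "cvec I (F' i) j (appm (F' (Suc i)) (D' i) v) (\<lambda>_. 0)"
      show "\<exists>w\<in>hvec H (F' (Suc (Suc i))) j. cvec I (F' (Suc i)) j (appm (F' (Suc (Suc i))) (D' (Suc i)) w) v"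
      proof (cases i)
        case 0
        have v': "v \<in> hvec H (F 2 @ ?F0) j" and z': "cvec I (F 1) j (appm (F 2 @ ?F0) (D' 0) v) (\<lambda>_. 0)"
          using v z 0 by (simp_all add: F')
        have "cvec I (F 0) j (appm (F 1) (D 0) (appm (F 2 @ ?F0) (D' 0) v)) (appm (F 1) (D 0) (\<lambda>_. 0))"
          using Dm'(1) z' by (intro cvec_appm[OF I]) simp_all
        then have fz: "cvec I (F 0) j (\<lambda>u. f * v (length (F 2) + u)) (\<lambda>_. 0)"
          using cvec_trans[OF I cvec_sym[OF I c0[OF v']]] by simp
        have v2: "v (length (F 2) + u) \<in> I (j - int a - int (F 0 ! u))" if u: "u < length (F 0)" for u
        proof (rule reg)
          show "v (length (F 2) + u) \<in> H (j - int a - int (F 0 ! u))"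
            using v' u by (simp add: hvec_append hvec_shift) (simp add: hvec_def)
          have "f * v (length (F 2) + u) \<in> I (j - int (F 0 ! u))" using fz u by (simp add: cvec_def hvec_def)
          then show "f * v (length (F 2) + u) \<in> I (int a + (j - int a - int (F 0 ! u)))"
            by (simp add: algebra_simps)
        qed
        then have v2': "(\<lambda>t. v (length (F 2) + t)) \<in> hvec I ?F0 j" unfolding hvec_shift by (simp add: hvec_def)
        have "cvec I (F 1) j (appm ?F0 h (\<lambda>t. v (length (F 2) + t))) (\<lambda>_. 0)"
          using appm_hvec_ideal[OF I hm v2'] by (simp add: cvec_def)
        from cvec_diff[OF I z' this] have "cvec I (F 1) j (appm (F 2) (D 1) v) (\<lambda>_. 0)"
          by (simp add: D'0)
        with exact[of v 1 j] v' obtain w where w: "w \<in> hvec H (F 3) j" "cvec I (F 2) j (appm (F 3) (D 2) w) v"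
          by (auto simp: two hvec_append)
        have "cvec I (F 2 @ ?F0) j (appm (F 3) (D' 1) w) v"
          using w(2) hvec_uminus[OF I v2'] unfolding cvec_def hvec_append by (simp add: D'1' hvec_def)
        then show ?thesis using w(1) 0 by (auto simp: F' two)
      next
        case (Suc k)
        show ?thesis
        proof (cases k)
          case 0
          have "cvec I (F 2) j (appm (F 3) (D 2) v) (\<lambda>_. 0)" "v \<in> hvec H (F 3) j"
            using z v Suc 0 unfolding cvec_def by (simp_all add: F' two hvec_append D'1') (simp_all add: hvec_def D'1')
          with exact[of v 2 j] show ?thesis using Suc 0 by (simp add: F' D' eval_nat_numeral)
        next
          case (Suc l)
          then show ?thesis using \<open>i = Suc k\<close> v z exact[of v "Suc (Suc (Suc l))" j] by (simp add: F' D')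
        qed
      qed
    qed
  next
    show "kills I a f F' D'"
      unfolding kills_def
    proof (intro allI ballI)
      fix j v assume "v \<in> hvec H (F' 0) j"
      then have v: "v \<in> hvec H (F 1) j" by (simp add: F')
      have 1: "(\<lambda>u. f * v u) \<in> hvec H (F 1) (int a + j)" by (rule hvec_mult[OF hideal_H f v])
      have 2: "appm (F 1) (D 0) v \<in> hvec H ?F0 (int a + j)"
        using appm_hvec[OF D10 v] by (simp add: hvec_shift)
      have 3: "cvec I (F 0) (int a + j) (appm (F 1) (D 0) (\<lambda>u. f * v u)) (\<lambda>u. f * appm (F 1) (D 0) v u)"
        unfolding appm_mult_fun by (rule cvec_refl[OF I])
      from e0[OF 1 2 3] show "\<exists>w\<in>hvec H (F' 1) (int a + j). cvec I (F' 0) (int a + j) (appm (F' 1) (D' 0) w) (\<lambda>u. f * v u)"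
        by (simp add: F')
    qed
  next
    show "length (F' 1) = length (F 2) + length (F 0)" by (simp add: F')
  next
    fix j w assume "w \<in> hvec H (F' 1) j"
    then have w: "w \<in> hvec H (F 2 @ ?F0) j" by (simp add: F')
    have "cvec (adjoin I a f) (F 0) j (appm (F 1) (D 0) (appm (F 2 @ ?F0) (D' 0) w)) (\<lambda>u. f * w (length (F 2) + u))"
      by (rule cvec_adjoin[OF c0[OF w]])
    moreover have "cvec (adjoin I a f) (F 0) j (\<lambda>u. f * w (length (F 2) + u)) (\<lambda>_. 0)"
    proof -
      have "f * w (length (F 2) + u) \<in> adjoin I a f (j - int (F 0 ! u))" if u: "u < length (F 0)" for u
      proof -
        have "w (length (F 2) + u) \<in> H (j - int (F 0 ! u) - int a)"
          using w u by (simp add: hvec_append hvec_shift) (simp add: hvec_def algebra_simps)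
        then show ?thesis unfolding adjoin_def using hideal_0[OF I]
          by (intro CollectI exI[of _ 0] exI[of _ "w (length (F 2) + u)"]) auto
      qed
      then show ?thesis by (simp add: cvec_def hvec_def)
    qed
    ultimately show "cvec (adjoin I a f) (F 0) j (appm (F 1) (D 0) (appm (F' 1) (D' 0) w)) (\<lambda>_. 0)"
      using cvec_trans[OF adjoin_ideal[OF I f]] by (simp add: F')
  next
    fix j v assume v: "v \<in> hvec H (F 1) j" and z: "cvec (adjoin I a f) (F 0) j (appm (F 1) (D 0) v) (\<lambda>_. 0)"
    have "\<exists>q. q \<in> H (j - int (F 0 ! u) - int a) \<and> appm (F 1) (D 0) v u - f * q \<in> I (j - int (F 0 ! u))"
      if "u < length (F 0)" for u
    proof -
      have "appm (F 1) (D 0) v u \<in> adjoin I a f (j - int (F 0 ! u))" using z that by (simp add: cvec_def hvec_def)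
      then show ?thesis unfolding adjoin_def by force
    qed
    then obtain q where q: "\<And>u. u < length (F 0) \<Longrightarrow> q u \<in> H (j - int (F 0 ! u) - int a)"
      "\<And>u. u < length (F 0) \<Longrightarrow> appm (F 1) (D 0) v u - f * q u \<in> I (j - int (F 0 ! u))" by metis
    have "q \<in> hvec H ?F0 j" using q(1) unfolding hvec_shift by (simp add: hvec_def algebra_simps)
    from e0[OF v this] q(2) show "\<exists>w\<in>hvec H (F' 1) j. cvec I (F 1) j (appm (F' 1) (D' 0) w) v"
      by (simp add: F' cvec_def hvec_def)
  qed
qed

text \<open>
  Gluing the presentations of the successive syzygies that \<open>shamash_step\<close> yields gives a resolution over
  \<open>A / (I, f)\<close> whose ranks are those of the given one multiplied by the series \<open>1 / (1 - z^2)\<close>.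
\<close>

lemma shamash:
  assumes I: "hideal I" and a: "a > 0" and f: "f \<in> H (int a)"
    and reg: "\<And>d g. g \<in> H d \<Longrightarrow> f * g \<in> I (int a + d) \<Longrightarrow> g \<in> I d"
    and F: "hres I F D" and F1: "F 1 = [0]" "D 0 = (\<lambda>t u. if u = t then 1 else 0)"
  shows "\<exists>G E. hres (adjoin I a f) G E \<and> G 1 = [0] \<and> E 0 = (\<lambda>t u. if u = t then 1 else 0) \<and>
     length (G 2) = length (F 2) \<and> (\<forall>k. length (G (k + 3)) = length (F (k + 3)) + length (G (k + 1)))"
proof -
  let ?J = "adjoin I a f"
  have J: "hideal ?J" by (rule adjoin_ideal[OF I f])
  have id1: "appm [0] (\<lambda>t u. if u = t then 1 else 0) v 0 = v 0" for v :: "nat \<Rightarrow> 'p"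
    by (simp add: appm_def)
  have augJ: "aug ?J d = aug I d" for d
  proof -
    have "?J d = I d" if "d \<le> 0"
      using that a Hneg[of "d - int a"] H0 by (force simp: adjoin_def)
    then show ?thesis by (auto simp: aug_def)
  qed
  \<comment> \<open>The complex chosen at stage \<open>k\<close> presents the \<open>k\<close>-th syzygy of the residue field over \<open>A / (I, f)\<close>.\<close>
  define P where "P S \<longleftrightarrow> exact_mod I (fst S) (snd S) \<and> kills I a f (fst S) (snd S)" for S
  define Q where "Q S S' \<longleftrightarrow> (case S of (F, D) \<Rightarrow> case S' of (F', D') \<Rightarrow> F' 0 = F 1 \<and>
     length (F' 1) = length (F 2) + length (F 0) \<and> (\<forall>k. F' (Suc (Suc k)) = F (Suc (Suc (Suc k)))) \<and>
     (\<forall>j. \<forall>w\<in>hvec H (F' 1) j. cvec ?J (F 0) j (appm (F 1) (D 0) (appm (F' 1) (D' 0) w)) (\<lambda>_. 0)) \<and>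
     (\<forall>j. \<forall>v\<in>hvec H (F 1) j. cvec ?J (F 0) j (appm (F 1) (D 0) v) (\<lambda>_. 0) \<longrightarrow>
        (\<exists>w\<in>hvec H (F' 1) j. cvec I (F 1) j (appm (F' 1) (D' 0) w) v)))"
    for S S' :: "(nat \<Rightarrow> nat list) \<times> (nat \<Rightarrow> nat \<Rightarrow> nat \<Rightarrow> 'p)"
  have "\<exists>S. \<forall>k. (P (S k) \<and> (k = 0 \<longrightarrow> S k = (\<lambda>i. F (Suc i), \<lambda>i. D (Suc i)))) \<and> Q (S k) (S (Suc k))"
  proof (rule dependent_nat_choice)
    have "exact_mod I (\<lambda>i. F (Suc i)) (\<lambda>i. D (Suc i))"
      unfolding exact_mod_def
    proof (intro conjI allI ballI impI)
      show "hmat H (F (Suc (Suc i))) (F (Suc i)) (D (Suc i))" for i by (rule hres_mat[OF I F])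
    next
      fix i j v assume "v \<in> hvec H (F (Suc (Suc (Suc i)))) j"
      from hres_comp[OF I F this] show "cvec I (F (Suc i)) j (appm (F (Suc (Suc i))) (D (Suc i))
          (appm (F (Suc (Suc (Suc i)))) (D (Suc (Suc i))) v)) (\<lambda>_. 0)" by (simp add: rel_def)
    next
      fix i j v assume "v \<in> hvec H (F (Suc (Suc i))) j"
        and "cvec I (F (Suc i)) j (appm (F (Suc (Suc i))) (D (Suc i)) v) (\<lambda>_. 0)"
      with hres_exact[OF I F, of v "Suc i" j]
      show "\<exists>w\<in>hvec H (F (Suc (Suc (Suc i)))) j. cvec I (F (Suc (Suc i))) j
          (appm (F (Suc (Suc (Suc i)))) (D (Suc (Suc i))) w) v" by (simp add: rel_def)
    qed
    moreover have "kills I a f (\<lambda>i. F (Suc i)) (\<lambda>i. D (Suc i))"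
      unfolding kills_def
    proof (intro allI ballI)
      fix j v assume "v \<in> hvec H (F (Suc 0)) j"
      then have v: "v \<in> hvec H [0] j" using F1 by simp
      have fv: "(\<lambda>u. f * v u) \<in> hvec H (F (Suc 0)) (int a + j)"
        using hvec_mult[OF hideal_H f v] F1 by simp
      have "f * v 0 \<in> aug I (int a + j)"
        using fv F1 a v Hneg[of j "v 0"] hideal_0[OF I] by (cases "j < 0") (auto simp: hvec_def aug_def)
      then have "cvec (rel I 0) (F 0) (int a + j) (appm (F (Suc 0)) (D 0) (\<lambda>u. f * v u)) (\<lambda>_. 0)"
        using F1 id1 by (simp add: cvec_def hvec_def rel_def hres_0[OF I F])
      from hres_exact[OF I F fv this]
      show "\<exists>w\<in>hvec H (F (Suc 1)) (int a + j). cvec I (F (Suc 0)) (int a + j) (appm (F (Suc 1)) (D (Suc 0)) w) (\<lambda>u. f * v u)"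
        by simp
    qed
    ultimately show "\<exists>S. P S \<and> (0 = 0 \<longrightarrow> S = (\<lambda>i. F (Suc i), \<lambda>i. D (Suc i)))"
      by (auto simp: P_def)
  next
    fix S :: "(nat \<Rightarrow> nat list) \<times> (nat \<Rightarrow> nat \<Rightarrow> nat \<Rightarrow> 'p)" and k :: nat
    assume "P S \<and> (k = 0 \<longrightarrow> S = (\<lambda>i. F (Suc i), \<lambda>i. D (Suc i)))"
    then have "exact_mod I (fst S) (snd S)" "kills I a f (fst S) (snd S)" by (auto simp: P_def)
    from shamash_step[OF I f reg this] obtain F' D' where "P (F', D')" "Q S (F', D')"
      unfolding P_def Q_def by (cases S) auto
    then show "\<exists>S'. (P S' \<and> (Suc k = 0 \<longrightarrow> S' = (\<lambda>i. F (Suc i), \<lambda>i. D (Suc i)))) \<and> Q S S'" by blast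
  qed
  then obtain S where PS: "\<And>k. P (S k)" and S0: "S 0 = (\<lambda>i. F (Suc i), \<lambda>i. D (Suc i))"
    and QS: "\<And>k. Q (S k) (S (Suc k))" by metis
  define FF where "FF k = fst (S k)" for k
  define DD where "DD k = snd (S k)" for k
  have Smat: "hmat H (FF k 1) (FF k 0) (DD k 0)" for k
    using PS[of k] by (auto simp: P_def exact_mod_def FF_def DD_def)
  have Q1: "FF (Suc k) 0 = FF k 1" and Q2: "length (FF (Suc k) 1) = length (FF k 2) + length (FF k 0)"
    and Q3: "FF (Suc k) (Suc (Suc i)) = FF k (Suc (Suc (Suc i)))"
    and Q4: "w \<in> hvec H (FF (Suc k) 1) j \<Longrightarrow> cvec ?J (FF k 0) j (appm (FF k 1) (DD k 0) (appm (FF (Suc k) 1) (DD (Suc k) 0) w)) (\<lambda>_. 0)"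
    and Q5: "v \<in> hvec H (FF k 1) j \<Longrightarrow> cvec ?J (FF k 0) j (appm (FF k 1) (DD k 0) v) (\<lambda>_. 0) \<Longrightarrow>
        \<exists>w\<in>hvec H (FF (Suc k) 1) j. cvec I (FF k 1) j (appm (FF (Suc k) 1) (DD (Suc k) 0) w) v" for k i j w v
    using QS[of k] unfolding Q_def FF_def DD_def by (auto split: prod.splits)
  have FF0: "FF 0 i = F (Suc i)" and DD0: "DD 0 i = D (Suc i)" for i by (simp_all add: FF_def DD_def S0)
  have FFk: "FF k (Suc (Suc i)) = F (Suc (Suc (Suc (k + i))))" for k i
    by (induction k arbitrary: i) (simp_all add: FF0 Q3)
  define G where "G k = (case k of 0 \<Rightarrow> [0] | Suc l \<Rightarrow> FF l 0)" for k
  define E where "E k = (case k of 0 \<Rightarrow> (\<lambda>t u. if u = t then 1 else 0) | Suc l \<Rightarrow> DD l 0)" for k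
  have G: "G 0 = [0]" "G (Suc k) = FF k 0" "E (Suc k) = DD k 0" "E 0 = (\<lambda>t u. if u = t then 1 else 0)" for k
    by (simp_all add: G_def E_def)
  have G1: "G 1 = [0]" using F1 by (simp add: G_def FF0)
  have GF: "G (Suc (Suc k)) = FF k 1" for k by (simp add: G Q1)
  have m01: "FF 0 1 = F (Suc (Suc 0))" "FF 0 (Suc 0) = F (Suc (Suc 0))" by (simp_all add: FF0)
  have "hres ?J G E"
    unfolding hres_def
  proof (intro conjI allI ballI impI G)
    fix i show "hmat H (G (Suc i)) (G i) (E i)"
      using Smat hmat_id[of "[0]"] G1 by (cases i) (auto simp: G GF Q1)
  next
    fix j v assume "v \<in> hvec H (G 0) j"
    then show "\<exists>w\<in>hvec H (G 1) j. cvec (rel ?J 0) (G 0) j (appm (G 1) (E 0) w) v"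
      using G1 hideal_0[OF rel_ideal[OF J, of 0]]
      by (intro bexI[of _ v]) (simp_all add: G id1 cvec_def hvec_def)
  next
    fix i j v assume v: "v \<in> hvec H (G (Suc (Suc i))) j"
    show "cvec (rel ?J i) (G i) j (appm (G (Suc i)) (E i) (appm (G (Suc (Suc i))) (E (Suc i)) v)) (\<lambda>_. 0)"
    proof (cases i)
      case 0
      then have "v \<in> hvec H (F (Suc (Suc 0))) j" using v by (simp add: GF m01)
      from hres_comp[OF I F this] F1 show ?thesis using 0 G1
        by (simp add: cvec_def hvec_def G GF Q1 m01 DD0 rel_def augJ hres_0[OF I F] id1)
    next
      case (Suc k)
      then show ?thesis using Q4[of v k j] v by (simp add: G GF Q1 rel_def)
    qed
  next
    fix i j v assume v: "v \<in> hvec H (G (Suc i)) j" and z: "cvec (rel ?J i) (G i) j (appm (G (Suc i)) (E i) v) (\<lambda>_. 0)"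
    show "\<exists>w\<in>hvec H (G (Suc (Suc i))) j. cvec ?J (G (Suc i)) j (appm (G (Suc (Suc i))) (E (Suc i)) w) v"
    proof (cases i)
      case 0
      then have v': "v \<in> hvec H (F (Suc 0)) j" using v F1 G1 by simp
      have "cvec (rel I 0) (F 0) j (appm (F (Suc 0)) (D 0) v) (\<lambda>_. 0)"
        using z 0 G1 F1 by (simp add: cvec_def hvec_def G rel_def augJ hres_0[OF I F] id1)
      from hres_exact[OF I F v' this] obtain w where
        "w \<in> hvec H (F (Suc (Suc 0))) j" "cvec I (F (Suc 0)) j (appm (F (Suc (Suc 0))) (D (Suc 0)) w) v" by blast
      with cvec_adjoin[OF this(2)] show ?thesis using 0 F1 G1
        by (auto simp: GF m01 G Q1 DD0 FF0)
    next
      case (Suc k)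
      have "\<exists>w\<in>hvec H (FF (Suc k) 1) j. cvec I (FF k 1) j (appm (FF (Suc k) 1) (DD (Suc k) 0) w) v"
        using Q5[of v k j] v z Suc by (simp add: G GF Q1 rel_def)
      then show ?thesis using Suc cvec_adjoin by (fastforce simp: G GF Q1)
    qed
  qed
  moreover have "length (G 2) = length (F 2)" by (simp add: numeral_2_eq_2 GF m01)
  moreover have "length (G (k + 3)) = length (F (k + 3)) + length (G (k + 1))" for k
    using Q2[of k] FFk[of k 0] by (simp add: eval_nat_numeral GF G(2) Q1)
  ultimately show ?thesis using G1 G(4) by blast
qed

end

text \<open>
  Division by \<open>1 - z^2\<close> raises the order of polynomial growth by at most one.
\<close>

lemma shamash_growth:
  fixes g b :: "nat \<Rightarrow> nat" and C :: nat
  assumes "\<And>k. b k \<le> C * (k + 1) ^ r" "g 0 = b 0" "g 1 = b 1" "\<And>k. g (k + 2) = b (k + 2) + g k"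
  shows "g k \<le> C * (k + 1) ^ Suc r"
proof (induction k rule: less_induct)
  case (less k)
  consider "k = 0" | "k = 1" | l where "k = l + 2"
    by (metis One_nat_def Suc_1 add.commute add_Suc_right less_2_cases_iff le_Suc_ex not_less)
  then show ?case
  proof cases
    case 1
    then show ?thesis using assms(1)[of 0] assms(2) by simp
  next
    case 2
    have "b 1 \<le> C * 2 ^ r" using assms(1)[of 1] by (simp add: numeral_2_eq_2)
    also have "\<dots> \<le> C * 2 ^ Suc r" by (intro mult_le_mono) auto
    finally show ?thesis using assms(3) 2 by (simp add: numeral_2_eq_2)
  next
    case 3
    have "g l \<le> C * ((l + 1) * (l + 1) ^ r)" using less[of l] 3 by simp
    also have "\<dots> \<le> C * ((l + 1) * (l + 3) ^ r)" by (intro mult_le_mono power_mono) auto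
    finally have "g k \<le> C * (l + 3) ^ r + C * ((l + 1) * (l + 3) ^ r)"
      using assms(1)[of "l + 2"] assms(4)[of l] 3 by (simp add: eval_nat_numeral)
    also have "\<dots> = C * ((l + 2) * (l + 3) ^ r)" by (simp add: algebra_simps)
    also have "\<dots> \<le> C * ((l + 3) * (l + 3) ^ r)" by (intro mult_le_mono) auto
    finally show ?thesis using 3 by (simp add: eval_nat_numeral)
  qed
qed

section \<open>Homogeneous pieces of Veronese subrings\<close>

type_synonym 'k mpol = "mon \<Rightarrow>\<^sub>0 'k"

text \<open>
  The pieces of \<open>S^(c)\<close> for \<open>S\<close> the polynomial ring in \<open>n\<close> variables, in the grading in which
  monomials of degree \<open>c\<close> have degree one.
\<close>

definition Hp :: "nat \<Rightarrow> nat \<Rightarrow> int \<Rightarrow> 'k::field mpol set" where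
  "Hp n c d = {p. \<forall>m\<in>Poly_Mapping.keys p. Poly_Mapping.keys m \<subseteq> {..<n} \<and> int (mdeg m) = d * int c}"

abbreviation X :: "mon \<Rightarrow> 'k::field mpol" where "X m \<equiv> Poly_Mapping.single m 1"

lemma X_mult: "X a * X b = (X (a + b) :: 'k::field mpol)"
  by (simp add: mult_single)

lemma lookup_const_mult: "Poly_Mapping.lookup (Poly_Mapping.single 0 c * p) m = c * Poly_Mapping.lookup p m" for c :: "'k::field"
  by (subst mult_map_scale_conv_mult[symmetric]) (simp add: Poly_Mapping.map.rep_eq when_def)

lemma keys_mult_mon:
  "m \<in> Poly_Mapping.keys (p * q :: 'k::field mpol) \<Longrightarrow>
     \<exists>a\<in>Poly_Mapping.keys p. \<exists>b\<in>Poly_Mapping.keys q. m = a + b"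
  using keys_mult[of p q] by blast

lemma poly_mapping_sum_singles: "p = (\<Sum>m\<in>Poly_Mapping.keys p. Poly_Mapping.single m (Poly_Mapping.lookup p m))"
  by (rule poly_mapping_eqI) (auto simp: lookup_sum lookup_single when_def in_keys_iff cong: if_cong)

lemma lookup_mult_X:
  "Poly_Mapping.lookup (p * X u) k = (if mdvd u k then Poly_Mapping.lookup p (k - u) else 0)" for p :: "'k::field mpol"
proof -
  have "p * X u = (\<Sum>m\<in>Poly_Mapping.keys p. Poly_Mapping.single (m + u) (Poly_Mapping.lookup p m))"
    by (subst poly_mapping_sum_singles[of p]) (simp add: sum_distrib_right mult_single)
  then have "Poly_Mapping.lookup (p * X u) k = (\<Sum>m\<in>Poly_Mapping.keys p. if m + u = k then Poly_Mapping.lookup p m else 0)"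
    by (simp add: lookup_sum lookup_single when_def)
  also have "\<dots> = (if mdvd u k then Poly_Mapping.lookup p (k - u) else 0)"
  proof (cases "mdvd u k")
    case True
    have "(m + u = k) = (m = k - u)" for m
      using mdvd_add_diff[OF True] by (metis add.commute add_diff_cancel_right')
    then show ?thesis using True by (auto simp: in_keys_iff)
  next
    case False
    then have "m + u \<noteq> k" for m by (auto simp: mdvd_def add.commute)
    then show ?thesis using False by simp
  qed
  finally show ?thesis .
qed

lemma graded_pieces_Hp: assumes c: "c > 0" shows "graded_pieces (Hp n c :: int \<Rightarrow> 'k::field mpol set)"
proof
  fix d and x y :: "'k mpol"
  assume "x \<in> Hp n c d" "y \<in> Hp n c d"
  then show "x + y \<in> Hp n c d" unfolding Hp_def using Poly_Mapping.keys_add[of x y] by blast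
next
  fix d e and x y :: "'k mpol"
  assume "x \<in> Hp n c d" "y \<in> Hp n c e"
  then show "x * y \<in> Hp n c (d + e)" unfolding Hp_def
    by (auto dest!: keys_mult_mon simp: mon_keys_add mdeg_add algebra_simps subset_iff)
next
  fix d :: int and x :: "'k mpol" assume d: "d < 0" and x: "x \<in> Hp n c d"
  have "d * int c < 0" using d c by (simp add: mult_neg_pos)
  then have "Poly_Mapping.keys x = {}" using x by (auto simp: Hp_def)
  then show "x = 0" by simp
qed (auto simp: Hp_def)

definition const_coeff :: "'k::field mpol \<Rightarrow> 'k" where
  "const_coeff p = Poly_Mapping.lookup p 0"

lemma const_coeff_mult: "const_coeff (p * q) = const_coeff p * const_coeff q"
proof -
  have "const_coeff (p * q) = (\<Sum>m\<in>Poly_Mapping.keys q. const_coeff (p * (Poly_Mapping.single 0 (Poly_Mapping.lookup q m) * X m)))"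
    by (subst poly_mapping_sum_singles[of q])
       (simp add: const_coeff_def sum_distrib_left lookup_sum mult_single)
  also have "\<dots> = (\<Sum>m\<in>Poly_Mapping.keys q. if m = 0 then const_coeff p * Poly_Mapping.lookup q m else 0)"
  proof (rule sum.cong[OF refl])
    fix m
    have "mdvd m 0 \<longleftrightarrow> m = 0" by (metis add_eq_0_iff_both_eq_0 mdeg_0 mdeg_add mdeg_eq_0_iff mdvd_def add_0)
    then have e: "const_coeff ((Poly_Mapping.single 0 (Poly_Mapping.lookup q m) * p) * X m) =
        (if m = 0 then const_coeff p * Poly_Mapping.lookup q m else 0)"
      unfolding const_coeff_def lookup_mult_X lookup_const_mult by simp
    have "p * (Poly_Mapping.single 0 (Poly_Mapping.lookup q m) * X m) = (Poly_Mapping.single 0 (Poly_Mapping.lookup q m) * p) * X m"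
      by (simp only: ac_simps)
    then show "const_coeff (p * (Poly_Mapping.single 0 (Poly_Mapping.lookup q m) * X m)) =
        (if m = 0 then const_coeff p * Poly_Mapping.lookup q m else 0)"
      using e by (simp only:)
  qed
  also have "\<dots> = const_coeff p * const_coeff q"
    by (auto simp: const_coeff_def in_keys_iff)
  finally show ?thesis .
qed

lemma augmented_pieces_Hp:
  assumes c: "c > 0" and I: "graded_pieces.hideal (Hp n c) I" and I0: "\<And>x. x \<in> I 0 \<Longrightarrow> x = 0"
  shows "augmented_pieces (Hp n c) (const_coeff :: 'k::field mpol \<Rightarrow> 'k) I"
proof -
  interpret graded_pieces "Hp n c :: int \<Rightarrow> 'k mpol set" by (rule graded_pieces_Hp[OF c])
  have deg: "const_coeff x = 0" if "x \<in> Hp n c d" "d \<noteq> 0" for x :: "'k mpol" and d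
  proof (rule ccontr)
    assume "const_coeff x \<noteq> 0"
    then have "0 \<in> Poly_Mapping.keys x" by (simp add: const_coeff_def in_keys_iff)
    then have "int (mdeg 0) = d * int c" using that(1) unfolding Hp_def by blast
    then show False using that(2) c by simp
  qed
  show ?thesis
  proof
    fix x d assume x: "x \<in> I d"
    show "const_coeff x = 0"
      using I0[of x] x deg[OF hideal_sub[OF I x]] by (cases "d = 0") (auto simp: const_coeff_def)
  qed (use I deg in \<open>auto simp: const_coeff_mult\<close>, auto simp: const_coeff_def lookup_add)
qed

lemma X_in_Hp: "m \<in> Mon n c \<Longrightarrow> X m \<in> Hp n c 1"
  by (auto simp: Hp_def Mon_def)

section \<open>A linear resolution over the Veronese ring\<close>

locale veronese_step =
  fixes n c :: nat
  assumes c: "c > 0"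
begin

sublocale graded_pieces "Hp n c :: int \<Rightarrow> 'k::field mpol set"
  by (rule graded_pieces_Hp[OF c])

text \<open>
  In \<open>S^(c)\<close> the colon ideal \<open>(U) : u\<close>, for \<open>u\<close> and the elements of \<open>U\<close> monomials of degree one, is again
  generated by monomials of degree one: if \<open>u'\<close> divides \<open>m u\<close>, then \<open>u' / gcd (u, u')\<close> divides \<open>m\<close> and can be
  enlarged inside \<open>m\<close> to a monomial of degree one.
\<close>

lemma colon_linear:
  assumes u: "u \<in> Mon n c" "u' \<in> Mon n c" "u \<noteq> u'"
    and m: "Poly_Mapping.keys m \<subseteq> {..<n}" "c dvd mdeg m" and dv: "mdvd u' (m + u)"
  shows "\<exists>w\<in>Mon n c. mdvd w m \<and> mdvd u' (w + u)"
proof -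
  have "m \<noteq> 0" using u dv mdvd_deg_eq[of u' u] by (auto simp: Mon_def)
  then have m1: "c \<le> mdeg m" using m(2) by (metis dvd_imp_le gr0I mdeg_eq_0_iff)
  have a: "mdvd (u' - u) m" "mdvd (u' - u) u'" using dv
    by (simp_all add: mdvd_iff lookup_minus lookup_add le_diff_conv)
  from mdvd_deg[OF a(2)] u have "mdeg (u' - u) \<le> c" by (simp add: Mon_def)
  from mdvd_interpolate[OF a(1) this m1] obtain w where w: "mdvd (u' - u) w" "mdvd w m" "mdeg w = c" by blast
  have "mdvd u' (w + u)" using w(1) by (simp add: mdvd_iff lookup_minus lookup_add le_diff_conv)
  moreover have "w \<in> Mon n c" using mdvd_keys[OF w(2)] m(1) w(3) by (auto simp: Mon_def)
  ultimately show ?thesis using w by blast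
qed

text \<open>
  A graded submodule \<open>Z\<close> of \<open>A(-i)\<^sup>b\<close> whose ideals of leading coefficients (with respect to the
  last nonzero coordinate) are generated by sets \<open>T t\<close> of monomials of degree one.
\<close>

definition linear_leading :: "nat \<Rightarrow> nat \<Rightarrow> (nat \<Rightarrow> mon set) \<Rightarrow> (int \<Rightarrow> (nat \<Rightarrow> 'k::field mpol) set) \<Rightarrow> bool" where
  "linear_leading i b T Z \<longleftrightarrow> (\<forall>t<b. T t \<subseteq> Mon n c) \<and>
     (\<forall>j. Z j \<subseteq> hvec (Hp n c) (replicate b i) j) \<and> (\<forall>j. (\<lambda>_. 0) \<in> Z j) \<and>
     (\<forall>j. \<forall>v\<in>Z j. \<forall>w\<in>Z j. (\<lambda>s. v s + w s) \<in> Z j) \<and>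
     (\<forall>e j. \<forall>x\<in>Hp n c e. \<forall>v\<in>Z j. (\<lambda>s. x * v s) \<in> Z (e + j)) \<and>
     (\<forall>j. \<forall>v\<in>Z j. \<forall>t<b. (\<forall>s. t < s \<and> s < b \<longrightarrow> v s = 0) \<longrightarrow>
        (\<forall>m\<in>Poly_Mapping.keys (v t). \<exists>u\<in>T t. mdvd u m)) \<and>
     (\<forall>t<b. \<forall>u\<in>T t. \<exists>g\<in>Z (int i + 1). g t = X u \<and> (\<forall>s. t < s \<and> s < b \<longrightarrow> g s = 0))"

lemma linear_leading_gens: "linear_leading i b T Z \<Longrightarrow> t < b \<Longrightarrow> T t \<subseteq> Mon n c"
  and linear_leading_sub: "linear_leading i b T Z \<Longrightarrow> Z j \<subseteq> hvec (Hp n c) (replicate b i) j"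
  and linear_leading_zero: "linear_leading i b T Z \<Longrightarrow> (\<lambda>_. 0) \<in> Z j"
  and linear_leading_add: "linear_leading i b T Z \<Longrightarrow> v \<in> Z j \<Longrightarrow> w \<in> Z j \<Longrightarrow> (\<lambda>s. v s + w s) \<in> Z j"
  and linear_leading_mult: "linear_leading i b T Z \<Longrightarrow> x \<in> Hp n c e \<Longrightarrow> v \<in> Z j \<Longrightarrow> (\<lambda>s. x * v s) \<in> Z (e + j)"
  by (simp_all add: linear_leading_def)

lemma linear_leading_lead:
  assumes "linear_leading i b T Z" "v \<in> Z j" "t < b" "\<And>s. t < s \<Longrightarrow> s < b \<Longrightarrow> v s = 0" "m \<in> Poly_Mapping.keys (v t)"
  shows "\<exists>u\<in>T t. mdvd u m"
proof -
  have *: "\<forall>j. \<forall>v\<in>Z j. \<forall>t<b. (\<forall>s. t < s \<and> s < b \<longrightarrow> v s = 0) \<longrightarrow>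
        (\<forall>m\<in>Poly_Mapping.keys (v t). \<exists>u\<in>T t. mdvd u m)"
    using assms(1) unfolding linear_leading_def by (elim conjE)
  from *[rule_format, OF assms(2,3) _ assms(5)] assms(4) show ?thesis by simp
qed

lemma linear_leading_gen:
  assumes "linear_leading i b T Z" "t < b" "u \<in> T t"
  shows "\<exists>g. g \<in> Z (int i + 1) \<and> g t = X u \<and> (\<forall>s. t < s \<and> s < b \<longrightarrow> g s = 0)"
proof -
  have *: "\<forall>t<b. \<forall>u\<in>T t. \<exists>g\<in>Z (int i + 1). g t = X u \<and> (\<forall>s. t < s \<and> s < b \<longrightarrow> g s = 0)"
    using assms(1) unfolding linear_leading_def by (elim conjE)
  from *[rule_format, OF assms(2,3)] show ?thesis by (simp only: Bex_def)
qed

text \<open>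
  The number of leading monomials of degree \<open>l\<close>; for a submodule of \<open>A(-i)^b\<close> this is its dimension in degree \<open>i + l\<close>.
\<close>

definition mcount :: "nat \<Rightarrow> (nat \<Rightarrow> mon set) \<Rightarrow> nat \<Rightarrow> nat" where
  "mcount b T l = (\<Sum>t<b. card {m \<in> Mon n (l * c). \<exists>u\<in>T t. mdvd u m})"

lemma sum_nth_distinct: "distinct L \<Longrightarrow> (\<Sum>p<length L. f (L ! p)) = (\<Sum>x\<in>set L. f x)"
  for f :: "_ \<Rightarrow> 'b::comm_monoid_add"
  by (rule sum.reindex_bij_betw) (auto intro: bij_betw_nth)

lemma sorted_by_first_exists:
  assumes "finite (S :: (nat \<times> 'a) set)"
  shows "\<exists>L. distinct L \<and> set L = S \<and> sorted (map fst L)"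
proof -
  from finite_distinct_list[OF assms] obtain L where "set L = S" "distinct L" by blast
  then show ?thesis by (intro exI[of _ "sort_key fst L"]) simp
qed

text \<open>
  Division with remainder zero: subtracting multiples of the generators removes the nonzero coordinates
  from the last one downwards.
\<close>

lemma generators_span:
  fixes Z :: "int \<Rightarrow> (nat \<Rightarrow> 'k::field mpol) set"
  assumes st: "linear_leading i b T Z"
    and g: "\<And>t u. t < b \<Longrightarrow> u \<in> T t \<Longrightarrow> g t u \<in> Z (int i + 1) \<and> g t u t = X u \<and> (\<forall>s. t < s \<and> s < b \<longrightarrow> g t u s = 0)"
    and z: "z \<in> Z j" "\<forall>s. k \<le> s \<and> s < b \<longrightarrow> z s = 0"
  shows "\<exists>W. (\<forall>t u. W t u \<in> Hp n c (j - (int i + 1))) \<and> (\<forall>t u. k \<le> t \<longrightarrow> W t u = 0) \<and>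
     (\<forall>s<b. z s = (\<Sum>t<b. \<Sum>u\<in>T t. W t u * g t u s))"
  using z
proof (induction k arbitrary: z)
  case 0
  then show ?case by (intro exI[of _ "\<lambda>_ _. 0"]) (auto simp: H0)
next
  case (Suc k)
  show ?case
  proof (cases "k < b")
    case False
    then have "\<forall>s. k \<le> s \<and> s < b \<longrightarrow> z s = 0" by auto
    from Suc.IH[OF Suc.prems(1) this] obtain W where "(\<forall>t u. W t u \<in> Hp n c (j - (int i + 1)))"
      "(\<forall>t u. k \<le> t \<longrightarrow> W t u = 0)" "(\<forall>s<b. z s = (\<Sum>t<b. \<Sum>u\<in>T t. W t u * g t u s))" by blast
    then show ?thesis by (intro exI[of _ W]) auto
  next
    case True
    have Tk: "T k \<subseteq> Mon n c" by (rule linear_leading_gens[OF st True])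
    have finT: "finite (T k)" by (rule finite_subset[OF Tk finite_Mon])
    have zk: "z k \<in> Hp n c (j - int i)" 
      using subsetD[OF linear_leading_sub[OF st] Suc.prems(1)] True by (simp add: hvec_def)
    have "\<forall>m\<in>Poly_Mapping.keys (z k). \<exists>u\<in>T k. mdvd u m"
      using linear_leading_lead[OF st Suc.prems(1) True] Suc.prems(2) by auto
    then obtain d where d: "\<And>m. m \<in> Poly_Mapping.keys (z k) \<Longrightarrow> d m \<in> T k \<and> mdvd (d m) m" by metis
    define y where "y u = (\<Sum>m\<in>{m \<in> Poly_Mapping.keys (z k). d m = u}.
        Poly_Mapping.single (m - u) (Poly_Mapping.lookup (z k) m))" for u
    have yH: "y u \<in> Hp n c (j - (int i + 1))" for u
      unfolding y_def
    proof (rule Hsum)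
      fix m assume m: "m \<in> {m \<in> Poly_Mapping.keys (z k). d m = u}"
      then have u: "u \<in> Mon n c" "mdvd u m" using d Tk by auto
      have e: "mdeg m = mdeg u + mdeg (m - u)" "Poly_Mapping.keys (m - u) \<subseteq> Poly_Mapping.keys m"
        using mdvd_add_diff[OF u(2)] by (metis mdeg_add, metis mon_keys_add sup_ge2)
      then show "Poly_Mapping.single (m - u) (Poly_Mapping.lookup (z k) m) \<in> Hp n c (j - (int i + 1))"
        using m zk u(1) by (auto simp: Hp_def Mon_def algebra_simps)
    qed
    have zk_eq: "z k = (\<Sum>u\<in>T k. y u * X u)"
    proof -
      have "(\<Sum>u\<in>T k. y u * X u) = (\<Sum>u\<in>T k. \<Sum>m\<in>{m \<in> Poly_Mapping.keys (z k). d m = u}. Poly_Mapping.single m (Poly_Mapping.lookup (z k) m))"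
        unfolding y_def sum_distrib_right
        by (intro sum.cong[OF refl]) (use d mdvd_add_diff in \<open>auto simp: mult_single add.commute\<close>)
      also have "\<dots> = (\<Sum>m\<in>Poly_Mapping.keys (z k). Poly_Mapping.single m (Poly_Mapping.lookup (z k) m))"
        using d by (intro sum.group finT) auto
      finally show ?thesis using poly_mapping_sum_singles[of "z k"] by simp
    qed
    have Zsum: "(\<lambda>s. \<Sum>u\<in>U. y u * g k u s) \<in> Z j" if "finite U" "U \<subseteq> T k" for U
      using that
    proof (induction U)
      case empty then show ?case using linear_leading_zero[OF st] by simp
    next
      case (insert u U)
      then have "g k u \<in> Z (int i + 1)" using g True by auto
      then have "(\<lambda>s. y u * g k u s) \<in> Z (j - (int i + 1) + (int i + 1))"
        by (rule linear_leading_mult[OF st yH])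
      then have "(\<lambda>s. y u * g k u s + (\<Sum>u\<in>U. y u * g k u s)) \<in> Z j"
        using linear_leading_add[OF st, of "\<lambda>s. y u * g k u s" j] insert by simp
      then show ?case using insert by simp
    qed
    define z' where "z' s = z s + - 1 * (\<Sum>u\<in>T k. y u * g k u s)" for s
    have "(\<lambda>s. - 1 * (\<Sum>u\<in>T k. y u * g k u s)) \<in> Z (0 + j)"
      by (rule linear_leading_mult[OF st Huminus[OF Hone] Zsum[OF finT order_refl]])
    then have "(\<lambda>s. - 1 * (\<Sum>u\<in>T k. y u * g k u s)) \<in> Z j" by (simp only: add_0_left)
    then have z'Z: "z' \<in> Z j" unfolding z'_def[abs_def] by (rule linear_leading_add[OF st Suc.prems(1)])
    have "z' s = 0" if s: "k \<le> s" "s < b" for s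
    proof (cases "s = k")
      case True
      have "(\<Sum>u\<in>T k. y u * g k u k) = z k"
        unfolding zk_eq using g[OF \<open>k < b\<close>] by (intro sum.cong) auto
      then show ?thesis by (simp add: z'_def True)
    next
      case False
      then have "z s = 0" "\<And>u. u \<in> T k \<Longrightarrow> g k u s = 0" using s Suc.prems(2) g[OF \<open>k < b\<close>] by auto
      then show ?thesis by (simp add: z'_def)
    qed
    with Suc.IH[OF z'Z] obtain W where W: "\<And>t u. W t u \<in> Hp n c (j - (int i + 1))"
      "\<And>t u. k \<le> t \<Longrightarrow> W t u = 0" "\<And>s. s < b \<Longrightarrow> z' s = (\<Sum>t<b. \<Sum>u\<in>T t. W t u * g t u s)" by blast
    let ?W = "\<lambda>t u. if t = k then y u else W t u"
    have "z s = (\<Sum>t<b. \<Sum>u\<in>T t. ?W t u * g t u s)" if s: "s < b" for s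
    proof -
      have "(\<Sum>t<b. \<Sum>u\<in>T t. ?W t u * g t u s) =
          (\<Sum>t<b. (\<Sum>u\<in>T t. W t u * g t u s) + (if t = k then \<Sum>u\<in>T k. y u * g k u s else 0))"
        by (rule sum.cong) (auto simp: W(2))
      also have "\<dots> = z' s + (\<Sum>u\<in>T k. y u * g k u s)" using True s by (simp add: sum.distrib W(3))
      finally show ?thesis by (simp add: z'_def)
    qed
    then show ?thesis using W yH by (intro exI[of _ ?W]) auto
  qed
qed

end

context veronese_step begin

text \<open>
  The syzygies of the generators of \<open>Z\<close> are again generated by elements of degree one.  The generators are
  ordered by the position of their leading coefficient; the leading coefficients of the syzygies whose
  last nonzero coordinate belongs to the \<open>p\<close>-th generator form the colon ideal of the earlier generators
  with the same leading position, to which \<open>colon_linear\<close> applies.  The last clause is the additivity of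
  Hilbert functions.
\<close>

lemma linear_step:
  fixes Z :: "int \<Rightarrow> (nat \<Rightarrow> 'k::field mpol) set"
  assumes st: "linear_leading i b T Z"
  shows "\<exists>b' T' Z' M. linear_leading (Suc i) b' T' Z' \<and> hmat (Hp n c) (replicate b' (Suc i)) (replicate b i) M \<and>
     (\<forall>j. \<forall>v\<in>hvec (Hp n c) (replicate b' (Suc i)) j. appm (replicate b' (Suc i)) M v \<in> Z j) \<and>
     (\<forall>j. \<forall>z\<in>Z j. \<exists>w\<in>hvec (Hp n c) (replicate b' (Suc i)) j. \<forall>s<b. z s = appm (replicate b' (Suc i)) M w s) \<and>
     (\<forall>j. Z' j = {v \<in> hvec (Hp n c) (replicate b' (Suc i)) j. \<forall>s<b. appm (replicate b' (Suc i)) M v s = 0}) \<and>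
     (\<forall>l. b' * card (Mon n (l * c)) = mcount b' T' l + mcount b T (Suc l))"
proof -
  note T = linear_leading_gens[OF st]
  have finT: "finite (T t)" if "t < b" for t using finite_subset[OF T[OF that]] by simp
  have "\<exists>g. g \<in> Z (int i + 1) \<and> g t = X u \<and> (\<forall>s. t < s \<and> s < b \<longrightarrow> g s = 0)" if "t < b" "u \<in> T t" for t u
    by (rule linear_leading_gen[OF st that])
  then obtain g where g: "\<And>t u. t < b \<Longrightarrow> u \<in> T t \<Longrightarrow> g t u \<in> Z (int i + 1) \<and> g t u t = X u \<and> (\<forall>s. t < s \<and> s < b \<longrightarrow> g t u s = 0)"
    by metis
  have finS: "finite (Sigma {..<b} T)" using finT by auto
  obtain L where L: "distinct L" "set L = Sigma {..<b} T" "sorted (map fst L)"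
    using sorted_by_first_exists[OF finS] by blast
  define b' where "b' = length L"
  let ?t = "\<lambda>p. fst (L ! p)" and ?u = "\<lambda>p. snd (L ! p)"
  have Lp: "?t p < b" "?u p \<in> T (?t p)" "?u p \<in> Mon n c" if "p < b'" for p
  proof -
    have "L ! p \<in> set L" using that by (simp add: b'_def)
    then show "?t p < b" "?u p \<in> T (?t p)" by (auto simp: L(2))
    then show "?u p \<in> Mon n c" using T by blast
  qed
  have Lex: "\<exists>p<b'. ?t p = t \<and> ?u p = u" if "t < b" "u \<in> T t" for t u
  proof -
    have "(t, u) \<in> set L" using that by (simp add: L(2))
    then show ?thesis by (metis b'_def fst_conv in_set_conv_nth snd_conv)
  qed
  have Linj: "p = q" if "p < b'" "q < b'" "?t p = ?t q" "?u p = ?u q" for p q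
    using that nth_eq_iff_index_eq[OF L(1), of p q] by (simp add: b'_def prod_eq_iff)
  have Lmono: "?t p \<le> ?t q" if "p \<le> q" "q < b'" for p q
    using L(3) that by (simp add: b'_def sorted_iff_nth_mono)
  define M where "M p = g (?t p) (?u p)" for p
  have gp: "M p \<in> Z (int i + 1)" "M p (?t p) = X (?u p)" "\<And>s. ?t p < s \<Longrightarrow> s < b \<Longrightarrow> M p s = 0" if "p < b'" for p
    using g[OF Lp(1,2)[OF that]] by (auto simp: M_def)
  let ?F' = "replicate b' (Suc i)" and ?H = "Hp n c :: int \<Rightarrow> 'k mpol set"
  have hv': "v \<in> hvec ?H ?F' j \<longleftrightarrow> (\<forall>p<b'. v p \<in> Hp n c (j - (int i + 1)))" for v j
    by (auto simp: hvec_def add.commute)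
  note ZH = linear_leading_sub[OF st]
  have hm: "hmat ?H ?F' (replicate b i) M"
    using gp(1) ZH[of "int i + 1"] by (auto simp: hmat_def add.commute)
  have appZ: "appm ?F' M v \<in> Z j" if v: "v \<in> hvec ?H ?F' j" for v j
  proof -
    have "(\<lambda>s. \<Sum>p<q. v p * M p s) \<in> Z j" if "q \<le> b'" for q
      using that
    proof (induction q)
      case 0 then show ?case using linear_leading_zero[OF st] by simp
    next
      case (Suc q)
      have "(\<lambda>s. v q * M q s) \<in> Z (j - (int i + 1) + (int i + 1))"
        using v Suc.prems unfolding hv' by (intro linear_leading_mult[OF st] gp(1)) auto
      then have "(\<lambda>s. (\<Sum>p<q. v p * M p s) + v q * M q s) \<in> Z j"
        using linear_leading_add[OF st, of "\<lambda>s. \<Sum>p<q. v p * M p s" j] Suc by simp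
      then show ?case by simp
    qed
    from this[of b'] show ?thesis by (simp add: appm_def[abs_def])
  qed
  have appL: "appm ?F' M (\<lambda>p. W (?t p) (?u p)) s = (\<Sum>t<b. \<Sum>u\<in>T t. W t u * g t u s)" for W s
  proof -
    have "appm ?F' M (\<lambda>p. W (?t p) (?u p)) s = (\<Sum>x\<in>Sigma {..<b} T. W (fst x) (snd x) * g (fst x) (snd x) s)"
      using sum_nth_distinct[OF L(1), of "\<lambda>x. W (fst x) (snd x) * g (fst x) (snd x) s"]
      by (simp add: appm_def M_def b'_def L(2))
    also have "\<dots> = (\<Sum>t<b. \<Sum>u\<in>T t. W t u * g t u s)"
      using finT by (subst sum.Sigma) (auto simp: case_prod_beta)
    finally show ?thesis .
  qed
  \<comment> \<open>The monomials of degree one that multiply generator \<open>p\<close> into the leading ideal of the earlier ones.\<close>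
  define T' where "T' p = {w \<in> Mon n c. \<exists>q<p. ?t q = ?t p \<and> mdvd (?u q) (w + ?u p)}" for p
  define Z' where "Z' j = {v \<in> hvec ?H ?F' j. \<forall>s<b. appm ?F' M v s = 0}" for j
  have colon: "(\<exists>w\<in>T' p. mdvd w m) \<longleftrightarrow> (\<exists>q<p. ?t q = ?t p \<and> mdvd (?u q) (m + ?u p))"
    if p: "p < b'" and m: "Poly_Mapping.keys m \<subseteq> {..<n}" "c dvd mdeg m" for p m
  proof
    assume "\<exists>w\<in>T' p. mdvd w m"
    then obtain w q where wq: "q < p" "?t q = ?t p" "mdvd (?u q) (w + ?u p)" "mdvd w m" by (auto simp: T'_def)
    have "mdvd (w + ?u p) (m + ?u p)" using wq(4) by (auto simp: mdvd_iff lookup_add)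
    with wq show "\<exists>q<p. ?t q = ?t p \<and> mdvd (?u q) (m + ?u p)" using mdvd_trans by blast
  next
    assume "\<exists>q<p. ?t q = ?t p \<and> mdvd (?u q) (m + ?u p)"
    then obtain q where q: "q < p" "?t q = ?t p" "mdvd (?u q) (m + ?u p)" by blast
    have "?u p \<noteq> ?u q" using Linj[of p q] q p by auto
    from colon_linear[OF Lp(3)[OF p] Lp(3)[of q] this m q(3)] p q
    show "\<exists>w\<in>T' p. mdvd w m" unfolding T'_def by auto
  qed
  have "linear_leading (Suc i) b' T' Z'"
    unfolding linear_leading_def
  proof (intro conjI allI ballI impI)
    fix j v p m
    assume v: "v \<in> Z' j" and p: "p < b'" and top: "\<forall>s. p < s \<and> s < b' \<longrightarrow> v s = 0" and m: "m \<in> Poly_Mapping.keys (v p)"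
    have vH: "v q \<in> Hp n c (j - (int i + 1))" if "q < b'" for q using v that by (simp add: Z'_def hv')
    have mc: "Poly_Mapping.keys m \<subseteq> {..<n}" "int (mdeg m) = (j - (int i + 1)) * int c"
      using vH[OF p] m by (auto simp: Hp_def)
    have "int c dvd int (mdeg m)" by (simp add: mc(2))
    then have cd: "c dvd mdeg m" by simp
    have "(\<Sum>q<b'. v q * M q (?t p)) = 0" using v Lp(1)[OF p] by (simp add: Z'_def appm_def)
    then have "(\<Sum>q<b'. Poly_Mapping.lookup (v q * M q (?t p)) (m + ?u p)) = 0"
      by (simp flip: lookup_sum)
    moreover have "Poly_Mapping.lookup (v p * M p (?t p)) (m + ?u p) = Poly_Mapping.lookup (v p) m"
      by (simp add: gp(2)[OF p] lookup_mult_X)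
    ultimately have "(\<Sum>q\<in>{..<b'} - {p}. Poly_Mapping.lookup (v q * M q (?t p)) (m + ?u p)) \<noteq> 0"
      using m p by (simp add: sum.remove[of "{..<b'}" p] in_keys_iff eq_neg_iff_add_eq_0[symmetric])
    then obtain q where q: "q < b'" "q \<noteq> p" "Poly_Mapping.lookup (v q * M q (?t p)) (m + ?u p) \<noteq> 0"
      by (auto elim!: sum.not_neutral_contains_not_neutral)
    have qp: "q < p" using q top by (cases "q < p") auto
    have tq: "?t q = ?t p"
      using Lmono[of q p] qp p q gp(3)[of q "?t p"] Lp(1)[OF p] by (cases "?t q = ?t p") auto
    have "mdvd (?u q) (m + ?u p)"
      using q(3) gp(2)[OF q(1)] by (simp add: tq lookup_mult_X split: if_splits)
    with colon[OF p mc(1) cd] qp tq show "\<exists>w\<in>T' p. mdvd w m" by blast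
  next
    fix p w assume p: "p < b'" and "w \<in> T' p"
    then obtain q where w: "w \<in> Mon n c" and q: "q < p" "?t q = ?t p" "mdvd (?u q) (w + ?u p)" by (auto simp: T'_def)
    \<comment> \<open>The S-pair of the generators \<open>p\<close> and \<open>q\<close>: their leading terms cancel, and dividing the rest gives a syzygy with leading term \<open>X w\<close>.\<close>
    define w' where "w' = w + ?u p - ?u q"
    have w'eq: "?u q + w' = w + ?u p" unfolding w'_def by (rule mdvd_add_diff[OF q(3)])
    have uq: "?u q \<in> Mon n c" "?u p \<in> Mon n c" using Lp(3) p q by auto
    have w': "w' \<in> Mon n c"
    proof -
      have "mdeg (?u q) + mdeg w' = mdeg w + mdeg (?u p)" using w'eq by (metis mdeg_add)
      moreover have "Poly_Mapping.keys w' \<subseteq> Poly_Mapping.keys w \<union> Poly_Mapping.keys (?u p)"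
        using w'eq by (metis mon_keys_add sup_ge2)
      ultimately show ?thesis using w uq by (auto simp: Mon_def)
    qed
    define z where "z s = X w * M p s + - X w' * M q s" for s
    have Xw: "X w \<in> Hp n c 1" "- X w' \<in> Hp n c 1" 
      by (rule X_in_Hp[OF w], rule Huminus[OF X_in_Hp[OF w']])
    have "(\<lambda>s. X w * M p s) \<in> Z (1 + (int i + 1))" "(\<lambda>s. - X w' * M q s) \<in> Z (1 + (int i + 1))"
      using p q by (intro linear_leading_mult[OF st] Xw gp(1); simp)+
    then have zZ: "z \<in> Z (1 + (int i + 1))" unfolding z_def[abs_def] by (rule linear_leading_add[OF st])
    have zt: "\<forall>s. ?t p \<le> s \<and> s < b \<longrightarrow> z s = 0"
    proof (intro allI impI)
      fix s assume s: "?t p \<le> s \<and> s < b"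
      show "z s = 0"
      proof (cases "s = ?t p")
        case True
        have "M q (?t p) = X (?u q)" using gp(2)[of q] p q by simp
        then show ?thesis using gp(2)[OF p] w'eq by (simp add: True z_def X_mult add.commute)
      next
        case False
        then show ?thesis using gp(3)[OF p, of s] gp(3)[of q s] s p q by (simp add: z_def)
      qed
    qed
    from generators_span[OF st g zZ zt] obtain W where
      W: "\<And>t u. W t u \<in> Hp n c (1 + (int i + 1) - (int i + 1))" "\<And>t u. ?t p \<le> t \<Longrightarrow> W t u = 0"
      "\<And>s. s < b \<Longrightarrow> z s = (\<Sum>t<b. \<Sum>u\<in>T t. W t u * g t u s)" by blast
    let ?v = "\<lambda>r. (if r = p then X w else 0) + (if r = q then - X w' else 0) - W (?t r) (?u r)"
    have vH: "?v r \<in> Hp n c (1 + (int i + 1) - (int i + 1))" for r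
      using Xw W(1) by (intro Hdiff Hadd) (auto simp: H0)
    have "appm ?F' M ?v s = 0" if s: "s < b" for s
    proof -
      have "appm ?F' M ?v s = appm ?F' M (\<lambda>r. (if r = p then X w else 0)) s + appm ?F' M (\<lambda>r. (if r = q then - X w' else 0)) s
          - appm ?F' M (\<lambda>r. W (?t r) (?u r)) s"
        by (simp only: appm_diff appm_add)
      also have "\<dots> = z s - z s"
        using p q by (simp add: appL W(3)[OF s, symmetric]) (simp add: appm_def z_def if_distrib[of "\<lambda>x. x * _"] cong: if_cong)
      finally show ?thesis by simp
    qed
    then have "?v \<in> Z' (int (Suc i) + 1)" using vH by (simp add: Z'_def hv' add.commute)
    moreover have "?v p = X w" using q W(2)[of "?t p"] by simp
    moreover have "?v r = 0" if "p < r" "r < b'" for r using q that W(2) Lmono[of p r] by simp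
    ultimately show "\<exists>g\<in>Z' (int (Suc i) + 1). g p = X w \<and> (\<forall>s. p < s \<and> s < b' \<longrightarrow> g s = 0)"
      by (intro bexI[of _ ?v]) auto
  next
    show "T' t \<subseteq> Mon n c" for t by (auto simp: T'_def)
    show "Z' j \<subseteq> hvec ?H ?F' j" for j by (auto simp: Z'_def)
    show "(\<lambda>_. 0) \<in> Z' j" for j by (simp add: Z'_def hv' H0)
    show "(\<lambda>s. v s + w s) \<in> Z' j" if "v \<in> Z' j" "w \<in> Z' j" for v w j
      using that by (simp add: Z'_def hv' Hadd appm_add)
    show "(\<lambda>s. x * v s) \<in> Z' (e + j)" if "x \<in> Hp n c e" "v \<in> Z' j" for x e v j
      using that hvec_mult[OF hideal_H, of x e v ?F' j] by (simp add: Z'_def appm_mult)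
  qed
  moreover have "b' * card (Mon n (l * c)) = mcount b' T' l + mcount b T (Suc l)" for l
  proof -
    let ?A = "\<lambda>p. {m \<in> Mon n (l * c). \<not> (\<exists>w\<in>T' p. mdvd w m)}"
    let ?B = "\<lambda>t. {m \<in> Mon n (Suc l * c). \<exists>u\<in>T t. mdvd u m}"
    let ?f = "\<lambda>(p, m). (?t p, m + ?u p)"
    have Am: "m \<in> ?A p \<longleftrightarrow> m \<in> Mon n (l * c) \<and> \<not> (\<exists>q<p. ?t q = ?t p \<and> mdvd (?u q) (m + ?u p))" if "p < b'" for p m
      using colon[OF that, of m] by (auto simp: Mon_def)
    have "bij_betw ?f (Sigma {..<b'} ?A) (Sigma {..<b} ?B)"
    proof (rule bij_betw_imageI)
      show "inj_on ?f (Sigma {..<b'} ?A)"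
      proof (rule inj_onI)
        fix x y assume x: "x \<in> Sigma {..<b'} ?A" and y: "y \<in> Sigma {..<b'} ?A" and f: "?f x = ?f y"
        obtain p m where xp: "x = (p, m)" by force
        obtain p2 m2 where yp: "y = (p2, m2)" by force
        have p: "p < b'" "p2 < b'" and m: "m \<in> ?A p" and m2: "m2 \<in> ?A p2" using x y xp yp by auto
        have eq: "?t p = ?t p2" "m + ?u p = m2 + ?u p2" using f xp yp by auto
        have "\<not> p < p2" using Am[OF p(2), of m2] m2 eq mdvd_add(2)[of "?u p" m] by metis
        moreover have "\<not> p2 < p" using Am[OF p(1), of m] m eq mdvd_add(2)[of "?u p2" m2] by metis
        ultimately have "p = p2" by simp
        with eq show "x = y" by (simp add: xp yp)
      qed
      show "?f ` Sigma {..<b'} ?A = Sigma {..<b} ?B"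
      proof (intro equalityI subsetI)
        fix x assume "x \<in> ?f ` Sigma {..<b'} ?A"
        then obtain p m where p: "p < b'" "m \<in> Mon n (l * c)" and x: "x = (?t p, m + ?u p)" by auto
        have "m + ?u p \<in> Mon n (Suc l * c)" using Mon_add[OF p(2) Lp(3)[OF p(1)]] by (simp add: add.commute)
        then show "x \<in> Sigma {..<b} ?B" using Lp[OF p(1)] x by (auto intro!: bexI[of _ "?u p"])
      next
        fix x assume "x \<in> Sigma {..<b} ?B"
        then obtain t m' u where x: "x = (t, m')" "t < b" "m' \<in> Mon n (Suc l * c)" "u \<in> T t" "mdvd u m'" by auto
        from Lex[OF x(2,4)] x have ex: "\<exists>p. p < b' \<and> ?t p = t \<and> mdvd (?u p) m'" by blast
        define p where "p = (LEAST p. p < b' \<and> ?t p = t \<and> mdvd (?u p) m')"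
        have p: "p < b'" "?t p = t" "mdvd (?u p) m'" using LeastI_ex[OF ex] unfolding p_def by auto
        have least: "\<not> (q < b' \<and> ?t q = t \<and> mdvd (?u q) m')" if "q < p" for q
          using not_less_Least that unfolding p_def by blast
        define m where "m = m' - ?u p"
        have m': "m' = m + ?u p" using mdvd_add_diff[OF p(3)] by (simp add: m_def add.commute)
        have "m \<in> Mon n (l * c)"
          using x(3) Lp(3)[OF p(1)] unfolding m' by (auto simp: Mon_def mdeg_add mon_keys_add)
        moreover have "\<not> (\<exists>q<p. ?t q = ?t p \<and> mdvd (?u q) (m + ?u p))"
          using least p by (auto simp flip: m')
        ultimately have "(p, m) \<in> Sigma {..<b'} ?A" using Am[OF p(1)] p(1) by blast
        then show "x \<in> ?f ` Sigma {..<b'} ?A" using p(2) x(1) m' by (intro image_eqI[of _ _ "(p, m)"]) auto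
      qed
    qed
    from bij_betw_same_card[OF this] have 1: "(\<Sum>p<b'. card (?A p)) = mcount b T (Suc l)"
      by (simp add: card_SigmaI mcount_def)
    have "card (?A p) + card {m \<in> Mon n (l * c). \<exists>w\<in>T' p. mdvd w m} = card (Mon n (l * c))" for p
      by (subst card_Un_disjoint[symmetric]) (auto intro!: arg_cong[where f = card])
    then have "(\<Sum>p<b'. card (?A p) + card {m \<in> Mon n (l * c). \<exists>w\<in>T' p. mdvd w m}) = b' * card (Mon n (l * c))"
      by simp
    with 1 show ?thesis by (simp add: sum.distrib mcount_def)
  qed
  moreover have "\<exists>w\<in>hvec ?H ?F' j. \<forall>s<b. z s = appm ?F' M w s" if z: "z \<in> Z j" for z j
  proof -
    have "\<forall>s. b \<le> s \<and> s < b \<longrightarrow> z s = 0" by auto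
    from generators_span[OF st g z this] obtain W where "\<And>t u. W t u \<in> Hp n c (j - (int i + 1))"
      "\<And>s. s < b \<Longrightarrow> z s = (\<Sum>t<b. \<Sum>u\<in>T t. W t u * g t u s)" by blast
    then show ?thesis by (intro bexI[of _ "\<lambda>p. W (?t p) (?u p)"]) (auto simp: appL hv')
  qed
  ultimately show ?thesis using hm appZ Z'_def by blast
qed

end

context veronese_step begin

lemma zero_ideal: "hideal (\<lambda>d. {0})"
  by (auto simp: hideal_def H0)

text \<open>
  Iterating \<open>linear_step\<close>, with the ideal of elements of positive degree as the first syzygy, resolves \<open>k\<close>
  over \<open>S^(c)\<close> with a basis of the \<open>i\<close>-th module in degree \<open>i\<close> only.  Here \<open>N i l\<close> is the dimension of the
  \<open>(i+1)\<close>-st syzygy in degree \<open>i + l\<close>.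
\<close>

lemma linear_resolution:
  "\<exists>F (D :: nat \<Rightarrow> nat \<Rightarrow> nat \<Rightarrow> 'k::field mpol) b N. hres (\<lambda>d. {0}) F D \<and> F 0 = [0] \<and> (\<forall>i. F (Suc i) = replicate (b i) i) \<and>
     D 0 = (\<lambda>t u. if u = t then 1 else 0) \<and> b 0 = 1 \<and>
     (\<forall>l. N 0 l + (if l = 0 then 1 else 0) = card (Mon n (l * c))) \<and> (\<forall>i. N i 0 = 0) \<and>
     (\<forall>i l. b (Suc i) * card (Mon n (l * c)) = N (Suc i) l + N i (Suc l))"
proof -
  let ?H = "Hp n c :: int \<Rightarrow> 'k mpol set"
  define Z0 where "Z0 j = {v \<in> hvec ?H [0] j. v 0 \<in> aug (\<lambda>d. {0}) j}" for j
  note I = zero_ideal[where 'a = 'k]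
  have st0: "linear_leading 0 1 (\<lambda>_. Mon n c) Z0"
    unfolding linear_leading_def
  proof (intro conjI allI ballI impI)
    fix j v t m assume v: "v \<in> Z0 j" and t: "t < (1::nat)" and m: "m \<in> Poly_Mapping.keys (v t)"
    have v0: "v 0 \<in> Hp n c j" "v 0 \<in> aug (\<lambda>d. {0}) j" using v by (auto simp: Z0_def hvec_def)
    have "j > 0" using v0 m t by (auto simp: aug_def split: if_splits)
    have mm: "Poly_Mapping.keys m \<subseteq> {..<n}" "int (mdeg m) = j * int c" using v0 m t by (auto simp: Hp_def)
    have "1 * int c \<le> j * int c" using \<open>j > 0\<close> by (intro mult_right_mono) auto
    with mm(2) have "c \<le> mdeg m" by linarith
    then obtain w where "mdvd 0 w" "mdvd w m" "mdeg w = c" using mdvd_interpolate[of 0 m c] by (auto simp: mdvd_iff)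
    then show "\<exists>u\<in>Mon n c. mdvd u m" using mm(1) mdvd_keys[of w m] by (auto simp: Mon_def)
  next
    fix t u assume "t < (1::nat)" "u \<in> Mon n c"
    then show "\<exists>g\<in>Z0 (int 0 + 1). g t = X u \<and> (\<forall>s. t < s \<and> s < 1 \<longrightarrow> g s = 0)"
      using X_in_Hp[of u n c] by (intro bexI[of _ "\<lambda>_. X u"]) (auto simp: Z0_def hvec_def aug_def)
  next
    fix e j v and x :: "'k mpol"
    assume x: "x \<in> Hp n c e" and v: "v \<in> Z0 j"
    then show "(\<lambda>s. x * v s) \<in> Z0 (e + j)"
      using hvec_mult[OF hideal_H x, of v "[0]" j] hideal_mult[OF aug_ideal[OF I] x] by (auto simp: Z0_def)
  qed (auto simp: Z0_def hvec_def H0 Hadd intro: hideal_add[OF aug_ideal[OF I]] hideal_0[OF aug_ideal[OF I]])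
  define P where "P i S \<longleftrightarrow> (case S of (b, T, Z) \<Rightarrow> linear_leading i b T Z \<and> (i = 0 \<longrightarrow> S = (1, \<lambda>_. Mon n c, Z0)))" for i S
  define Q where "Q i S S' \<longleftrightarrow> (case S of (b, T, Z) \<Rightarrow> case S' of (b', T', Z') \<Rightarrow> \<exists>M.
     hmat ?H (replicate b' (Suc i)) (replicate b i) M \<and>
     (\<forall>j. \<forall>v\<in>hvec ?H (replicate b' (Suc i)) j. appm (replicate b' (Suc i)) M v \<in> Z j) \<and>
     (\<forall>j. \<forall>z\<in>Z j. \<exists>w\<in>hvec ?H (replicate b' (Suc i)) j. \<forall>s<b. z s = appm (replicate b' (Suc i)) M w s) \<and>
     (\<forall>j. Z' j = {v \<in> hvec ?H (replicate b' (Suc i)) j. \<forall>s<b. appm (replicate b' (Suc i)) M v s = 0}) \<and>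
     (\<forall>l. b' * card (Mon n (l * c)) = mcount b' T' l + mcount b T (Suc l)))" for i S S'
  have "\<exists>S. \<forall>i. P i (S i) \<and> Q i (S i) (S (Suc i))"
  proof (rule dependent_nat_choice)
    show "\<exists>S. P 0 S" using st0 by (intro exI[of _ "(1, \<lambda>_. Mon n c, Z0)"]) (simp add: P_def)
  next
    fix S i assume "P i S"
    then obtain b T Z where S: "S = (b, T, Z)" "linear_leading i b T Z" by (auto simp: P_def split: prod.splits)
    from linear_step[OF S(2)] obtain b' T' Z' where "linear_leading (Suc i) b' T' Z'" "Q i S (b', T', Z')"
      unfolding Q_def S(1) prod.case by (elim exE conjE) blast
    then show "\<exists>S'. P (Suc i) S' \<and> Q i S S'" by (intro exI[of _ "(b', T', Z')"]) (simp add: P_def)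
  qed
  then obtain S where PS: "\<And>i. P i (S i)" and QS: "\<And>i. Q i (S i) (S (Suc i))" by blast
  define b where "b i = fst (S i)" for i
  define T where "T i = fst (snd (S i))" for i
  define Z where "Z i = snd (snd (S i))" for i
  have S: "S i = (b i, T i, Z i)" for i by (simp add: b_def T_def Z_def)
  have st: "linear_leading i (b i) (T i) (Z i)" for i using PS[of i] by (simp add: P_def S)
  have "S 0 = (1, \<lambda>_. Mon n c, Z0)" using PS[of 0] by (auto simp: P_def split: prod.splits)
  then have S0: "b 0 = 1" "T 0 = (\<lambda>_. Mon n c)" "Z 0 = Z0" by (simp_all add: b_def T_def Z_def)
  have "\<forall>i. \<exists>M. hmat ?H (replicate (b (Suc i)) (Suc i)) (replicate (b i) i) M \<and>
     (\<forall>j. \<forall>v\<in>hvec ?H (replicate (b (Suc i)) (Suc i)) j. appm (replicate (b (Suc i)) (Suc i)) M v \<in> Z i j) \<and>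
     (\<forall>j. \<forall>z\<in>Z i j. \<exists>w\<in>hvec ?H (replicate (b (Suc i)) (Suc i)) j. \<forall>s<b i. z s = appm (replicate (b (Suc i)) (Suc i)) M w s) \<and>
     (\<forall>j. Z (Suc i) j = {v \<in> hvec ?H (replicate (b (Suc i)) (Suc i)) j. \<forall>s<b i. appm (replicate (b (Suc i)) (Suc i)) M v s = 0}) \<and>
     (\<forall>l. b (Suc i) * card (Mon n (l * c)) = mcount (b (Suc i)) (T (Suc i)) l + mcount (b i) (T i) (Suc l))"
    using QS unfolding Q_def S prod.case by (rule allI)
  from choice[OF this] obtain M where MM: "\<And>i. hmat ?H (replicate (b (Suc i)) (Suc i)) (replicate (b i) i) (M i) \<and>
     (\<forall>j. \<forall>v\<in>hvec ?H (replicate (b (Suc i)) (Suc i)) j. appm (replicate (b (Suc i)) (Suc i)) (M i) v \<in> Z i j) \<and>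
     (\<forall>j. \<forall>z\<in>Z i j. \<exists>w\<in>hvec ?H (replicate (b (Suc i)) (Suc i)) j. \<forall>s<b i. z s = appm (replicate (b (Suc i)) (Suc i)) (M i) w s) \<and>
     (\<forall>j. Z (Suc i) j = {v \<in> hvec ?H (replicate (b (Suc i)) (Suc i)) j. \<forall>s<b i. appm (replicate (b (Suc i)) (Suc i)) (M i) v s = 0}) \<and>
     (\<forall>l. b (Suc i) * card (Mon n (l * c)) = mcount (b (Suc i)) (T (Suc i)) l + mcount (b i) (T i) (Suc l))" by blast
  have M: "hmat ?H (replicate (b (Suc i)) (Suc i)) (replicate (b i) i) (M i)" for i using MM[of i] by (elim conjE)
  have MZ: "appm (replicate (b (Suc i)) (Suc i)) (M i) v \<in> Z i j"
    if "v \<in> hvec ?H (replicate (b (Suc i)) (Suc i)) j" for i j v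
    using MM[THEN conjunct2, THEN conjunct1, rule_format, OF that] .
  have ZM: "\<exists>w\<in>hvec ?H (replicate (b (Suc i)) (Suc i)) j. \<forall>s<b i. z s = appm (replicate (b (Suc i)) (Suc i)) (M i) w s"
    if "z \<in> Z i j" for i j z
    using MM[THEN conjunct2, THEN conjunct2, THEN conjunct1, THEN spec, THEN bspec, OF that] .
  have Z: "Z (Suc i) j = {v \<in> hvec ?H (replicate (b (Suc i)) (Suc i)) j. \<forall>s<b i. appm (replicate (b (Suc i)) (Suc i)) (M i) v s = 0}" for i j
    using MM[THEN conjunct2, THEN conjunct2, THEN conjunct2, THEN conjunct1, THEN spec] .
  have cnt: "b (Suc i) * card (Mon n (l * c)) = mcount (b (Suc i)) (T (Suc i)) l + mcount (b i) (T i) (Suc l)" for i l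
    using MM[THEN conjunct2, THEN conjunct2, THEN conjunct2, THEN conjunct2, THEN spec] .
  define F where "F i = (case i of 0 \<Rightarrow> [0] | Suc k \<Rightarrow> replicate (b k) k)" for i
  define D where "D i = (case i of 0 \<Rightarrow> (\<lambda>t u. if u = t then 1 else 0) | Suc k \<Rightarrow> M k)" for i
  have F: "F 0 = [0]" "F (Suc k) = replicate (b k) k" "D 0 = (\<lambda>t u. if u = t then 1 else 0)" "D (Suc k) = M k" for k
    by (simp_all add: F_def D_def)
  have id1: "appm [0] (\<lambda>t u. if u = t then 1 else 0) v 0 = v 0" for v :: "nat \<Rightarrow> 'k mpol"
    by (simp add: appm_def)
  have F1: "F (Suc 0) = [0]" by (simp add: F S0)
  have cv: "cvec (\<lambda>d. {0}) (replicate q i) j v w \<longleftrightarrow> (\<forall>u<q. v u = w u)" for q i j and v w :: "nat \<Rightarrow> 'k mpol"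
    by (auto simp: cvec_def hvec_def)
  have "hres (\<lambda>d. {0}) F D"
    unfolding hres_def
  proof (intro conjI allI ballI impI F)
    fix i show "hmat ?H (F (Suc i)) (F i) (D i)"
      using M hmat_id[of "[0]"] by (cases i) (auto simp: F F1[simplified F] S0)
  next
    fix j v assume "v \<in> hvec ?H (F 0) j"
    then show "\<exists>w\<in>hvec ?H (F 1) j. cvec (rel (\<lambda>d. {0}) 0) (F 0) j (appm (F 1) (D 0) w) v"
      using F1 hideal_0[OF rel_ideal[OF I, of 0]]
      by (intro bexI[of _ v]) (simp_all add: F id1 cvec_def hvec_def)
  next
    fix i j v assume v: "v \<in> hvec ?H (F (Suc (Suc i))) j"
    then have MvZ: "appm (F (Suc (Suc i))) (D (Suc i)) v \<in> Z i j" using MZ[of v i j] by (simp add: F)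
    show "cvec (rel (\<lambda>d. {0}) i) (F i) j (appm (F (Suc i)) (D i) (appm (F (Suc (Suc i))) (D (Suc i)) v)) (\<lambda>_. 0)"
    proof (cases i)
      case 0
      then show ?thesis using MvZ F1 by (simp add: S0 Z0_def cvec_def hvec_def F(1,3) id1 rel_def)
    next
      case (Suc k)
      then show ?thesis using MvZ by (simp add: Z F rel_def cv)
    qed
  next
    fix i j v assume v: "v \<in> hvec ?H (F (Suc i)) j"
      and z: "cvec (rel (\<lambda>d. {0}) i) (F i) j (appm (F (Suc i)) (D i) v) (\<lambda>_. 0)"
    have "v \<in> Z i j"
    proof (cases i)
      case 0
      then show ?thesis using v z F1 by (simp add: S0 Z0_def cvec_def hvec_def F(1,3) id1 rel_def)
    next
      case (Suc k)
      then show ?thesis using v z by (simp add: Z F rel_def cv)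
    qed
    from ZM[OF this]
    show "\<exists>w\<in>hvec ?H (F (Suc (Suc i))) j. cvec (\<lambda>d. {0}) (F (Suc i)) j (appm (F (Suc (Suc i))) (D (Suc i)) w) v"
      by (auto simp: F cv)
  qed
  moreover have "mcount (b 0) (T 0) l + (if l = 0 then 1 else 0) = card (Mon n (l * c))" for l
  proof (cases l)
    case 0
    have "{m \<in> Mon n 0. \<exists>u\<in>Mon n c. mdvd u m} = {}"
      using c by (auto simp: Mon_0) (auto simp: Mon_def dest: mdvd_deg)
    then show ?thesis by (simp add: 0 mcount_def S0 Mon_0)
  next
    case (Suc k)
    have "\<exists>u\<in>Mon n c. mdvd u m" if m: "m \<in> Mon n (l * c)" for m
    proof -
      have "mdeg 0 \<le> c" "c \<le> mdeg m" using m Suc by (auto simp: Mon_def)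
      then obtain w where "mdvd w m" "mdeg w = c" using mdvd_interpolate[of 0 m c] by (auto simp: mdvd_iff)
      then show ?thesis using m mdvd_keys[of w m] by (auto simp: Mon_def)
    qed
    then have "{m \<in> Mon n (l * c). \<exists>u\<in>Mon n c. mdvd u m} = Mon n (l * c)" by blast
    then show ?thesis using Suc by (simp add: mcount_def S0)
  qed
  moreover have "mcount (b i) (T i) 0 = 0" for i
  proof -
    have "{m \<in> Mon n 0. \<exists>u\<in>T i t. mdvd u m} = {}" if "t < b i" for t
      using c linear_leading_gens[OF st that] by (auto simp: Mon_0) (auto simp: Mon_def dest!: mdvd_deg)
    then show ?thesis by (simp add: mcount_def)
  qed
  ultimately show ?thesis
    using F S0(1) cnt by (intro exI[of _ F] exI[of _ D] exI[of _ b] exI[of _ "\<lambda>i. mcount (b i) (T i)"]) auto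
qed

end

text \<open>The equation says that the Euler characteristic of the linear resolution in degree \<open>j\<close> is the dimension of
  the degree \<open>j\<close> part of \<open>k\<close>.\<close>

lemma linear_euler:
  fixes b h :: "nat \<Rightarrow> nat" and N :: "nat \<Rightarrow> nat \<Rightarrow> nat"
  assumes "b 0 = 1" "\<And>l. N 0 l + (if l = 0 then 1 else 0) = h l" "\<And>i. N i 0 = 0"
    "\<And>i l. b (Suc i) * h l = N (Suc i) l + N i (Suc l)"
  shows "(\<Sum>i\<le>j. (-1) ^ i * int (b i) * int (h (j - i))) = (if j = 0 then 1 else 0)"
proof -
  have "(\<Sum>i\<le>k. (-1) ^ i * int (b i) * int (h (j - i))) = (if j = 0 then 1 else 0) + (-1) ^ k * int (N k (j - k))"
    if "k \<le> j" for k
    using that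
  proof (induction k)
    case 0
    have "int (h j) = (if j = 0 then 1 else 0) + int (N 0 j)" using assms(2)[of j] by (auto split: if_splits)
    then show ?case using assms(1) by simp
  next
    case (Suc k)
    have "j - k = Suc (j - Suc k)" using Suc.prems by simp
    then have "int (b (Suc k)) * int (h (j - Suc k)) = int (N (Suc k) (j - Suc k)) + int (N k (j - k))"
      using assms(4)[of k "j - Suc k"] by (metis of_nat_add of_nat_mult)
    then have "(-1) ^ Suc k * int (b (Suc k)) * int (h (j - Suc k)) =
        (-1) ^ Suc k * int (N (Suc k) (j - Suc k)) - (-1) ^ k * int (N k (j - k))"
      by (simp only: mult.assoc) (simp add: algebra_simps)
    with Suc show ?case by simp
  qed
  from this[of j] assms(3) show ?thesis by simp
qed

lemma Mon_series: "Abs_fps (\<lambda>d. of_nat (card (Mon n d))) * (1 - fps_X) ^ n = (1 :: 'a::comm_ring_1 fps)"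
proof (induction n)
  case 0
  have "Mon 0 d = (if d = 0 then {0} else {})" for d by (auto simp: Mon_def)
  then show ?case by (auto intro!: fps_ext)
next
  case (Suc n)
  have "Abs_fps (\<lambda>d. of_nat (card (Mon (Suc n) d))) * (1 - fps_X) = (Abs_fps (\<lambda>d. of_nat (card (Mon n d))) :: 'a fps)"
  proof (rule fps_ext)
    fix d
    show "fps_nth (Abs_fps (\<lambda>d. of_nat (card (Mon (Suc n) d))) * (1 - fps_X)) d = fps_nth (Abs_fps (\<lambda>d. of_nat (card (Mon n d))) :: 'a fps) d"
    proof (cases d)
      case 0
      then show ?thesis by (simp add: right_diff_distrib Mon_0)
    next
      case (Suc e)
      have disj: "Mon n (Suc e) \<inter> (\<lambda>m. m + Poly_Mapping.single n 1) ` Mon (Suc n) e = {}"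
        by (auto simp: Mon_def mon_keys_add)
      have inj: "inj_on (\<lambda>m. m + Poly_Mapping.single n 1) (Mon (Suc n) e)" by (auto simp: inj_on_def)
      have "card (Mon (Suc n) (Suc e)) = card (Mon n (Suc e)) + card (Mon (Suc n) e)"
        unfolding Mon_Suc_Suc using card_Un_disjoint[OF finite_Mon finite_imageI[OF finite_Mon] disj]
        by (simp only: card_image[OF inj])
      then show ?thesis using Suc by (simp add: right_diff_distrib fps_X_mult_right_nth)
    qed
  qed
  then show ?case using Suc by (simp add: mult.assoc[symmetric])
qed

text \<open>For \<open>c = 1\<close> the ranks are those of the Koszul complex, that is, binomial coefficients.\<close>

lemma linear_ranks_polynomial_ring:
  fixes b :: "nat \<Rightarrow> nat"
  assumes "\<And>j. (\<Sum>i\<le>j. (-1) ^ i * int (b i) * int (card (Mon n (j - i)))) = (if j = 0 then 1 else 0)"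
  shows "b i \<le> 2 ^ n"
proof -
  let ?B = "Abs_fps (\<lambda>i. (-1) ^ i * int (b i))" and ?M = "Abs_fps (\<lambda>d. int (card (Mon n d)))"
  have BM: "?B * ?M = 1"
    using assms by (intro fps_ext) (simp add: fps_mult_nth atLeast0AtMost)
  have "?B = ?B * (?M * (1 - fps_X) ^ n)" using Mon_series[of n, where 'a = int] by simp
  also have "\<dots> = (1 - fps_X) ^ n" by (simp only: mult.assoc[symmetric] BM mult_1)
  finally have "fps_nth ?B i = fps_nth ((1 - fps_X) ^ n) i" by simp
  moreover have "\<bar>fps_nth ((1 - fps_X :: int fps) ^ n) i\<bar> \<le> 2 ^ n"
  proof (induction n arbitrary: i)
    case 0
    then show ?case by simp
  next
    case (Suc n)
    have "fps_nth ((1 - fps_X :: int fps) ^ Suc n) i =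
        fps_nth ((1 - fps_X) ^ n) i - (if i = 0 then 0 else fps_nth ((1 - fps_X) ^ n) (i - 1))"
      by (simp add: left_diff_distrib fps_X_mult_nth)
    with Suc.IH[of i] Suc.IH[of "i - 1"] show ?case by (auto split: if_splits)
  qed
  ultimately have "\<bar>(-1) ^ i * int (b i)\<bar> \<le> 2 ^ n" by simp
  then have "int (b i) \<le> int (2 ^ n)" by (simp add: abs_mult)
  then show ?thesis by (simp only: of_nat_le_iff)
qed

section \<open>Dimensions of homology spaces\<close>

lemma (in vectorspace) subspace_dim_le:
  assumes fd: "fin_dim" and sub: "subspace K U V"
  shows "vectorspace.dim K (vs U) \<le> dim" and "vectorspace.fin_dim K (vs U)"
proof -
  interpret U: vectorspace K "vs U" by (rule subspace_is_vs[OF sub])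
  have subm: "submodule K U V" using sub by simp
  have UV: "U \<subseteq> carrier V" using subm by (simp add: submodule_def)
  have li: "lin_indpt A" if "U.lin_indpt A" "A \<subseteq> U" for A
    using span_li_not_depend(2)[OF that(2) subm] that(1) by simp
  have bound: "finite A \<and> card A \<le> dim" if "U.lin_indpt A" "A \<subseteq> U" for A
    using li_le_dim[OF fd _ li[OF that]] that(2) UV by auto
  have "\<exists>A. finite A \<and> maximal A (\<lambda>S. S \<subseteq> carrier (vs U) \<and> U.lin_indpt S)"
  proof (rule maximal_exists[of _ "dim" "{}"])
    show "finite A \<and> card A \<le> dim" if "A \<subseteq> carrier (vs U) \<and> U.lin_indpt A" for A
      using bound[of A] that by simp
    have "\<not> U.lin_dep {}" unfolding U.lin_dep_def by blast
    then show "{} \<subseteq> carrier (vs U) \<and> U.lin_indpt {}" by simp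
  qed
  then obtain A where A: "finite A" "maximal A (\<lambda>S. S \<subseteq> carrier (vs U) \<and> U.lin_indpt S)" by blast
  have bA: "U.basis A" by (rule U.max_li_is_basis[OF A(2)])
  then have A': "U.lin_indpt A" "A \<subseteq> U" by (auto simp: U.basis_def)
  show "vectorspace.dim K (vs U) \<le> dim"
    using U.dim_basis[OF A(1) bA] bound[OF A'] by simp
  show "vectorspace.fin_dim K (vs U)"
    using A(1) bA by (auto simp: U.fin_dim_def U.basis_def)
qed

lemma dim_coordinates:
  fixes V :: "('k::field, 'v, 'm) module_scheme" and lk :: "'v \<Rightarrow> 'x \<Rightarrow> 'k"
  assumes V: "vectorspace class_ring V" and J: "finite J" "\<And>x. x \<in> J \<Longrightarrow> e x \<in> carrier V"
    and add: "\<And>v w x. v \<in> carrier V \<Longrightarrow> w \<in> carrier V \<Longrightarrow> x \<in> J \<Longrightarrow> lk (v \<oplus>\<^bsub>V\<^esub> w) x = lk v x + lk w x"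
    and smult: "\<And>a v x. v \<in> carrier V \<Longrightarrow> x \<in> J \<Longrightarrow> lk (a \<odot>\<^bsub>V\<^esub> v) x = a * lk v x"
    and dual: "\<And>x y. x \<in> J \<Longrightarrow> y \<in> J \<Longrightarrow> lk (e x) y = (if x = y then 1 else 0)"
    and inj: "\<And>v w. v \<in> carrier V \<Longrightarrow> w \<in> carrier V \<Longrightarrow> (\<And>x. x \<in> J \<Longrightarrow> lk v x = lk w x) \<Longrightarrow> v = w"
  shows "vectorspace.dim class_ring V = card J" "vectorspace.fin_dim class_ring V"
proof -
  interpret V: vectorspace "class_ring :: 'k ring" V by (rule V)
  have lk0: "lk \<zero>\<^bsub>V\<^esub> x = 0" if "x \<in> J" for x
    using smult[OF V.M.zero_closed that, of 0] by (simp add: V.lmult_0)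
  have lkc: "lk (V.lincomb a A) x = (\<Sum>v\<in>A. a v * lk v x)" if "finite A" "A \<subseteq> carrier V" "x \<in> J" for a A x
    using that(1,2)
  proof (induction A)
    case empty
    then show ?case using lk0[OF that(3)] by (simp add: V.lincomb_def)
  next
    case (insert v A)
    have "V.lincomb a (insert v A) = a v \<odot>\<^bsub>V\<^esub> v \<oplus>\<^bsub>V\<^esub> V.lincomb a A"
      using insert by (intro V.lincomb_insert2) auto
    then show ?case using insert that(3) by (simp add: add smult)
  qed
  have inje: "inj_on e J" 
  proof (rule inj_onI)
    fix x y assume "x \<in> J" "y \<in> J" "e x = e y"
    then show "x = y" using dual[of x y] dual[of y y] by (cases "x = y") auto
  qed
  have sub: "e ` J \<subseteq> carrier V" using J by auto
  have "V.lin_indpt (e ` J)"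
  proof
    assume "V.lin_dep (e ` J)"
    then obtain A a v where A: "finite A" "A \<subseteq> e ` J" "V.lincomb a A = \<zero>\<^bsub>V\<^esub>" "v \<in> A" "a v \<noteq> 0"
      by (auto simp: V.lin_dep_def)
    then obtain x where x: "x \<in> J" "v = e x" by auto
    have "0 = (\<Sum>w\<in>A. a w * lk w x)" using lkc[OF A(1) _ x(1), of a] A lk0[OF x(1)] sub by auto
    also have "\<dots> = (\<Sum>w\<in>A. if w = v then a w else 0)"
    proof (rule sum.cong[OF refl])
      fix w assume "w \<in> A"
      then obtain y where "y \<in> J" "w = e y" using A(2) by blast
      then show "a w * lk w x = (if w = v then a w else 0)" using dual[of y x] x inje by (auto simp: inj_on_def)
    qed
    also have "\<dots> = a v" using A by simp
    finally show False using A(5) by simp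
  qed
  moreover have "V.gen_set (e ` J)"
  proof
    show "V.span (e ` J) \<subseteq> carrier V" by (rule V.span_is_subset2[OF sub])
    show "carrier V \<subseteq> V.span (e ` J)"
    proof
      fix v assume v: "v \<in> carrier V"
      let ?w = "V.lincomb (\<lambda>u. lk v (inv_into J e u)) (e ` J)"
      have "?w \<in> carrier V" using sub by (intro V.lincomb_closed) auto
      moreover have "lk v x = lk ?w x" if x: "x \<in> J" for x
      proof -
        have "lk ?w x = (\<Sum>y\<in>J. lk v y * lk (e y) x)"
          using lkc[OF finite_imageI[OF J(1)] sub x] inje by (simp add: sum.reindex)
        also have "\<dots> = lk v x" using J(1) x by (simp add: dual if_distrib[of "\<lambda>z. _ * z"] cong: if_cong)
        finally show ?thesis by simp
      qed
      ultimately have "v = ?w" using inj[OF v] by blast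
      then show "v \<in> V.span (e ` J)" using J(1) sub by (auto simp: V.finite_span)
    qed
  qed
  ultimately have b: "V.basis (e ` J)" using sub by (simp add: V.basis_def)
  from V.dim_basis[OF _ this] J(1) show "vectorspace.dim class_ring V = card J"
    by (simp add: card_image[OF inje])
  show "vectorspace.fin_dim class_ring V"
    unfolding V.fin_dim_def using J(1) b by (auto simp: V.basis_def intro!: exI[of _ "e ` J"])
qed

text \<open>
  Quotients by graded submodules are sets of cosets; the vector space axioms are carried over to them
  along the projection.
\<close>

lemma vectorspace_surjective_image:
  fixes V :: "('k::field, 'v, 'm) module_scheme" and T :: "('k, 'w, 'l) module_scheme"
  assumes V: "vectorspace class_ring V" and q: "q ` carrier V = carrier T"
    and add: "\<And>x y. x \<in> carrier V \<Longrightarrow> y \<in> carrier V \<Longrightarrow> q x \<oplus>\<^bsub>T\<^esub> q y = q (x \<oplus>\<^bsub>V\<^esub> y)"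
    and smult: "\<And>a x. x \<in> carrier V \<Longrightarrow> a \<odot>\<^bsub>T\<^esub> q x = q (a \<odot>\<^bsub>V\<^esub> x)"
    and zero: "\<zero>\<^bsub>T\<^esub> = q \<zero>\<^bsub>V\<^esub>"
  shows "vectorspace class_ring T" "linear_map class_ring V T q"
proof -
  interpret V: vectorspace "class_ring :: 'k ring" V by (rule V)
  have ex: "\<exists>x\<in>carrier V. y = q x" if "y \<in> carrier T" for y using that q by auto
  have im: "q x \<in> carrier T" if "x \<in> carrier V" for x using that q by auto
  have "module class_ring T"
  proof (rule module_criteria)
    show "cring (class_ring :: 'k ring)" by (rule class_cring.is_cring)
    show "\<zero>\<^bsub>T\<^esub> \<in> carrier T" unfolding zero by (rule im) simp
    show "\<forall>v\<in>carrier T. \<exists>neg_v\<in>carrier T. v \<oplus>\<^bsub>T\<^esub> neg_v = \<zero>\<^bsub>T\<^esub>"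
    proof
      fix v assume "v \<in> carrier T"
      then obtain x where x: "x \<in> carrier V" "v = q x" using ex by blast
      then show "\<exists>neg_v\<in>carrier T. v \<oplus>\<^bsub>T\<^esub> neg_v = \<zero>\<^bsub>T\<^esub>"
        by (intro bexI[of _ "q (\<ominus>\<^bsub>V\<^esub> x)"]) (simp_all add: add zero im V.M.r_neg)
    qed
    show "\<forall>v w. v \<in> carrier T \<and> w \<in> carrier T \<longrightarrow> v \<oplus>\<^bsub>T\<^esub> w = w \<oplus>\<^bsub>T\<^esub> v"
    proof (intro allI impI; elim conjE)
      fix v w assume "v \<in> carrier T" "w \<in> carrier T"
      then obtain x y where x: "x \<in> carrier V" "v = q x" "y \<in> carrier V" "w = q y" using ex by metis
      then show "v \<oplus>\<^bsub>T\<^esub> w = w \<oplus>\<^bsub>T\<^esub> v" using V.M.a_comm[of x y] by (simp add: add)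
    qed
    show "\<forall>v w x. v \<in> carrier T \<and> w \<in> carrier T \<and> x \<in> carrier T \<longrightarrow> v \<oplus>\<^bsub>T\<^esub> w \<oplus>\<^bsub>T\<^esub> x = v \<oplus>\<^bsub>T\<^esub> (w \<oplus>\<^bsub>T\<^esub> x)"
    proof (intro allI impI; elim conjE)
      fix v w u assume "v \<in> carrier T" "w \<in> carrier T" "u \<in> carrier T"
      then obtain x y z where x: "x \<in> carrier V" "v = q x" "y \<in> carrier V" "w = q y" "z \<in> carrier V" "u = q z"
        using ex by metis
      then show "v \<oplus>\<^bsub>T\<^esub> w \<oplus>\<^bsub>T\<^esub> u = v \<oplus>\<^bsub>T\<^esub> (w \<oplus>\<^bsub>T\<^esub> u)" using V.M.a_assoc[of x y z] by (simp add: add)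
    qed
    show "\<forall>a b v. a \<in> carrier class_ring \<and> b \<in> carrier class_ring \<and> v \<in> carrier T \<longrightarrow>
        (a \<oplus>\<^bsub>class_ring\<^esub> b) \<odot>\<^bsub>T\<^esub> v = a \<odot>\<^bsub>T\<^esub> v \<oplus>\<^bsub>T\<^esub> b \<odot>\<^bsub>T\<^esub> v"
    proof (intro allI impI; elim conjE)
      fix a b :: 'k and v assume "v \<in> carrier T"
      then obtain x where x: "x \<in> carrier V" "v = q x" using ex by blast
      then show "(a \<oplus>\<^bsub>class_ring\<^esub> b) \<odot>\<^bsub>T\<^esub> v = a \<odot>\<^bsub>T\<^esub> v \<oplus>\<^bsub>T\<^esub> b \<odot>\<^bsub>T\<^esub> v"
        using V.smult_l_distr[of a b x] by (simp add: add smult)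
    qed
    show "\<forall>a b v. a \<in> carrier class_ring \<and> b \<in> carrier class_ring \<and> v \<in> carrier T \<longrightarrow>
        (a \<otimes>\<^bsub>class_ring\<^esub> b) \<odot>\<^bsub>T\<^esub> v = a \<odot>\<^bsub>T\<^esub> (b \<odot>\<^bsub>T\<^esub> v)"
    proof (intro allI impI; elim conjE)
      fix a b :: 'k and v assume "v \<in> carrier T"
      then obtain x where x: "x \<in> carrier V" "v = q x" using ex by blast
      then show "(a \<otimes>\<^bsub>class_ring\<^esub> b) \<odot>\<^bsub>T\<^esub> v = a \<odot>\<^bsub>T\<^esub> (b \<odot>\<^bsub>T\<^esub> v)"
        using V.smult_assoc1[of a b x] by (simp add: smult)
    qed
    show "\<forall>v\<in>carrier T. \<one>\<^bsub>class_ring\<^esub> \<odot>\<^bsub>T\<^esub> v = v"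
    proof
      fix v assume "v \<in> carrier T"
      then obtain x where x: "x \<in> carrier V" "v = q x" using ex by blast
      then show "\<one>\<^bsub>class_ring\<^esub> \<odot>\<^bsub>T\<^esub> v = v" using V.smult_one[of x] by (simp add: smult)
    qed
    show "\<forall>a v w. a \<in> carrier class_ring \<and> v \<in> carrier T \<and> w \<in> carrier T \<longrightarrow> a \<odot>\<^bsub>T\<^esub> (v \<oplus>\<^bsub>T\<^esub> w) = a \<odot>\<^bsub>T\<^esub> v \<oplus>\<^bsub>T\<^esub> a \<odot>\<^bsub>T\<^esub> w"
    proof (intro allI impI; elim conjE)
      fix a :: 'k and v w assume "v \<in> carrier T" "w \<in> carrier T"
      then obtain x y where x: "x \<in> carrier V" "v = q x" "y \<in> carrier V" "w = q y" using ex by metis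
      then show "a \<odot>\<^bsub>T\<^esub> (v \<oplus>\<^bsub>T\<^esub> w) = a \<odot>\<^bsub>T\<^esub> v \<oplus>\<^bsub>T\<^esub> a \<odot>\<^bsub>T\<^esub> w"
        using V.smult_r_distr[of a x y] by (simp add: add smult)
    qed
    show "\<forall>v w. v \<in> carrier T \<and> w \<in> carrier T \<longrightarrow> v \<oplus>\<^bsub>T\<^esub> w \<in> carrier T"
    proof (intro allI impI; elim conjE)
      fix v w assume "v \<in> carrier T" "w \<in> carrier T"
      then obtain x y where x: "x \<in> carrier V" "v = q x" "y \<in> carrier V" "w = q y" using ex by metis
      then show "v \<oplus>\<^bsub>T\<^esub> w \<in> carrier T" by (simp add: add im)
    qed
    show "\<forall>c v. c \<in> carrier class_ring \<and> v \<in> carrier T \<longrightarrow> c \<odot>\<^bsub>T\<^esub> v \<in> carrier T"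
    proof (intro allI impI; elim conjE)
      fix c :: 'k and v assume "v \<in> carrier T"
      then obtain x where x: "x \<in> carrier V" "v = q x" using ex by blast
      then show "c \<odot>\<^bsub>T\<^esub> v \<in> carrier T" by (simp add: smult im)
    qed
    show "\<forall>v\<in>carrier T. v \<oplus>\<^bsub>T\<^esub> \<zero>\<^bsub>T\<^esub> = v"
    proof
      fix v assume "v \<in> carrier T"
      then obtain x where x: "x \<in> carrier V" "v = q x" using ex by blast
      then show "v \<oplus>\<^bsub>T\<^esub> \<zero>\<^bsub>T\<^esub> = v" by (simp add: add zero)
    qed
  qed
  then show T: "vectorspace class_ring T" by (simp add: vectorspace_def class_field)
  show "linear_map class_ring V T q"
  proof (intro linear_map.intro mod_hom.intro mod_hom_axioms.intro V T)
    show "module class_ring V" by (rule V.module_axioms)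
    show "module class_ring T" by fact
    show "q \<in> module_hom class_ring V T" unfolding module_hom_def using im by (auto simp: add smult)
  qed
qed

text \<open>The graded vector space \<open>K(-d\<^sub>0) \<oplus> \<dots> \<oplus> K(-d\<^sub>r)\<close>.\<close>

abbreviation kfree :: "nat list \<Rightarrow> ('k::field, nat \<Rightarrow> 'k) graded" where
  "kfree ds \<equiv> graded_free (base_algebra class_ring) ds"

lemma kfree_simps:
  "carrier (kfree ds) = {..<length ds} \<rightarrow>\<^sub>E UNIV"
  "\<zero>\<^bsub>kfree ds\<^esub> = (\<lambda>t\<in>{..<length ds}. 0)"
  "v \<oplus>\<^bsub>kfree ds\<^esub> w = (\<lambda>t\<in>{..<length ds}. v t + w t)"
  "a \<odot>\<^bsub>kfree ds\<^esub> v = (\<lambda>t\<in>{..<length ds}. a * v t)"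
  "grade (kfree ds) j = {v \<in> {..<length ds} \<rightarrow>\<^sub>E UNIV. \<forall>t<length ds. ds ! t \<noteq> j \<longrightarrow> v t = 0}"
  by (auto simp: graded_free_def base_algebra_def split: if_splits)

lemma kfree_vectorspace: "vectorspace class_ring (kfree ds :: ('k::field, nat \<Rightarrow> 'k) graded)"
proof -
  have "module class_ring (kfree ds :: ('k, nat \<Rightarrow> 'k) graded)"
  proof (rule module_criteria)
    show "cring (class_ring :: 'k ring)" by (rule class_cring.is_cring)
    show "\<forall>v\<in>carrier (kfree ds). \<exists>neg_v\<in>carrier (kfree ds). v \<oplus>\<^bsub>kfree ds\<^esub> neg_v = (\<zero>\<^bsub>kfree ds\<^esub> :: nat \<Rightarrow> 'k)"
    proof
      fix v :: "nat \<Rightarrow> 'k" assume "v \<in> carrier (kfree ds)"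
      then show "\<exists>neg_v\<in>carrier (kfree ds). v \<oplus>\<^bsub>kfree ds\<^esub> neg_v = (\<zero>\<^bsub>kfree ds\<^esub> :: nat \<Rightarrow> 'k)"
        unfolding kfree_simps
        by (intro bexI[of _ "\<lambda>t\<in>{..<length ds}. - v t"] restrict_ext) simp_all
    qed
    show "\<forall>v w. v \<in> carrier (kfree ds) \<and> w \<in> carrier (kfree ds) \<longrightarrow> v \<oplus>\<^bsub>kfree ds\<^esub> w = w \<oplus>\<^bsub>kfree ds\<^esub> (v :: nat \<Rightarrow> 'k)"
      by (simp add: kfree_simps add.commute)
    show "\<forall>v w x. v \<in> carrier (kfree ds) \<and> w \<in> carrier (kfree ds) \<and> x \<in> carrier (kfree ds) \<longrightarrow>
        v \<oplus>\<^bsub>kfree ds\<^esub> w \<oplus>\<^bsub>kfree ds\<^esub> x = v \<oplus>\<^bsub>kfree ds\<^esub> (w \<oplus>\<^bsub>kfree ds\<^esub> (x :: nat \<Rightarrow> 'k))"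
      unfolding kfree_simps by (intro allI impI restrict_ext) (simp add: add.assoc)
    show "\<forall>v\<in>carrier (kfree ds). v \<oplus>\<^bsub>kfree ds\<^esub> \<zero>\<^bsub>kfree ds\<^esub> = (v :: nat \<Rightarrow> 'k)"
      unfolding kfree_simps by (intro ballI) (auto simp: PiE_restrict cong: restrict_cong)
    show "\<forall>a b v. a \<in> carrier class_ring \<and> b \<in> carrier class_ring \<and> v \<in> carrier (kfree ds) \<longrightarrow>
        (a \<otimes>\<^bsub>class_ring\<^esub> b) \<odot>\<^bsub>kfree ds\<^esub> v = a \<odot>\<^bsub>kfree ds\<^esub> (b \<odot>\<^bsub>kfree ds\<^esub> (v :: nat \<Rightarrow> 'k))"
      unfolding kfree_simps by (intro allI impI restrict_ext) (simp add: mult.assoc)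
    show "\<forall>v\<in>carrier (kfree ds). \<one>\<^bsub>class_ring\<^esub> \<odot>\<^bsub>kfree ds\<^esub> v = (v :: nat \<Rightarrow> 'k)"
      unfolding kfree_simps by (intro ballI) (auto simp: PiE_restrict cong: restrict_cong)
    show "\<forall>a b v. a \<in> carrier class_ring \<and> b \<in> carrier class_ring \<and> v \<in> carrier (kfree ds) \<longrightarrow>
        (a \<oplus>\<^bsub>class_ring\<^esub> b) \<odot>\<^bsub>kfree ds\<^esub> v = a \<odot>\<^bsub>kfree ds\<^esub> v \<oplus>\<^bsub>kfree ds\<^esub> b \<odot>\<^bsub>kfree ds\<^esub> (v :: nat \<Rightarrow> 'k)"
      unfolding kfree_simps by (intro allI impI restrict_ext) (simp add: distrib_right)
    show "\<forall>a v w. a \<in> carrier class_ring \<and> v \<in> carrier (kfree ds) \<and> w \<in> carrier (kfree ds) \<longrightarrow>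
        a \<odot>\<^bsub>kfree ds\<^esub> (v \<oplus>\<^bsub>kfree ds\<^esub> w) = a \<odot>\<^bsub>kfree ds\<^esub> v \<oplus>\<^bsub>kfree ds\<^esub> a \<odot>\<^bsub>kfree ds\<^esub> (w :: nat \<Rightarrow> 'k)"
      unfolding kfree_simps by (intro allI impI restrict_ext) (simp add: distrib_left)
  qed (simp_all add: kfree_simps)
  then show ?thesis by (simp add: vectorspace_def class_field)
qed

definition ksub :: "nat list \<Rightarrow> (nat \<Rightarrow> 'k::field) set \<Rightarrow> bool" where
  "ksub ds U \<longleftrightarrow> subspace class_ring U (kfree ds)"

lemma ksubI:
  assumes "U \<subseteq> {..<length ds} \<rightarrow>\<^sub>E UNIV" "(\<lambda>t\<in>{..<length ds}. 0) \<in> U"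
    and "\<And>v w. v \<in> U \<Longrightarrow> w \<in> U \<Longrightarrow> (\<lambda>t\<in>{..<length ds}. v t + w t) \<in> U"
    and "\<And>a v. v \<in> U \<Longrightarrow> (\<lambda>t\<in>{..<length ds}. a * v t) \<in> U"
  shows "ksub ds U"
  unfolding ksub_def subspace_def submodule_def
  using assms kfree_vectorspace[of ds] by (auto simp: kfree_simps vectorspace_def)

lemma ksubD:
  assumes "ksub ds U"
  shows "U \<subseteq> {..<length ds} \<rightarrow>\<^sub>E UNIV" "(\<lambda>t\<in>{..<length ds}. 0) \<in> U"
    and "\<And>v w. v \<in> U \<Longrightarrow> w \<in> U \<Longrightarrow> (\<lambda>t\<in>{..<length ds}. v t + w t) \<in> U"
    and "\<And>a v. v \<in> U \<Longrightarrow> (\<lambda>t\<in>{..<length ds}. a * v t) \<in> U"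
  using assms unfolding ksub_def subspace_def submodule_def by (auto simp: kfree_simps)

lemma ksub_Int: "ksub ds U \<Longrightarrow> ksub ds U' \<Longrightarrow> ksub ds (U \<inter> U')"
  by (rule ksubI) (auto dest: ksubD)

lemma ksub_grade: "ksub ds (grade (kfree ds) j)"
  by (rule ksubI) (auto simp: kfree_simps)

lemma ksub_vectorspace: "ksub ds U \<Longrightarrow> vectorspace class_ring (kfree ds\<lparr>carrier := U\<rparr>)"
  unfolding ksub_def using vectorspace.subspace_is_vs[OF kfree_vectorspace] by blast

lemma kfree_grade_dim:
  "vectorspace.dim class_ring (kfree ds\<lparr>carrier := grade (kfree ds) j\<rparr> :: ('k::field, nat \<Rightarrow> 'k) graded) = card {t. t < length ds \<and> ds ! t = j}"
  "vectorspace.fin_dim class_ring (kfree ds\<lparr>carrier := grade (kfree ds) j\<rparr> :: ('k::field, nat \<Rightarrow> 'k) graded)"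
proof -
  let ?X = "{t. t < length ds \<and> ds ! t = j}"
  let ?V = "kfree ds\<lparr>carrier := grade (kfree ds) j\<rparr> :: ('k, nat \<Rightarrow> 'k) graded"
  have a: "vectorspace class_ring ?V" by (rule ksub_vectorspace[OF ksub_grade])
  have inj: "v = w" if "v \<in> carrier ?V" "w \<in> carrier ?V" "\<And>x. x \<in> ?X \<Longrightarrow> v x = w x" for v w :: "nat \<Rightarrow> 'k"
  proof (rule extensionalityI[of v "{..<length ds}"])
    show "v x = w x" if "x \<in> {..<length ds}" for x
      using \<open>v \<in> carrier ?V\<close> \<open>w \<in> carrier ?V\<close> \<open>\<And>x. x \<in> ?X \<Longrightarrow> v x = w x\<close>[of x] that
      by (cases "ds ! x = j") (auto simp: kfree_simps)
  qed (use that in \<open>auto simp: kfree_simps PiE_def\<close>)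
  let ?e = "\<lambda>x. \<lambda>t\<in>{..<length ds}. if t = x then 1 else 0 :: 'k"
  have e: "?e x \<in> carrier ?V" if "x \<in> ?X" for x using that by (auto simp: kfree_simps)
  have add: "(v \<oplus>\<^bsub>?V\<^esub> w) x = v x + w x" if "v \<in> carrier ?V" "w \<in> carrier ?V" "x \<in> ?X" for v w x
    using that by (simp add: kfree_simps)
  have smult: "(c \<odot>\<^bsub>?V\<^esub> v) x = c * v x" if "v \<in> carrier ?V" "x \<in> ?X" for c v x
    using that by (simp add: kfree_simps)
  have dual: "?e x y = (if x = y then 1 else 0)" if "x \<in> ?X" "y \<in> ?X" for x y using that by auto
  show "vectorspace.dim class_ring ?V = card ?X"
    by (rule dim_coordinates(1)[OF a, of ?X ?e "\<lambda>v. v", OF _ e add smult dual inj]) auto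
  show "vectorspace.fin_dim class_ring ?V"
    by (rule dim_coordinates(2)[OF a, of ?X ?e "\<lambda>v. v", OF _ e add smult dual inj]) auto
qed

text \<open>
  The degree \<open>j\<close> part of the quotient \<open>C / B\<close> of graded subspaces of \<open>kfree ds\<close>, as it is formed by
  \<open>graded_quot\<close>.
\<close>

definition hdim :: "nat list \<Rightarrow> (nat \<Rightarrow> 'k::field) set \<Rightarrow> (nat \<Rightarrow> 'k) set \<Rightarrow> nat \<Rightarrow> nat" where
  "hdim ds C B j = hilbert_function class_ring (graded_quot (graded_sub (kfree ds) C) B) j"

definition hspace :: "nat list \<Rightarrow> (nat \<Rightarrow> 'k::field) set \<Rightarrow> (nat \<Rightarrow> 'k) set \<Rightarrow> nat \<Rightarrow> ('k, (nat \<Rightarrow> 'k) set) graded" where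
  "hspace ds C B j = (let T = graded_quot (graded_sub (kfree ds) C) B in T\<lparr>carrier := grade T j\<rparr>)"

lemma hdim_hspace: "hdim ds C B j = vectorspace.dim class_ring (hspace ds C B j)"
  by (simp add: hdim_def hilbert_function_def hspace_def Let_def)

definition kcoset :: "nat list \<Rightarrow> (nat \<Rightarrow> 'k::field) set \<Rightarrow> (nat \<Rightarrow> 'k) \<Rightarrow> (nat \<Rightarrow> 'k) set" where
  "kcoset ds B x = (\<lambda>b. \<lambda>t\<in>{..<length ds}. b t + x t) ` B"

lemma kcoset_eq_iff:
  assumes B: "ksub ds B" and x: "x \<in> {..<length ds} \<rightarrow>\<^sub>E UNIV" and y: "y \<in> {..<length ds} \<rightarrow>\<^sub>E UNIV"
  shows "kcoset ds B x = kcoset ds B y \<longleftrightarrow> (\<lambda>t\<in>{..<length ds}. x t - y t) \<in> B"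
proof
  let ?S = "{..<length ds}"
  have *: "(\<lambda>t\<in>?S. b t - b' t) \<in> B" if "b \<in> B" "b' \<in> B" for b b'
    using ksubD(3)[OF B that(1) ksubD(4)[OF B that(2), of "-1"]] by (simp cong: restrict_cong)
  {
    assume "kcoset ds B x = kcoset ds B y"
    moreover have "(\<lambda>t\<in>?S. (\<lambda>t\<in>?S. 0) t + x t) \<in> kcoset ds B x"
      unfolding kcoset_def by (rule imageI) (rule ksubD(2)[OF B])
    ultimately obtain b where b: "b \<in> B" "(\<lambda>t\<in>?S. (\<lambda>t\<in>?S. 0) t + x t) = (\<lambda>t\<in>?S. b t + y t)"
      unfolding kcoset_def by auto
    have "x t - y t = b t" if "t \<in> ?S" for t using fun_cong[OF b(2), of t] that by simp
    then have "(\<lambda>t\<in>?S. x t - y t) = restrict b ?S" by (intro restrict_ext) auto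
    also have "restrict b ?S = b" using b(1) ksubD(1)[OF B] by (intro PiE_restrict) auto
    finally show "(\<lambda>t\<in>?S. x t - y t) \<in> B" using b(1) by simp
  }
  assume d: "(\<lambda>t\<in>?S. x t - y t) \<in> B"
  show "kcoset ds B x = kcoset ds B y"
  proof (intro equalityI subsetI)
    fix z assume "z \<in> kcoset ds B x"
    then obtain b where b: "b \<in> B" "z = (\<lambda>t\<in>?S. b t + x t)" by (auto simp: kcoset_def)
    have "z = (\<lambda>t\<in>?S. (\<lambda>t\<in>?S. b t + (\<lambda>t\<in>?S. x t - y t) t) t + y t)"
      unfolding b(2) by (intro restrict_ext) simp
    then show "z \<in> kcoset ds B y" unfolding kcoset_def using ksubD(3)[OF B b(1) d] by blast
  next
    fix z assume "z \<in> kcoset ds B y"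
    then obtain b where b: "b \<in> B" "z = (\<lambda>t\<in>?S. b t + y t)" by (auto simp: kcoset_def)
    have "z = (\<lambda>t\<in>?S. (\<lambda>t\<in>?S. b t - (\<lambda>t\<in>?S. x t - y t) t) t + x t)"
      unfolding b(2) by (intro restrict_ext) simp
    then show "z \<in> kcoset ds B x" unfolding kcoset_def using *[OF b(1) d] by blast
  qed
qed

lemma kcoset_zero:
  assumes B: "ksub ds B" shows "kcoset ds B (\<lambda>t\<in>{..<length ds}. 0) = B"
proof -
  have "(\<lambda>t\<in>{..<length ds}. b t + (\<lambda>t\<in>{..<length ds}. 0) t) = b" if "b \<in> B" for b
    using PiE_restrict[of b "{..<length ds}" "\<lambda>_. UNIV"] ksubD(1)[OF B] that by (auto cong: restrict_cong)
  then show ?thesis unfolding kcoset_def by simp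
qed

lemma kcoset_zero_iff:
  assumes B: "ksub ds B" and x: "x \<in> {..<length ds} \<rightarrow>\<^sub>E UNIV"
  shows "kcoset ds B x = B \<longleftrightarrow> x \<in> B"
proof -
  have "(\<lambda>t\<in>{..<length ds}. x t - (\<lambda>t\<in>{..<length ds}. 0) t) = x"
    using PiE_restrict[OF x] by (simp cong: restrict_cong)
  then show ?thesis using kcoset_eq_iff[OF B x, of "\<lambda>t\<in>{..<length ds}. 0"] kcoset_zero[OF B] by simp
qed

context
  fixes ds and C B :: "(nat \<Rightarrow> 'k::field) set"
  assumes C: "ksub ds C" and B: "ksub ds B" and BC: "B \<subseteq> C"
begin

abbreviation (input) "Cj j \<equiv> grade (kfree ds) j \<inter> C"

lemma hspace_simps:
  "carrier (hspace ds C B j) = kcoset ds B ` (grade (kfree ds) j \<inter> C)"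
  "\<zero>\<^bsub>hspace ds C B j\<^esub> = B"
  "x \<in> C \<Longrightarrow> y \<in> C \<Longrightarrow> kcoset ds B x \<oplus>\<^bsub>hspace ds C B j\<^esub> kcoset ds B y = kcoset ds B (x \<oplus>\<^bsub>kfree ds\<^esub> y)"
  "x \<in> C \<Longrightarrow> a \<odot>\<^bsub>hspace ds C B j\<^esub> kcoset ds B x = kcoset ds B (a \<odot>\<^bsub>kfree ds\<^esub> x)"
proof -
  let ?S = "{..<length ds}"
  have cos: "B +>\<^bsub>graded_sub (kfree ds) C\<^esub> x = kcoset ds B x" for x
    by (auto simp: a_r_coset_def r_coset_def graded_sub_def kfree_simps kcoset_def)
  show "carrier (hspace ds C B j) = kcoset ds B ` (grade (kfree ds) j \<inter> C)"
    by (simp add: hspace_def Let_def graded_quot_def cos) (simp add: graded_sub_def)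
  show "\<zero>\<^bsub>hspace ds C B j\<^esub> = B" by (simp add: hspace_def Let_def graded_quot_def)
  show "kcoset ds B x \<oplus>\<^bsub>hspace ds C B j\<^esub> kcoset ds B y = kcoset ds B (x \<oplus>\<^bsub>kfree ds\<^esub> y)"
    if "x \<in> C" "y \<in> C"
  proof -
    have "kcoset ds B x \<oplus>\<^bsub>hspace ds C B j\<^esub> kcoset ds B y =
        {\<lambda>t\<in>?S. u t + v t | u v. u \<in> kcoset ds B x \<and> v \<in> kcoset ds B y}"
      by (auto simp: hspace_def Let_def graded_quot_def set_add_def set_mult_def graded_sub_def kfree_simps)
    also have "\<dots> = kcoset ds B (x \<oplus>\<^bsub>kfree ds\<^esub> y)"
    proof (intro equalityI subsetI)
      fix z assume "z \<in> {\<lambda>t\<in>?S. u t + v t | u v. u \<in> kcoset ds B x \<and> v \<in> kcoset ds B y}"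
      then obtain b b' where b: "b \<in> B" "b' \<in> B"
        and z: "z = (\<lambda>t\<in>?S. (\<lambda>t\<in>?S. b t + x t) t + (\<lambda>t\<in>?S. b' t + y t) t)"
        by (auto simp: kcoset_def)
      have "z = (\<lambda>t\<in>?S. (\<lambda>t\<in>?S. b t + b' t) t + (x \<oplus>\<^bsub>kfree ds\<^esub> y) t)"
        unfolding z by (intro restrict_ext) (simp add: kfree_simps)
      then show "z \<in> kcoset ds B (x \<oplus>\<^bsub>kfree ds\<^esub> y)" unfolding kcoset_def using ksubD(3)[OF B b] by blast
    next
      fix z assume "z \<in> kcoset ds B (x \<oplus>\<^bsub>kfree ds\<^esub> y)"
      then obtain b where b: "b \<in> B" and z: "z = (\<lambda>t\<in>?S. b t + (x \<oplus>\<^bsub>kfree ds\<^esub> y) t)" by (auto simp: kcoset_def)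
      have "z = (\<lambda>t\<in>?S. (\<lambda>t\<in>?S. b t + x t) t + (\<lambda>t\<in>?S. (\<lambda>t\<in>?S. 0) t + y t) t)"
        unfolding z by (intro restrict_ext) (simp add: kfree_simps)
      then show "z \<in> {\<lambda>t\<in>?S. u t + v t | u v. u \<in> kcoset ds B x \<and> v \<in> kcoset ds B y}"
        unfolding kcoset_def using b ksubD(2)[OF B] by blast
    qed
    finally show ?thesis .
  qed
  show "a \<odot>\<^bsub>hspace ds C B j\<^esub> kcoset ds B x = kcoset ds B (a \<odot>\<^bsub>kfree ds\<^esub> x)" if x: "x \<in> C"
  proof -
    have "a \<odot>\<^bsub>hspace ds C B j\<^esub> kcoset ds B x = (\<Union>z\<in>kcoset ds B x. kcoset ds B (a \<odot>\<^bsub>kfree ds\<^esub> z))"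
      by (simp add: hspace_def Let_def graded_quot_def cos) (simp add: graded_sub_def)
    also have "\<dots> = (\<Union>z\<in>kcoset ds B x. kcoset ds B (a \<odot>\<^bsub>kfree ds\<^esub> x))"
    proof (rule SUP_cong[OF refl])
      fix z assume "z \<in> kcoset ds B x"
      then obtain b where b: "b \<in> B" "z = (\<lambda>t\<in>?S. b t + x t)" by (auto simp: kcoset_def)
      have "(\<lambda>t\<in>?S. (a \<odot>\<^bsub>kfree ds\<^esub> z) t - (a \<odot>\<^bsub>kfree ds\<^esub> x) t) = (\<lambda>t\<in>?S. a * b t)"
        by (intro restrict_ext) (simp add: kfree_simps b(2) algebra_simps)
      then show "kcoset ds B (a \<odot>\<^bsub>kfree ds\<^esub> z) = kcoset ds B (a \<odot>\<^bsub>kfree ds\<^esub> x)"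
        using ksubD(4)[OF B b(1), of a] by (subst kcoset_eq_iff[OF B]) (auto simp: kfree_simps)
    qed
    also have "\<dots> = kcoset ds B (a \<odot>\<^bsub>kfree ds\<^esub> x)"
      using ksubD(2)[OF B] by (auto simp: kcoset_def)
    finally show ?thesis .
  qed
qed

lemma Cj_ksub: "ksub ds (grade (kfree ds) j \<inter> C)"
  by (rule ksub_Int[OF ksub_grade C])

lemma Cj_fin: "vectorspace.fin_dim class_ring (kfree ds\<lparr>carrier := grade (kfree ds) j \<inter> C\<rparr>)"
proof -
  interpret V: vectorspace class_ring "kfree ds\<lparr>carrier := grade (kfree ds) j\<rparr> :: ('k, nat \<Rightarrow> 'k) graded"
    by (rule ksub_vectorspace[OF ksub_grade])
  have "subspace class_ring (grade (kfree ds) j \<inter> C) (kfree ds\<lparr>carrier := grade (kfree ds) j\<rparr>)"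
    using ksubD[OF Cj_ksub] V.vectorspace_axioms V.module_axioms
    by (auto simp: subspace_def submodule_def kfree_simps)
  from V.subspace_dim_le(2)[OF kfree_grade_dim(2) this] show ?thesis by simp
qed

lemma hspace_linear:
  "vectorspace class_ring (hspace ds C B j)"
  "linear_map class_ring (kfree ds\<lparr>carrier := grade (kfree ds) j \<inter> C\<rparr>) (hspace ds C B j) (kcoset ds B)"
proof -
  have *: "\<zero>\<^bsub>hspace ds C B j\<^esub> = kcoset ds B \<zero>\<^bsub>kfree ds\<lparr>carrier := grade (kfree ds) j \<inter> C\<rparr>\<^esub>"
    using kcoset_zero[OF B] by (simp add: hspace_simps kfree_simps)
  show "vectorspace class_ring (hspace ds C B j)"
    by (rule vectorspace_surjective_image(1)[where q = "kcoset ds B", OF ksub_vectorspace[OF Cj_ksub[of j]] _ _ _ *])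
       (simp_all add: hspace_simps)
  show "linear_map class_ring (kfree ds\<lparr>carrier := grade (kfree ds) j \<inter> C\<rparr>) (hspace ds C B j) (kcoset ds B)"
    by (rule vectorspace_surjective_image(2)[where q = "kcoset ds B", OF ksub_vectorspace[OF Cj_ksub[of j]] _ _ _ *])
       (simp_all add: hspace_simps)
qed

lemma hspace_fin: "vectorspace.fin_dim class_ring (hspace ds C B j)"
proof -
  interpret L: linear_map class_ring "kfree ds\<lparr>carrier := grade (kfree ds) j \<inter> C\<rparr>" "hspace ds C B j" "kcoset ds B"
    by (rule hspace_linear(2))
  show ?thesis by (rule L.rank_nullity_main(2)[OF Cj_fin]) (simp add: hspace_simps)
qed

text \<open>
  The quotient \<open>C / B\<close> is a subquotient of \<open>kfree ds\<close>, whose degree \<open>j\<close> part has as many basis vectors.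
\<close>

lemma hdim_le: "hdim ds C B j \<le> card {t. t < length ds \<and> ds ! t = j}"
proof -
  interpret V: vectorspace class_ring "kfree ds\<lparr>carrier := grade (kfree ds) j\<rparr> :: ('k, nat \<Rightarrow> 'k) graded"
    by (rule ksub_vectorspace[OF ksub_grade])
  have "subspace class_ring (grade (kfree ds) j \<inter> C) (kfree ds\<lparr>carrier := grade (kfree ds) j\<rparr>)"
    using ksubD[OF Cj_ksub] V.vectorspace_axioms V.module_axioms
    by (auto simp: subspace_def submodule_def kfree_simps)
  from V.subspace_dim_le(1)[OF kfree_grade_dim(2) this]
  have 1: "vectorspace.dim class_ring (kfree ds\<lparr>carrier := grade (kfree ds) j \<inter> C\<rparr>) \<le> card {t. t < length ds \<and> ds ! t = j}"
    by (simp add: kfree_grade_dim(1))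
  interpret L: linear_map class_ring "kfree ds\<lparr>carrier := grade (kfree ds) j \<inter> C\<rparr>" "hspace ds C B j" "kcoset ds B"
    by (rule hspace_linear(2))
  have im: "L.imT = carrier (hspace ds C B j)" by (simp add: L.im_def hspace_simps)
  have "hspace ds C B j\<lparr>carrier := L.imT\<rparr> = hspace ds C B j" unfolding im by simp
  with L.rank_nullity[OF Cj_fin] 1 show ?thesis by (simp add: hdim_hspace)
qed

end

lemma hdim_free: "hdim ds ({..<length ds} \<rightarrow>\<^sub>E UNIV) {\<lambda>t\<in>{..<length ds}. 0 :: 'k::field} j = card {t. t < length ds \<and> ds ! t = j}"
proof -
  let ?C = "{..<length ds} \<rightarrow>\<^sub>E UNIV :: (nat \<Rightarrow> 'k) set" and ?B = "{\<lambda>t\<in>{..<length ds}. 0 :: 'k}"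
  have C: "ksub ds ?C" by (rule ksubI) simp_all
  have B: "ksub ds ?B" by (rule ksubI) (simp_all cong: restrict_cong)
  have CB: "?B \<subseteq> ?C" by auto
  have CC: "grade (kfree ds) j \<inter> ?C = grade (kfree ds) j" by (auto simp: kfree_simps)
  interpret L: linear_map class_ring "kfree ds\<lparr>carrier := grade (kfree ds) j\<rparr>" "hspace ds ?C ?B j" "kcoset ds ?B"
    using hspace_linear(2)[OF C B CB, of j] unfolding CC .
  have "inj_on (kcoset ds ?B) (grade (kfree ds) j)"
  proof (rule inj_onI)
    fix x y assume xy: "x \<in> grade (kfree ds) j" "y \<in> grade (kfree ds) j" "kcoset ds ?B x = kcoset ds ?B y"
    then have P: "x \<in> ?C" "y \<in> ?C" by (auto simp: kfree_simps)
    with kcoset_eq_iff[OF B P] xy(3) have e: "(\<lambda>t\<in>{..<length ds}. x t - y t) = (\<lambda>t\<in>{..<length ds}. 0)" by blast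
    have "x t = y t" if "t < length ds" for t using fun_cong[OF e, of t] that by simp
    then show "x = y" by (intro PiE_ext[OF P]) simp
  qed
  then have "vectorspace.dim class_ring (kfree ds\<lparr>carrier := grade (kfree ds) j\<rparr> :: ('k, nat \<Rightarrow> 'k) graded) = vectorspace.dim class_ring (hspace ds ?C ?B j)"
    using L.dim_eq[OF kfree_grade_dim(2)] by (simp add: hspace_simps[OF C B CB] CC)
  then show ?thesis by (simp add: hdim_hspace kfree_grade_dim(1))
qed

text \<open>
  The map induced on \<open>C / B\<close> is linear and injective, and the target is finite dimensional.
\<close>

lemma hdim_mono:
  fixes f :: "(nat \<Rightarrow> 'k::field) \<Rightarrow> nat \<Rightarrow> 'k"
  assumes C1: "ksub ds1 C1" and B1: "ksub ds1 B1" and BC1: "B1 \<subseteq> C1"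
    and C2: "ksub ds2 C2" and B2: "ksub ds2 B2" and BC2: "B2 \<subseteq> C2"
    and add: "\<And>x y. f (x \<oplus>\<^bsub>kfree ds1\<^esub> y) = f x \<oplus>\<^bsub>kfree ds2\<^esub> f y"
    and smult: "\<And>a x. f (a \<odot>\<^bsub>kfree ds1\<^esub> x) = a \<odot>\<^bsub>kfree ds2\<^esub> f x"
    and gr: "\<And>x. x \<in> grade (kfree ds1) j \<Longrightarrow> f x \<in> grade (kfree ds2) j"
    and cyc: "\<And>x. x \<in> C1 \<Longrightarrow> f x \<in> C2" and bnd: "\<And>x. x \<in> C1 \<Longrightarrow> f x \<in> B2 \<longleftrightarrow> x \<in> B1"
  shows "hdim ds1 C1 B1 j \<le> hdim ds2 C2 B2 j"
proof -
  let ?V = "kfree ds1\<lparr>carrier := grade (kfree ds1) j \<inter> C1\<rparr>"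
  interpret L1: linear_map class_ring ?V "hspace ds1 C1 B1 j" "kcoset ds1 B1"
    by (rule hspace_linear(2)[OF C1 B1 BC1])
  interpret L2: linear_map class_ring "kfree ds2\<lparr>carrier := grade (kfree ds2) j \<inter> C2\<rparr>" "hspace ds2 C2 B2 j" "kcoset ds2 B2"
    by (rule hspace_linear(2)[OF C2 B2 BC2])
  let ?g = "\<lambda>x. kcoset ds2 B2 (f x)"
  have "?g \<in> module_hom class_ring ?V (hspace ds2 C2 B2 j)"
    unfolding module_hom_def using gr cyc
    by (auto simp: hspace_simps[OF C2 B2 BC2] add smult)
  then interpret L: linear_map class_ring ?V "hspace ds2 C2 B2 j" ?g
    by unfold_locales
  have P: "x \<in> {..<length ds1} \<rightarrow>\<^sub>E UNIV" "f x \<in> {..<length ds2} \<rightarrow>\<^sub>E UNIV" if "x \<in> C1" for x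
    using that ksubD(1)[OF C1] ksubD(1)[OF C2] cyc by auto
  have k1: "L1.kerT = {x \<in> grade (kfree ds1) j \<inter> C1. x \<in> B1}"
    unfolding L1.ker_def by (simp add: hspace_simps(2)[OF C1 B1 BC1] kcoset_zero_iff[OF B1 P(1)] cong: conj_cong)
  have k2: "L.kerT = {x \<in> grade (kfree ds1) j \<inter> C1. x \<in> B1}"
    unfolding L.ker_def by (simp add: hspace_simps(2)[OF C2 B2 BC2] kcoset_zero_iff[OF B2 P(2)] bnd cong: conj_cong)
  have im: "L1.imT = carrier (hspace ds1 C1 B1 j)" by (simp add: L1.im_def hspace_simps[OF C1 B1 BC1])
  have h1: "hspace ds1 C1 B1 j\<lparr>carrier := L1.imT\<rparr> = hspace ds1 C1 B1 j" unfolding im by simp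
  have "hdim ds1 C1 B1 j = vectorspace.dim class_ring (hspace ds2 C2 B2 j\<lparr>carrier := L.imT\<rparr>)"
    using L1.rank_nullity[OF Cj_fin[OF C1 B1 BC1]] L.rank_nullity[OF Cj_fin[OF C1 B1 BC1]]
    unfolding k1 k2 h1 hdim_hspace by simp
  also have "\<dots> \<le> hdim ds2 C2 B2 j"
    unfolding hdim_hspace
    by (rule L2.W.subspace_dim_le(1)[OF hspace_fin[OF C2 B2 BC2] L.imT_is_subspace])
  finally show ?thesis .
qed

section \<open>Algebras presented by polynomials\<close>

text \<open>
  The carrier of \<open>S^(c)\<close>, the direct sum of the pieces \<open>Hp n c d\<close>.
\<close>

definition Ap :: "nat \<Rightarrow> nat \<Rightarrow> 'k::field mpol set" where
  "Ap n c = {p. \<forall>m\<in>Poly_Mapping.keys p. Poly_Mapping.keys m \<subseteq> {..<n} \<and> c dvd mdeg m}"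

text \<open>
  The homogeneous component of degree \<open>d\<close> with respect to the grading by the pieces \<open>Hp n c d\<close>.
\<close>

definition cmp :: "nat \<Rightarrow> 'k::field mpol \<Rightarrow> int \<Rightarrow> 'k mpol" where
  "cmp c p d = (\<Sum>m\<in>{m \<in> Poly_Mapping.keys p. int (mdeg m) = d * int c}. Poly_Mapping.single m (Poly_Mapping.lookup p m))"

definition dbound :: "'k::field mpol \<Rightarrow> nat" where
  "dbound p = (\<Sum>m\<in>Poly_Mapping.keys p. mdeg m)"

lemma lookup_cmp: "Poly_Mapping.lookup (cmp c p d) m = (if int (mdeg m) = d * int c then Poly_Mapping.lookup p m else 0)"
proof -
  have "Poly_Mapping.lookup (cmp c p d) m =
      (\<Sum>m'\<in>{m \<in> Poly_Mapping.keys p. int (mdeg m) = d * int c}. if m' = m then Poly_Mapping.lookup p m' else 0)"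
    by (simp add: cmp_def lookup_sum lookup_single when_def)
  also have "\<dots> = (if m \<in> {m \<in> Poly_Mapping.keys p. int (mdeg m) = d * int c} then Poly_Mapping.lookup p m else 0)"
    by (rule sum.delta) simp
  finally show ?thesis by (auto simp: in_keys_iff)
qed

lemma cmp_add: "cmp c (p + q) d = cmp c p d + cmp c q d"
  by (rule poly_mapping_eqI) (simp add: lookup_cmp lookup_add)

lemma cmp_0 [simp]: "cmp c 0 d = 0"
  by (rule poly_mapping_eqI) (simp add: lookup_cmp)

lemma cmp_diff: "cmp c (p - q) d = cmp c p d - cmp c q d"
  by (rule poly_mapping_eqI) (simp add: lookup_cmp lookup_minus)

lemma cmp_sum: "cmp c (sum f S) d = (\<Sum>x\<in>S. cmp c (f x) d)"
  by (induction S rule: infinite_finite_induct) (auto simp: cmp_add)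

lemma cmp_in_Hp: "p \<in> Ap n c \<Longrightarrow> cmp c p d \<in> Hp n c d"
  by (auto simp: Hp_def Ap_def in_keys_iff lookup_cmp split: if_splits)

lemma cmp_Hp: assumes "c > 0" "p \<in> Hp n c e" shows "cmp c p d = (if d = e then p else 0)"
proof (rule poly_mapping_eqI)
  fix m show "Poly_Mapping.lookup (cmp c p d) m = Poly_Mapping.lookup (if d = e then p else 0) m"
    using assms by (cases "m \<in> Poly_Mapping.keys p") (auto simp: lookup_cmp Hp_def in_keys_iff)
qed

lemma Hp_Ap: "p \<in> Hp n c d \<Longrightarrow> p \<in> Ap n c"
proof -
  assume p: "p \<in> Hp n c d"
  have "c dvd mdeg m" if "m \<in> Poly_Mapping.keys p" for m
  proof -
    have "int c dvd int (mdeg m)" using p that by (simp add: Hp_def)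
    then show ?thesis by simp
  qed
  then show ?thesis using p by (simp add: Ap_def Hp_def)
qed

lemma Ap_0 [simp]: "0 \<in> Ap n c" and Ap_1 [simp]: "1 \<in> Ap n c"
  and Ap_const [simp]: "Poly_Mapping.single 0 a \<in> Ap n c"
  by (auto simp: Ap_def)

lemma Ap_add: "p \<in> Ap n c \<Longrightarrow> q \<in> Ap n c \<Longrightarrow> p + q \<in> Ap n c"
  unfolding Ap_def using Poly_Mapping.keys_add[of p q] by blast

lemma Ap_mult: "p \<in> Ap n c \<Longrightarrow> q \<in> Ap n c \<Longrightarrow> p * q \<in> Ap n c"
  unfolding Ap_def by (auto dest!: keys_mult_mon simp: mon_keys_add mdeg_add subset_iff)

lemma Ap_uminus: "p \<in> Ap n c \<Longrightarrow> - p \<in> Ap n c"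
  by (simp add: Ap_def)

lemma Ap_diff: "p \<in> Ap n c \<Longrightarrow> q \<in> Ap n c \<Longrightarrow> p - q \<in> Ap n c"
  using Ap_add[of p n c "- q"] Ap_uminus[of q n c] by simp

lemma Ap_sum: "(\<And>x. x \<in> S \<Longrightarrow> f x \<in> Ap n c) \<Longrightarrow> sum f S \<in> Ap n c"
  by (induction S rule: infinite_finite_induct) (auto intro: Ap_add)

lemma cmp_beyond:
  assumes c: "c > 0" and d: "d < 0 \<or> int (dbound p) < d" shows "cmp c p d = 0"
proof (rule poly_mapping_eqI)
  fix m
  show "Poly_Mapping.lookup (cmp c p d) m = Poly_Mapping.lookup 0 m"
  proof (cases "m \<in> Poly_Mapping.keys p \<and> int (mdeg m) = d * int c")
    case True
    have m: "mdeg m \<le> dbound p" unfolding dbound_def using True by (intro member_le_sum) auto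
    have "0 \<le> d" using True c by (metis linorder_not_le mult_less_0_iff of_nat_0_le_iff of_nat_0_less_iff)
    then have "d \<le> d * int c" using c mult_left_mono[of 1 "int c" d] by simp
    with True m d \<open>0 \<le> d\<close> show ?thesis by simp
  next
    case False
    then show ?thesis by (auto simp: lookup_cmp in_keys_iff)
  qed
qed

lemma cmp_decompose:
  assumes c: "c > 0" and p: "p \<in> Ap n c" and N: "dbound p \<le> N"
  shows "p = (\<Sum>i\<le>N. cmp c p (int i))"
proof (rule poly_mapping_eqI)
  fix m
  show "Poly_Mapping.lookup p m = Poly_Mapping.lookup (\<Sum>i\<le>N. cmp c p (int i)) m"
  proof (cases "m \<in> Poly_Mapping.keys p")
    case True
    then have "c dvd mdeg m" using p by (simp add: Ap_def)
    then obtain e where e: "mdeg m = c * e" by (elim dvdE)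
    have "mdeg m \<le> dbound p" unfolding dbound_def using True by (intro member_le_sum) auto
    moreover have "e \<le> c * e" using c by (cases c) auto
    ultimately have "e \<le> N" using N e by linarith
    have "Poly_Mapping.lookup (\<Sum>i\<le>N. cmp c p (int i)) m = (\<Sum>i\<le>N. if i = e then Poly_Mapping.lookup p m else 0)"
      unfolding lookup_sum lookup_cmp
    proof (rule sum.cong[OF refl])
      fix i
      have "int (mdeg m) = int i * int c \<longleftrightarrow> i = e"
        using c unfolding e of_nat_mult by (simp add: mult.commute) auto
      then show "(if int (mdeg m) = int i * int c then Poly_Mapping.lookup p m else 0) = (if i = e then Poly_Mapping.lookup p m else 0)"
        by simp
    qed
    then show ?thesis using \<open>e \<le> N\<close> by simp
  next
    case False
    then show ?thesis by (simp add: lookup_sum lookup_cmp in_keys_iff)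
  qed
qed

lemma cmp_mult:
  assumes c: "c > 0" and p: "p \<in> Ap n c" and b: "b \<in> Hp n c e"
  shows "cmp c (p * b) d = cmp c p (d - e) * b"
proof -
  interpret graded_pieces "Hp n c :: int \<Rightarrow> 'a mpol set" by (rule graded_pieces_Hp[OF c])
  let ?N = "dbound p"
  have "p * b = (\<Sum>i\<le>?N. cmp c p (int i) * b)"
    by (subst cmp_decompose[OF c p order_refl]) (simp add: sum_distrib_right)
  then have "cmp c (p * b) d = (\<Sum>i\<le>?N. cmp c (cmp c p (int i) * b) d)" by (simp add: cmp_sum)
  also have "\<dots> = (\<Sum>i\<le>?N. if int i = d - e then cmp c p (d - e) * b else 0)"
    by (rule sum.cong[OF refl], subst cmp_Hp[OF c Hmult[OF cmp_in_Hp[OF p] b]]) auto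
  also have "\<dots> = cmp c p (d - e) * b"
  proof (cases "0 \<le> d - e \<and> d - e \<le> int ?N")
    case True
    then have "(\<Sum>i\<le>?N. if int i = d - e then cmp c p (d - e) * b else 0) =
        (\<Sum>i\<le>?N. if i = nat (d - e) then cmp c p (d - e) * b else 0)"
      by (intro sum.cong) auto
    then show ?thesis using True by (simp add: nat_le_iff)
  next
    case False
    then have "cmp c p (d - e) = 0" by (intro cmp_beyond[OF c]) auto
    then show ?thesis by simp
  qed
  finally show ?thesis .
qed

lemma Hp_0: assumes "p \<in> Hp n c 0" shows "p = Poly_Mapping.single 0 (const_coeff p)"
proof (rule poly_mapping_eqI)
  fix m show "Poly_Mapping.lookup p m = Poly_Mapping.lookup (Poly_Mapping.single 0 (const_coeff p)) m"
  proof (cases "m = 0")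
    case False
    then have "m \<notin> Poly_Mapping.keys p" using assms by (auto simp: Hp_def mdeg_eq_0_iff)
    then show ?thesis using False by (simp add: lookup_single when_def in_keys_iff)
  qed (simp add: const_coeff_def)
qed

lemma cmp_0_const: "cmp c p 0 = Poly_Mapping.single 0 (const_coeff p)"
  by (rule poly_mapping_eqI) (auto simp: lookup_cmp const_coeff_def mdeg_eq_0_iff lookup_single when_def)

lemma const_Hp: "Poly_Mapping.single 0 a \<in> Hp n c 0"
  by (auto simp: Hp_def)

lemma graded_free_simps:
  "carrier (graded_free B ds) = {..<length ds} \<rightarrow>\<^sub>E carrier B"
  "\<zero>\<^bsub>graded_free B ds\<^esub> = (\<lambda>t\<in>{..<length ds}. \<zero>\<^bsub>B\<^esub>)"
  "v \<oplus>\<^bsub>graded_free B ds\<^esub> w = (\<lambda>t\<in>{..<length ds}. v t \<oplus>\<^bsub>B\<^esub> w t)"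
  "a \<odot>\<^bsub>graded_free B ds\<^esub> v = (\<lambda>t\<in>{..<length ds}. a \<otimes>\<^bsub>B\<^esub> v t)"
  by (simp_all add: graded_free_def)

text \<open>
  The algebra \<open>B\<close> is a graded quotient of \<open>S^(c)\<close> by the kernel of \<open>\<pi>\<close>.  Complete intersections arise for
  \<open>c = 1\<close>, Veronese subrings with \<open>\<pi>\<close> the identity; modules over \<open>B\<close> can thus be handled with
  polynomial representatives modulo \<open>ker\<close>.
\<close>

locale presented_algebra =
  fixes n c :: nat and B :: "('k::field, 'b) graded" and \<pi> :: "'k mpol \<Rightarrow> 'b"
  assumes c: "c > 0" and sga: "standard_graded_algebra class_ring B"
    and pi_carrier: "carrier B = \<pi> ` Ap n c"
    and pi_grade: "grade B i = \<pi> ` Hp n c (int i)"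
    and pi_add: "p \<in> Ap n c \<Longrightarrow> q \<in> Ap n c \<Longrightarrow> \<pi> (p + q) = \<pi> p \<oplus>\<^bsub>B\<^esub> \<pi> q"
    and pi_mult: "p \<in> Ap n c \<Longrightarrow> q \<in> Ap n c \<Longrightarrow> \<pi> (p * q) = \<pi> p \<otimes>\<^bsub>B\<^esub> \<pi> q"
    and pi_one: "\<pi> 1 = \<one>\<^bsub>B\<^esub>"
    and pi_smult: "p \<in> Ap n c \<Longrightarrow> a \<odot>\<^bsub>B\<^esub> \<pi> p = \<pi> (Poly_Mapping.single 0 a * p)"
begin

definition ker :: "int \<Rightarrow> 'k mpol set" where
  "ker d = {p \<in> Hp n c d. \<pi> p = \<zero>\<^bsub>B\<^esub>}"

sublocale graded_pieces "Hp n c :: int \<Rightarrow> 'k mpol set" by (rule graded_pieces_Hp[OF c])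

lemma cring_B: "cring B"
  using sga unfolding standard_graded_algebra_def algebra_def by blast

sublocale B: cring B by (rule cring_B)

lemma pi_closed [simp]: "p \<in> Ap n c \<Longrightarrow> \<pi> p \<in> carrier B" by (simp add: pi_carrier)

lemma pi_zero [simp]: "\<pi> 0 = \<zero>\<^bsub>B\<^esub>"
  using pi_add[of 0 0] by (metis Ap_0 B.add.r_cancel_one' add_0 pi_closed)

lemma pi_uminus: assumes p: "p \<in> Ap n c" shows "\<pi> (- p) = \<ominus>\<^bsub>B\<^esub> \<pi> p"
proof -
  have "\<pi> (- p) \<oplus>\<^bsub>B\<^esub> \<pi> p = \<zero>\<^bsub>B\<^esub>" using pi_add[of "- p" p] p by (simp add: Ap_uminus)
  then show ?thesis using p by (intro B.minus_equality[symmetric]) (auto simp: Ap_uminus)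
qed

lemma pi_eq_iff: assumes "p \<in> Ap n c" "q \<in> Ap n c" shows "\<pi> p = \<pi> q \<longleftrightarrow> \<pi> (p - q) = \<zero>\<^bsub>B\<^esub>"
proof -
  have "\<pi> (p - q) = \<pi> p \<ominus>\<^bsub>B\<^esub> \<pi> q"
    using pi_add[of p "- q"] pi_uminus[of q] assms by (simp add: Ap_uminus a_minus_def)
  then show ?thesis using assms by (simp add: B.r_right_minus_eq)
qed

lemma pi_sum: "(\<And>x. x \<in> S \<Longrightarrow> f x \<in> Ap n c) \<Longrightarrow> finite S \<Longrightarrow> \<pi> (sum f S) = (\<Oplus>\<^bsub>B\<^esub>x\<in>S. \<pi> (f x))"
proof (induction S rule: infinite_finite_induct)
  case (insert x S)
  then have "\<pi> (sum f (insert x S)) = \<pi> (f x) \<oplus>\<^bsub>B\<^esub> (\<Oplus>\<^bsub>B\<^esub>x\<in>S. \<pi> (f x))"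
    by (simp add: pi_add Ap_sum)
  also have "\<dots> = (\<Oplus>\<^bsub>B\<^esub>x\<in>insert x S. \<pi> (f x))"
    using insert by (intro B.finsum_insert[symmetric]) auto
  finally show ?case .
qed auto

lemma pi_sum_zero: "(\<And>x. x \<in> S \<Longrightarrow> f x \<in> Ap n c \<and> \<pi> (f x) = \<zero>\<^bsub>B\<^esub>) \<Longrightarrow> \<pi> (sum f S) = \<zero>\<^bsub>B\<^esub>"
  by (induction S rule: infinite_finite_induct) (auto simp: pi_add Ap_sum)

lemma decomposition_pi:
  assumes p: "p \<in> Ap n c" shows "is_decomposition B (\<pi> p) (\<lambda>i. \<pi> (cmp c p (int i)))"
  unfolding is_decomposition_def
proof (intro conjI allI)
  have A: "cmp c p d \<in> Ap n c" for d by (rule Hp_Ap[OF cmp_in_Hp[OF p]])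
  let ?S = "{i. \<pi> (cmp c p (int i)) \<noteq> \<zero>\<^bsub>B\<^esub>}"
  show "\<pi> (cmp c p (int i)) \<in> grade B i" for i
    unfolding pi_grade by (intro imageI cmp_in_Hp p)
  have S: "?S \<subseteq> {..dbound p}"
  proof
    fix i assume "i \<in> ?S"
    then have "cmp c p (int i) \<noteq> 0" by auto
    then have "\<not> int (dbound p) < int i" using cmp_beyond[OF c, of "int i" p] by blast
    then show "i \<in> {..dbound p}" by simp
  qed
  show fin: "finite ?S" by (rule finite_subset[OF S]) simp
  have "p = (\<Sum>i\<in>?S. cmp c p (int i)) + (\<Sum>i\<in>{..dbound p} - ?S. cmp c p (int i))"
    by (subst cmp_decompose[OF c p order_refl]) (simp add: sum.subset_diff[OF S] add.commute)
  then have "\<pi> p = \<pi> ((\<Sum>i\<in>?S. cmp c p (int i)) + (\<Sum>i\<in>{..dbound p} - ?S. cmp c p (int i)))" by simp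
  also have "\<dots> = \<pi> (\<Sum>i\<in>?S. cmp c p (int i)) \<oplus>\<^bsub>B\<^esub> \<pi> (\<Sum>i\<in>{..dbound p} - ?S. cmp c p (int i))"
    by (intro pi_add Ap_sum A)
  also have "\<pi> (\<Sum>i\<in>{..dbound p} - ?S. cmp c p (int i)) = \<zero>\<^bsub>B\<^esub>"
    by (rule pi_sum_zero) (use A in auto)
  also have "\<pi> (\<Sum>i\<in>?S. cmp c p (int i)) \<oplus>\<^bsub>B\<^esub> \<zero>\<^bsub>B\<^esub> = (\<Oplus>\<^bsub>B\<^esub>i\<in>?S. \<pi> (cmp c p (int i)))"
    using pi_sum[of ?S "\<lambda>i. cmp c p (int i)"] A fin by (simp add: Ap_sum flip: pi_sum)
  finally show "\<pi> p = (\<Oplus>\<^bsub>B\<^esub>i\<in>?S. \<pi> (cmp c p (int i)))" .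
qed

lemma decomposition_unique:
  assumes "x \<in> carrier B" "is_decomposition B x f" "is_decomposition B x g" shows "f = g"
  using standard_graded_algebra.decomposition[OF sga assms(1)] assms(2,3) by blast

lemma component_pi: assumes p: "p \<in> Ap n c" shows "component B (\<pi> p) i = \<pi> (cmp c p (int i))"
proof -
  have "component B (\<pi> p) = (\<lambda>i. \<pi> (cmp c p (int i)))"
    unfolding component_def
    using decomposition_pi[OF p] decomposition_unique[OF pi_closed[OF p]] by (intro the_equality) auto
  then show ?thesis by simp
qed

lemma pi_cmp_zero:
  assumes p: "p \<in> Ap n c" and z: "\<pi> p = \<zero>\<^bsub>B\<^esub>" shows "\<pi> (cmp c p d) = \<zero>\<^bsub>B\<^esub>"
proof (cases "d < 0")
  case True
  then show ?thesis using cmp_beyond[OF c, of d p] by simp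
next
  case False
  have "is_decomposition B (\<pi> 0) (\<lambda>i. \<pi> (cmp c 0 (int i)))" by (rule decomposition_pi) simp
  then have "is_decomposition B (\<pi> p) (\<lambda>i. \<zero>\<^bsub>B\<^esub>)" using z by simp
  from decomposition_unique[OF pi_closed[OF p] decomposition_pi[OF p] this]
  show ?thesis using False by (metis int_nat_eq not_less)
qed

lemma inj_const: "a \<odot>\<^bsub>B\<^esub> \<one>\<^bsub>B\<^esub> = b \<odot>\<^bsub>B\<^esub> \<one>\<^bsub>B\<^esub> \<Longrightarrow> a = b"
  using standard_graded_algebra.grade_zero[OF sga] by (auto simp: bij_betw_def inj_on_def)

lemma pi_const: "\<pi> (Poly_Mapping.single 0 a) = a \<odot>\<^bsub>B\<^esub> \<one>\<^bsub>B\<^esub>"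
  using pi_smult[of 1 a] by (simp add: pi_one)

lemma augmentation_pi: assumes p: "p \<in> Ap n c" shows "augmentation class_ring B (\<pi> p) = const_coeff p"
  unfolding augmentation_def
  using component_pi[OF p, of 0] inj_const by (intro the_equality) (auto simp: cmp_0_const pi_const)

lemma ker_ideal: "hideal ker"
  unfolding hideal_def
proof (intro conjI allI ballI)
  fix d e and x y :: "'k mpol"
  assume "x \<in> Hp n c d" "y \<in> ker e"
  then show "x * y \<in> ker (d + e)" by (auto simp: ker_def pi_mult Hp_Ap intro: Hmult)
qed (auto simp: ker_def pi_add pi_uminus Hp_Ap H0 intro: Hadd Huminus)

lemma ker_0: assumes "x \<in> ker 0" shows "x = 0"
proof -
  have x: "x = Poly_Mapping.single 0 (const_coeff x)" using assms by (intro Hp_0) (auto simp: ker_def)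
  have "const_coeff x \<odot>\<^bsub>B\<^esub> \<one>\<^bsub>B\<^esub> = \<zero>\<^bsub>B\<^esub>" using assms x by (simp add: ker_def flip: pi_const)
  also have "\<dots> = 0 \<odot>\<^bsub>B\<^esub> \<one>\<^bsub>B\<^esub>" by (simp flip: pi_const)
  finally have "const_coeff x = 0" by (rule inj_const)
  then show ?thesis using x by simp
qed

sublocale augmented_pieces "Hp n c" const_coeff ker
  by (rule augmented_pieces_Hp[OF c ker_ideal ker_0])

text \<open>
  The vector over \<open>B\<close> represented by a vector of polynomials; \<open>Av\<close> collects the possible representatives.
\<close>

definition vp :: "nat list \<Rightarrow> (nat \<Rightarrow> 'k mpol) \<Rightarrow> nat \<Rightarrow> 'b" where
  "vp ds w = (\<lambda>t\<in>{..<length ds}. \<pi> (w t))"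

definition Av :: "nat list \<Rightarrow> (nat \<Rightarrow> 'k mpol) set" where
  "Av ds = {w. \<forall>t<length ds. w t \<in> Ap n c}"

definition cmpv :: "nat list \<Rightarrow> (nat \<Rightarrow> 'k mpol) \<Rightarrow> int \<Rightarrow> nat \<Rightarrow> 'k mpol" where
  "cmpv ds w j t = cmp c (w t) (j - int (ds ! t))"

lemma vp_carrier: "w \<in> Av ds \<Longrightarrow> vp ds w \<in> carrier (graded_free B ds)"
  by (auto simp: graded_free_simps vp_def Av_def)

lemma vp_surj: assumes "v \<in> carrier (graded_free B ds)" shows "\<exists>w\<in>Av ds. v = vp ds w"
proof -
  have "\<exists>p. p \<in> Ap n c \<and> (t < length ds \<longrightarrow> \<pi> p = v t)" for t
  proof (cases "t < length ds")
    case True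
    then have "v t \<in> carrier B" using assms by (auto simp: graded_free_simps)
    then show ?thesis by (auto simp: pi_carrier)
  next
    case False
    then show ?thesis by (intro exI[of _ 0]) simp
  qed
  then obtain w where w: "\<And>t. w t \<in> Ap n c" "\<And>t. t < length ds \<Longrightarrow> \<pi> (w t) = v t" by metis
  have "v = vp ds w"
  proof (rule ext)
    fix t
    have "v \<in> extensional {..<length ds}" using assms by (simp add: graded_free_simps PiE_def)
    then show "v t = vp ds w t"
      using w(2)[of t] extensional_arb[of v "{..<length ds}" t] by (cases "t < length ds") (simp_all add: vp_def)
  qed
  then show ?thesis using w(1) by (intro bexI[of _ w]) (auto simp: Av_def)
qed

lemma vp_add: "v \<in> Av ds \<Longrightarrow> w \<in> Av ds \<Longrightarrow> vp ds v \<oplus>\<^bsub>graded_free B ds\<^esub> vp ds w = vp ds (\<lambda>t. v t + w t)"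
  unfolding graded_free_simps vp_def by (intro restrict_ext) (simp add: Av_def pi_add)

lemma vp_smult: "p \<in> Ap n c \<Longrightarrow> w \<in> Av ds \<Longrightarrow> \<pi> p \<odot>\<^bsub>graded_free B ds\<^esub> vp ds w = vp ds (\<lambda>t. p * w t)"
  unfolding graded_free_simps vp_def by (intro restrict_ext) (simp add: Av_def pi_mult)

lemma vp_eq_iff: "v \<in> Av ds \<Longrightarrow> w \<in> Av ds \<Longrightarrow> vp ds v = vp ds w \<longleftrightarrow> (\<forall>t<length ds. \<pi> (v t - w t) = \<zero>\<^bsub>B\<^esub>)"
proof -
  assume vw: "v \<in> Av ds" "w \<in> Av ds"
  have "vp ds v = vp ds w \<longleftrightarrow> (\<forall>t<length ds. \<pi> (v t) = \<pi> (w t))"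
    unfolding vp_def by (auto simp: restrict_def fun_eq_iff)
  then show ?thesis using vw pi_eq_iff by (simp add: Av_def)
qed

lemma Av_0: "(\<lambda>_. 0) \<in> Av ds"
  and Av_add: "v \<in> Av ds \<Longrightarrow> w \<in> Av ds \<Longrightarrow> (\<lambda>t. v t + w t) \<in> Av ds"
  and Av_mult: "p \<in> Ap n c \<Longrightarrow> w \<in> Av ds \<Longrightarrow> (\<lambda>t. p * w t) \<in> Av ds"
  by (auto simp: Av_def Ap_add Ap_mult)

lemma vp_zero: "\<zero>\<^bsub>graded_free B ds\<^esub> = vp ds (\<lambda>_. 0)"
  by (simp add: graded_free_simps vp_def)

lemma Av_hvec: "v \<in> hvec (Hp n c) ds j \<Longrightarrow> v \<in> Av ds"
  by (auto simp: Av_def hvec_def intro: Hp_Ap)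

lemma vp_grade: "grade (graded_free B ds) j = vp ds ` (hvec (Hp n c) ds (int j))"
proof (intro equalityI subsetI)
  fix v assume v: "v \<in> grade (graded_free B ds) j"
  have "\<exists>p. p \<in> Ap n c \<and> (t < length ds \<longrightarrow> p \<in> Hp n c (int j - int (ds ! t)) \<and> \<pi> p = v t)" for t
  proof (cases "t < length ds \<and> ds ! t \<le> j")
    case True
    then have "v t \<in> grade B (j - ds ! t)" using v by (auto simp: graded_free_def)
    then obtain p where "p \<in> Hp n c (int (j - ds ! t))" "v t = \<pi> p" unfolding pi_grade by blast
    then show ?thesis using True Hp_Ap[of p] by (intro exI[of _ p]) (auto simp: of_nat_diff)
  next
    case False
    then show ?thesis using v by (intro exI[of _ 0]) (auto simp: graded_free_def H0)
  qed
  then obtain w where w: "\<And>t. w t \<in> Ap n c" "\<And>t. t < length ds \<Longrightarrow> w t \<in> Hp n c (int j - int (ds ! t))"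
    "\<And>t. t < length ds \<Longrightarrow> \<pi> (w t) = v t" by metis
  have "v = vp ds w"
  proof (rule ext)
    fix t
    have "v \<in> extensional {..<length ds}" using v by (simp add: graded_free_def PiE_def)
    then show "v t = vp ds w t"
      using w(3)[of t] extensional_arb[of v "{..<length ds}" t] by (cases "t < length ds") (simp_all add: vp_def)
  qed
  then show "v \<in> vp ds ` (hvec (Hp n c) ds (int j))" using w by (auto simp: Av_def hvec_def)
next
  fix v assume "v \<in> vp ds ` (hvec (Hp n c) ds (int j))"
  then obtain w where w: "w \<in> hvec (Hp n c) ds (int j)" "w \<in> Av ds" and v: "v = vp ds w"
    using Av_hvec by blast
  have "if ds ! t \<le> j then v t \<in> grade B (j - ds ! t) else v t = \<zero>\<^bsub>B\<^esub>" if t: "t < length ds" for t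
  proof (cases "ds ! t \<le> j")
    case True
    have "w t \<in> Hp n c (int (j - ds ! t))" using w(1) t True by (simp add: hvec_def of_nat_diff)
    then show ?thesis using True t by (simp add: v vp_def pi_grade)
  next
    case False
    then have "w t = 0" using w(1) t by (intro Hneg[of "int j - int (ds ! t)"]) (auto simp: hvec_def)
    then show ?thesis using False t by (simp add: v vp_def)
  qed
  moreover have "v \<in> {..<length ds} \<rightarrow>\<^sub>E carrier B"
    using vp_carrier[OF w(2)] v by (simp only: graded_free_simps)
  ultimately show "v \<in> grade (graded_free B ds) j" by (simp add: graded_free_def)
qed

lemma appm_Av:
  assumes w: "w \<in> Av ds" and M: "hmat (Hp n c) ds es M" shows "appm ds M w \<in> Av es"
  unfolding Av_def appm_def
proof (intro CollectI allI impI Ap_sum Ap_mult)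
  fix u t assume "u < length es" "t \<in> {..<length ds}"
  then have "w t \<in> Ap n c" "M t u \<in> Hp n c (int (ds ! t) - int (es ! u))"
    using w M by (simp_all add: Av_def hmat_def hvec_def)
  then show "w t \<in> Ap n c" "M t u \<in> Ap n c" using Hp_Ap by blast+
qed

lemma cmpv_hvec: "w \<in> Av ds \<Longrightarrow> cmpv ds w j \<in> hvec (Hp n c) ds j"
  by (auto simp: hvec_def cmpv_def Av_def cmp_in_Hp)

text \<open>Matrices with homogeneous entries commute with taking homogeneous components.\<close>

lemma appm_cmpv:
  assumes w: "w \<in> Av ds" and M: "hmat (Hp n c) ds es M" and u: "u < length es"
  shows "appm ds M (cmpv ds w j) u = cmp c (appm ds M w u) (j - int (es ! u))"
  unfolding appm_def cmp_sum
proof (rule sum.cong[OF refl])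
  fix t assume t: "t \<in> {..<length ds}"
  then have "M t u \<in> Hp n c (int (ds ! t) - int (es ! u))" using M u by (auto simp: hmat_def hvec_def)
  from cmp_mult[OF c _ this, of "w t" "j - int (es ! u)"] w t
  show "cmpv ds w j t * M t u = cmp c (w t * M t u) (j - int (es ! u))"
    by (simp add: cmpv_def Av_def algebra_simps)
qed

lemma cmpv_sum:
  assumes w: "w \<in> Av ds"
  shows "\<exists>N. \<forall>t<length ds. w t = (\<Sum>j\<le>N. cmpv ds w (int j) t)"
proof -
  define N where "N = (\<Sum>t<length ds. dbound (w t) + ds ! t)"
  have "w t = (\<Sum>j\<le>N. cmpv ds w (int j) t)" if t: "t < length ds" for t
  proof -
    have le: "dbound (w t) + ds ! t \<le> N" unfolding N_def using t by (intro member_le_sum) auto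
    have "(\<Sum>j\<le>N. cmpv ds w (int j) t) = (\<Sum>j\<in>{ds ! t..N}. cmpv ds w (int j) t)"
    proof (rule sum.mono_neutral_right)
      show "\<forall>j\<in>{..N} - {ds ! t..N}. cmpv ds w (int j) t = 0"
        by (auto simp: cmpv_def intro!: cmp_beyond[OF c])
    qed auto
    also have "\<dots> = (\<Sum>i\<le>N - ds ! t. cmp c (w t) (int i))"
    proof (rule sum.reindex_bij_witness[of _ "\<lambda>i. i + ds ! t" "\<lambda>j. j - ds ! t"])
      fix j assume "j \<in> {ds ! t..N}"
      then show "cmp c (w t) (int (j - ds ! t)) = cmpv ds w (int j) t" by (simp add: cmpv_def of_nat_diff)
    qed (use le in auto)
    also have "\<dots> = w t" using w t le by (intro cmp_decompose[symmetric, OF c, of _ n]) (auto simp: Av_def)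
    finally show ?thesis by simp
  qed
  then show ?thesis by blast
qed

end

context presented_algebra
begin

lemma free_basis_vp: "free_basis B ds t = vp ds (\<lambda>s. if s = t then 1 else 0)"
  unfolding free_basis_def vp_def by (intro restrict_ext) (simp add: pi_one)

lemma unit_Av: "(\<lambda>s. if s = t then 1 else 0) \<in> Av ds"
  by (simp add: Av_def)

lemma vp_partial_Suc:
  assumes w: "w \<in> Av ds" and k: "k < length ds"
  shows "vp ds (\<lambda>t. if t < Suc k then w t else 0) =
    vp ds (\<lambda>t. if t < k then w t else 0) \<oplus>\<^bsub>graded_free B ds\<^esub> \<pi> (w k) \<odot>\<^bsub>graded_free B ds\<^esub> free_basis B ds k"
proof -
  have A: "w k \<in> Ap n c" "(\<lambda>t. if t < k then w t else 0) \<in> Av ds" using w k by (auto simp: Av_def)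
  have "vp ds (\<lambda>t. if t < k then w t else 0) \<oplus>\<^bsub>graded_free B ds\<^esub> \<pi> (w k) \<odot>\<^bsub>graded_free B ds\<^esub> free_basis B ds k =
      vp ds (\<lambda>t. (if t < k then w t else 0) + w k * (if t = k then 1 else 0))"
    unfolding free_basis_vp vp_smult[OF A(1) unit_Av] by (rule vp_add[OF A(2) Av_mult[OF A(1) unit_Av]])
  also have "(\<lambda>t. (if t < k then w t else 0) + w k * (if t = k then 1 else 0)) = (\<lambda>t. if t < Suc k then w t else 0)"
    by (auto simp: fun_eq_iff less_Suc_eq)
  finally show ?thesis by simp
qed

text \<open>
  A homomorphism of free modules is given by the matrix of representatives of the images of the basis.
\<close>

lemma hom_vp:
  assumes f: "f \<in> module_hom B (graded_free B ds) (graded_free B es)"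
    and M: "hmat (Hp n c) ds es M" "\<And>t. t < length ds \<Longrightarrow> f (free_basis B ds t) = vp es (M t)"
    and w: "w \<in> Av ds"
  shows "f (vp ds w) = vp es (appm ds M w)"
proof -
  have fadd: "f (x \<oplus>\<^bsub>graded_free B ds\<^esub> y) = f x \<oplus>\<^bsub>graded_free B es\<^esub> f y"
    if "x \<in> carrier (graded_free B ds)" "y \<in> carrier (graded_free B ds)" for x y by (rule module_hom_add[OF f that])
  have fsm: "f (r \<odot>\<^bsub>graded_free B ds\<^esub> x) = r \<odot>\<^bsub>graded_free B es\<^esub> f x"
    if "r \<in> carrier B" "x \<in> carrier (graded_free B ds)" for r x by (rule module_hom_smult[OF f that])
  have MA: "M t \<in> Av es" if "t < length ds" for t using M(1) that by (intro Av_hvec[of _ _ "int (ds ! t)"]) (simp add: hmat_def)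
  have wA: "w t \<in> Ap n c" if "t < length ds" for t using w that by (simp add: Av_def)
  have pA: "(\<lambda>u. \<Sum>t<k. w t * M t u) \<in> Av es" if "k \<le> length ds" for k
    unfolding Av_def using that wA MA by (auto simp: Av_def intro!: Ap_sum Ap_mult)
  have "f (vp ds (\<lambda>t. if t < k then w t else 0)) = vp es (\<lambda>u. \<Sum>t<k. w t * M t u)" if "k \<le> length ds" for k
    using that
  proof (induction k)
    case 0
    have z: "vp ds (\<lambda>_. 0) \<in> carrier (graded_free B ds)" by (rule vp_carrier[OF Av_0])
    have "f (vp ds (\<lambda>_. 0)) \<in> carrier (graded_free B es)" using module_hom_closed[OF f] z by blast
    then obtain x where x: "x \<in> Av es" "f (vp ds (\<lambda>_. 0)) = vp es x" using vp_surj by blast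
    have "vp ds (\<lambda>_. 0) = \<pi> 0 \<odot>\<^bsub>graded_free B ds\<^esub> vp ds (\<lambda>_. 0)" by (simp only: vp_smult[OF Ap_0 Av_0] mult_zero_left)
    then have "f (vp ds (\<lambda>_. 0)) = \<pi> 0 \<odot>\<^bsub>graded_free B es\<^esub> vp es x"
      using fsm[OF pi_closed[OF Ap_0] z] x(2) by simp
    also have "\<dots> = vp es (\<lambda>_. 0)" by (simp only: vp_smult[OF Ap_0 x(1)] mult_zero_left)
    finally show ?case by simp
  next
    case (Suc k)
    then have k: "k < length ds" by simp
    have b: "free_basis B ds k \<in> carrier (graded_free B ds)" unfolding free_basis_vp by (rule vp_carrier[OF unit_Av])
    have sb: "\<pi> (w k) \<odot>\<^bsub>graded_free B ds\<^esub> free_basis B ds k \<in> carrier (graded_free B ds)"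
      unfolding free_basis_vp vp_smult[OF wA[OF k] unit_Av] by (rule vp_carrier[OF Av_mult[OF wA[OF k] unit_Av]])
    have p: "vp ds (\<lambda>t. if t < k then w t else 0) \<in> carrier (graded_free B ds)"
      using wA by (intro vp_carrier) (simp add: Av_def)
    have "f (vp ds (\<lambda>t. if t < Suc k then w t else 0)) =
        vp es (\<lambda>u. \<Sum>t<k. w t * M t u) \<oplus>\<^bsub>graded_free B es\<^esub> \<pi> (w k) \<odot>\<^bsub>graded_free B es\<^esub> vp es (M k)"
      using Suc k by (simp add: vp_partial_Suc[OF w k] fadd[OF p sb] fsm[OF pi_closed[OF wA[OF k]] b] M(2))
    also have "\<dots> = vp es (\<lambda>u. (\<Sum>t<k. w t * M t u) + w k * M k u)"
      unfolding vp_smult[OF wA[OF k] MA[OF k]]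
      using k by (intro vp_add pA Av_mult wA MA) auto
    finally show ?case by simp
  qed
  from this[of "length ds"] have "f (vp ds (\<lambda>t. if t < length ds then w t else 0)) = vp es (appm ds M w)"
    by (simp add: appm_def[abs_def])
  moreover have "vp ds (\<lambda>t. if t < length ds then w t else 0) = vp ds w"
    unfolding vp_def by (intro restrict_ext) simp
  ultimately show ?thesis by simp
qed

lemma residue_simps:
  "carrier (residue_module class_ring B) = UNIV"
  "\<zero>\<^bsub>residue_module class_ring B\<^esub> = 0"
  "x \<oplus>\<^bsub>residue_module class_ring B\<^esub> y = x + y"
  "r \<odot>\<^bsub>residue_module class_ring B\<^esub> x = augmentation class_ring B r * x"
  "grade (residue_module class_ring B) i = (if i = 0 then UNIV else {0})"
  by (simp_all add: residue_module_def)

lemma residue_hom_vp: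
  assumes f: "f \<in> module_hom B (graded_free B ds) (residue_module class_ring B)" and w: "w \<in> Av ds"
  shows "f (vp ds w) = (\<Sum>t<length ds. const_coeff (w t) * f (free_basis B ds t))"
proof -
  have fadd: "f (x \<oplus>\<^bsub>graded_free B ds\<^esub> y) = f x + f y"
    if "x \<in> carrier (graded_free B ds)" "y \<in> carrier (graded_free B ds)" for x y
    using module_hom_add[OF f that] by (simp add: residue_simps)
  have fsm: "f (\<pi> r \<odot>\<^bsub>graded_free B ds\<^esub> x) = const_coeff r * f x"
    if "r \<in> Ap n c" "x \<in> carrier (graded_free B ds)" for r x
    using module_hom_smult[OF f pi_closed[OF that(1)] that(2)] that by (simp add: residue_simps augmentation_pi)
  have wA: "w t \<in> Ap n c" if "t < length ds" for t using w that by (simp add: Av_def)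
  have "f (vp ds (\<lambda>t. if t < k then w t else 0)) = (\<Sum>t<k. const_coeff (w t) * f (free_basis B ds t))" if "k \<le> length ds" for k
    using that
  proof (induction k)
    case 0
    have "vp ds (\<lambda>_. 0) = \<pi> 0 \<odot>\<^bsub>graded_free B ds\<^esub> vp ds (\<lambda>_. 0)" by (simp only: vp_smult[OF Ap_0 Av_0] mult_zero_left)
    then have "f (vp ds (\<lambda>_. 0)) = const_coeff 0 * f (vp ds (\<lambda>_. 0))"
      using fsm[OF Ap_0 vp_carrier[OF Av_0]] by simp
    then show ?case by (simp add: const_coeff_def)
  next
    case (Suc k)
    then have k: "k < length ds" by simp
    have b: "free_basis B ds k \<in> carrier (graded_free B ds)" unfolding free_basis_vp by (rule vp_carrier[OF unit_Av])
    have sb: "\<pi> (w k) \<odot>\<^bsub>graded_free B ds\<^esub> free_basis B ds k \<in> carrier (graded_free B ds)"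
      unfolding free_basis_vp vp_smult[OF wA[OF k] unit_Av] by (rule vp_carrier[OF Av_mult[OF wA[OF k] unit_Av]])
    have p: "vp ds (\<lambda>t. if t < k then w t else 0) \<in> carrier (graded_free B ds)"
      using wA by (intro vp_carrier) (simp add: Av_def)
    show ?case using Suc k by (simp add: vp_partial_Suc[OF w k] fadd[OF p sb] fsm[OF wA[OF k] b])
  qed
  from this[of "length ds"] have "f (vp ds (\<lambda>t. if t < length ds then w t else 0)) = (\<Sum>t<length ds. const_coeff (w t) * f (free_basis B ds t))"
    by simp
  moreover have "vp ds (\<lambda>t. if t < length ds then w t else 0) = vp ds w"
    unfolding vp_def by (intro restrict_ext) simp
  ultimately show ?thesis by simp
qed

lemma free_basis_grade: "t < length ds \<Longrightarrow> free_basis B ds t \<in> grade (graded_free B ds) (ds ! t)"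
  unfolding vp_grade free_basis_vp by (intro imageI) (auto simp: hvec_def Hone H0)

lemma aug_iff: assumes "x \<in> Hp n c d" shows "x \<in> aug ker d \<longleftrightarrow> const_coeff x = 0"
proof
  assume "x \<in> aug ker d"
  then show "const_coeff x = 0" using k_deg[OF assms] k_ideal by (auto simp: aug_def split: if_splits)
next
  assume z: "const_coeff x = 0"
  consider "d > 0" | "d = 0" | "d < 0" by linarith
  then show "x \<in> aug ker d"
  proof cases
    case 2
    then have "x = 0" using Hp_0[of x n c] assms z by simp
    then show ?thesis using hideal_0[OF aug_ideal[OF ker_ideal]] by simp
  next
    case 3
    then show ?thesis using Hneg[OF 3 assms] hideal_0[OF aug_ideal[OF ker_ideal]] by simp
  qed (use assms in \<open>simp add: aug_def\<close>)
qed

text \<open>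
  The matrix entries are polynomial representatives of the coordinates of the images of basis vectors; they
  can be chosen homogeneous because the differentials preserve degrees.
\<close>

lemma resolution_matrices:
  assumes res: "graded_free_resolution B (residue_module class_ring B) (F, d, \<epsilon>)"
  shows "\<exists>D. hres ker (case_nat [0] F) D \<and>
     (\<forall>i. \<forall>t<length (F (Suc i)). d i (free_basis B (F (Suc i)) t) = vp (F i) (D (Suc i) t))"
proof -
  let ?R = "residue_module class_ring B"
  have dh: "d i \<in> graded_module_hom B (graded_free B (F (Suc i))) (graded_free B (F i))" for i
    using res unfolding graded_free_resolution_def by simp
  have eh: "\<epsilon> \<in> graded_module_hom B (graded_free B (F 0)) ?R"
    and es: "\<epsilon> ` carrier (graded_free B (F 0)) = carrier ?R"
    and e0: "{v \<in> carrier (graded_free B (F 0)). \<epsilon> v = \<zero>\<^bsub>?R\<^esub>} = d 0 ` carrier (graded_free B (F 1))"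
    and ei: "{v \<in> carrier (graded_free B (F (Suc i))). d i v = \<zero>\<^bsub>graded_free B (F i)\<^esub>} =
          d (Suc i) ` carrier (graded_free B (F (Suc (Suc i))))" for i
    using res unfolding graded_free_resolution_def by simp_all
  have dh': "d i \<in> module_hom B (graded_free B (F (Suc i))) (graded_free B (F i))" for i
    using dh[of i] by (simp add: graded_module_hom_def)
  have eh': "\<epsilon> \<in> module_hom B (graded_free B (F 0)) ?R" using eh by (simp add: graded_module_hom_def)
  have ex: "\<exists>x. x \<in> hvec (Hp n c) (F i) (int (F (Suc i) ! t)) \<and> d i (free_basis B (F (Suc i)) t) = vp (F i) x"
    if t: "t < length (F (Suc i))" for i t
  proof -
    have "d i ` grade (graded_free B (F (Suc i))) (F (Suc i) ! t) \<subseteq> grade (graded_free B (F i)) (F (Suc i) ! t)"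
      using dh[of i] by (simp add: graded_module_hom_def)
    then have "d i (free_basis B (F (Suc i)) t) \<in> grade (graded_free B (F i)) (F (Suc i) ! t)"
      using free_basis_grade[OF t] by blast
    then show ?thesis unfolding vp_grade by blast
  qed
  define M where "M i t = (SOME x. x \<in> hvec (Hp n c) (F i) (int (F (Suc i) ! t)) \<and> d i (free_basis B (F (Suc i)) t) = vp (F i) x)" for i t
  have M: "M i t \<in> hvec (Hp n c) (F i) (int (F (Suc i) ! t)) \<and> d i (free_basis B (F (Suc i)) t) = vp (F i) (M i t)"
    if "t < length (F (Suc i))" for i t
    unfolding M_def by (rule someI_ex[OF ex[OF that]])
  have Mm: "hmat (Hp n c) (F (Suc i)) (F i) (M i)" for i using M by (simp add: hmat_def)
  have dvp: "d i (vp (F (Suc i)) w) = vp (F i) (appm (F (Suc i)) (M i) w)" if "w \<in> Av (F (Suc i))" for i w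
    using hom_vp[OF dh' Mm _ that] M by blast
  let ?e = "\<lambda>t. \<epsilon> (free_basis B (F 0) t)"
  have e_deg: "?e t = 0" if "t < length (F 0)" "F 0 ! t \<noteq> 0" for t
  proof -
    have "\<epsilon> ` grade (graded_free B (F 0)) (F 0 ! t) \<subseteq> grade ?R (F 0 ! t)"
      using eh by (simp add: graded_module_hom_def)
    then have "?e t \<in> grade ?R (F 0 ! t)" using free_basis_grade[OF that(1)] by blast
    then show ?thesis using that(2) by (simp add: residue_simps)
  qed
  define F' where "F' = case_nat [0] F"
  define D where "D i = (case i of 0 \<Rightarrow> (\<lambda>t u. Poly_Mapping.single 0 (?e t)) | Suc k \<Rightarrow> M k)" for i
  have F': "F' 0 = [0]" "F' (Suc i) = F i" "D 0 = (\<lambda>t u. Poly_Mapping.single 0 (?e t))" "D (Suc i) = M i" for i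
    by (simp_all add: F'_def D_def)
  have em: "hmat (Hp n c) (F 0) [0] (\<lambda>t u. Poly_Mapping.single 0 (?e t))"
    unfolding hmat_def hvec_def
  proof (intro allI impI CollectI)
    fix t u assume t: "t < length (F 0)" and "u < length [0::nat]"
    then show "Poly_Mapping.single 0 (?e t) \<in> Hp n c (int (F 0 ! t) - int ([0] ! u))"
      using e_deg[OF t] const_Hp by (cases "F 0 ! t = 0") (auto simp: H0)
  qed
  have eps: "\<epsilon> (vp (F 0) w) = const_coeff (appm (F 0) (\<lambda>t u. Poly_Mapping.single 0 (?e t)) w 0)" if "w \<in> Av (F 0)" for w
    unfolding residue_hom_vp[OF eh' that] appm_def k_sum k_mult
    by (simp add: const_coeff_def)
  have eps0: "cvec (aug ker) [0] j (appm (F 0) (\<lambda>t u. Poly_Mapping.single 0 (?e t)) w) (\<lambda>_. 0) \<longleftrightarrow> \<epsilon> (vp (F 0) w) = 0"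
    if w: "w \<in> hvec (Hp n c) (F 0) j" for w j
    using aug_iff[of "appm (F 0) (\<lambda>t u. Poly_Mapping.single 0 (?e t)) w 0" j] appm_hvec[OF em w]
    by (simp add: cvec_def hvec_def eps[OF Av_hvec[OF w]])
  have lift: "\<exists>w\<in>hvec (Hp n c) (F (Suc i)) j. cvec ker (F i) j (appm (F (Suc i)) (M i) w) v"
    if v: "v \<in> hvec (Hp n c) (F i) j" and im: "vp (F i) v \<in> d i ` carrier (graded_free B (F (Suc i)))" for i j v
  proof -
    obtain y where "y \<in> carrier (graded_free B (F (Suc i)))" "vp (F i) v = d i y" using im by blast
    then obtain w where w: "w \<in> Av (F (Suc i))" "vp (F i) v = vp (F i) (appm (F (Suc i)) (M i) w)"
      using vp_surj dvp by metis
    have "\<pi> (appm (F (Suc i)) (M i) (cmpv (F (Suc i)) w j) u - v u) = \<zero>\<^bsub>B\<^esub>" if u: "u < length (F i)" for u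
    proof -
      have vu: "v u \<in> Hp n c (j - int (F i ! u))" using v u by (simp add: hvec_def)
      have A: "appm (F (Suc i)) (M i) w u \<in> Ap n c" using appm_Av[OF w(1) Mm] u by (simp add: Av_def)
      have "\<pi> (appm (F (Suc i)) (M i) w u - v u) = \<zero>\<^bsub>B\<^esub>"
        using w(2) u vp_eq_iff[OF appm_Av[OF w(1) Mm] Av_hvec[OF v]] by metis
      from pi_cmp_zero[OF Ap_diff[OF A Hp_Ap[OF vu]] this, of "j - int (F i ! u)"]
      show ?thesis unfolding appm_cmpv[OF w(1) Mm u] by (simp add: cmp_diff cmp_Hp[OF c vu])
    qed
    moreover have "(\<lambda>u. appm (F (Suc i)) (M i) (cmpv (F (Suc i)) w j) u - v u) \<in> hvec (Hp n c) (F i) j"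
      by (rule hvec_diff[OF hideal_H appm_hvec[OF Mm cmpv_hvec[OF w(1)]] v])
    ultimately have "cvec ker (F i) j (appm (F (Suc i)) (M i) (cmpv (F (Suc i)) w j)) v"
      unfolding cvec_def by (auto simp: hvec_def ker_def)
    then show ?thesis using cmpv_hvec[OF w(1)] by blast
  qed
  have kerc: "cvec ker ds j v (\<lambda>_. 0) \<longleftrightarrow> vp ds v = \<zero>\<^bsub>graded_free B ds\<^esub>" if v: "v \<in> hvec (Hp n c) ds j" for ds j v
    unfolding vp_zero vp_eq_iff[OF Av_hvec[OF v] Av_0] using v by (auto simp: cvec_def hvec_def ker_def)
  have "hres ker F' D"
    unfolding hres_def
  proof (intro conjI allI ballI impI F')
    fix i show "hmat (Hp n c) (F' (Suc i)) (F' i) (D i)" using em Mm by (cases i) (auto simp: F')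
  next
    fix j and v :: "nat \<Rightarrow> 'k mpol" assume v: "v \<in> hvec (Hp n c) (F' 0) j"
    then have v0: "v 0 \<in> Hp n c j" by (simp add: hvec_def F')
    have "\<exists>w\<in>hvec (Hp n c) (F 0) j. appm (F 0) (\<lambda>t u. Poly_Mapping.single 0 (?e t)) w 0 - v 0 \<in> aug ker j"
    proof (cases "j = 0")
      case False
      then have "const_coeff (- v 0) = 0" using k_deg[OF Huminus[OF v0]] by simp
      then have "- v 0 \<in> aug ker j" using aug_iff[OF Huminus[OF v0]] by simp
      then show ?thesis by (intro bexI[of _ "\<lambda>_. 0"]) (simp_all add: hvec_0[OF hideal_H])
    next
      case True
      have "const_coeff (v 0) \<in> \<epsilon> ` carrier (graded_free B (F 0))" unfolding es by (simp add: residue_simps)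
      then obtain y where y: "y \<in> carrier (graded_free B (F 0))" "const_coeff (v 0) = \<epsilon> y" by blast
      obtain w where w: "w \<in> Av (F 0)" "y = vp (F 0) w" using vp_surj[OF y(1)] by blast
      let ?w = "cmpv (F 0) w 0"
      have wH: "?w \<in> hvec (Hp n c) (F 0) j" using cmpv_hvec[OF w(1)] True by simp
      let ?a = "\<lambda>w. appm (F 0) (\<lambda>t u. Poly_Mapping.single 0 (?e t)) w 0"
      have "?a ?w = cmp c (?a w) 0" using appm_cmpv[OF w(1) em, of 0 0] by simp
      then have "const_coeff (?a ?w) = \<epsilon> y" using eps[OF w(1)] w(2) by (simp add: cmp_0_const const_coeff_def)
      then have "const_coeff (?a ?w - v 0) = 0" using y(2) by (simp add: k_diff)
      moreover have "?a ?w - v 0 \<in> Hp n c j"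
        using Hdiff[OF _ v0] appm_hvec[OF em wH] by (simp add: hvec_def)
      ultimately show ?thesis using aug_iff wH by blast
    qed
    then show "\<exists>w\<in>hvec (Hp n c) (F' 1) j. cvec (rel ker 0) (F' 0) j (appm (F' 1) (D 0) w) v"
      unfolding One_nat_def F' by (simp add: cvec_def hvec_def rel_def)
  next
    fix i j and v :: "nat \<Rightarrow> 'k mpol" assume "v \<in> hvec (Hp n c) (F' (Suc (Suc i))) j"
    then have v: "v \<in> hvec (Hp n c) (F (Suc i)) j" by (simp add: F')
    have Mv: "appm (F (Suc i)) (M i) v \<in> hvec (Hp n c) (F i) j" by (rule appm_hvec[OF Mm v])
    have im: "vp (F i) (appm (F (Suc i)) (M i) v) \<in> d i ` carrier (graded_free B (F (Suc i)))"
      unfolding dvp[OF Av_hvec[OF v], symmetric] by (intro imageI vp_carrier Av_hvec[OF v])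
    show "cvec (rel ker i) (F' i) j (appm (F' (Suc i)) (D i) (appm (F' (Suc (Suc i))) (D (Suc i)) v)) (\<lambda>_. 0)"
    proof (cases i)
      case 0
      have "\<epsilon> (vp (F 0) (appm (F 1) (M 0) v)) = 0"
        using im e0 unfolding 0 by (auto simp: residue_simps)
      then show ?thesis using eps0[of "appm (F 1) (M 0) v" j] Mv 0 by (simp add: F' rel_def)
    next
      case (Suc k)
      have "d k (vp (F i) (appm (F (Suc i)) (M i) v)) = \<zero>\<^bsub>graded_free B (F k)\<^esub>"
        using im ei[of k] unfolding Suc by blast
      then have "vp (F k) (appm (F (Suc k)) (M k) (appm (F (Suc i)) (M i) v)) = \<zero>\<^bsub>graded_free B (F k)\<^esub>"
        using dvp[of "appm (F (Suc i)) (M i) v" k] Av_hvec[OF Mv] Suc by simp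
      moreover have "appm (F (Suc k)) (M k) (appm (F (Suc i)) (M i) v) \<in> hvec (Hp n c) (F k) j"
        using appm_hvec[OF Mm Mv[unfolded Suc]] Suc by simp
      ultimately show ?thesis using kerc Suc by (simp add: F' rel_def)
    qed
  next
    fix i j and v :: "nat \<Rightarrow> 'k mpol" assume v: "v \<in> hvec (Hp n c) (F' (Suc i)) j"
      and z: "cvec (rel ker i) (F' i) j (appm (F' (Suc i)) (D i) v) (\<lambda>_. 0)"
    have v': "v \<in> hvec (Hp n c) (F i) j" using v by (simp add: F')
    have vc: "vp (F i) v \<in> carrier (graded_free B (F i))" by (rule vp_carrier[OF Av_hvec[OF v']])
    have "vp (F i) v \<in> d i ` carrier (graded_free B (F (Suc i)))"
    proof (cases i)
      case 0
      have "\<epsilon> (vp (F 0) v) = 0" using eps0[of v j] v' z 0 by (simp add: F' rel_def)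
      then have "vp (F 0) v \<in> {v \<in> carrier (graded_free B (F 0)). \<epsilon> v = \<zero>\<^bsub>?R\<^esub>}" using vc 0 by (simp add: residue_simps)
      then show ?thesis unfolding e0 by (simp add: 0)
    next
      case (Suc k)
      have vk: "v \<in> hvec (Hp n c) (F (Suc k)) j" using v' Suc by simp
      have "vp (F k) (appm (F (Suc k)) (M k) v) = \<zero>\<^bsub>graded_free B (F k)\<^esub>"
        using z kerc[OF appm_hvec[OF Mm vk]] Suc by (simp add: F' rel_def)
      then have "d k (vp (F i) v) = \<zero>\<^bsub>graded_free B (F k)\<^esub>" using dvp[OF Av_hvec[OF vk]] Suc by simp
      then show ?thesis using vc ei[of k] Suc by blast
    qed
    from lift[OF v' this]
    show "\<exists>w\<in>hvec (Hp n c) (F' (Suc (Suc i))) j. cvec ker (F' (Suc i)) j (appm (F' (Suc (Suc i))) (D (Suc i)) w) v"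
      by (simp add: F')
  qed
  then show ?thesis using M F'(4) unfolding F'_def by (intro exI[of _ D]) simp
qed

end

context presented_algebra
begin

lemma zero_by_components:
  assumes x: "x \<in> Ap n c" and z: "\<And>d. cmp c x d \<in> ker d" shows "\<pi> x = \<zero>\<^bsub>B\<^esub>"
proof -
  have "\<pi> x = \<pi> (\<Sum>i\<le>dbound x. cmp c x (int i))" using cmp_decompose[OF c x order_refl] by simp
  also have "\<dots> = \<zero>\<^bsub>B\<^esub>"
    using z Hp_Ap[OF cmp_in_Hp[OF x]] by (intro pi_sum_zero) (auto simp: ker_def)
  finally show ?thesis .
qed

lemma vp_appm_cong:
  assumes w: "w \<in> Av ds" "w' \<in> Av ds" "vp ds w = vp ds w'" and M: "hmat (Hp n c) ds es M"
  shows "vp es (appm ds M w) = vp es (appm ds M w')"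
  unfolding vp_eq_iff[OF appm_Av[OF w(1) M] appm_Av[OF w(2) M]]
proof (intro allI impI)
  fix u assume u: "u < length es"
  have z: "\<pi> (w t - w' t) = \<zero>\<^bsub>B\<^esub>" "w t - w' t \<in> Ap n c" if "t < length ds" for t
    using w vp_eq_iff[OF w(1,2)] that by (auto simp: Av_def Ap_diff)
  have "appm ds M w u - appm ds M w' u = (\<Sum>t<length ds. (w t - w' t) * M t u)"
    by (simp add: appm_def left_diff_distrib sum_subtractf)
  also have "\<pi> \<dots> = \<zero>\<^bsub>B\<^esub>"
  proof (rule pi_sum_zero)
    fix t assume t: "t \<in> {..<length ds}"
    then have "M t u \<in> Hp n c (int (ds ! t) - int (es ! u))" using M u by (simp add: hmat_def hvec_def)
    then have "M t u \<in> Ap n c" by (rule Hp_Ap)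
    then show "(w t - w' t) * M t u \<in> Ap n c \<and> \<pi> ((w t - w' t) * M t u) = \<zero>\<^bsub>B\<^esub>"
      using z t by (simp add: Ap_mult pi_mult)
  qed
  finally show "\<pi> (appm ds M w u - appm ds M w' u) = \<zero>\<^bsub>B\<^esub>" .
qed

context
  fixes G E
  assumes G: "hres ker G E"
begin

lemma G_mat: "hmat (Hp n c) (G (Suc i)) (G i) (E i)" by (rule hres_mat[OF ker_ideal G])

text \<open>
  Complex and exactness conditions are stated for homogeneous vectors; here they are extended to all
  vectors by treating the homogeneous components separately.
\<close>

lemma full_comp:
  assumes w: "w \<in> Av (G (Suc (Suc i)))" and u: "u < length (G i)"
  shows "cmp c (appm (G (Suc i)) (E i) (appm (G (Suc (Suc i))) (E (Suc i)) w) u) d \<in> rel ker i d"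
proof -
  let ?es = "G (Suc i)" and ?fs = "G (Suc (Suc i))"
  let ?w = "appm ?fs (E (Suc i)) w" and ?j = "d + int (G i ! u)"
  have A: "?w \<in> Av ?es" by (rule appm_Av[OF w G_mat])
  have "cmp c (appm ?es (E i) ?w u) d = appm ?es (E i) (cmpv ?es ?w ?j) u"
    using appm_cmpv[OF A G_mat u, of ?j] by simp
  also have "\<dots> = appm ?es (E i) (appm ?fs (E (Suc i)) (cmpv ?fs w ?j)) u"
    by (rule appm_cong) (simp add: appm_cmpv[OF w G_mat], simp add: cmpv_def)
  also have "\<dots> \<in> rel ker i d"
  proof -
    have *: "\<forall>t<length (G i). appm ?es (E i) (appm ?fs (E (Suc i)) (cmpv ?fs w ?j)) t \<in> rel ker i (?j - int (G i ! t))"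
      using hres_comp[OF ker_ideal G cmpv_hvec[OF w], of ?j] by (simp add: cvec_def hvec_def)
    from *[rule_format, OF u] show ?thesis by simp
  qed
  finally show ?thesis .
qed

lemma full_exact:
  assumes w: "w \<in> Av (G (Suc i))"
    and z: "\<And>u d. u < length (G i) \<Longrightarrow> cmp c (appm (G (Suc i)) (E i) w u) d \<in> rel ker i d"
  shows "\<exists>y\<in>Av (G (Suc (Suc i))). vp (G (Suc i)) (appm (G (Suc (Suc i))) (E (Suc i)) y) = vp (G (Suc i)) w"
proof -
  let ?es = "G (Suc i)" and ?fs = "G (Suc (Suc i))"
  have "\<exists>y\<in>hvec (Hp n c) ?fs j. cvec ker ?es j (appm ?fs (E (Suc i)) y) (cmpv ?es w j)" for j
  proof (rule hres_exact[OF ker_ideal G cmpv_hvec[OF w]])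
    show "cvec (rel ker i) (G i) j (appm ?es (E i) (cmpv ?es w j)) (\<lambda>_. 0)"
      using z by (simp add: cvec_def hvec_def appm_cmpv[OF w G_mat])
  qed
  then obtain y where y: "\<And>j. y j \<in> hvec (Hp n c) ?fs j"
    "\<And>j. cvec ker ?es j (appm ?fs (E (Suc i)) (y j)) (cmpv ?es w j)" by metis
  obtain N where N: "\<And>t. t < length ?es \<Longrightarrow> w t = (\<Sum>j\<le>N. cmpv ?es w (int j) t)"
    using cmpv_sum[OF w] by blast
  let ?y = "\<lambda>t. \<Sum>j\<le>N. y (int j) t"
  have "y j \<in> Av ?fs" for j by (rule Av_hvec[OF y(1)])
  then have yA: "?y \<in> Av ?fs" unfolding Av_def by (auto intro!: Ap_sum)
  have "\<pi> (appm ?fs (E (Suc i)) ?y u - w u) = \<zero>\<^bsub>B\<^esub>" if u: "u < length ?es" for u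
  proof -
    have "appm ?fs (E (Suc i)) ?y u = (\<Sum>j\<le>N. appm ?fs (E (Suc i)) (y (int j)) u)"
      unfolding appm_def sum_distrib_right by (rule sum.swap)
    then have "appm ?fs (E (Suc i)) ?y u - w u = (\<Sum>j\<le>N. appm ?fs (E (Suc i)) (y (int j)) u - cmpv ?es w (int j) u)"
      using N[OF u] by (simp add: sum_subtractf)
    also have "\<pi> \<dots> = \<zero>\<^bsub>B\<^esub>"
    proof (rule pi_sum_zero)
      fix j
      have "appm ?fs (E (Suc i)) (y (int j)) u - cmpv ?es w (int j) u \<in> ker (int j - int (?es ! u))"
        using y(2)[of "int j"] u by (simp add: cvec_def hvec_def)
      then show "appm ?fs (E (Suc i)) (y (int j)) u - cmpv ?es w (int j) u \<in> Ap n c \<and>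
          \<pi> (appm ?fs (E (Suc i)) (y (int j)) u - cmpv ?es w (int j) u) = \<zero>\<^bsub>B\<^esub>"
        using Hp_Ap by (auto simp: ker_def)
    qed
    finally show ?thesis .
  qed
  then show ?thesis using vp_eq_iff[OF appm_Av[OF yA G_mat] w] yA by blast
qed

end

lemma const_coeff_cmp: "const_coeff (cmp c p d) = (if d = 0 then const_coeff p else 0)"
  using c by (simp add: const_coeff_def lookup_cmp)

text \<open>
  The converse of \<open>resolution_matrices\<close>: the matrices act on representatives, and the action is well
  defined because entries of \<open>ker\<close> are sent to \<open>ker\<close>.
\<close>

lemma resolution_from_matrices:
  assumes G: "hres ker G E" and G1: "G 1 = [0]" and E0: "E 0 = (\<lambda>t u. if u = t then 1 else 0)"
  shows "\<exists>d \<epsilon>. graded_free_resolution B (residue_module class_ring B) (\<lambda>i. G (Suc i), d, \<epsilon>)"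
proof -
  let ?R = "residue_module class_ring B" and ?G = "\<lambda>i. graded_free B (G i)"
  note Em = G_mat[OF G]
  define d where "d i v = vp (G (Suc i)) (appm (G (Suc (Suc i))) (E (Suc i)) (SOME w. w \<in> Av (G (Suc (Suc i))) \<and> v = vp (G (Suc (Suc i))) w))" for i v
  define \<epsilon> where "\<epsilon> v = augmentation class_ring B (v 0)" for v :: "nat \<Rightarrow> 'b"
  have dvp: "d i (vp (G (Suc (Suc i))) w) = vp (G (Suc i)) (appm (G (Suc (Suc i))) (E (Suc i)) w)"
    if w: "w \<in> Av (G (Suc (Suc i)))" for i w
  proof -
    let ?P = "\<lambda>w'. w' \<in> Av (G (Suc (Suc i))) \<and> vp (G (Suc (Suc i))) w = vp (G (Suc (Suc i))) w'"
    have P: "?P (SOME w'. ?P w')" by (rule someI[of ?P w]) (simp add: w)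
    show ?thesis unfolding d_def
      by (rule vp_appm_cong[OF w conjunct1[OF P] conjunct2[OF P] Em, symmetric])
  qed
  have evp: "\<epsilon> (vp (G 1) w) = const_coeff (w 0)" if "w \<in> Av (G 1)" for w
    using that by (simp add: \<epsilon>_def G1[unfolded One_nat_def] vp_def Av_def augmentation_pi)
  have dhom: "d i \<in> graded_module_hom B (?G (Suc (Suc i))) (?G (Suc i))" for i
    unfolding graded_module_hom_def module_hom_def
  proof (intro CollectI conjI ballI allI impI Pi_I; (elim conjE)?)
    fix v assume "v \<in> carrier (?G (Suc (Suc i)))"
    then obtain w where w: "w \<in> Av (G (Suc (Suc i)))" "v = vp (G (Suc (Suc i))) w" using vp_surj by blast
    show "d i v \<in> carrier (?G (Suc i))" unfolding w(2) dvp[OF w(1)] by (rule vp_carrier[OF appm_Av[OF w(1) Em]])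
  next
    fix v v' assume vv: "v \<in> carrier (?G (Suc (Suc i)))" "v' \<in> carrier (?G (Suc (Suc i)))"
    obtain w w' where w: "w \<in> Av (G (Suc (Suc i)))" "v = vp (G (Suc (Suc i))) w"
      "w' \<in> Av (G (Suc (Suc i)))" "v' = vp (G (Suc (Suc i))) w'" using vp_surj[OF vv(1)] vp_surj[OF vv(2)] by blast
    have "d i (v \<oplus>\<^bsub>?G (Suc (Suc i))\<^esub> v') = vp (G (Suc i)) (appm (G (Suc (Suc i))) (E (Suc i)) (\<lambda>t. w t + w' t))"
      unfolding w(2,4) vp_add[OF w(1,3)] by (rule dvp[OF Av_add[OF w(1,3)]])
    also have "appm (G (Suc (Suc i))) (E (Suc i)) (\<lambda>t. w t + w' t) =
        (\<lambda>u. appm (G (Suc (Suc i))) (E (Suc i)) w u + appm (G (Suc (Suc i))) (E (Suc i)) w' u)"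
      by (rule ext) (rule appm_add)
    finally show "d i (v \<oplus>\<^bsub>?G (Suc (Suc i))\<^esub> v') = d i v \<oplus>\<^bsub>?G (Suc i)\<^esub> d i v'"
      unfolding w(2,4) dvp[OF w(1)] dvp[OF w(3)] vp_add[OF appm_Av[OF w(1) Em] appm_Av[OF w(3) Em]] .
  next
    fix r v assume "r \<in> carrier B" "v \<in> carrier (?G (Suc (Suc i)))"
    then obtain p w where w: "p \<in> Ap n c" "r = \<pi> p" "w \<in> Av (G (Suc (Suc i)))" "v = vp (G (Suc (Suc i))) w"
      using vp_surj pi_carrier by blast
    have "d i (r \<odot>\<^bsub>?G (Suc (Suc i))\<^esub> v) = vp (G (Suc i)) (appm (G (Suc (Suc i))) (E (Suc i)) (\<lambda>t. p * w t))"
      unfolding w(2,4) vp_smult[OF w(1,3)] by (rule dvp[OF Av_mult[OF w(1,3)]])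
    then show "d i (r \<odot>\<^bsub>?G (Suc (Suc i))\<^esub> v) = r \<odot>\<^bsub>?G (Suc i)\<^esub> d i v"
      unfolding w(2,4) dvp[OF w(3)] vp_smult[OF w(1) appm_Av[OF w(3) Em]] appm_mult_fun .
  next
    fix j show "d i ` grade (?G (Suc (Suc i))) j \<subseteq> grade (?G (Suc i)) j"
    proof
      fix y assume "y \<in> d i ` grade (?G (Suc (Suc i))) j"
      then obtain w where w: "w \<in> hvec (Hp n c) (G (Suc (Suc i))) (int j)" "y = d i (vp (G (Suc (Suc i))) w)"
        unfolding vp_grade by blast
      show "y \<in> grade (?G (Suc i)) j"
        unfolding w(2) dvp[OF Av_hvec[OF w(1)]] vp_grade by (rule imageI) (rule appm_hvec[OF Em w(1)])
    qed
  qed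
  have ehom: "\<epsilon> \<in> graded_module_hom B (?G 1) ?R"
    unfolding graded_module_hom_def module_hom_def
  proof (intro CollectI conjI ballI allI impI Pi_I; (elim conjE)?)
    fix v v' assume vv: "v \<in> carrier (?G 1)" "v' \<in> carrier (?G 1)"
    obtain w w' where w: "w \<in> Av (G 1)" "v = vp (G 1) w" "w' \<in> Av (G 1)" "v' = vp (G 1) w'"
      using vp_surj[OF vv(1)] vp_surj[OF vv(2)] by blast
    show "\<epsilon> (v \<oplus>\<^bsub>?G 1\<^esub> v') = \<epsilon> v \<oplus>\<^bsub>?R\<^esub> \<epsilon> v'"
      unfolding w(2,4) vp_add[OF w(1,3)] evp[OF w(1)] evp[OF w(3)] evp[OF Av_add[OF w(1,3)]] residue_simps
      by (rule k_add)
  next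
    fix r v assume "r \<in> carrier B" "v \<in> carrier (?G 1)"
    then obtain p w where w: "p \<in> Ap n c" "r = \<pi> p" "w \<in> Av (G 1)" "v = vp (G 1) w"
      using vp_surj pi_carrier by blast
    show "\<epsilon> (r \<odot>\<^bsub>?G 1\<^esub> v) = r \<odot>\<^bsub>?R\<^esub> \<epsilon> v"
      unfolding w(2,4) vp_smult[OF w(1,3)] evp[OF w(3)] evp[OF Av_mult[OF w(1,3)]] residue_simps augmentation_pi[OF w(1)]
      by (rule k_mult)
  next
    fix j show "\<epsilon> ` grade (?G 1) j \<subseteq> grade ?R j"
    proof
      fix y assume "y \<in> \<epsilon> ` grade (?G 1) j"
      then obtain w where w: "w \<in> hvec (Hp n c) (G 1) (int j)" "y = \<epsilon> (vp (G 1) w)"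
        unfolding vp_grade by blast
      then show "y \<in> grade ?R j"
        using evp[OF Av_hvec[OF w(1)]] k_deg[of "w 0" "int j"] by (auto simp: residue_simps hvec_def G1[unfolded One_nat_def])
    qed
  qed (simp add: residue_simps)
  have lev0: "(\<forall>u<length (G 0). \<forall>d. cmp c (appm (G (Suc 0)) (E 0) w u) d \<in> rel ker 0 d) \<longleftrightarrow> const_coeff (w 0) = 0"
    if w: "w \<in> Av (G 1)" for w
  proof -
    have w0: "w 0 \<in> Ap n c" using w G1 by (simp add: Av_def)
    have "appm (G (Suc 0)) (E 0) w 0 = w 0" using G1 by (simp add: E0 appm_def)
    then have "(\<forall>u<length (G 0). \<forall>d. cmp c (appm (G (Suc 0)) (E 0) w u) d \<in> rel ker 0 d) \<longleftrightarrow>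
        (\<forall>d. const_coeff (cmp c (w 0) d) = 0)"
      using aug_iff[OF cmp_in_Hp[OF w0]] by (simp add: hres_0[OF ker_ideal G] rel_def)
    then show ?thesis by (auto simp: const_coeff_cmp)
  qed
  have image: "d i ` carrier (?G (Suc (Suc i))) = {vp (G (Suc i)) (appm (G (Suc (Suc i))) (E (Suc i)) w) | w. w \<in> Av (G (Suc (Suc i)))}" for i
  proof (intro equalityI subsetI)
    fix y assume "y \<in> d i ` carrier (?G (Suc (Suc i)))"
    then obtain w where w: "w \<in> Av (G (Suc (Suc i)))" "y = d i (vp (G (Suc (Suc i))) w)" using vp_surj by blast
    then show "y \<in> {vp (G (Suc i)) (appm (G (Suc (Suc i))) (E (Suc i)) w) | w. w \<in> Av (G (Suc (Suc i)))}"
      using dvp[OF w(1)] by blast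
  next
    fix y assume "y \<in> {vp (G (Suc i)) (appm (G (Suc (Suc i))) (E (Suc i)) w) | w. w \<in> Av (G (Suc (Suc i)))}"
    then obtain w where w: "w \<in> Av (G (Suc (Suc i)))" "y = vp (G (Suc i)) (appm (G (Suc (Suc i))) (E (Suc i)) w)" by blast
    show "y \<in> d i ` carrier (?G (Suc (Suc i)))" unfolding w(2) dvp[OF w(1), symmetric] by (intro imageI vp_carrier w(1))
  qed
  have "graded_free_resolution B ?R (\<lambda>i. G (Suc i), d, \<epsilon>)"
    unfolding graded_free_resolution_def prod.case
  proof (intro conjI allI)
    show "d i \<in> graded_module_hom B (?G (Suc (Suc i))) (?G (Suc i))" for i by (rule dhom)
    show "\<epsilon> \<in> graded_module_hom B (?G (Suc 0)) ?R" using ehom by simp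
    show "\<epsilon> ` carrier (?G (Suc 0)) = carrier ?R"
    proof (intro equalityI subsetI)
      fix a assume "a \<in> carrier ?R"
      have w: "(\<lambda>_. Poly_Mapping.single 0 a) \<in> Av (G 1)" by (simp add: Av_def)
      have "a = \<epsilon> (vp (G 1) (\<lambda>_. Poly_Mapping.single 0 a))" using evp[OF w] by (simp add: const_coeff_def)
      then show "a \<in> \<epsilon> ` carrier (?G (Suc 0))" using vp_carrier[OF w] by simp
    qed (simp add: residue_simps)
    show "{v \<in> carrier (?G (Suc 0)). \<epsilon> v = \<zero>\<^bsub>?R\<^esub>} = d 0 ` carrier (?G (Suc 1))"
    proof (intro equalityI subsetI)
      fix v assume v: "v \<in> {v \<in> carrier (?G (Suc 0)). \<epsilon> v = \<zero>\<^bsub>?R\<^esub>}"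
      then obtain w where w: "w \<in> Av (G (Suc 0))" "v = vp (G (Suc 0)) w" using vp_surj by blast
      have "const_coeff (w 0) = 0" using v w evp[of w] by (simp add: residue_simps)
      then have "\<forall>u<length (G 0). \<forall>d. cmp c (appm (G (Suc 0)) (E 0) w u) d \<in> rel ker 0 d" using lev0[of w] w by simp
      with full_exact[OF G w(1)] obtain y where "y \<in> Av (G (Suc (Suc 0)))"
        "vp (G (Suc 0)) (appm (G (Suc (Suc 0))) (E (Suc 0)) y) = v" using w(2) by blast
      then show "v \<in> d 0 ` carrier (?G (Suc 1))" unfolding One_nat_def image by blast
    next
      fix v assume "v \<in> d 0 ` carrier (?G (Suc 1))"
      then obtain w where w: "w \<in> Av (G (Suc (Suc 0)))" "v = vp (G (Suc 0)) (appm (G (Suc (Suc 0))) (E (Suc 0)) w)"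
        unfolding One_nat_def image by blast
      let ?w = "appm (G (Suc (Suc 0))) (E (Suc 0)) w"
      have A: "?w \<in> Av (G (Suc 0))" by (rule appm_Av[OF w(1) Em])
      have "const_coeff (?w 0) = 0" using lev0[of ?w] A full_comp[OF G w(1)] by simp
      then show "v \<in> {v \<in> carrier (?G (Suc 0)). \<epsilon> v = \<zero>\<^bsub>?R\<^esub>}"
        using vp_carrier[OF A] evp[of ?w] A by (simp add: w(2) residue_simps)
    qed
    show "{v \<in> carrier (?G (Suc (Suc i))). d i v = \<zero>\<^bsub>?G (Suc i)\<^esub>} = d (Suc i) ` carrier (?G (Suc (Suc (Suc i))))" for i
    proof (intro equalityI subsetI)
      fix v assume v: "v \<in> {v \<in> carrier (?G (Suc (Suc i))). d i v = \<zero>\<^bsub>?G (Suc i)\<^esub>}"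
      then obtain w where w: "w \<in> Av (G (Suc (Suc i)))" "v = vp (G (Suc (Suc i))) w" using vp_surj by blast
      let ?x = "appm (G (Suc (Suc i))) (E (Suc i)) w"
      have A: "?x \<in> Av (G (Suc i))" by (rule appm_Av[OF w(1) Em])
      have "vp (G (Suc i)) ?x = vp (G (Suc i)) (\<lambda>_. 0)" using v w dvp[OF w(1)] by (simp add: vp_zero)
      then have "\<pi> (?x u) = \<zero>\<^bsub>B\<^esub>" if "u < length (G (Suc i))" for u using vp_eq_iff[OF A Av_0] that by simp
      then have "cmp c (?x u) e \<in> rel ker (Suc i) e" if "u < length (G (Suc i))" for u e
        using pi_cmp_zero[of "?x u"] A that cmp_in_Hp[of "?x u" n c e] by (auto simp: rel_def ker_def Av_def)
      with full_exact[OF G w(1)] obtain y where "y \<in> Av (G (Suc (Suc (Suc i))))"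
        "vp (G (Suc (Suc i))) (appm (G (Suc (Suc (Suc i)))) (E (Suc (Suc i))) y) = v" using w(2) by blast
      then show "v \<in> d (Suc i) ` carrier (?G (Suc (Suc (Suc i))))" unfolding image by blast
    next
      fix v assume "v \<in> d (Suc i) ` carrier (?G (Suc (Suc (Suc i))))"
      then obtain w where w: "w \<in> Av (G (Suc (Suc (Suc i))))" "v = vp (G (Suc (Suc i))) (appm (G (Suc (Suc (Suc i)))) (E (Suc (Suc i))) w)"
        unfolding image by blast
      let ?w = "appm (G (Suc (Suc (Suc i)))) (E (Suc (Suc i))) w"
      let ?x = "appm (G (Suc (Suc i))) (E (Suc i)) ?w"
      have A: "?w \<in> Av (G (Suc (Suc i)))" by (rule appm_Av[OF w(1) Em])
      have A': "?x \<in> Av (G (Suc i))" by (rule appm_Av[OF A Em])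
      have "\<pi> (?x u - 0) = \<zero>\<^bsub>B\<^esub>" if u: "u < length (G (Suc i))" for u
        using full_comp[OF G w(1) u] A' u zero_by_components[of "?x u"] by (simp add: rel_def Av_def)
      then have "d i v = \<zero>\<^bsub>?G (Suc i)\<^esub>"
        unfolding w(2) dvp[OF A] vp_zero vp_eq_iff[OF A' Av_0] by blast
      then show "v \<in> {v \<in> carrier (?G (Suc (Suc i))). d i v = \<zero>\<^bsub>?G (Suc i)\<^esub>}"
        using vp_carrier[OF A] by (simp add: w(2))
    qed
  qed
  then show ?thesis by blast
qed

end

section \<open>Betti numbers of the residue field\<close>

context presented_algebra
begin

definition KC :: "(nat \<Rightarrow> nat list) \<Rightarrow> (nat \<Rightarrow> nat \<Rightarrow> nat \<Rightarrow> 'k mpol) \<Rightarrow> nat \<Rightarrow> (nat \<Rightarrow> 'k) set" where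
  "KC F D i = {z \<in> {..<length (F (Suc i))} \<rightarrow>\<^sub>E UNIV. kcyc F D i z}"

definition KB :: "(nat \<Rightarrow> nat list) \<Rightarrow> (nat \<Rightarrow> nat \<Rightarrow> nat \<Rightarrow> 'k mpol) \<Rightarrow> nat \<Rightarrow> (nat \<Rightarrow> 'k) set" where
  "KB F D i = {z \<in> {..<length (F (Suc i))} \<rightarrow>\<^sub>E UNIV. kbnd F D i z}"

lemma appm_restrict: "appm ds M (\<lambda>t\<in>{..<length ds}. v t) u = appm ds M v u"
  by (simp add: appm_def)

lemma appm_add_any: "appm ds M (\<lambda>t. v t + w t) u = appm ds M v u + appm ds M w u"
  by (simp add: appm_def distrib_right sum.distrib)

lemma appm_mult_any: "appm ds M (\<lambda>t. x * v t) u = x * appm ds M v u"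
  by (simp add: appm_def sum_distrib_left mult.assoc)

lemma appm_zero_any: "appm ds M (\<lambda>t. 0) u = 0"
  by (simp add: appm_def)

lemma kcyc_restrict: "kcyc F D i (\<lambda>t\<in>{..<length (F (Suc i))}. z t) \<longleftrightarrow> kcyc F D i z"
  by (simp add: kcyc_def appm_restrict)

lemma kbnd_restrict: "kbnd F D i (\<lambda>t\<in>{..<length (F (Suc i))}. z t) \<longleftrightarrow> kbnd F D i z"
  by (simp add: kbnd_def)

lemma KC_ksub: "ksub (F (Suc i)) (KC F D i)"
proof (rule ksubI)
  show "(\<lambda>t\<in>{..<length (F (Suc i))}. 0) \<in> KC F D i"
    by (simp add: KC_def kcyc_restrict) (simp add: kcyc_def appm_zero_any)
  show "(\<lambda>t\<in>{..<length (F (Suc i))}. v t + w t) \<in> KC F D i" if "v \<in> KC F D i" "w \<in> KC F D i" for v w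
    using that by (simp add: KC_def kcyc_restrict) (simp add: kcyc_def appm_add_any)
  show "(\<lambda>t\<in>{..<length (F (Suc i))}. a * v t) \<in> KC F D i" if "v \<in> KC F D i" for a v
    using that by (simp add: KC_def kcyc_restrict) (simp add: kcyc_def appm_mult_any)
qed (auto simp: KC_def)

lemma KB_ksub: "ksub (F (Suc i)) (KB F D i)"
proof (rule ksubI)
  show "(\<lambda>t\<in>{..<length (F (Suc i))}. 0) \<in> KB F D i"
    unfolding KB_def kbnd_def
    by (intro CollectI conjI exI[of _ "\<lambda>_. 0"]) (simp_all add: appm_zero_any)
  show "(\<lambda>t\<in>{..<length (F (Suc i))}. v t + w t) \<in> KB F D i" if vw: "v \<in> KB F D i" "w \<in> KB F D i" for v w
  proof -
    obtain x y where "\<forall>u<length (F (Suc i)). v u = appm (F (Suc (Suc i))) (kmat const_coeff (D (Suc i))) x u"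
      "\<forall>u<length (F (Suc i)). w u = appm (F (Suc (Suc i))) (kmat const_coeff (D (Suc i))) y u"
      using vw by (auto simp: KB_def kbnd_def)
    then show ?thesis unfolding KB_def kbnd_def
      by (intro CollectI conjI exI[of _ "\<lambda>t. x t + y t"]) (simp_all add: appm_add_any)
  qed
  show "(\<lambda>t\<in>{..<length (F (Suc i))}. a * v t) \<in> KB F D i" if v: "v \<in> KB F D i" for a v
  proof -
    obtain x where "\<forall>u<length (F (Suc i)). v u = appm (F (Suc (Suc i))) (kmat const_coeff (D (Suc i))) x u"
      using v by (auto simp: KB_def kbnd_def)
    then show ?thesis unfolding KB_def kbnd_def
      by (intro CollectI conjI exI[of _ "\<lambda>t. a * x t"]) (simp_all add: appm_mult_any)
  qed
qed (auto simp: KB_def)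

lemma kbnd_kcyc:
  assumes F: "hres ker F D" and z: "kbnd F D i z" shows "kcyc F D i z"
  unfolding kcyc_def
proof (intro allI impI)
  fix k u assume k: "i = Suc k" and u: "u < length (F i)"
  obtain y where y: "\<And>u. u < length (F (Suc i)) \<Longrightarrow> z u = appm (F (Suc (Suc i))) (kmat const_coeff (D (Suc i))) y u"
    using z by (auto simp: kbnd_def)
  have "appm (F (Suc i)) (kmat const_coeff (D i)) z u =
      appm (F (Suc i)) (kmat const_coeff (D i)) (appm (F (Suc (Suc i))) (kmat const_coeff (D (Suc i))) y) u"
    by (rule appm_cong) (rule y)
  also have "\<dots> = appm (F (Suc (Suc i))) (kmat const_coeff (\<lambda>t. appm (F (Suc i)) (D i) (D (Suc i) t))) y u"
    by (simp add: appm_comp kmat_comp)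
  also have "\<dots> = appm (F (Suc (Suc i))) (kmat const_coeff (\<lambda>t u. 0)) y u"
  proof (rule k_columns[OF _ _ _ u])
    show "cvec ker (F i) j (appm (F (Suc i)) (D i) (appm (F (Suc (Suc i))) (D (Suc i)) v)) (\<lambda>_. 0)"
      if "v \<in> hvec (Hp n c) (F (Suc (Suc i))) j" for j v
      using hres_comp[OF ker_ideal F that] k by (simp add: rel_def)
  qed (simp_all add: appm_comp)
  also have "\<dots> = 0" by (simp add: kmat_def k_zero appm_def)
  finally show "appm (F (Suc i)) (kmat const_coeff (D i)) z u = 0" .
qed

lemma KB_KC: "hres ker F D \<Longrightarrow> KB F D i \<subseteq> KC F D i"
  by (auto simp: KB_def KC_def intro: kbnd_kcyc)

text \<open>
  The dimension in degree \<open>j\<close> of the \<open>i\<close>-th homology of the complex reduced to \<open>k\<close>.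
\<close>

definition hdimP :: "(nat \<Rightarrow> nat list) \<Rightarrow> (nat \<Rightarrow> nat \<Rightarrow> nat \<Rightarrow> 'k mpol) \<Rightarrow> nat \<Rightarrow> nat \<Rightarrow> nat" where
  "hdimP F D i j = hdim (F (Suc i)) (KC F D i) (KB F D i) j"

text \<open>
  The comparison map of \<open>homology_injection\<close> is linear and preserves degrees.  Exchanging the two
  resolutions gives equality.
\<close>

lemma hdimP_le:
  assumes F: "hres ker F D" and G: "hres ker G E"
  shows "hdimP F D i j \<le> hdimP G E i j"
proof -
  obtain \<Phi> where deg: "\<And>t u. t < length (F (Suc i)) \<Longrightarrow> u < length (G (Suc i)) \<Longrightarrow> \<Phi> t u \<noteq> 0 \<Longrightarrow> F (Suc i) ! t = G (Suc i) ! u"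
    and cyc: "\<And>z. kcyc F D i z \<Longrightarrow> kcyc G E i (appm (F (Suc i)) \<Phi> z)"
    and bnd: "\<And>z. kcyc F D i z \<Longrightarrow> kbnd F D i z \<longleftrightarrow> kbnd G E i (appm (F (Suc i)) \<Phi> z)"
    using homology_injection[OF F G, of i] by blast
  let ?f = "\<lambda>z. \<lambda>u\<in>{..<length (G (Suc i))}. appm (F (Suc i)) \<Phi> z u"
  show ?thesis
    unfolding hdimP_def
  proof (rule hdim_mono[where f = ?f])
    show "?f (x \<oplus>\<^bsub>kfree (F (Suc i))\<^esub> y) = ?f x \<oplus>\<^bsub>kfree (G (Suc i))\<^esub> ?f y" for x y
      unfolding kfree_simps by (intro restrict_ext) (simp add: appm_restrict appm_add_any)
    show "?f (a \<odot>\<^bsub>kfree (F (Suc i))\<^esub> x) = a \<odot>\<^bsub>kfree (G (Suc i))\<^esub> ?f x" for a x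
      unfolding kfree_simps by (intro restrict_ext) (simp add: appm_restrict appm_mult_any)
    show "?f x \<in> grade (kfree (G (Suc i))) j" if x: "x \<in> grade (kfree (F (Suc i))) j" for x
    proof -
      have "appm (F (Suc i)) \<Phi> x u = 0" if u: "u < length (G (Suc i))" "G (Suc i) ! u \<noteq> j" for u
        unfolding appm_def
      proof (rule sum.neutral, rule ballI)
        fix t assume "t \<in> {..<length (F (Suc i))}"
        then show "x t * \<Phi> t u = 0" using deg[of t u] x u by (cases "\<Phi> t u = 0") (auto simp: kfree_simps)
      qed
      then show ?thesis by (simp add: kfree_simps)
    qed
    show "?f x \<in> KC G E i" if "x \<in> KC F D i" for x
      using that cyc[of x] by (simp add: KC_def kcyc_restrict)
    show "?f x \<in> KB G E i \<longleftrightarrow> x \<in> KB F D i" if "x \<in> KC F D i" for x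
      using that bnd[of x] by (simp add: KC_def KB_def kbnd_restrict)
  qed (rule KC_ksub KB_ksub KB_KC[OF F] KB_KC[OF G])+
qed

lemma hdimP_count: "hres ker F D \<Longrightarrow> hdimP F D i j \<le> card {t. t < length (F (Suc i)) \<and> F (Suc i) ! t = j}"
  unfolding hdimP_def by (rule hdim_le[OF KC_ksub KB_ksub KB_KC])

text \<open>
  In a minimal resolution the reduced matrices vanish, so that every basis element contributes to
  homology.
\<close>

lemma hdimP_minimal:
  assumes "\<And>k t u. t < length (F (Suc (Suc k))) \<Longrightarrow> u < length (F (Suc k)) \<Longrightarrow> const_coeff (D (Suc k) t u) = 0"
  shows "hdimP F D i j = card {t. t < length (F (Suc i)) \<and> F (Suc i) ! t = j}"
proof -
  have z: "appm (F (Suc (Suc k))) (kmat const_coeff (D (Suc k))) y u = 0" if "u < length (F (Suc k))" for k y u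
    using assms that by (simp add: appm_def kmat_def)
  have "KC F D i = {..<length (F (Suc i))} \<rightarrow>\<^sub>E UNIV" using z by (auto simp: KC_def kcyc_def)
  moreover have "KB F D i = {\<lambda>t\<in>{..<length (F (Suc i))}. 0}"
  proof (intro equalityI subsetI)
    fix x assume "x \<in> KB F D i"
    then have x: "x \<in> {..<length (F (Suc i))} \<rightarrow>\<^sub>E UNIV" "\<And>u. u < length (F (Suc i)) \<Longrightarrow> x u = 0"
      using z by (auto simp: KB_def kbnd_def)
    have "x = restrict x {..<length (F (Suc i))}" using PiE_restrict[OF x(1)] by simp
    also have "\<dots> = (\<lambda>t\<in>{..<length (F (Suc i))}. 0)" by (intro restrict_ext) (use x(2) in simp)
    finally show "x \<in> {\<lambda>t\<in>{..<length (F (Suc i))}. 0}" by simp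
  qed (use ksubD(2)[OF KB_ksub] in blast)
  ultimately show ?thesis unfolding hdimP_def by (simp only: hdim_free)
qed

text \<open>
  The matrices give some resolution of \<open>k\<close>, so that the choice made in the definition of Tor returns one; its
  own matrices, from \<open>resolution_matrices\<close>, have the same homology as the given ones by \<open>hdimP_le\<close>.
\<close>

theorem betti_residue_eq:
  assumes G: "hres ker G E" and G1: "G 1 = [0]" and E0: "E 0 = (\<lambda>t u. if u = t then 1 else 0)"
  shows "betti class_ring B (residue_module class_ring B) i j = hdimP G E i j"
proof -
  let ?R = "residue_module class_ring B"
  obtain F d \<epsilon> where r: "(SOME r. graded_free_resolution B ?R r) = (F, d, \<epsilon>)" by (metis prod_cases3)
  have "\<exists>r. graded_free_resolution B ?R r" using resolution_from_matrices[OF G G1 E0] by blast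
  from someI_ex[OF this] have "graded_free_resolution B ?R (F, d, \<epsilon>)" unfolding r .
  from resolution_matrices[OF this] obtain D where D: "hres ker (case_nat [0] F) D"
    and dD: "\<And>i t. t < length (F (Suc i)) \<Longrightarrow> d i (free_basis B (F (Suc i)) t) = vp (F i) (D (Suc i) t)" by blast
  define F' where "F' = case_nat [0] F"
  have F': "hres ker F' D" "F' (Suc i) = F i" for i using D by (simp_all add: F'_def)
  have DA: "D (Suc i) t u \<in> Ap n c" if "t < length (F (Suc i))" "u < length (F i)" for i t u
    using hres_mat[OF ker_ideal F'(1), of "Suc i"] that Hp_Ap unfolding hmat_def hvec_def F'(2) by blast
  have tm: "tensor_map class_ring B (F (Suc i)) (F i) (d i) v =
      (\<lambda>u\<in>{..<length (F i)}. appm (F (Suc i)) (kmat const_coeff (D (Suc i))) v u)" for i v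
    unfolding tensor_map_def
  proof (rule restrict_ext)
    fix u assume u: "u \<in> {..<length (F i)}"
    have "augmentation class_ring B (d i (free_basis B (F (Suc i)) t) u) = const_coeff (D (Suc i) t u)"
      if t: "t < length (F (Suc i))" for t
      using u t by (simp add: dD vp_def augmentation_pi DA)
    then show "(\<Oplus>\<^bsub>class_ring\<^esub>t\<in>{..<length (F (Suc i))}. augmentation class_ring B (d i (free_basis B (F (Suc i)) t) u) \<otimes>\<^bsub>class_ring\<^esub> v t) =
        appm (F (Suc i)) (kmat const_coeff (D (Suc i))) v u"
      by (auto simp: class_ring_simps appm_def kmat_def mult.commute intro!: sum.cong)
  qed
  have zero_iff: "(\<lambda>u\<in>{..<q}. x u) = (\<lambda>u\<in>{..<q}. 0) \<longleftrightarrow> (\<forall>u<q. x u = 0)" for q and x :: "nat \<Rightarrow> 'k"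
    by (auto simp: fun_eq_iff restrict_def)
  have cyc: "tor_cycles class_ring B F d i = KC F' D i"
  proof (cases i)
    case 0
    then show ?thesis by (simp add: tor_cycles_def KC_def kcyc_def kfree_simps F')
  next
    case (Suc m)
    then show ?thesis
      by (simp add: tor_cycles_def KC_def kcyc_def kfree_simps F' tm zero_iff)
  qed
  have bnd: "tor_boundaries class_ring B F d i = KB F' D i"
  proof (intro equalityI subsetI)
    fix z assume "z \<in> tor_boundaries class_ring B F d i"
    then obtain y where "z = (\<lambda>u\<in>{..<length (F i)}. appm (F (Suc i)) (kmat const_coeff (D (Suc i))) y u)"
      by (auto simp: tor_boundaries_def tm)
    then show "z \<in> KB F' D i" by (auto simp: KB_def kbnd_def F')
  next
    fix z assume "z \<in> KB F' D i"
    then obtain y where z: "z \<in> {..<length (F i)} \<rightarrow>\<^sub>E UNIV"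
      "\<forall>u<length (F i). z u = appm (F (Suc i)) (kmat const_coeff (D (Suc i))) y u"
      by (auto simp: KB_def kbnd_def F')
    let ?y = "\<lambda>t\<in>{..<length (F (Suc i))}. y t"
    have "z = restrict z {..<length (F i)}" using PiE_restrict[OF z(1)] by simp
    also have "\<dots> = tensor_map class_ring B (F (Suc i)) (F i) (d i) ?y"
      unfolding tm by (intro restrict_ext) (simp add: z(2) appm_restrict)
    finally have e: "z = tensor_map class_ring B (F (Suc i)) (F i) (d i) ?y" .
    have "?y \<in> carrier (kfree (F (Suc i)))" by (simp add: kfree_simps)
    then show "z \<in> tor_boundaries class_ring B F d i"
      unfolding tor_boundaries_def by (subst e) (rule imageI)
  qed
  \<comment> \<open>The resolution chosen in the definition of Tor is compared with the given one.\<close>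
  have "betti class_ring B ?R i j = hdimP F' D i j"
    unfolding betti_def Tor_def r prod.case hdimP_def hdim_def F'(2) cyc bnd ..
  also have "\<dots> = hdimP G E i j" using hdimP_le[OF F'(1) G] hdimP_le[OF G F'(1)] by (rule antisym)
  finally show ?thesis .
qed

end

section \<open>Polynomial rings and Veronese subrings\<close>

lemma poly_ring_simps:
  "carrier (poly_ring n :: ('k::field, 'k mpol) graded) = Ap n 1"
  "x \<otimes>\<^bsub>poly_ring n :: ('k, 'k mpol) graded\<^esub> y = x * y"
  "\<one>\<^bsub>poly_ring n :: ('k, 'k mpol) graded\<^esub> = 1"
  "\<zero>\<^bsub>poly_ring n :: ('k, 'k mpol) graded\<^esub> = 0"
  "x \<oplus>\<^bsub>poly_ring n :: ('k, 'k mpol) graded\<^esub> y = x + y"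
  "a \<odot>\<^bsub>poly_ring n :: ('k, 'k mpol) graded\<^esub> x = Poly_Mapping.single 0 a * x"
  "grade (poly_ring n :: ('k, 'k mpol) graded) i = Hp n 1 (int i)"
proof -
  have "int (mdeg u) = int i \<longleftrightarrow> mdeg u = i" for u :: mon by (rule of_nat_eq_iff)
  then show "grade (poly_ring n :: ('k, 'k mpol) graded) i = Hp n 1 (int i)"
    unfolding poly_ring_def Hp_def by (simp add: mdeg_def del: of_nat_sum)
qed (auto simp: poly_ring_def Ap_def)

lemma veronese_simps0:
  "x \<otimes>\<^bsub>veronese (poly_ring n :: ('k::field, 'k mpol) graded) c\<^esub> y = x * y"
  "\<one>\<^bsub>veronese (poly_ring n :: ('k, 'k mpol) graded) c\<^esub> = 1"
  "\<zero>\<^bsub>veronese (poly_ring n :: ('k, 'k mpol) graded) c\<^esub> = 0"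
  "x \<oplus>\<^bsub>veronese (poly_ring n :: ('k, 'k mpol) graded) c\<^esub> y = x + y"
  "a \<odot>\<^bsub>veronese (poly_ring n :: ('k, 'k mpol) graded) c\<^esub> x = Poly_Mapping.single 0 a * x"
  by (simp_all add: veronese_def poly_ring_simps)

lemma veronese_grade: "grade (veronese (poly_ring n :: ('k::field, 'k mpol) graded) c) i = Hp n c (int i)"
  by (auto simp: veronese_def poly_ring_simps Hp_def simp flip: of_nat_mult)

lemma subring_cring:
  fixes R :: "('k::field mpol, 'm) ring_scheme"
  assumes R: "carrier R = Ap n c" "\<And>x y. x \<otimes>\<^bsub>R\<^esub> y = x * y" "\<one>\<^bsub>R\<^esub> = 1" "\<zero>\<^bsub>R\<^esub> = 0" "\<And>x y. x \<oplus>\<^bsub>R\<^esub> y = x + y"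
  shows "cring R"
proof (intro cringI abelian_groupI comm_monoidI)
  show "\<exists>y\<in>carrier R. y \<oplus>\<^bsub>R\<^esub> x = \<zero>\<^bsub>R\<^esub>" if "x \<in> carrier R" for x
    using that by (intro bexI[of _ "- x"]) (simp_all add: R Ap_uminus)
qed (simp_all add: R Ap_add Ap_mult algebra_simps)

lemma subring_idealD:
  fixes R :: "('k::field mpol, 'm) ring_scheme"
  assumes R: "carrier R = Ap n c" "\<And>x y. x \<otimes>\<^bsub>R\<^esub> y = x * y" "\<one>\<^bsub>R\<^esub> = 1" "\<zero>\<^bsub>R\<^esub> = 0" "\<And>x y. x \<oplus>\<^bsub>R\<^esub> y = x + y"
    and N: "ideal N R"
  shows "N \<subseteq> Ap n c" "0 \<in> N" "\<And>x y. x \<in> N \<Longrightarrow> y \<in> N \<Longrightarrow> x + y \<in> N" "\<And>x y. x \<in> Ap n c \<Longrightarrow> y \<in> N \<Longrightarrow> x * y \<in> N"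
    "\<And>x. x \<in> N \<Longrightarrow> - x \<in> N"
proof -
  interpret cring R by (rule subring_cring[OF R])
  interpret N: ideal N R by (rule N)
  show "N \<subseteq> Ap n c" using N.a_subset by (simp add: R)
  show "0 \<in> N" by (rule N.zero_closed[unfolded R])
  show "x + y \<in> N" if "x \<in> N" "y \<in> N" for x y by (rule N.a_closed[OF that, unfolded R])
  show mult: "x * y \<in> N" if "x \<in> Ap n c" "y \<in> N" for x y
    by (rule N.I_l_closed[of y x, unfolded R, OF that(2,1)])
  show "- x \<in> N" if "x \<in> N" for x using mult[of "-1" x] that Ap_uminus[of 1 n c] by simp
qed

lemma subring_idealI:
  fixes R :: "('k::field mpol, 'm) ring_scheme"
  assumes R: "carrier R = Ap n c" "\<And>x y. x \<otimes>\<^bsub>R\<^esub> y = x * y" "\<one>\<^bsub>R\<^esub> = 1" "\<zero>\<^bsub>R\<^esub> = 0" "\<And>x y. x \<oplus>\<^bsub>R\<^esub> y = x + y"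
    and N: "N \<subseteq> Ap n c" "0 \<in> N" "\<And>x y. x \<in> N \<Longrightarrow> y \<in> N \<Longrightarrow> x + y \<in> N" "\<And>x y. x \<in> Ap n c \<Longrightarrow> y \<in> N \<Longrightarrow> x * y \<in> N"
  shows "ideal N R"
proof -
  interpret cring R by (rule subring_cring[OF R])
  have uminus: "- x \<in> N" if "x \<in> N" for x using N(4)[of "-1" x] that Ap_uminus[of 1 n c] by simp
  show ?thesis
  proof (rule idealI)
    show "ring R" by (rule ring_axioms)
    show "subgroup N (add_monoid R)"
    proof (rule add.subgroupI)
      fix x assume x: "x \<in> N"
      have "\<ominus>\<^bsub>R\<^esub> x = - x"
        using x N(1) by (intro minus_equality) (auto simp: R Ap_uminus)
      then show "\<ominus>\<^bsub>R\<^esub> x \<in> N" using uminus[OF x] by simp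
    qed (use N in \<open>auto simp: R\<close>)
    show "x \<otimes>\<^bsub>R\<^esub> a \<in> N" "a \<otimes>\<^bsub>R\<^esub> x \<in> N" if "a \<in> N" "x \<in> carrier R" for a x
      using N(4)[of x a] that by (simp_all add: R mult.commute)
  qed
qed

lemma poly_ring_cring: "cring (poly_ring n :: ('k::field, 'k mpol) graded)"
  by (rule subring_cring[of _ n 1]) (simp_all add: poly_ring_simps)

lemma poly_ring_finsum:
  assumes "\<And>x. x \<in> S \<Longrightarrow> f x \<in> Ap n 1" "finite S"
  shows "(\<Oplus>\<^bsub>poly_ring n :: ('k::field, 'k mpol) graded\<^esub>x\<in>S. f x) = (\<Sum>x\<in>S. f x)"
proof -
  interpret cring "poly_ring n :: ('k, 'k mpol) graded" by (rule poly_ring_cring)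
  show ?thesis using assms(2,1)
  proof (induction S)
    case (insert x S)
    then have "(\<Oplus>\<^bsub>poly_ring n :: ('k, 'k mpol) graded\<^esub>x\<in>insert x S. f x) = f x \<oplus>\<^bsub>poly_ring n :: ('k, 'k mpol) graded\<^esub> (\<Oplus>\<^bsub>poly_ring n :: ('k, 'k mpol) graded\<^esub>x\<in>S. f x)"
      by (intro finsum_insert) (auto simp: poly_ring_simps)
    then show ?case using insert by (simp add: poly_ring_simps)
  qed (simp add: poly_ring_simps)
qed

lemma poly_ring_component:
  fixes x :: "'k::field mpol"
  assumes x: "x \<in> Ap n 1"
  shows "component (poly_ring n :: ('k, 'k mpol) graded) x i = cmp 1 x (int i)"
proof -
  let ?P = "poly_ring n :: ('k, 'k mpol) graded"
  have H: "f i \<in> Ap n 1" if "\<forall>i. f i \<in> grade ?P i" for f i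
    using that Hp_Ap[of "f i" n 1 "int i"] by (simp add: poly_ring_simps)
  have uniq: "f = (\<lambda>i. cmp 1 x (int i))" if f: "is_decomposition ?P x f" for f
  proof
    fix j
    have fi: "\<forall>i. f i \<in> grade ?P i" and fin: "finite {i. f i \<noteq> 0}" and xs: "x = (\<Sum>i\<in>{i. f i \<noteq> 0}. f i)"
      using f poly_ring_finsum[of "{i. f i \<noteq> 0}" f n] H[of f] unfolding is_decomposition_def by (simp_all add: poly_ring_simps)
    have "cmp 1 x (int j) = (\<Sum>i\<in>{i. f i \<noteq> 0}. cmp 1 (f i) (int j))" by (subst xs) (rule cmp_sum)
    also have "\<dots> = (\<Sum>i\<in>{i. f i \<noteq> 0}. if i = j then f j else 0)"
    proof (rule sum.cong[OF refl])
      fix i show "cmp 1 (f i) (int j) = (if i = j then f j else 0)"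
        using cmp_Hp[of 1 "f i" n "int i" "int j"] fi by (auto simp: poly_ring_simps)
    qed
    also have "\<dots> = f j" using fin by simp
    finally show "f j = cmp 1 x (int j)" by simp
  qed
  have ex: "is_decomposition ?P x (\<lambda>i. cmp 1 x (int i))"
  proof -
    let ?S = "{i. cmp 1 x (int i) \<noteq> 0}"
    have S: "?S \<subseteq> {..dbound x}"
    proof
      fix i assume "i \<in> ?S"
      then have "\<not> int (dbound x) < int i" using cmp_beyond[of 1 "int i" x] by auto
      then show "i \<in> {..dbound x}" by simp
    qed
    have fin: "finite ?S" by (rule finite_subset[OF S]) simp
    have "x = (\<Sum>i\<le>dbound x. cmp 1 x (int i))" by (rule cmp_decompose[OF _ x]) auto
    also have "\<dots> = (\<Sum>i\<in>?S. cmp 1 x (int i))" using S by (intro sum.mono_neutral_right) auto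
    finally have "x = (\<Sum>i\<in>?S. cmp 1 x (int i))" .
    from trans[OF this poly_ring_finsum[OF Hp_Ap[OF cmp_in_Hp[OF x]] fin, of "\<lambda>i. int i", symmetric]]
    have "x = (\<Oplus>\<^bsub>?P\<^esub>i\<in>?S. cmp 1 x (int i))" .
    then show ?thesis unfolding is_decomposition_def poly_ring_simps
      by (intro conjI allI cmp_in_Hp[OF x] fin)
  qed
  have "component ?P x = (\<lambda>i. cmp 1 x (int i))"
    unfolding component_def using ex uniq by (rule the_equality)
  then show ?thesis by simp
qed

lemma veronese_carrier:
  assumes c: "c > 0"
  shows "carrier (veronese (poly_ring n :: ('k::field, 'k mpol) graded) c) = Ap n c"
proof -
  let ?P = "poly_ring n :: ('k, 'k mpol) graded"
  have car: "carrier (veronese ?P c) = {x \<in> Ap n 1. \<forall>i. \<not> c dvd i \<longrightarrow> cmp 1 x (int i) = 0}"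
    by (auto simp: veronese_def poly_ring_simps poly_ring_component)
  have eq: "(\<forall>i. \<not> c dvd i \<longrightarrow> cmp 1 x (int i) = 0) \<longleftrightarrow> (\<forall>m\<in>Poly_Mapping.keys x. c dvd mdeg m)" for x :: "'k mpol"
  proof (intro iffI allI impI ballI)
    fix m assume *: "\<forall>i. \<not> c dvd i \<longrightarrow> cmp 1 x (int i) = 0" and m: "m \<in> Poly_Mapping.keys x"
    have "Poly_Mapping.lookup (cmp 1 x (int (mdeg m))) m \<noteq> 0" using m by (simp add: lookup_cmp in_keys_iff)
    then have "cmp 1 x (int (mdeg m)) \<noteq> 0" by auto
    with * show "c dvd mdeg m" by blast
  next
    fix i assume *: "\<forall>m\<in>Poly_Mapping.keys x. c dvd mdeg m" and i: "\<not> c dvd i"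
    show "cmp 1 x (int i) = 0"
      using * i by (intro poly_mapping_eqI) (auto simp: lookup_cmp in_keys_iff)
  qed
  show ?thesis unfolding car eq Ap_def using one_dvd by blast
qed

lemma veronese_cring: "c > 0 \<Longrightarrow> cring (veronese (poly_ring n :: ('k::field, 'k mpol) graded) c)"
  by (rule subring_cring[of _ n c]) (simp_all add: veronese_carrier veronese_simps0)

lemma presented_veronese:
  assumes c: "c > 0" and sga: "standard_graded_algebra class_ring (veronese (poly_ring n :: ('k::field, 'k mpol) graded) c)"
  shows "presented_algebra n c (veronese (poly_ring n :: ('k, 'k mpol) graded) c) (\<lambda>p. p)"
  using c sga by (intro presented_algebra.intro) (simp_all add: veronese_carrier veronese_simps0 veronese_grade image_ident)

section \<open>Resolutions over complete intersections\<close>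

context
  fixes m :: nat and fs :: "'k::field mpol list"
  assumes reg: "homogeneous_regular_sequence (poly_ring m) fs"
begin

abbreviation (input) "PR \<equiv> (poly_ring m :: ('k, 'k mpol) graded)"

interpretation PR: cring PR by (rule poly_ring_cring)

lemma fs_carrier: "set fs \<subseteq> Ap m 1"
  using reg Hp_Ap[of _ m 1] unfolding homogeneous_regular_sequence_def poly_ring_simps by blast

lemma take_ideal: "ideal (Idl\<^bsub>PR\<^esub> (set (take i fs))) PR"
  using fs_carrier set_take_subset[of i fs] by (intro PR.genideal_ideal) (auto simp: poly_ring_simps)

lemmas ideal_memD = subring_idealD[of "PR" m 1, OF poly_ring_simps(1-5)]

lemmas idealI_set = subring_idealI[of "PR" m 1, OF poly_ring_simps(1-5)]

lemma take_Suc_ideal: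
  assumes i: "i < length fs"
  shows "Idl\<^bsub>PR\<^esub> (set (take (Suc i) fs)) = {p + fs ! i * q | p q. p \<in> Idl\<^bsub>PR\<^esub> (set (take i fs)) \<and> q \<in> Ap m 1}"
    (is "?L = ?S")
proof
  note N = ideal_memD[OF take_ideal[of i]] and L = ideal_memD[OF take_ideal[of "Suc i"]]
  have fA: "fs ! i \<in> Ap m 1" using fs_carrier i by auto
  have sub: "set (take j fs) \<subseteq> carrier PR" for j using fs_carrier set_take_subset[of j fs] by (auto simp: poly_ring_simps)
  have SI: "z \<in> ?S" if "z = p + fs ! i * q" "p \<in> Idl\<^bsub>PR\<^esub> (set (take i fs))" "q \<in> Ap m 1" for z p q
    using that by blast
  have SE: "\<exists>p q. z = p + fs ! i * q \<and> p \<in> Idl\<^bsub>PR\<^esub> (set (take i fs)) \<and> q \<in> Ap m 1" if "z \<in> ?S" for z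
    using that by blast
  have "ideal ?S PR"
  proof (rule idealI_set)
    show "?S \<subseteq> Ap m 1" using N(1) fA by (auto intro!: Ap_add Ap_mult)
    show "0 \<in> ?S" by (rule SI[of _ 0 0]) (use N(2) in auto)
    show "x + y \<in> ?S" if xy: "x \<in> ?S" "y \<in> ?S" for x y
    proof -
      obtain p q p' q' where "x = p + fs ! i * q" "y = p' + fs ! i * q'" "p \<in> Idl\<^bsub>PR\<^esub> (set (take i fs))"
        "p' \<in> Idl\<^bsub>PR\<^esub> (set (take i fs))" "q \<in> Ap m 1" "q' \<in> Ap m 1"
        using SE[OF xy(1)] SE[OF xy(2)] by blast
      then show ?thesis
        by (intro SI[of _ "p + p'" "q + q'"] N(3) Ap_add) (simp_all add: algebra_simps)
    qed
    fix x y :: "'k mpol"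
    assume x: "x \<in> Ap m 1" and yS: "y \<in> ?S"
    show "x * y \<in> ?S"
    proof -
      obtain p q where y: "y = p + fs ! i * q" "p \<in> Idl\<^bsub>PR\<^esub> (set (take i fs))" "q \<in> Ap m 1" using SE[OF yS] by blast
      have "x * y = x * p + fs ! i * (x * q)" by (simp add: y algebra_simps)
      then show ?thesis by (rule SI[OF _ N(4)[OF x y(2)] Ap_mult[OF x y(3)]])
    qed
  qed
  moreover have "set (take (Suc i) fs) \<subseteq> ?S"
  proof
    fix g assume "g \<in> set (take (Suc i) fs)"
    then consider "g \<in> set (take i fs)" | "g = fs ! i" using i by (auto simp: take_Suc_conv_app_nth)
    then show "g \<in> ?S"
    proof cases
      case 1
      then have "g \<in> Idl\<^bsub>PR\<^esub> (set (take i fs))" using PR.genideal_self[OF sub[of i]] by (rule subsetD[rotated])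
      then show ?thesis by (intro SI[of _ g 0]) simp_all
    next
      case 2
      then show ?thesis using N(2) by (intro SI[of _ 0 1]) simp_all
    qed
  qed
  ultimately show "?L \<subseteq> ?S" by (rule PR.genideal_minimal)
  have "set (take i fs) \<subseteq> ?L" using PR.genideal_self[OF sub[of "Suc i"]] i by (auto simp: take_Suc_conv_app_nth)
  then have 1: "Idl\<^bsub>PR\<^esub> (set (take i fs)) \<subseteq> ?L" by (intro PR.genideal_minimal take_ideal)
  have 2: "fs ! i \<in> ?L" using PR.genideal_self[OF sub[of "Suc i"]] i by (auto simp: take_Suc_conv_app_nth)
  show "?S \<subseteq> ?L"
  proof
    fix x assume "x \<in> ?S"
    then obtain p q where x: "x = p + fs ! i * q" "p \<in> Idl\<^bsub>PR\<^esub> (set (take i fs))" "q \<in> Ap m 1" by blast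
    then show "x \<in> ?L" using 1 L(3) L(4)[OF x(3) 2] by (auto simp: mult.commute)
  qed
qed

lemma take_ideal_mono: "Idl\<^bsub>PR\<^esub> (set (take i fs)) \<subseteq> Idl\<^bsub>PR\<^esub> (set fs)"
proof (rule PR.genideal_minimal)
  show "ideal (Idl\<^bsub>PR\<^esub> (set fs)) PR" using take_ideal[of "length fs"] by simp
  show "set (take i fs) \<subseteq> Idl\<^bsub>PR\<^esub> (set fs)"
    using PR.genideal_self[of "set fs"] fs_carrier set_take_subset[of i fs] by (auto simp: poly_ring_simps)
qed

lemma one_notin: "1 \<notin> Idl\<^bsub>PR\<^esub> (set fs)"
proof
  assume 1: "1 \<in> Idl\<^bsub>PR\<^esub> (set fs)"
  have "ideal (Idl\<^bsub>PR\<^esub> (set fs)) PR" using take_ideal[of "length fs"] by simp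
  note I = ideal_memD[OF this]
  have "Idl\<^bsub>PR\<^esub> (set fs) = Ap m 1" using I(1) I(4)[OF _ 1] by auto
  then show False using reg by (simp add: homogeneous_regular_sequence_def poly_ring_simps)
qed

text \<open>
  A regular sequence contains no constants: a nonzero constant would generate the unit ideal, and if \<open>0\<close>
  were regular modulo the earlier elements, these would generate the unit ideal.
\<close>

lemma degree_positive:
  assumes i: "i < length fs"
  shows "\<exists>a>0. fs ! i \<in> Hp m 1 (int a)"
proof -
  obtain a where a: "fs ! i \<in> Hp m 1 (int a)"
    using reg i unfolding homogeneous_regular_sequence_def poly_ring_simps by (metis nth_mem)
  have "a \<noteq> 0"
  proof
    assume "a = 0"
    then have f: "fs ! i = Poly_Mapping.single 0 (const_coeff (fs ! i))" using a Hp_0[of "fs ! i" m 1] by simp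
    show False
    proof (cases "const_coeff (fs ! i) = 0")
      case True
      then have "fs ! i = 0" using f by simp
      then have "fs ! i * 1 \<in> Idl\<^bsub>PR\<^esub> (set (take i fs))" using ideal_memD(2)[OF take_ideal] by simp
      then have "1 \<in> Idl\<^bsub>PR\<^esub> (set (take i fs))"
        using reg i unfolding homogeneous_regular_sequence_def poly_ring_simps using Ap_1 by blast
      then show False using take_ideal_mono one_notin by blast
    next
      case False
      have "fs ! i \<in> Idl\<^bsub>PR\<^esub> (set fs)"
        using PR.genideal_self[of "set fs"] fs_carrier i by (auto simp: poly_ring_simps)
      moreover have "ideal (Idl\<^bsub>PR\<^esub> (set fs)) PR" using take_ideal[of "length fs"] by simp
      ultimately have "Poly_Mapping.single 0 (inverse (const_coeff (fs ! i))) * fs ! i \<in> Idl\<^bsub>PR\<^esub> (set fs)"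
        using ideal_memD(4)[of "Idl\<^bsub>PR\<^esub> (set fs)"] Ap_const by blast
      also have "Poly_Mapping.single 0 (inverse (const_coeff (fs ! i))) * fs ! i = 1"
        by (subst (2) f) (simp add: mult_single False single_one)
      finally show False using one_notin by blast
    qed
  qed
  with a show ?thesis by blast
qed

lemma take_homogeneous: "i \<le> length fs \<Longrightarrow> x \<in> Idl\<^bsub>PR\<^esub> (set (take i fs)) \<Longrightarrow> cmp 1 x d \<in> Idl\<^bsub>PR\<^esub> (set (take i fs))"
proof (induction i arbitrary: x d)
  case 0
  have "ideal {0} PR" by (rule idealI_set) auto
  from PR.genideal_minimal[OF this, of "{}"] have "Idl\<^bsub>PR\<^esub> {} \<subseteq> {0}" by simp
  with 0 have "x = 0" by auto
  then show ?case using ideal_memD(2)[OF take_ideal[of 0]] by simp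
next
  case (Suc i)
  then have i: "i < length fs" by simp
  obtain a where a: "fs ! i \<in> Hp m 1 (int a)" using degree_positive[OF i] by blast
  obtain p q where x: "x = p + fs ! i * q" "p \<in> Idl\<^bsub>PR\<^esub> (set (take i fs))" "q \<in> Ap m 1"
    using Suc.prems(2) unfolding take_Suc_ideal[OF i] by blast
  have "cmp 1 x d = cmp 1 p d + fs ! i * cmp 1 q (d - int a)"
    using cmp_mult[OF _ x(3) a, of d] by (simp add: x(1) cmp_add mult.commute)
  moreover have "cmp 1 p d \<in> Idl\<^bsub>PR\<^esub> (set (take i fs))" using Suc.IH x(2) i by simp
  ultimately show ?case unfolding take_Suc_ideal[OF i] using Hp_Ap[OF cmp_in_Hp[OF x(3)]] by blast
qed

definition Ih :: "nat \<Rightarrow> int \<Rightarrow> 'k mpol set" where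
  "Ih i d = Idl\<^bsub>PR\<^esub> (set (take i fs)) \<inter> Hp m 1 d"

lemma Ih_0: "Ih 0 = (\<lambda>d. {0})"
proof
  fix d
  have "ideal {0} PR" by (rule idealI_set) auto
  from PR.genideal_minimal[OF this, of "{}"] have "Idl\<^bsub>PR\<^esub> {} \<subseteq> {0}" by simp
  then show "Ih 0 d = {0}" using ideal_memD(2)[OF take_ideal[of 0]] by (auto simp: Ih_def Hp_def)
qed

lemma Ih_ideal: "graded_pieces.hideal (Hp m 1) (Ih i)"
proof -
  interpret graded_pieces "Hp m 1 :: int \<Rightarrow> 'k mpol set" by (rule graded_pieces_Hp) simp
  note N = ideal_memD[OF take_ideal[of i]]
  show ?thesis unfolding hideal_def Ih_def
  proof (intro conjI allI ballI)
    fix d e and x y :: "'k mpol"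
    assume x: "x \<in> Hp m 1 d" and y: "y \<in> Idl\<^bsub>PR\<^esub> (set (take i fs)) \<inter> Hp m 1 e"
    then show "x * y \<in> Idl\<^bsub>PR\<^esub> (set (take i fs)) \<inter> Hp m 1 (d + e)" using N(4) Hp_Ap[OF x] Hmult by blast
  qed (use N H0 Hadd Huminus in auto)
qed

lemma Ih_Suc:
  assumes i: "i < length fs" and a: "fs ! i \<in> Hp m 1 (int a)"
  shows "Ih (Suc i) = graded_pieces.adjoin (Hp m 1) (Ih i) a (fs ! i)"
proof
  fix d
  interpret graded_pieces "Hp m 1 :: int \<Rightarrow> 'k mpol set" by (rule graded_pieces_Hp) simp
  show "Ih (Suc i) d = adjoin (Ih i) a (fs ! i) d"
  proof (intro equalityI subsetI)
    fix x assume "x \<in> Ih (Suc i) d"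
    then obtain p q where x: "x = p + fs ! i * q" "p \<in> Idl\<^bsub>PR\<^esub> (set (take i fs))" "q \<in> Ap m 1" "x \<in> Hp m 1 d"
      unfolding Ih_def take_Suc_ideal[OF i] by blast
    have "p \<in> Ap m 1" using x(2) ideal_memD(1)[OF take_ideal] by blast
    then have "cmp 1 p d \<in> Ih i d" using take_homogeneous[of i p d] x(2) i cmp_in_Hp by (simp add: Ih_def)
    moreover have "cmp 1 q (d - int a) \<in> Hp m 1 (d - int a)" by (rule cmp_in_Hp[OF x(3)])
    moreover have "x = cmp 1 p d + fs ! i * cmp 1 q (d - int a)"
      using cmp_mult[OF _ x(3) a, of d] cmp_Hp[OF _ x(4), of d] by (simp add: x(1) cmp_add mult.commute)
    ultimately show "x \<in> adjoin (Ih i) a (fs ! i) d" unfolding adjoin_def by blast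
  next
    fix x assume "x \<in> adjoin (Ih i) a (fs ! i) d"
    then obtain p q where x: "x = p + fs ! i * q" "p \<in> Ih i d" "q \<in> Hp m 1 (d - int a)" unfolding adjoin_def by blast
    have "p \<in> Hp m 1 d" using x(2) by (simp add: Ih_def)
    moreover have "fs ! i * q \<in> Hp m 1 d" using Hmult[OF a x(3)] by simp
    ultimately have "x \<in> Hp m 1 d" unfolding x(1) by (rule Hadd)
    then show "x \<in> Ih (Suc i) d" unfolding Ih_def take_Suc_ideal[OF i] using x(1,2) Hp_Ap[OF x(3)] unfolding Ih_def by blast
  qed
qed

text \<open>
  The linear resolution over the polynomial ring has bounded ranks; adjoining the elements of the regular
  sequence one at a time with \<open>shamash\<close> keeps the growth polynomial.
\<close>

lemma ci_resolution:
  "i \<le> length fs \<Longrightarrow> \<exists>G E C r. graded_pieces.hres (Hp m 1) (Ih i) G E \<and> G 1 = [0] \<and>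
     E 0 = (\<lambda>t u. if u = t then 1 else 0) \<and> (\<forall>k. length (G (Suc k)) \<le> C * (k + 1) ^ r)"
proof (induction i)
  case 0
  interpret veronese_step m 1 by standard simp
  obtain F and D :: "nat \<Rightarrow> nat \<Rightarrow> nat \<Rightarrow> 'k mpol" and b N where F: "hres (\<lambda>d. {0}) F D" "\<And>i. F (Suc i) = replicate (b i) i"
    "D 0 = (\<lambda>t u. if u = t then 1 else 0)" "b 0 = 1"
    "\<And>l. N 0 l + (if l = 0 then 1 else 0) = card (Mon m (l * 1))" "\<And>i. N i 0 = 0"
    "\<And>i l. b (Suc i) * card (Mon m (l * 1)) = N (Suc i) l + N i (Suc l)"
    using linear_resolution by blast
  have "b i \<le> 2 ^ m" for i
    using linear_euler[of b N "\<lambda>l. card (Mon m l)"] F(4-7) by (intro linear_ranks_polynomial_ring) simp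
  then have "\<forall>k. length (F (Suc k)) \<le> 2 ^ m * (k + 1) ^ 0" by (simp add: F(2))
  moreover have "F 1 = [0]" by (simp add: F(2,4))
  ultimately show ?case unfolding Ih_0 using F(1,3) by blast
next
  case (Suc i)
  interpret graded_pieces "Hp m 1 :: int \<Rightarrow> 'k mpol set" by (rule graded_pieces_Hp) simp
  have i: "i < length fs" using Suc.prems by simp
  from Suc obtain F D C r where F: "hres (Ih i) F D" "F 1 = [0]" "D 0 = (\<lambda>t u. if u = t then 1 else 0)"
    "\<And>k. length (F (Suc k)) \<le> C * (k + 1) ^ r" by auto
  obtain a where a: "a > 0" "fs ! i \<in> Hp m 1 (int a)" using degree_positive[OF i] by blast
  have rg: "g \<in> Ih i d" if g: "g \<in> Hp m 1 d" "fs ! i * g \<in> Ih i (int a + d)" for d g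
  proof -
    have "g \<in> Idl\<^bsub>PR\<^esub> (set (take i fs))"
      using reg i g Hp_Ap[OF g(1)] unfolding homogeneous_regular_sequence_def poly_ring_simps Ih_def by blast
    then show ?thesis using g(1) by (simp add: Ih_def)
  qed
  obtain G E where G: "hres (adjoin (Ih i) a (fs ! i)) G E" "G 1 = [0]" "E 0 = (\<lambda>t u. if u = t then 1 else 0)"
     "length (G 2) = length (F 2)" "\<And>k. length (G (k + 3)) = length (F (k + 3)) + length (G (k + 1))"
    using shamash[OF Ih_ideal a rg F(1-3)] by blast
  have "length (G (Suc k)) \<le> C * (k + 1) ^ Suc r" for k
    by (rule shamash_growth[of "\<lambda>k. length (F (Suc k))"])
       (use F(2,4) G(2,4,5) in \<open>auto simp: numeral_2_eq_2 numeral_3_eq_3\<close>)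
  then show ?case unfolding Ih_Suc[OF i a(2)] using G(1-3) by blast
qed

lemma presented_ci:
  assumes sga: "standard_graded_algebra class_ring (graded_quot PR (Idl\<^bsub>PR\<^esub> (set fs)))"
  shows "presented_algebra m 1 (graded_quot PR (Idl\<^bsub>PR\<^esub> (set fs))) (\<lambda>p. Idl\<^bsub>PR\<^esub> (set fs) +>\<^bsub>PR\<^esub> p)"
    and "presented_algebra.ker m 1 (graded_quot PR (Idl\<^bsub>PR\<^esub> (set fs))) (\<lambda>p. Idl\<^bsub>PR\<^esub> (set fs) +>\<^bsub>PR\<^esub> p) = Ih (length fs)"
proof -
  let ?N = "Idl\<^bsub>PR\<^esub> (set fs)" and ?Q = "graded_quot PR (Idl\<^bsub>PR\<^esub> (set fs))"
  interpret N: ideal ?N PR using take_ideal[of "length fs"] by simp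
  note NN = ideal_memD[OF N.ideal_axioms]
  have coset_eq: "?N +>\<^bsub>PR\<^esub> x = ?N +>\<^bsub>PR\<^esub> y" if "x - y \<in> ?N" "x \<in> Ap m 1" "y \<in> Ap m 1" for x y
  proof -
    have "x \<in> ?N +>\<^bsub>PR\<^esub> y"
      unfolding a_r_coset_def r_coset_def using that by (auto simp: poly_ring_simps intro!: bexI[of _ "x - y"])
    then show ?thesis using N.a_repr_independence'[of x y] that by (simp add: poly_ring_simps)
  qed
  show P: "presented_algebra m 1 ?Q (\<lambda>p. ?N +>\<^bsub>PR\<^esub> p)"
  proof (rule presented_algebra.intro)
    show "carrier ?Q = (\<lambda>p. ?N +>\<^bsub>PR\<^esub> p) ` Ap m 1"
      by (auto simp: graded_quot_def A_RCOSETS_def' poly_ring_simps)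
    show "grade ?Q i = (\<lambda>p. ?N +>\<^bsub>PR\<^esub> p) ` Hp m 1 (int i)" for i
      by (simp add: graded_quot_def poly_ring_simps)
    show "?N +>\<^bsub>PR\<^esub> (p + q) = (?N +>\<^bsub>PR\<^esub> p) \<oplus>\<^bsub>?Q\<^esub> (?N +>\<^bsub>PR\<^esub> q)" if "p \<in> Ap m 1" "q \<in> Ap m 1" for p q
      using N.a_rcos_sum[of p q] that by (simp add: graded_quot_def poly_ring_simps)
    show "?N +>\<^bsub>PR\<^esub> (p * q) = (?N +>\<^bsub>PR\<^esub> p) \<otimes>\<^bsub>?Q\<^esub> (?N +>\<^bsub>PR\<^esub> q)" if "p \<in> Ap m 1" "q \<in> Ap m 1" for p q
      using N.rcoset_mult_add[of p q] that by (simp add: graded_quot_def poly_ring_simps)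
    show "?N +>\<^bsub>PR\<^esub> 1 = \<one>\<^bsub>?Q\<^esub>" by (simp add: graded_quot_def poly_ring_simps)
    show "a \<odot>\<^bsub>?Q\<^esub> (?N +>\<^bsub>PR\<^esub> p) = ?N +>\<^bsub>PR\<^esub> (Poly_Mapping.single 0 a * p)" if p: "p \<in> Ap m 1" for p a
    proof -
      have mem: "x \<in> ?N +>\<^bsub>PR\<^esub> p \<longleftrightarrow> (\<exists>h\<in>?N. x = h + p)" for x
        by (auto simp: a_r_coset_def r_coset_def poly_ring_simps)
      have "?N +>\<^bsub>PR\<^esub> (Poly_Mapping.single 0 a * x) = ?N +>\<^bsub>PR\<^esub> (Poly_Mapping.single 0 a * p)" if xp: "x \<in> ?N +>\<^bsub>PR\<^esub> p" for x
      proof -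
        obtain h where h: "h \<in> ?N" "x = h + p" using xp mem by blast
        have "Poly_Mapping.single 0 a * x - Poly_Mapping.single 0 a * p = Poly_Mapping.single 0 a * h"
          by (simp add: h(2) algebra_simps)
        moreover have "Poly_Mapping.single 0 a * h \<in> ?N" using NN(4)[OF Ap_const h(1)] .
        moreover have "x \<in> Ap m 1" using h NN(1) p by (auto intro: Ap_add)
        ultimately show ?thesis using p by (intro coset_eq) (auto intro: Ap_mult)
      qed
      then have "(\<Union>x\<in>?N +>\<^bsub>PR\<^esub> p. ?N +>\<^bsub>PR\<^esub> (Poly_Mapping.single 0 a * x)) = (\<Union>x\<in>?N +>\<^bsub>PR\<^esub> p. ?N +>\<^bsub>PR\<^esub> (Poly_Mapping.single 0 a * p))"
        by (intro SUP_cong) auto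
      also have "\<dots> = ?N +>\<^bsub>PR\<^esub> (Poly_Mapping.single 0 a * p)" using mem[of "0 + p"] NN(2) by blast
      finally show ?thesis by (simp add: graded_quot_def poly_ring_simps)
    qed
  qed (simp_all add: sga)
  interpret presented_algebra m 1 ?Q "\<lambda>p. ?N +>\<^bsub>PR\<^esub> p" by (rule P)
  have "x \<in> ker d \<longleftrightarrow> x \<in> Ih (length fs) d" for d and x :: "'k mpol"
  proof -
    have "?N +>\<^bsub>PR\<^esub> x = ?N \<longleftrightarrow> x \<in> ?N" if "x \<in> Hp m 1 d"
      using N.a_rcos_const[of x] N.rcos_const_imp_mem[of x] Hp_Ap[OF that] by (auto simp: poly_ring_simps)
    moreover have "\<zero>\<^bsub>?Q\<^esub> = ?N" by (simp add: graded_quot_def)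
    ultimately show ?thesis unfolding ker_def Ih_def by auto
  qed
  then show "ker = Ih (length fs)" by blast
qed

end

section \<open>Evaluating the Golod identity\<close>

lemma shifted_sum:
  fixes \<beta> :: "nat \<Rightarrow> int"
  assumes fin: "\<And>j. M < j \<Longrightarrow> \<beta> j = 0" and J: "M + k \<le> J"
  shows "(\<Sum>j\<le>J. if j < k then 0 else \<beta> (j - k)) = (\<Sum>j\<le>M. \<beta> j)"
proof -
  have "(\<Sum>j\<le>J. if j < k then 0 else \<beta> (j - k)) = (\<Sum>j\<in>{k..J}. \<beta> (j - k))"
    by (rule sum.mono_neutral_cong_right) auto
  also have "\<dots> = (\<Sum>j\<le>J - k. \<beta> j)"
    using J by (intro sum.reindex_bij_witness[of _ "\<lambda>j. j + k" "\<lambda>j. j - k"]) auto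
  also have "\<dots> = (\<Sum>j\<le>M. \<beta> j)"
    using fin J by (intro sum.mono_neutral_right) auto
  finally show ?thesis .
qed

text \<open>
  Multiplying the Golod identity by \<open>H(-sz)\<close>, the inverse of the Poincare series with linear Betti numbers
  \<open>b\<close>, leaves \<open>P^Q_k(s,z) H(-sz) = 1 - z (P^Q_R(s,z) - 1)\<close>.  The degrees in \<open>s\<close> belonging to \<open>z^l\<close> are bounded by
  \<open>M l\<close>, so that the coefficients of all powers of \<open>s\<close> may be added up.
\<close>

lemma golod_coefficients:
  fixes b H :: "nat \<Rightarrow> nat" and \<beta> \<nu> :: "nat \<Rightarrow> nat \<Rightarrow> nat"
  assumes eq: "Abs_fps (\<lambda>i. Abs_fps (\<lambda>j. int (if i = j then b i else 0))) *
      (1 - fps_X * (Abs_fps (\<lambda>i. Abs_fps (\<lambda>j. int (\<nu> i j))) - 1)) = Abs_fps (\<lambda>i. Abs_fps (\<lambda>j. int (\<beta> i j)))"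
    and euler: "\<And>j. (\<Sum>i\<le>j. (-1) ^ i * int (b i) * int (H (j - i))) = (if j = 0 then 1 else 0)"
    and fin: "\<And>l j. M l < j \<Longrightarrow> \<beta> l j = 0"
  shows "2 \<le> i \<Longrightarrow> (\<Sum>l\<le>i. int (\<Sum>j\<le>M l. \<beta> l j) * ((-1) ^ (i - l) * int (H (i - l)))) \<le> 0"
    and "(\<Sum>j\<le>M 0. \<beta> 0 j) = 1"
proof -
  let ?B = "Abs_fps (\<lambda>i. Abs_fps (\<lambda>j. int (if i = j then b i else 0)))"
  let ?N = "Abs_fps (\<lambda>i. Abs_fps (\<lambda>j. int (\<nu> i j)))" and ?P = "Abs_fps (\<lambda>i. Abs_fps (\<lambda>j. int (\<beta> i j)))"
  let ?H = "Abs_fps (\<lambda>i. fps_const ((-1) ^ i * int (H i)) * fps_X ^ i) :: int fps fps"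
  have B: "fps_nth ?B i = fps_const (int (b i)) * fps_X ^ i" for i
    by (rule fps_ext) (simp add: fps_X_power_nth)
  have H: "fps_nth ?H i = fps_const ((-1) ^ i * int (H i)) * fps_X ^ i" for i by simp
  have "?B * ?H = 1"
  proof (rule fps_ext)
    fix n
    have "fps_nth (?B * ?H) n = (\<Sum>i\<le>n. fps_nth ?B i * fps_nth ?H (n - i))"
      by (simp add: fps_mult_nth atLeast0AtMost)
    also have "\<dots> = (\<Sum>i\<le>n. fps_const ((-1) ^ n * ((-1) ^ i * int (b i) * int (H (n - i)))) * fps_X ^ n)"
    proof (rule sum.cong[OF refl])
      fix i assume "i \<in> {..n}"
      then have i: "i + (n - i) = n" by simp
      have X: "(fps_X :: int fps) ^ i * fps_X ^ (n - i) = fps_X ^ n" unfolding power_add[symmetric] i ..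
      have s: "(-1 :: int) ^ (n - i) = (-1) ^ n * (-1) ^ i"
      proof -
        have "(-1 :: int) ^ n * (-1) ^ i = (-1) ^ (n - i) * ((-1) ^ i * (-1) ^ i)"
          using power_add[of "-1::int" i "n - i"] i by simp
        also have "(-1 :: int) ^ i * (-1) ^ i = 1" by (simp flip: power_mult_distrib)
        finally show ?thesis by simp
      qed
      have "fps_nth ?B i * fps_nth ?H (n - i) =
          fps_const (int (b i)) * fps_X ^ i * (fps_const ((-1) ^ (n - i) * int (H (n - i))) * fps_X ^ (n - i))"
        unfolding B by simp
      also have "\<dots> = (fps_const (int (b i)) * fps_const ((-1) ^ (n - i) * int (H (n - i)))) * (fps_X ^ i * fps_X ^ (n - i))"
        by (simp only: mult.assoc mult.commute mult.left_commute)
      also have "\<dots> = fps_const ((-1) ^ n * ((-1) ^ i * int (b i) * int (H (n - i)))) * fps_X ^ n"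
        unfolding X s fps_const_mult by (simp only: mult_ac)
      finally show "fps_nth ?B i * fps_nth ?H (n - i) = fps_const ((-1) ^ n * ((-1) ^ i * int (b i) * int (H (n - i)))) * fps_X ^ n" .
    qed
    also have "\<dots> = fps_const ((-1) ^ n * (\<Sum>i\<le>n. (-1) ^ i * int (b i) * int (H (n - i)))) * fps_X ^ n"
      unfolding sum_distrib_right[symmetric] sum_distrib_left
      by (intro arg_cong[of _ _ "\<lambda>f. f * _"] fps_ext) (simp add: fps_sum_nth)
    also have "\<dots> = fps_nth 1 n" unfolding euler by simp
    finally show "fps_nth (?B * ?H) n = fps_nth 1 n" .
  qed
  then have "?P * ?H = 1 - fps_X * (?N - 1)"
  proof -
    have "?P * ?H = (?B * ?H) * (1 - fps_X * (?N - 1))" unfolding eq[symmetric] by (simp only: mult_ac)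
    with \<open>?B * ?H = 1\<close> show ?thesis by (simp only: mult_1_left)
  qed
  note PH = arg_cong[OF this, of "\<lambda>f. fps_nth f _"]
  have co: "(\<Sum>l\<le>i. (if j < i - l then 0 else int (\<beta> l (j - (i - l)))) * ((-1) ^ (i - l) * int (H (i - l)))) = fps_nth (fps_nth (?P * ?H) i) j" for i j
  proof -
    have "fps_nth (fps_nth (?P * ?H) i) j = (\<Sum>l\<le>i. fps_nth (fps_nth ?P l * fps_nth ?H (i - l)) j)"
      by (simp add: fps_mult_nth[of ?P] atLeast0AtMost fps_sum_nth)
    also have "\<dots> = (\<Sum>l\<le>i. (if j < i - l then 0 else int (\<beta> l (j - (i - l)))) * ((-1) ^ (i - l) * int (H (i - l))))"
    proof (rule sum.cong[OF refl])
      fix l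
      have e: "fps_nth ?P l * fps_nth ?H (i - l) =
         fps_const ((-1) ^ (i - l) * int (H (i - l))) * (fps_nth ?P l * fps_X ^ (i - l))"
        unfolding H by (rule mult.left_commute)
      show "fps_nth (fps_nth ?P l * fps_nth ?H (i - l)) j =
         (if j < i - l then 0 else int (\<beta> l (j - (i - l)))) * ((-1) ^ (i - l) * int (H (i - l)))"
        unfolding e fps_mult_left_const_nth fps_X_power_mult_right_nth by simp
    qed
    finally show ?thesis ..
  qed
  show "(\<Sum>l\<le>i. int (\<Sum>j\<le>M l. \<beta> l j) * ((-1) ^ (i - l) * int (H (i - l)))) \<le> 0" if i: "2 \<le> i"
  proof -
    \<comment> \<open>A bound for all powers of \<open>s\<close> that occur with \<open>z^i\<close>.\<close>
    let ?J = "(\<Sum>l\<le>i. M l) + i"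
    have i': "i = Suc (Suc (i - 2))" using i by simp
    have neg: "fps_nth (fps_nth (?P * ?H) i) j \<le> 0" for j
      unfolding PH by (subst i') simp
    have "(\<Sum>l\<le>i. int (\<Sum>j\<le>M l. \<beta> l j) * ((-1) ^ (i - l) * int (H (i - l)))) =
        (\<Sum>l\<le>i. (\<Sum>j\<le>?J. if j < i - l then 0 else int (\<beta> l (j - (i - l)))) * ((-1) ^ (i - l) * int (H (i - l))))"
    proof (rule sum.cong[OF refl])
      fix l assume l: "l \<in> {..i}"
      have "M l \<le> (\<Sum>l\<le>i. M l)" using l by (intro member_le_sum) auto
      then have "M l + (i - l) \<le> ?J" by simp
      from shifted_sum[of "M l" "\<lambda>j. int (\<beta> l j)", OF _ this]
      show "int (\<Sum>j\<le>M l. \<beta> l j) * ((-1) ^ (i - l) * int (H (i - l))) =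
        (\<Sum>j\<le>?J. if j < i - l then 0 else int (\<beta> l (j - (i - l)))) * ((-1) ^ (i - l) * int (H (i - l)))"
        using fin by simp
    qed
    also have "\<dots> = (\<Sum>j\<le>?J. fps_nth (fps_nth (?P * ?H) i) j)"
      unfolding co[symmetric] sum_distrib_right by (rule sum.swap)
    also have "\<dots> \<le> 0" using neg by (intro sum_nonpos) auto
    finally show ?thesis .
  qed
  have H0: "H 0 = 1" and b0: "b 0 = 1" using euler[of 0] by (auto simp: zmult_eq_1_iff)
  have "fps_nth ?P 0 = 1" using PH[of 0] H0 by simp
  then have "fps_nth (fps_nth ?P 0) j = fps_nth 1 j" for j by (rule arg_cong)
  then have "int (\<beta> 0 j) = (if j = 0 then 1 else 0)" for j by (simp only: fps_nth_Abs_fps fps_one_nth)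
  then have "(\<Sum>j\<le>M 0. int (\<beta> 0 j)) = (\<Sum>j\<le>M 0. if j = 0 then 1 else 0)" by (intro sum.cong refl)
  also have "\<dots> = 1" by (subst sum.delta) simp_all
  finally show "(\<Sum>j\<le>M 0. \<beta> 0 j) = 1" by (simp flip: of_nat_sum)
qed

section \<open>Veronese subrings without Golod covers by complete intersections\<close>

text \<open>
  The matrices of the linear resolution have entries of degree one, so that it is minimal.
\<close>

lemma veronese_linear_betti:
  assumes c: "c > 0" and sga: "standard_graded_algebra class_ring (veronese (poly_ring n :: ('k::field, 'k mpol) graded) c)"
  shows "\<exists>b. (\<forall>i j. betti class_ring (veronese (poly_ring n :: ('k, 'k mpol) graded) c)
        (residue_module class_ring (veronese (poly_ring n :: ('k, 'k mpol) graded) c)) i j = (if i = j then b i else 0)) \<and>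
    (\<forall>j. (\<Sum>i\<le>j. (-1) ^ i * int (b i) * int (card (Mon n ((j - i) * c)))) = (if j = 0 then 1 else 0))"
proof -
  let ?R = "veronese (poly_ring n :: ('k, 'k mpol) graded) c"
  have pres: "presented_algebra n c ?R (\<lambda>p. p)" by (rule presented_veronese[OF c sga])
  define kr where "kr = presented_algebra.ker n c ?R (\<lambda>p. p)"
  have ker: "kr = (\<lambda>d. {0})" unfolding kr_def
    by (rule ext) (auto simp: presented_algebra.ker_def[OF pres] veronese_simps0 Hp_def)
  interpret veronese_step n c by standard (rule c)
  obtain F and D :: "nat \<Rightarrow> nat \<Rightarrow> nat \<Rightarrow> 'k mpol" and b N where F: "hres (\<lambda>d. {0}) F D" "\<And>i. F (Suc i) = replicate (b i) i"
    "D 0 = (\<lambda>t u. if u = t then 1 else 0)" "b 0 = 1"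
    "\<And>l. N 0 l + (if l = 0 then 1 else 0) = card (Mon n (l * c))" "\<And>i. N i 0 = 0"
    "\<And>i l. b (Suc i) * card (Mon n (l * c)) = N (Suc i) l + N i (Suc l)"
    using linear_resolution by blast
  have F1: "F 1 = [0]" by (simp add: F(2,4))
  interpret augmented_pieces "Hp n c :: int \<Rightarrow> 'k mpol set" const_coeff "\<lambda>d. {0}"
    by (rule augmented_pieces_Hp[OF c zero_ideal]) simp
  have min: "const_coeff (D (Suc k) t u) = 0" if "t < length (F (Suc (Suc k)))" "u < length (F (Suc k))" for k t u
  proof -
    have "D (Suc k) t \<in> hvec (Hp n c) (F (Suc k)) (int (F (Suc (Suc k)) ! t))"
      using F(1) that(1) unfolding hres_def hmat_def by blast
    then have "D (Suc k) t u \<in> Hp n c (int (F (Suc (Suc k)) ! t) - int (F (Suc k) ! u))"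
      using that(2) by (simp add: hvec_def)
    then have "D (Suc k) t u \<in> Hp n c 1" using that by (simp add: F(2))
    then show ?thesis by (rule k_deg) simp
  qed
  have "betti class_ring ?R (residue_module class_ring ?R) i j = (if i = j then b i else 0)" for i j
  proof -
    have "betti class_ring ?R (residue_module class_ring ?R) i j = presented_algebra.hdimP F D i j"
      by (rule presented_algebra.betti_residue_eq[OF pres]) (simp_all only: ker[unfolded kr_def] F(1) F1 F(3))
    also have "\<dots> = card {t. t < length (F (Suc i)) \<and> F (Suc i) ! t = j}" by (rule presented_algebra.hdimP_minimal[OF pres]) (rule min)
    also have "{t. t < length (F (Suc i)) \<and> F (Suc i) ! t = j} = (if i = j then {..<b i} else {})" by (auto simp: F(2))
    finally show ?thesis by simp
  qed
  moreover have "(\<Sum>i\<le>j. (-1) ^ i * int (b i) * int (card (Mon n ((j - i) * c)))) = (if j = 0 then 1 else 0)" for j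
    using F(4-7) by (rule linear_euler[of b N "\<lambda>l. card (Mon n (l * c))"])
  ultimately show ?thesis by (intro exI[of _ b] conjI allI)
qed

text \<open>
  All basis degrees in the \<open>l\<close>-th module of the resolution are bounded by their sum, which serves as \<open>M l\<close>.
\<close>

lemma ci_betti_growth:
  fixes fs :: "'k::field mpol list"
  assumes reg: "homogeneous_regular_sequence (poly_ring m) fs"
    and Q: "Q = graded_quot (poly_ring m) (Idl\<^bsub>poly_ring m\<^esub> (set fs))"
    and sga: "standard_graded_algebra class_ring Q"
  shows "\<exists>M C r. (\<forall>l j. M l < j \<longrightarrow> betti class_ring Q (residue_module class_ring Q) l j = 0) \<and>
    (\<forall>l. (\<Sum>j\<le>M l. betti class_ring Q (residue_module class_ring Q) l j) \<le> C * (l + 1) ^ r)"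
proof -
  let ?N = "Idl\<^bsub>poly_ring m\<^esub> (set fs)"
  note P = presented_ci[OF reg sga[unfolded Q], folded Q]
  interpret presented_algebra m 1 Q "\<lambda>p. ?N +>\<^bsub>poly_ring m\<^esub> p" by (rule P(1))
  obtain G E C r where G: "hres ker G E" "G 1 = [0]" "E 0 = (\<lambda>t u. if u = t then 1 else 0)"
    "\<And>k. length (G (Suc k)) \<le> C * (k + 1) ^ r"
    using ci_resolution[OF reg, of "length fs"] unfolding P(2) by blast
  let ?b = "betti class_ring Q (residue_module class_ring Q)"
  have b: "?b l j \<le> card {t. t < length (G (Suc l)) \<and> G (Suc l) ! t = j}" for l j
    unfolding betti_residue_eq[OF G(1-3)] by (rule hdimP_count[OF G(1)])
  have "?b l j = 0" if "sum_list (G (Suc l)) < j" for l j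
  proof -
    have "G (Suc l) ! t \<noteq> j" if "t < length (G (Suc l))" for t
      using elem_le_sum_list[OF that] \<open>sum_list (G (Suc l)) < j\<close> by simp
    then have "{t. t < length (G (Suc l)) \<and> G (Suc l) ! t = j} = {}" by blast
    with b[of l j] show ?thesis by (simp only: card.empty le_zero_eq)
  qed
  moreover have "(\<Sum>j\<le>sum_list (G (Suc l)). ?b l j) \<le> C * (l + 1) ^ r" for l
  proof -
    have "(\<Sum>j\<le>sum_list (G (Suc l)). ?b l j) \<le> (\<Sum>j\<le>sum_list (G (Suc l)). card {t. t < length (G (Suc l)) \<and> G (Suc l) ! t = j})"
      by (intro sum_mono b)
    also have "\<dots> = card (\<Union>j\<in>{..sum_list (G (Suc l))}. {t. t < length (G (Suc l)) \<and> G (Suc l) ! t = j})"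
      by (rule card_UN_disjoint[symmetric]) auto
    also have "\<dots> \<le> card {..<length (G (Suc l))}" by (rule card_mono) auto
    also have "\<dots> \<le> C * (l + 1) ^ r" using G(4) by simp
    finally show ?thesis .
  qed
  ultimately show ?thesis
    by (intro exI[of _ "\<lambda>l. sum_list (G (Suc l))"] exI[of _ C] exI[of _ r] conjI allI impI)
qed

text \<open>
  The Golod identity leads to the situation that \<open>no_sign_return\<close> excludes.
\<close>

theorem veronese_not_backelin_roos:
  fixes h :: "real poly"
  assumes c: "c > 0" and n: "n > 0"
    and h: "Abs_fps (\<lambda>i. real (card (Mon n (i * c)))) * (1 - fps_X) ^ d = fps_of_poly h"
    and w0: "0 < w0" "w0 < 1" "poly h (- w0) \<le> 0" and pos: "poly h (-1) > 0"
  shows "\<not> backelin_roos (veronese (poly_ring n :: ('k::field, 'k mpol) graded) c)"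
proof
  let ?R = "veronese (poly_ring n :: ('k, 'k mpol) graded) c"
  assume "backelin_roos ?R"
  then obtain Q :: "('k, 'k mpol set) graded" and \<phi> m fs where reg: "homogeneous_regular_sequence (poly_ring m) fs"
    and Q: "Q = graded_quot (poly_ring m) (Idl\<^bsub>poly_ring m\<^esub> (set fs))" and gol: "golod class_ring Q ?R \<phi>"
    unfolding backelin_roos_def standard_graded_ci_def by blast
  have sga: "standard_graded_algebra class_ring Q" "standard_graded_algebra class_ring ?R"
    and eq: "poincare_series class_ring ?R (residue_module class_ring ?R) *
       (1 - fps_X * (poincare_series class_ring Q (restrict_scalars \<phi> ?R) - 1)) =
       poincare_series class_ring Q (residue_module class_ring Q)"
    using gol unfolding golod_def by blast+
  obtain b where b: "\<And>i j. betti class_ring ?R (residue_module class_ring ?R) i j = (if i = j then b i else 0)"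
    and euler: "\<And>j. (\<Sum>i\<le>j. (-1) ^ i * int (b i) * int (card (Mon n ((j - i) * c)))) = (if j = 0 then 1 else 0)"
    using veronese_linear_betti[OF c sga(2)] by blast
  let ?b = "betti class_ring Q (residue_module class_ring Q)"
  obtain M C r where fin: "\<And>l j. M l < j \<Longrightarrow> ?b l j = 0" and gr: "\<And>l. (\<Sum>j\<le>M l. ?b l j) \<le> C * (l + 1) ^ r"
    using ci_betti_growth[OF reg Q sga(1)] by blast
  have eq': "Abs_fps (\<lambda>i. Abs_fps (\<lambda>j. int (if i = j then b i else 0))) *
      (1 - fps_X * (Abs_fps (\<lambda>i. Abs_fps (\<lambda>j. int (betti class_ring Q (restrict_scalars \<phi> ?R) i j))) - 1)) =
      Abs_fps (\<lambda>i. Abs_fps (\<lambda>j. int (?b i j)))"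
    using eq unfolding poincare_series_def b .
  define p where "p l = (\<Sum>j\<le>M l. ?b l j)" for l
  note co = golod_coefficients[where H = "\<lambda>k. card (Mon n (k * c))" and M = M, OF eq' euler fin, folded p_def]
  obtain n' where n': "n = Suc n'" using n by (cases n) auto
  show False
  proof (rule no_sign_return[OF _ _ _ _ _ h _ w0 pos])
    show "0 \<le> real (p i)" for i by simp
    show "real (p i) \<le> real C * real (i + 1) ^ r" for i
    proof -
      have "real (p i) \<le> real (C * (i + 1) ^ r)" using gr[of i] by (simp only: of_nat_le_iff p_def)
      then show ?thesis by simp
    qed
    show "real (p 0) = 1" using co(2) by simp
    show "\<bar>real (card (Mon n (i * c)))\<bar> \<le> real ((n' + c) ^ n') * real (i + 1) ^ n'" for i
    proof -
      have "card (Mon n (i * c)) = (n' + i * c) choose n'" by (simp add: n' card_Mon)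
      also have "\<dots> \<le> (n' + i * c) ^ n'" by (rule binomial_le_pow) simp
      also have "\<dots> \<le> ((n' + c) * (i + 1)) ^ n'" by (rule power_mono) (auto simp: algebra_simps)
      also have "\<dots> = (n' + c) ^ n' * (i + 1) ^ n'" by (rule power_mult_distrib)
      finally have "real (card (Mon n (i * c))) \<le> real ((n' + c) ^ n' * (i + 1) ^ n')" by (simp only: of_nat_le_iff)
      then show ?thesis by simp
    qed
    show "real (card (Mon n (0 * c))) = 1" by (simp add: n' card_Mon)
    show "(\<Sum>l\<le>i. real (p l) * ((- 1) ^ (i - l) * real (card (Mon n ((i - l) * c))))) \<le> 0" if "2 \<le> i" for i
    proof -
      have "real_of_int (\<Sum>l\<le>i. int (p l) * ((-1) ^ (i - l) * int (card (Mon n ((i - l) * c))))) \<le> 0"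
        unfolding of_int_le_0_iff by (rule co(1)[OF _ that])
      then show ?thesis by simp
    qed
  qed
qed

section \<open>Hilbert function and Krull dimension of the Veronese subring\<close>

lemma hilbert_function_veronese:
  "hilbert_function class_ring (veronese (poly_ring n :: ('k::field, 'k mpol) graded) c) i = card (Mon n (i * c))"
proof -
  let ?R = "veronese (poly_ring n :: ('k, 'k mpol) graded) c"
  let ?V = "?R\<lparr>carrier := grade ?R i\<rparr>"
  have car: "carrier ?V = Hp n c (int i)" by (simp add: veronese_grade)
  have ops: "x \<oplus>\<^bsub>?V\<^esub> y = x + y" "\<zero>\<^bsub>?V\<^esub> = 0" "a \<odot>\<^bsub>?V\<^esub> x = Poly_Mapping.single 0 a * x" for a x y
    by (simp_all add: veronese_simps0)
  have add: "x + y \<in> Hp n c (int i)" if "x \<in> Hp n c (int i)" "y \<in> Hp n c (int i)" for x y :: "'k mpol"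
    using that Poly_Mapping.keys_add[of x y] unfolding Hp_def by blast
  have smult: "Poly_Mapping.single 0 a * x \<in> Hp n c (int i)" if "x \<in> Hp n c (int i)" for a and x :: "'k mpol"
    using that by (auto simp: Hp_def in_keys_iff lookup_const_mult)
  have mod: "module class_ring ?V"
  proof (rule module_criteria)
    show "cring (class_ring :: 'k ring)" by (rule class_cring.is_cring)
    show "\<forall>v\<in>carrier ?V. \<exists>w\<in>carrier ?V. v \<oplus>\<^bsub>?V\<^esub> w = \<zero>\<^bsub>?V\<^esub>"
    proof
      fix v assume "v \<in> carrier ?V"
      then show "\<exists>w\<in>carrier ?V. v \<oplus>\<^bsub>?V\<^esub> w = \<zero>\<^bsub>?V\<^esub>"
        unfolding car ops by (intro bexI[of _ "- v"]) (auto simp: Hp_def)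
    qed
    show "\<zero>\<^bsub>?V\<^esub> \<in> carrier ?V" unfolding car ops by (simp add: Hp_def)
    show "\<forall>a v. a \<in> carrier class_ring \<and> v \<in> carrier ?V \<longrightarrow> a \<odot>\<^bsub>?V\<^esub> v \<in> carrier ?V"
      unfolding car ops using smult by blast
  qed (unfold car ops, auto simp: add class_ring_simps algebra_simps mult_single single_add single_one)
  have V: "vectorspace class_ring ?V" by (rule vectorspace.intro[OF mod class_field])
  have "vectorspace.dim class_ring ?V = card (Mon n (i * c))"
  proof (rule dim_coordinates(1)[OF V, where e = X and lk = Poly_Mapping.lookup])
    show "X x \<in> carrier ?V" if "x \<in> Mon n (i * c)" for x
      using that unfolding car by (simp add: Hp_def Mon_def)
    fix v w :: "'k mpol" assume v: "v \<in> carrier ?V" and w: "w \<in> carrier ?V"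
      and eq: "\<And>x. x \<in> Mon n (i * c) \<Longrightarrow> Poly_Mapping.lookup v x = Poly_Mapping.lookup w x"
    have z: "Poly_Mapping.lookup u x = 0" if "u \<in> Hp n c (int i)" "x \<notin> Mon n (i * c)" for u :: "'k mpol" and x :: mon
    proof (rule ccontr)
      assume "Poly_Mapping.lookup u x \<noteq> 0"
      then have "Poly_Mapping.keys x \<subseteq> {..<n} \<and> int (mdeg x) = int i * int c" using that(1) by (simp add: Hp_def in_keys_iff)
      then show False using that(2) by (simp add: Mon_def flip: of_nat_mult)
    qed
    show "v = w"
    proof (rule poly_mapping_eqI)
      fix x show "Poly_Mapping.lookup v x = Poly_Mapping.lookup w x"
        using eq[of x] z[of v x] z[of w x] v w unfolding car by (cases "x \<in> Mon n (i * c)") simp_all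
    qed
  qed (simp_all only: ops finite_Mon lookup_add lookup_const_mult lookup_single when_def)
  then show ?thesis unfolding hilbert_function_def .
qed

primrec power_product :: "(nat \<Rightarrow> 'a::comm_ring_1) \<Rightarrow> nat \<Rightarrow> nat list \<Rightarrow> 'a" where
  "power_product a i [] = 1"
| "power_product a i (x # es) = a i ^ x * power_product a (Suc i) es"

definition exponents :: "nat \<Rightarrow> nat \<Rightarrow> nat list set" where
  "exponents e k = {es. set es \<subseteq> {..e} \<and> length es = k}"

lemma finite_exponents [simp]: "finite (exponents e k)"
  and card_exponents: "card (exponents e k) = (e + 1) ^ k"
  unfolding exponents_def by (simp_all add: finite_lists_length_eq card_lists_length_eq)

lemma exponents_0: "exponents e 0 = {[]}" by (auto simp: exponents_def)

lemma sum_exponents_Suc: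
  "(\<Sum>es\<in>exponents e (Suc k). f es) = (\<Sum>x\<le>e. \<Sum>es\<in>exponents e k. f (x # es))"
  unfolding sum.cartesian_product
  by (rule sum.reindex_bij_witness[of _ "\<lambda>(x, es). x # es" "\<lambda>es. (hd es, tl es)"])
    (auto simp: exponents_def length_Suc_conv)

text \<open>
  Choosing \<open>a i\<close> in \<open>P (i + 1)\<close> outside \<open>P i\<close> along a chain of primes gives elements that are algebraically
  independent over \<open>k\<close> modulo \<open>P 0\<close>.  For a relation with values in \<open>P i\<close>, a power of \<open>a i\<close> can be cancelled until a
  coefficient polynomial \<open>G x\<close> is left modulo \<open>a i\<close>, hence lies in \<open>P (i + 1)\<close>, and induction applies to it.
\<close>

lemma chain_independent:
  fixes A :: "'a::comm_ring_1 set" and P :: "nat \<Rightarrow> 'a set" and \<iota> :: "'k::field \<Rightarrow> 'a"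
  assumes A: "1 \<in> A" "0 \<in> A" "\<And>x y. x \<in> A \<Longrightarrow> y \<in> A \<Longrightarrow> x + y \<in> A" "\<And>x y. x \<in> A \<Longrightarrow> y \<in> A \<Longrightarrow> x * y \<in> A"
    and \<iota>: "\<And>u. \<iota> u \<in> A" "\<And>u. u \<noteq> 0 \<Longrightarrow> \<iota> u * \<iota> (inverse u) = 1" "\<iota> 0 = 0"
    and P: "\<And>i. i \<le> m \<Longrightarrow> P i \<subseteq> A" "\<And>i x y. i \<le> m \<Longrightarrow> x \<in> P i \<Longrightarrow> y \<in> P i \<Longrightarrow> x - y \<in> P i"
      "\<And>i x y. i \<le> m \<Longrightarrow> x \<in> A \<Longrightarrow> y \<in> P i \<Longrightarrow> x * y \<in> P i" "\<And>i. i \<le> m \<Longrightarrow> 1 \<notin> P i"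
      "\<And>i x y. i \<le> m \<Longrightarrow> x \<in> A \<Longrightarrow> y \<in> A \<Longrightarrow> x * y \<in> P i \<Longrightarrow> x \<in> P i \<or> y \<in> P i"
      "\<And>i. i < m \<Longrightarrow> P i \<subseteq> P (Suc i)"
    and a: "\<And>i. i < m \<Longrightarrow> a i \<in> P (Suc i)" "\<And>i. i < m \<Longrightarrow> a i \<notin> P i"
  shows "i + k = m \<Longrightarrow> (\<Sum>es\<in>exponents e k. \<iota> (u es) * power_product a i es) \<in> P i \<Longrightarrow> es \<in> exponents e k \<Longrightarrow> u es = 0"
proof (induction k arbitrary: i u es)
  case 0
  then have im: "i \<le> m" and "\<iota> (u []) \<in> P i" "es = []" by (simp_all add: exponents_0)
  show ?case
  proof (rule ccontr)
    assume "u es \<noteq> 0"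
    then have "\<iota> (inverse (u [])) * \<iota> (u []) = 1" using \<iota>(2)[of "u []"] \<open>es = []\<close> by (simp add: mult.commute)
    then show False using P(3)[OF im \<iota>(1)[of "inverse (u [])"] \<open>\<iota> (u []) \<in> P i\<close>] P(4)[OF im] by simp
  qed
next
  case (Suc k)
  have im: "i < m" "i \<le> m" "Suc i \<le> m" "Suc i + k = m" using Suc.prems(1) by simp_all
  have aA: "a j \<in> A" if "j < m" for j using a(1)[OF that] P(1)[of "Suc j"] that by auto
  have Apow: "x ^ r \<in> A" if "x \<in> A" for x r by (induction r) (use that A in auto)
  have Asum: "sum f S \<in> A" if "\<And>x. x \<in> S \<Longrightarrow> f x \<in> A" for f and S :: "'z set"
    using that by (induction S rule: infinite_finite_induct) (auto intro: A)
  have pA: "power_product a j es \<in> A" if "j + length es \<le> m" for j es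
    using that by (induction es arbitrary: j) (auto intro!: A Apow aA)
  define G where "G x = (\<Sum>es\<in>exponents e k. \<iota> (u (x # es)) * power_product a (Suc i) es)" for x
  have GA: "G x \<in> A" for x
    unfolding G_def using im(4) by (intro Asum A(4) \<iota>(1) pA) (auto simp: exponents_def)
  have rel: "(\<Sum>x\<le>e. a i ^ x * G x) \<in> P i"
    using Suc.prems(2) by (simp add: sum_exponents_Suc G_def sum_distrib_left mult.left_commute)
  have cancel: "z \<in> P i" if "a i ^ r * z \<in> P i" "z \<in> A" for r z
    using that(1)
  proof (induction r)
    case (Suc r)
    then have "a i * (a i ^ r * z) \<in> P i" by (simp add: mult.assoc)
    then have "a i ^ r * z \<in> P i"
      using P(5)[OF im(2) aA[OF im(1)] A(4)[OF Apow[OF aA[OF im(1)]] that(2)]] a(2)[OF im(1)] by blast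
    then show ?case by (rule Suc.IH)
  qed simp
  have zero: "\<forall>es\<in>exponents e k. u (x # es) = 0" if "x \<le> e" for x
    using that
  proof (induction x rule: less_induct)
    case (less x)
    have G0: "G y = 0" if "y < x" for y
      unfolding G_def using less.IH[OF that] that less.prems by (intro sum.neutral) (auto simp: \<iota>(3))
    let ?r = "\<Sum>y\<in>{Suc x..e}. a i ^ (y - Suc x) * G y"
    have rA: "?r \<in> A" by (intro Asum A(4) Apow aA im GA)
    have "(\<Sum>y\<le>e. a i ^ y * G y) = (\<Sum>y\<in>{x..e}. a i ^ y * G y)"
      using G0 by (intro sum.mono_neutral_right) auto
    also have "\<dots> = a i ^ x * G x + (\<Sum>y\<in>{Suc x..e}. a i ^ y * G y)"
      using less.prems by (simp add: sum.atLeast_Suc_atMost)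
    also have "(\<Sum>y\<in>{Suc x..e}. a i ^ y * G y) = (\<Sum>y\<in>{Suc x..e}. a i ^ x * (a i * (a i ^ (y - Suc x) * G y)))"
    proof (rule sum.cong[OF refl])
      fix y assume "y \<in> {Suc x..e}"
      then have "y = x + Suc (y - Suc x)" by simp
      then have "a i ^ y = a i ^ x * (a i * a i ^ (y - Suc x))" by (metis power_add power_Suc)
      then show "a i ^ y * G y = a i ^ x * (a i * (a i ^ (y - Suc x) * G y))" by (simp only: mult.assoc)
    qed
    also have "a i ^ x * G x + \<dots> = a i ^ x * (G x + a i * ?r)" by (simp add: sum_distrib_left distrib_left)
    finally have "a i ^ x * (G x + a i * ?r) \<in> P i" using rel by simp
    then have "G x + a i * ?r \<in> P i" using cancel A GA rA aA[OF im(1)] by blast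
    then have "G x + a i * ?r \<in> P (Suc i)" using P(6)[OF im(1)] by blast
    moreover have "a i * ?r \<in> P (Suc i)" using P(3)[OF im(3) rA a(1)[OF im(1)]] by (simp add: mult.commute)
    ultimately have "G x \<in> P (Suc i)" using P(2)[OF im(3), of "G x + a i * ?r" "a i * ?r"] by simp
    then show ?case unfolding G_def using Suc.IH[OF im(4), of "\<lambda>es. u (x # es)"] by blast
  qed
  obtain x fs where "es = x # fs" "x \<le> e" "fs \<in> exponents e k"
    using Suc.prems(3) by (cases es) (auto simp: exponents_def)
  then show ?case using zero by simp
qed

definition degree_le :: "nat \<Rightarrow> nat \<Rightarrow> 'k::field mpol set" where
  "degree_le n N = {p. \<forall>u\<in>Poly_Mapping.keys p. Poly_Mapping.keys u \<subseteq> {..<n} \<and> mdeg u \<le> N}"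

lemma degree_le_1: "1 \<in> degree_le n 0"
  by (simp add: degree_le_def)

lemma degree_le_mult: "p \<in> degree_le n N \<Longrightarrow> q \<in> degree_le n M \<Longrightarrow> p * q \<in> degree_le n (N + M)"
  unfolding degree_le_def by (fastforce dest!: keys_mult_mon simp: mon_keys_add mdeg_add intro: add_mono)

lemma degree_le_mono: "N \<le> M \<Longrightarrow> p \<in> degree_le n N \<Longrightarrow> p \<in> degree_le n M"
  unfolding degree_le_def by fastforce

lemma degree_le_power: "p \<in> degree_le n N \<Longrightarrow> p ^ r \<in> degree_le n (r * N)"
  by (induction r) (auto simp: degree_le_1 intro: degree_le_mult)

lemma degree_le_power_product:
  assumes "\<And>j. a j \<in> degree_le n N" "set es \<subseteq> {..e}"
  shows "power_product a i es \<in> degree_le n (length es * (e * N))"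
  using assms(2)
proof (induction es arbitrary: i)
  case (Cons x es)
  have "a i ^ x \<in> degree_le n (e * N)"
    using Cons.prems by (intro degree_le_mono[OF _ degree_le_power[OF assms(1)]]) simp
  then show ?case using Cons by (simp add: degree_le_mult)
qed (simp add: degree_le_1)

lemma vector_space_mpol: "vector_space (\<lambda>a p. Poly_Mapping.single 0 a * p :: 'k::field mpol)"
  by standard (simp_all add: distrib_left distrib_right single_add mult_single single_one flip: mult.assoc)

text \<open>
  Monomials in \<open>a\<close> with exponents up to \<open>e\<close> lie in a space of polynomials of degree at most \<open>m e N\<close>, whose
  dimension grows like the \<open>n\<close>-th power of \<open>e\<close>.
\<close>

lemma card_independent_products:
  fixes a :: "nat \<Rightarrow> 'k::field mpol"
  assumes n: "n > 0"
    and ind: "\<And>u es. (\<Sum>es\<in>exponents e m. Poly_Mapping.single 0 (u es) * power_product a 0 es) = 0 \<Longrightarrow> es \<in> exponents e m \<Longrightarrow> u es = 0"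
    and deg: "\<And>j. a j \<in> degree_le n N"
  shows "(e + 1) ^ m \<le> ((m * N + n) * (e + 1)) ^ n"
proof -
  interpret vector_space "\<lambda>a p. Poly_Mapping.single 0 a * p :: 'k mpol" by (rule vector_space_mpol)
  let ?E = "exponents e m" and ?f = "power_product a 0" and ?M = "m * (e * N)"
  let ?T = "\<Union>d\<le>?M. Mon n d"
  have inj: "inj_on ?f ?E"
  proof (rule inj_onI, rule ccontr)
    fix x y assume xy: "x \<in> ?E" "y \<in> ?E" "?f x = ?f y" "x \<noteq> y"
    let ?u = "\<lambda>es. if es = x then 1 else if es = y then -1 else (0 :: 'k)"
    have "(\<Sum>es\<in>?E. Poly_Mapping.single 0 (?u es) * ?f es) = (\<Sum>es\<in>{x, y}. Poly_Mapping.single 0 (?u es) * ?f es)"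
      using xy by (intro sum.mono_neutral_right) auto
    also have "\<dots> = 0" using xy by (simp add: single_uminus)
    finally have "?u x = 0" using xy(1) by (rule ind)
    then show False by simp
  qed
  have indep: "independent (?f ` ?E)"
  proof (rule independent_if_scalars_zero)
    fix g and x :: "'k mpol"
    assume s: "(\<Sum>x\<in>?f ` ?E. Poly_Mapping.single 0 (g x) * x) = 0" and x: "x \<in> ?f ` ?E"
    have "(\<Sum>es\<in>?E. Poly_Mapping.single 0 (g (?f es)) * ?f es) = 0"
      using s by (simp add: sum.reindex[OF inj])
    then show "g x = 0" using ind[of "\<lambda>es. g (?f es)"] x by blast
  qed simp
  have span: "?f ` ?E \<subseteq> span (X ` ?T)"
  proof
    fix p assume "p \<in> ?f ` ?E"
    then have p: "p \<in> degree_le n ?M" using degree_le_power_product[OF deg] by (auto simp: exponents_def)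
    have "(\<Sum>u\<in>Poly_Mapping.keys p. Poly_Mapping.single 0 (Poly_Mapping.lookup p u) * X u) \<in> span (X ` ?T)"
    proof (intro span_sum span_scale span_base)
      fix u assume "u \<in> Poly_Mapping.keys p"
      then have "u \<in> ?T" using p by (auto simp: degree_le_def Mon_def)
      then show "X u \<in> X ` ?T" by (rule imageI)
    qed
    also have "(\<Sum>u\<in>Poly_Mapping.keys p. Poly_Mapping.single 0 (Poly_Mapping.lookup p u) * X u) = p"
      using poly_mapping_sum_singles[of p] by (simp add: mult_single)
    finally show "p \<in> span (X ` ?T)" .
  qed
  have "(e + 1) ^ m = card (?f ` ?E)" by (simp add: card_image[OF inj] card_exponents)
  also have "\<dots> \<le> card (X ` ?T :: 'k mpol set)" using independent_span_bound[OF _ indep span] by simp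
  also have "\<dots> \<le> card ?T" by (rule card_image_le) simp
  also have "\<dots> \<le> (\<Sum>d\<le>?M. card (Mon n d))" by (rule card_UN_le) simp
  also have "\<dots> \<le> (\<Sum>d\<le>?M. (n + ?M) ^ (n - 1))"
  proof (rule sum_mono)
    fix d assume d: "d \<in> {..?M}"
    obtain n' where n': "n = Suc n'" using n by (cases n) auto
    have "card (Mon n d) = (n' + d) choose n'" by (simp add: n' card_Mon)
    also have "\<dots> \<le> (n' + d) ^ n'" by (rule binomial_le_pow) simp
    also have "\<dots> \<le> (n + ?M) ^ n'" using d by (intro power_mono) (auto simp: n')
    finally show "card (Mon n d) \<le> (n + ?M) ^ (n - 1)" by (simp add: n')
  qed
  also have "\<dots> = (?M + 1) * (n + ?M) ^ (n - 1)" by simp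
  also have "\<dots> \<le> (n + ?M) * (n + ?M) ^ (n - 1)" using n by (intro mult_right_mono) auto
  also have "\<dots> = (n + ?M) ^ n" using n by (simp add: power_eq_if)
  also have "\<dots> \<le> ((m * N + n) * (e + 1)) ^ n" by (intro power_mono) (auto simp: algebra_simps)
  finally show ?thesis .
qed

lemma krull_dim_le:
  fixes R :: "('k::field mpol, 'm) ring_scheme"
  assumes R: "carrier R = Ap n c" "\<And>x y. x \<otimes>\<^bsub>R\<^esub> y = x * y" "\<one>\<^bsub>R\<^esub> = 1" "\<zero>\<^bsub>R\<^esub> = 0" "\<And>x y. x \<oplus>\<^bsub>R\<^esub> y = x + y"
    and n: "n > 0" and P: "\<forall>i\<le>m. primeideal (P i) R" "\<forall>i<m. P i \<subset> P (Suc i)"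
  shows "m \<le> n"
proof (rule ccontr)
  assume "\<not> m \<le> n"
  have pr: "primeideal (P i) R" if "i \<le> m" for i using P(1) that by blast
  note idl = primeideal.axioms(1)[OF pr]
  note I = subring_idealD[OF R idl]
  have "\<forall>i. \<exists>x. i < m \<longrightarrow> x \<in> P (Suc i) \<and> x \<notin> P i" using P(2) by blast
  then obtain a0 where a0: "\<And>i. i < m \<Longrightarrow> a0 i \<in> P (Suc i) \<and> a0 i \<notin> P i" by metis
  define a where "a i = (if i < m then a0 i else 1)" for i
  have a: "a i \<in> P (Suc i)" "a i \<notin> P i" if "i < m" for i using a0[OF that] that by (simp_all add: a_def)
  have aA: "a i \<in> Ap n c" for i using a(1)[of i] I(1)[of "Suc i"] by (cases "i < m") (auto simp: a_def)
  define N where "N = (\<Sum>i<m. dbound (a i))"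
  have deg: "a i \<in> degree_le n N" for i
  proof -
    have "mdeg u \<le> N" if u: "u \<in> Poly_Mapping.keys (a i)" for u
    proof (cases "i < m")
      case True
      have "mdeg u \<le> dbound (a i)" unfolding dbound_def using u by (intro member_le_sum) auto
      also have "\<dots> \<le> N" unfolding N_def using True by (intro member_le_sum) auto
      finally show ?thesis .
    qed (use u in \<open>simp add: a_def\<close>)
    then show ?thesis using aA[of i] by (auto simp: degree_le_def Ap_def)
  qed
  have one: "1 \<notin> P i" if "i \<le> m" for i
  proof
    assume "1 \<in> P i"
    then have "P i = Ap n c" using I(1)[OF that] I(4)[OF that _ \<open>1 \<in> P i\<close>] by auto
    then show False using primeideal.I_notcarr[OF pr[OF that]] R(1) by simp
  qed
  have prime: "x \<in> P i \<or> y \<in> P i" if "i \<le> m" "x \<in> Ap n c" "y \<in> Ap n c" "x * y \<in> P i" for i x y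
    by (rule primeideal.I_prime[OF pr, unfolded R, OF that])
  have diff: "x - y \<in> P i" if "i \<le> m" "x \<in> P i" "y \<in> P i" for i x y
    using I(3)[OF that(1,2) I(5)[OF that(1,3)]] by simp
  have ind: "u es = 0" if "(\<Sum>es\<in>exponents e m. Poly_Mapping.single 0 (u es) * power_product a 0 es) = 0"
    "es \<in> exponents e m" for u es e
  proof (rule chain_independent[where A = "Ap n c" and P = P and \<iota> = "Poly_Mapping.single 0" and i = 0 and k = m and a = a])
    show "(\<Sum>es\<in>exponents e m. Poly_Mapping.single 0 (u es) * power_product a 0 es) \<in> P 0" unfolding that(1) by (rule I(2)) simp
    show "P i \<subseteq> P (Suc i)" if "i < m" for i using P(2) that by blast
    show "Poly_Mapping.single 0 v * Poly_Mapping.single 0 (inverse v) = (1 :: 'k mpol)" if "v \<noteq> 0" for v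
      using that by (simp add: mult_single single_one)
    show "0 + m = m" by simp
    show "es \<in> exponents e m" by (rule that(2))
    show "a i \<in> P (Suc i)" "a i \<notin> P i" if "i < m" for i using a[OF that] .
    show "x * y \<in> P i" if "i \<le> m" "x \<in> Ap n c" "y \<in> P i" for i x y by (rule I(4)[OF that])
    show "P i \<subseteq> Ap n c" if "i \<le> m" for i by (rule I(1)[OF that])
  qed (fact Ap_1 Ap_0 Ap_add Ap_mult Ap_const single_zero one prime diff)+
  \<comment> \<open>For \<open>m > n\<close> the number \<open>(e + 1)^m\<close> is too large as soon as \<open>e + 1\<close> exceeds \<open>?K^n\<close>.\<close>
  let ?K = "m * N + n"
  have "(?K ^ n + 1) ^ Suc n \<le> (?K ^ n + 1) ^ m" using \<open>\<not> m \<le> n\<close> by (intro power_increasing) auto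
  also have "\<dots> \<le> (?K * (?K ^ n + 1)) ^ n" by (rule card_independent_products[OF n _ deg]) (rule ind)
  also have "\<dots> = ?K ^ n * (?K ^ n + 1) ^ n" by (rule power_mult_distrib)
  finally show False by simp
qed

text \<open>
  The chain of length \<open>n\<close> consists of the ideals \<open>P i\<close> of elements all of whose monomials involve one of the
  first \<open>i\<close> variables, the contractions of the prime ideals generated by these variables.  It cannot be
  prolonged, by counting monomials in algebraically independent elements.
\<close>

lemma krull_dim_veronese:
  assumes c: "c > 0" and n: "n > 0"
  shows "krull_dim (veronese (poly_ring n :: ('k::field, 'k mpol) graded) c) = enat n"
proof -
  let ?R = "veronese (poly_ring n :: ('k, 'k mpol) graded) c"
  note R = veronese_carrier[OF c] veronese_simps0(1-4)
  define P :: "nat \<Rightarrow> 'k mpol set"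
    where "P i = {p \<in> Ap n c. \<forall>u\<in>Poly_Mapping.keys p. \<exists>t<i. t \<in> Poly_Mapping.keys u}" for i
  define J :: "nat \<Rightarrow> 'k mpol set"
    where "J i = {p. \<forall>u\<in>Poly_Mapping.keys p. \<exists>t<i. t \<in> Poly_Mapping.keys u}" for i
  have P_J: "P i = Ap n c \<inter> J i" for i by (auto simp: P_def J_def)
  have Jadd: "x + y \<in> J i" if "x \<in> J i" "y \<in> J i" for x y i
    using that Poly_Mapping.keys_add[of x y] unfolding J_def by blast
  have Jmult: "x * y \<in> J i" if y: "y \<in> J i" for x y i
    unfolding J_def
  proof (intro CollectI ballI)
    fix u assume "u \<in> Poly_Mapping.keys (x * y)"
    then obtain a b where ab: "b \<in> Poly_Mapping.keys y" "u = a + b" using keys_mult_mon by blast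
    then obtain t where "t < i" "t \<in> Poly_Mapping.keys b" using y by (auto simp: J_def)
    then show "\<exists>t<i. t \<in> Poly_Mapping.keys u" by (auto simp: ab(2) mon_keys_add)
  qed
  have Jneg: "- x \<in> J i" if "x \<in> J i" for x i using that by (simp add: J_def)
  have prime: "primeideal (P i) ?R" for i
  proof (rule primeidealI)
    show "cring ?R" by (rule veronese_cring[OF c])
    show "ideal (P i) ?R"
    proof (rule subring_idealI[OF R])
      show "P i \<subseteq> Ap n c" "0 \<in> P i" by (auto simp: P_def)
      show "x + y \<in> P i" if "x \<in> P i" "y \<in> P i" for x y
        using that Jadd[of x i y] Ap_add[of x n c y] by (simp add: P_J)
      show "x * y \<in> P i" if "x \<in> Ap n c" "y \<in> P i" for x y
      proof -
        have "x * y \<in> J i" using that(2) by (intro Jmult) (simp add: P_J)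
        then show ?thesis using that Ap_mult[of x n c y] by (simp add: P_J)
      qed
    qed
    have "1 \<notin> P i" by (simp add: P_def)
    then show "carrier ?R \<noteq> P i" unfolding R using Ap_1[of n c] by metis
    fix p q assume p: "p \<in> carrier ?R" and q: "q \<in> carrier ?R" and pq: "p \<otimes>\<^bsub>?R\<^esub> q \<in> P i"
    define g :: "'k mpol \<Rightarrow> 'k mpol" where
      "g p = (\<Sum>u\<in>{u \<in> Poly_Mapping.keys p. \<forall>t<i. t \<notin> Poly_Mapping.keys u}. Poly_Mapping.single u (Poly_Mapping.lookup p u))" for p
    have lg: "Poly_Mapping.lookup (g p) u = (if \<forall>t<i. t \<notin> Poly_Mapping.keys u then Poly_Mapping.lookup p u else 0)" for p u
    proof -
      have "Poly_Mapping.lookup (g p) u = (\<Sum>w\<in>{u \<in> Poly_Mapping.keys p. \<forall>t<i. t \<notin> Poly_Mapping.keys u}. if w = u then Poly_Mapping.lookup p w else 0)"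
        by (simp add: g_def lookup_sum lookup_single when_def)
      also have "\<dots> = (if u \<in> {u \<in> Poly_Mapping.keys p. \<forall>t<i. t \<notin> Poly_Mapping.keys u} then Poly_Mapping.lookup p u else 0)"
        by (rule sum.delta) simp
      finally show ?thesis by (auto simp: in_keys_iff)
    qed
    have gJ: "p - g p \<in> J i" for p by (auto simp: J_def in_keys_iff lookup_minus lg split: if_splits)
    \<comment> \<open>Here \<open>g\<close> discards the monomials that involve one of the first \<open>i\<close> variables.\<close>
    have "g p * g q = p * q + - ((p - g p) * q) + - (g p * (q - g q))" by (simp add: algebra_simps)
    moreover have "p * q \<in> J i" using pq by (simp add: P_J veronese_simps0)
    moreover have "(p - g p) * q \<in> J i" using Jmult[OF gJ[of p], of q] by (simp add: mult.commute)
    ultimately have gg: "g p * g q \<in> J i" using Jmult[OF gJ[of q], of "g p"] by (simp only: Jadd Jneg)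
    have "Poly_Mapping.keys (g p * g q) = {}"
    proof (rule ccontr)
      assume "Poly_Mapping.keys (g p * g q) \<noteq> {}"
      then obtain u where u: "u \<in> Poly_Mapping.keys (g p * g q)" by blast
      obtain v w where vw: "v \<in> Poly_Mapping.keys (g p)" "w \<in> Poly_Mapping.keys (g q)" "u = v + w"
        using keys_mult_mon[OF u] by blast
      have "\<forall>t<i. t \<notin> Poly_Mapping.keys v" "\<forall>t<i. t \<notin> Poly_Mapping.keys w"
        using vw(1,2) by (auto simp: in_keys_iff lg split: if_splits)
      then have "\<forall>t<i. t \<notin> Poly_Mapping.keys u" by (simp add: vw(3) mon_keys_add)
      moreover have "\<exists>t<i. t \<in> Poly_Mapping.keys u" using gg u by (simp add: J_def)
      ultimately show False by blast
    qed
    then have "g p = 0 \<or> g q = 0" by simp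
    then have "p \<in> J i \<or> q \<in> J i" using gJ[of p] gJ[of q] by auto
    then show "p \<in> P i \<or> q \<in> P i" using p q unfolding R P_J by blast
  qed
  have strict: "P i \<subset> P (Suc i)" if "i < n" for i
  proof -
    let ?x = "X (Poly_Mapping.single i c) :: 'k mpol"
    have "?x \<in> P (Suc i)" "?x \<notin> P i" using that c by (auto simp: P_def Ap_def)
    moreover have "P i \<subseteq> P (Suc i)" unfolding P_def using less_SucI by blast
    ultimately show ?thesis by blast
  qed
  let ?S = "{n. \<exists>P. (\<forall>i\<le>n. primeideal (P i) ?R) \<and> (\<forall>i<n. P i \<subset> P (Suc i))}"
  have "n \<in> ?S" using prime strict by blast
  moreover have "m \<le> n" if "m \<in> ?S" for m using that krull_dim_le[OF R n] by blast
  ultimately show ?thesis unfolding krull_dim_def by (intro antisym SUP_least SUP_upper) auto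
qed

section \<open>The h-polynomials\<close>

text \<open>
  The hypothesis compares coefficients in \<open>H(z) = (h0 + h1 z + h2 z^2 + h3 z^3) / (1 - z)^n\<close>.
\<close>

lemma cubic_numerator:
  fixes h0 h1 h2 h3 :: int
  assumes eq: "\<And>i. int (card (Mon n (i * c))) = h0 * int (card (Mon n i))
     + (if 1 \<le> i then h1 * int (card (Mon n (i - 1))) else 0)
     + (if 2 \<le> i then h2 * int (card (Mon n (i - 2))) else 0)
     + (if 3 \<le> i then h3 * int (card (Mon n (i - 3))) else 0)"
  shows "Abs_fps (\<lambda>i. of_nat (card (Mon n (i * c)))) * (1 - fps_X) ^ n =
     fps_of_poly [:of_int h0, of_int h1, of_int h2, of_int h3 :: 'a::comm_ring_1:]"
proof -
  let ?S = "Abs_fps (\<lambda>i. of_nat (card (Mon n i))) :: 'a fps"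
  have "Abs_fps (\<lambda>i. of_nat (card (Mon n (i * c)))) =
      fps_const (of_int h0) * ?S + fps_const (of_int h1) * (fps_X ^ 1 * ?S)
      + fps_const (of_int h2) * (fps_X ^ 2 * ?S) + fps_const (of_int h3) * (fps_X ^ 3 * ?S)"
  proof (rule fps_ext)
    fix i
    have "(of_nat (card (Mon n (i * c))) :: 'a) = of_int (int (card (Mon n (i * c))))" by simp
    also have "\<dots> = of_int h0 * of_nat (card (Mon n i))
     + of_int h1 * (if i < 1 then 0 else of_nat (card (Mon n (i - 1))))
     + of_int h2 * (if i < 2 then 0 else of_nat (card (Mon n (i - 2))))
     + of_int h3 * (if i < 3 then 0 else of_nat (card (Mon n (i - 3))))"
      unfolding eq by simp
    finally show "fps_nth (Abs_fps (\<lambda>i. of_nat (card (Mon n (i * c))) :: 'a)) i = fps_nth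
     (fps_const (of_int h0) * ?S + fps_const (of_int h1) * (fps_X ^ 1 * ?S)
      + fps_const (of_int h2) * (fps_X ^ 2 * ?S) + fps_const (of_int h3) * (fps_X ^ 3 * ?S)) i"
      by (simp only: fps_add_nth fps_mult_left_const_nth fps_X_power_mult_nth fps_nth_Abs_fps)
  qed
  also have "\<dots> = fps_of_poly [:of_int h0, of_int h1, of_int h2, of_int h3:] * ?S"
    by (simp add: fps_of_poly_pCons algebra_simps power2_eq_square power3_eq_cube)
  finally show ?thesis by (simp only: mult.assoc Mon_series mult_1_right)
qed

lemma veronese_h_polynomial:
  assumes c: "c > 0" and n: "n > 0"
    and eq: "\<And>i. int (card (Mon n (i * c))) = h0 * int (card (Mon n i))
     + (if 1 \<le> i then h1 * int (card (Mon n (i - 1))) else 0)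
     + (if 2 \<le> i then h2 * int (card (Mon n (i - 2))) else 0)
     + (if 3 \<le> i then h3 * int (card (Mon n (i - 3))) else 0)"
  shows "h_polynomial class_ring (veronese (poly_ring n :: ('k::field, 'k mpol) graded) c) = [:h0, h1, h2, h3:]"
proof -
  have "hilbert_series class_ring (veronese (poly_ring n :: ('k, 'k mpol) graded) c) * (1 - fps_X) ^ n = fps_of_poly [:h0, h1, h2, h3:]"
    unfolding hilbert_series_def hilbert_function_veronese using cubic_numerator[OF eq, where 'a = int] by simp
  then show ?thesis
    unfolding h_polynomial_def krull_dim_veronese[OF c n] the_enat.simps
    by (intro the_equality) (simp_all add: fps_of_poly_eq_iff)
qed

lemma real_binomial_Suc:
  assumes "l = Suc k"
  shows "real ((l + d) choose l) = real ((k + d) choose k) * (real d + real l) / real l"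
proof -
  have "real (Suc (k + d)) * real ((k + d) choose k) = real (Suc (k + d) choose Suc k) * real (Suc k)"
    using Suc_times_binomial_eq[of "k + d" k] by (simp only: of_nat_mult[symmetric])
  then show ?thesis by (simp add: assms field_simps)
qed

lemma real_binomial_3: "real ((3 + d) choose 3) = (real d + 1) * (real d + 2) * (real d + 3) / 6"
  by (simp add: real_binomial_Suc[of 3 2 d] real_binomial_Suc[of 2 1 d] del: add_2_eq_Suc)

lemma real_binomial_4: "real ((4 + d) choose 4) = (real d + 1) * (real d + 2) * (real d + 3) * (real d + 4) / 24"
  by (simp add: real_binomial_Suc[of 4 3 d] real_binomial_3)

lemma real_binomial_6: "real ((6 + d) choose 6) =
    (real d + 1) * (real d + 2) * (real d + 3) * (real d + 4) * (real d + 5) * (real d + 6) / 720"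
  by (simp add: real_binomial_Suc[of 6 5 d] real_binomial_Suc[of 5 4 d] real_binomial_4)

text \<open>
  Here \<open>s\<close> is the Hilbert polynomial of the polynomial ring.  Its zeros at \<open>-1, -2, -3\<close> make one polynomial
  identity cover also the small \<open>i\<close>, where summands are missing.
\<close>

lemma hilbert_recursion:
  fixes s :: "real \<Rightarrow> real" and h0 h1 h2 h3 :: int
  assumes s: "\<And>d. real (card (Mon n d)) = s (real d)" "s (-1) = 0" "s (-2) = 0" "s (-3) = 0"
    and id: "\<And>x. s (x * real c) = real_of_int h0 * s x + real_of_int h1 * s (x - 1) + real_of_int h2 * s (x - 2) + real_of_int h3 * s (x - 3)"
  shows "int (card (Mon n (i * c))) = h0 * int (card (Mon n i))
     + (if 1 \<le> i then h1 * int (card (Mon n (i - 1))) else 0)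
     + (if 2 \<le> i then h2 * int (card (Mon n (i - 2))) else 0)
     + (if 3 \<le> i then h3 * int (card (Mon n (i - 3))) else 0)" (is "?L = ?R")
proof -
  have k: "(if k \<le> i then real (card (Mon n (i - k))) else 0) = s (real i - real k)" if "k \<in> {1, 2, 3}" for k
  proof (cases "k \<le> i")
    case True
    then show ?thesis by (simp add: s(1) of_nat_diff)
  next
    case False
    with that have "real i - real k \<in> {-1, -2, -3}" by auto
    with False s(2-4) show ?thesis by auto
  qed
  have "real_of_int ?R = real_of_int h0 * real (card (Mon n i))
     + real_of_int h1 * (if 1 \<le> i then real (card (Mon n (i - 1))) else 0)
     + real_of_int h2 * (if 2 \<le> i then real (card (Mon n (i - 2))) else 0)
     + real_of_int h3 * (if 3 \<le> i then real (card (Mon n (i - 3))) else 0)" by simp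
  also have "\<dots> = s (real i * real c)"
    using k[of 1] k[of 2] k[of 3] by (simp add: id s(1))
  also have "\<dots> = real_of_int ?L" using s(1)[of "i * c"] by simp
  finally show ?thesis by linarith
qed

text \<open>
  The last hypothesis on \<open>w\<close> is \<open>h(-w) \<le> 0\<close>, with \<open>h\<close> evaluated by nested multiplication.
\<close>

lemma veronese_from_cubic:
  fixes s :: "real \<Rightarrow> real" and p q r :: int
  assumes c: "c > 0" and n: "n > 0"
    and s: "\<And>d. real (card (Mon n d)) = s (real d)" "s (-1) = 0" "s (-2) = 0" "s (-3) = 0"
    and id: "\<And>x. s (x * real c) = s x + real_of_int p * s (x - 1) + real_of_int q * s (x - 2) + real_of_int r * s (x - 3)"
    and pos: "1 - p + q - r > 0"
    and w: "0 < w" "w < 1" "1 - w * (real_of_int p - w * (real_of_int q - w * real_of_int r)) \<le> 0"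
  shows "poly (h_polynomial class_ring (veronese (poly_ring n :: ('k::field, 'k mpol) graded) c)) (-1) > 0
     \<and> \<not> backelin_roos (veronese (poly_ring n :: ('k, 'k mpol) graded) c)"
proof
  note rec = hilbert_recursion[OF s, of c 1 p q r]
  have eq: "int (card (Mon n (i * c))) = 1 * int (card (Mon n i))
     + (if 1 \<le> i then p * int (card (Mon n (i - 1))) else 0)
     + (if 2 \<le> i then q * int (card (Mon n (i - 2))) else 0)
     + (if 3 \<le> i then r * int (card (Mon n (i - 3))) else 0)" for i
    using id by (intro rec) simp
  show "poly (h_polynomial class_ring (veronese (poly_ring n :: ('k, 'k mpol) graded) c)) (-1) > 0"
    unfolding veronese_h_polynomial[OF c n eq] using pos by simp
  show "\<not> backelin_roos (veronese (poly_ring n :: ('k, 'k mpol) graded) c)"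
  proof (rule veronese_not_backelin_roos[OF c n cubic_numerator[OF eq] w(1,2)])
    show "poly [:real_of_int 1, real_of_int p, real_of_int q, real_of_int r:] (- w) \<le> 0" using w(3) by (simp add: algebra_simps)
    have "0 < real_of_int (1 - p + q - r)" using pos by (simp only: of_int_0_less_iff)
    then show "0 < poly [:real_of_int 1, real_of_int p, real_of_int q, real_of_int r:] (- 1)" by simp
  qed
qed

theorem lemma5p7:
  fixes n c :: nat and S :: "('k::field, (nat \<Rightarrow>\<^sub>0 nat) \<Rightarrow>\<^sub>0 'k) graded"
  assumes "(n, c) \<in> {(7, 2), (5, 4), (5, 3)} \<union> {(4, c) | c. c > 4}"
    and "S = poly_ring n"
  shows "poly (h_polynomial class_ring (veronese S c)) (-1) > 0
       \<and> \<not> backelin_roos (veronese S c)"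
proof -
  have s4: "real (card (Mon 4 d)) = (real d + 1) * (real d + 2) * (real d + 3) / 6" for d
    using card_Mon[of 3 d] real_binomial_3[of d] by simp
  have s5: "real (card (Mon 5 d)) = (real d + 1) * (real d + 2) * (real d + 3) * (real d + 4) / 24" for d
    using card_Mon[of 4 d] real_binomial_4[of d] by simp
  have s7: "real (card (Mon 7 d)) = (real d + 1) * (real d + 2) * (real d + 3) * (real d + 4) * (real d + 5) * (real d + 6) / 720" for d
    using card_Mon[of 6 d] real_binomial_6[of d] by simp
  consider "n = 7" "c = 2" | "n = 5" "c = 4" | "n = 5" "c = 3" | "n = 4" "c > 4" using assms(1) by auto
  then show ?thesis
  proof cases
    case 1
    show ?thesis unfolding assms(2) 1
      by (rule veronese_from_cubic[where p = 21 and q = 35 and r = 7 and w = "1/4", OF _ _ s7]) (simp_all add: field_simps)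
  next
    case 2
    show ?thesis unfolding assms(2) 2
      by (rule veronese_from_cubic[where p = 65 and q = 155 and r = 35 and w = "1/4", OF _ _ s5]) (simp_all add: field_simps)
  next
    case 3
    show ?thesis unfolding assms(2) 3
      by (rule veronese_from_cubic[where p = 30 and q = 45 and r = 5 and w = "1/4", OF _ _ s5]) (simp_all add: field_simps)
  next
    case 4
    \<comment> \<open>The coefficients of the numerator are those of \<open>(1 + A z + B z^2 + C z^3 + ...) (1 - z)^4\<close>.\<close>
    define A B C where "A = int (card (Mon 4 c))" and "B = int (card (Mon 4 (2 * c)))" and "C = int (card (Mon 4 (3 * c)))"
    \<comment> \<open>With \<open>c = x + 5\<close> both inequalities become polynomials in \<open>x\<close> whose coefficients have one sign.\<close>
    define x where "x = real c - 5"
    have x: "real c = x + 5" "x \<ge> 0" using 4 by (simp_all add: x_def)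
    have A: "real_of_int A = (x + 6) * (x + 7) * (x + 8) / 6" by (simp add: A_def s4 x algebra_simps)
    have B: "real_of_int B = (2 * x + 11) * (2 * x + 12) * (2 * x + 13) / 6" by (simp add: B_def s4 x algebra_simps)
    have C: "real_of_int C = (3 * x + 16) * (3 * x + 17) * (3 * x + 18) / 6" by (simp add: C_def s4 x algebra_simps)
    have pw: "0 \<le> x ^ 2" "0 \<le> x ^ 3" using x(2) by simp_all
    show ?thesis unfolding assms(2) 4
    proof (rule veronese_from_cubic[where p = "A - 4" and q = "B - 4 * A + 6" and r = "C - 4 * B + 6 * A - 4" and w = "1/8", OF _ _ s4])
      show "(y * real c + 1) * (y * real c + 2) * (y * real c + 3) / 6 = (y + 1) * (y + 2) * (y + 3) / 6
        + real_of_int (A - 4) * ((y - 1 + 1) * (y - 1 + 2) * (y - 1 + 3) / 6)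
        + real_of_int (B - 4 * A + 6) * ((y - 2 + 1) * (y - 2 + 2) * (y - 2 + 3) / 6)
        + real_of_int (C - 4 * B + 6 * A - 4) * ((y - 3 + 1) * (y - 3 + 2) * (y - 3 + 3) / 6)" for y
        by (simp add: A B C x field_simps power2_eq_square power3_eq_cube)
      have "real_of_int (1 - (A - 4) + (B - 4 * A + 6) - (C - 4 * B + 6 * A - 4)) = (x ^ 3 + 15 * x ^ 2 + 53 * x + 39) / 3"
        by (simp add: A B C field_simps power2_eq_square power3_eq_cube)
      also have "\<dots> > 0" using pw x(2) by (simp add: add_nonneg_pos)
      finally show "1 - (A - 4) + (B - 4 * A + 6) - (C - 4 * B + 6 * A - 4) > 0" by (simp only: of_int_0_less_iff)
      show "1 - 1 / 8 * (real_of_int (A - 4) - 1 / 8 * (real_of_int (B - 4 * A + 6) - 1 / 8 * real_of_int (C - 4 * B + 6 * A - 4))) \<le> 0"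
      proof -
        have "0 \<le> x * x" "0 \<le> x * (x * x)" using x(2) by simp_all
        then have "- (x * (x * (x * 256608))) \<le> x * (x * 6788448) + (106189056 + x * 55567296)"
          using x(2) by (simp only: mult.assoc[symmetric])
        then show ?thesis by (simp add: A B C field_simps power2_eq_square power3_eq_cube)
      qed
    qed (use 4 in simp_all)
  qed
qed

end
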